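(* Let $d,T\ge 1$ be integers, $1\le p<\infty$, and let $\mu,\nu\in\mathcal P(F)$ (Borel probability measures on $(\mathbb R^d)^T$ concentrated on $F$) for some bounded set $F\subseteq(\mathbb R^d)^T$. (a) There exists a constant $C>0$ that depends only on $d,T,p,\operatorname{diam}(F)$ such that for all $\sigma>0$, $$\mathcal{AW}_p(\mu,\nu)^p\le C\left(\frac{(1+\sigma)^p}{\sigma}\mathcal W_1(\mu,\nu)+\left(\sum_{t=0}^{T-1}h^{t,p}_\mu(\sigma)\vee h^{t,p}_\nu(\sigma)\right)^p\right).$$ (b) Suppose further that $\mu,\nu\in\mathcal P_{p,\alpha,L}((\mathbb R^d)^T)$ for some $L>0$ and $0<\alpha\le 1$. Then there exists a constant $C>0$ that depends only on $d,T,p,\operatorname{diam}(F),L,\alpha$ such that $$\mathcal{AW}_p(\mu,\nu)\le C\,\mathcal W_1(\mu,\nu)^{\alpha^{T-1}/(p\alpha^{T-1}+1)}.$$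
   Context: $|\cdot|$ is the Euclidean norm. $\mathcal P_p(\mathbb R^N)$ is the set of Borel probability measures on $\mathbb R^N$ with finite $p$-th moment. $\mathcal W_p(\mu,\nu)=(\inf_{\pi\in\mathrm{Cpl}(\mu,\nu)}\int|x-y|^p\,d\pi)^{1/p}$, with $\mathrm{Cpl}(\mu,\nu)$ the set of couplings. For $x\in(\mathbb R^d)^T$, $x_{1:t}=(x_1,\dots,x_t)$. A coupling $\pi$ of $\mu,\nu\in\mathcal P((\mathbb R^d)^T)$ is bicausal if for $(X,Y)\sim\pi$ and every $t\in\{1,\dots,T-1\}$: $Y_{1:t}$ and $(X_{t+1},\dots,X_T)$ are conditionally independent given $X_{1:t}$, and $X_{1:t}$ and $(Y_{t+1},\dots,Y_T)$ are conditionally independent given $Y_{1:t}$; $\mathrm{Cpl}_{bc}(\mu,\nu)$ is the set of bicausal couplings. $\mathcal{AW}_p(\mu,\nu)=\left(\inf_{\pi\in\mathrm{Cpl}_{bc}(\mu,\nu)}\int\sum_{t=1}^T|x_t-y_t|^p\,\pi(dx,dy)\right)^{1/p}$. For $X\sim\mu$, $\mu_{x_{1:t}}\in\mathcal P(\mathbb R^d)$ denotes the regular conditional law $\mathbb P(X_{t+1}\in\cdot\mid X_{1:t}=x_{1:t})$. The $p$-modulus of continuity of $\mu$, for $t\in\{1,\dots,T-1\}$ and $\delta>0$, is $\omega^{t,p}_\mu(\delta)=\sup\left\{(\mathbb E[\mathcal W_p(\mu_{X_{1:t}},\mu_{Y_{1:t}})^p])^{1/p}: X,Y\sim\mu,\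 (\mathbb E[|X_{1:t}-Y_{1:t}|^p])^{1/p}<\delta\right\}$ (supremum over all jointly defined pairs with both marginal laws $\mu$). Iterated moduli: $h^{0,p}_\mu(\sigma)=\sigma$, $h^{t,p}_\mu(\sigma)=\omega^{t,p}_\mu\left(\sum_{s=0}^{t-1}h^{s,p}_\mu(\sigma)\right)$ for $t\in\{1,\dots,T-1\}$. $\mathcal P_{p,\alpha,L}((\mathbb R^d)^T)$ is the set of $\mu\in\mathcal P_p((\mathbb R^d)^T)$ whose conditional kernels (for some version of the disintegration) satisfy $\mathcal W_p(\mu_{x_{1:t}},\mu_{y_{1:t}})\le L|x_{1:t}-y_{1:t}|^\alpha$ for all $x_{1:t},y_{1:t}\in(\mathbb R^d)^t$ and $t\in\{1,\dots,T-1\}$. *)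

theory Defs
  imports "HOL-Probability.Probability"
begin

text \<open>
  Conventions. A path in \<open>(\<real>\<^sup>d)\<^sup>t\<close> is a function \<open>nat \<Rightarrow> real ^ 'd\<close> that is extensional on
  \<open>{1..t}\<close>, so \<open>x\<^sub>1\<^sub>:\<^sub>t\<close> is \<open>restrict x {1..t}\<close>. Integrals of nonnegative costs, infima, suprema
  and Wasserstein distances live in \<^typ>\<open>ennreal\<close>, so that none of them depends on
  an integrability or boundedness convention.
\<close>

text \<open>Real power on \<^typ>\<open>ennreal\<close>; only meant for exponents \<open>r > 0\<close>.\<close>

definition epowr :: "ennreal \<Rightarrow> real \<Rightarrow> ennreal" where
  "epowr x r = (if x = \<top> then \<top> else ennreal (enn2real x powr r))"

text \<open>
  The finite product of the Borel sigma-algebras, which for a finite product of Euclidean spaces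
  is the Borel sigma-algebra.
\<close>

definition path_space :: "nat \<Rightarrow> (nat \<Rightarrow> real ^ 'd) measure" where
  "path_space t = (\<Pi>\<^sub>M s\<in>{1..t}. borel)"

text \<open>Euclidean norm and distance on \<open>(\<real>\<^sup>d)\<^sup>t\<close>, only looking at the coordinates \<open>1, \<dots>, t\<close>.\<close>

definition path_norm :: "nat \<Rightarrow> (nat \<Rightarrow> real ^ 'd) \<Rightarrow> real" where
  "path_norm t x = L2_set (\<lambda>s. norm (x s)) {1..t}"

definition path_dist :: "nat \<Rightarrow> (nat \<Rightarrow> real ^ 'd) \<Rightarrow> (nat \<Rightarrow> real ^ 'd) \<Rightarrow> real" where
  "path_dist t x y = L2_set (\<lambda>s. norm (x s - y s)) {1..t}"

definition path_bounded :: "nat \<Rightarrow> (nat \<Rightarrow> real ^ 'd) set \<Rightarrow> bool" where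
  "path_bounded T F \<longleftrightarrow> F \<subseteq> space (path_space T) \<and> (\<exists>B. \<forall>x\<in>F. path_norm T x \<le> B)"

definition path_diam :: "nat \<Rightarrow> (nat \<Rightarrow> real ^ 'd) set \<Rightarrow> real" where
  "path_diam T F = (SUP (x, y)\<in>F \<times> F. path_dist T x y)"

text \<open>
  Probability measures concentrated on \<open>F\<close>. \<open>F\<close> need not be measurable: the almost-everywhere
  quantifier only asks that the complement of \<open>F\<close> be contained in a null set.
\<close>

definition probs_on :: "nat \<Rightarrow> (nat \<Rightarrow> real ^ 'd) set \<Rightarrow> (nat \<Rightarrow> real ^ 'd) measure set" where
  "probs_on T F = {\<mu> \<in> space (prob_algebra (path_space T)). AE x in \<mu>. x \<in> F}"

definition couplings :: "'a measure \<Rightarrow> 'b measure \<Rightarrow> ('a \<times> 'b) measure set" where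
  "couplings \<mu> \<nu> = {\<pi>. sets \<pi> = sets (\<mu> \<Otimes>\<^sub>M \<nu>) \<and> distr \<pi> \<mu> fst = \<mu> \<and> distr \<pi> \<nu> snd = \<nu>}"

definition wasserstein ::
  "('a \<Rightarrow> 'a \<Rightarrow> real) \<Rightarrow> real \<Rightarrow> 'a measure \<Rightarrow> 'a measure \<Rightarrow> ennreal" where
  "wasserstein \<rho> p \<mu> \<nu> =
     epowr (INF \<pi>\<in>couplings \<mu> \<nu>. \<integral>\<^sup>+ (x, y). ennreal (\<rho> x y powr p) \<partial>\<pi>) (1 / p)"

text \<open>
  Conditional independence of the random variables \<open>U\<close> and \<open>V\<close> (with values in \<open>NU\<close>, \<open>NV\<close>) given
  \<open>W\<close> (with values in \<open>NW\<close>): conditional probabilities given the sigma-algebra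
  generated by \<open>W\<close> factorise almost surely.
\<close>

definition cond_indep_var ::
  "'a measure \<Rightarrow> 'b measure \<Rightarrow> ('a \<Rightarrow> 'b) \<Rightarrow> 'c measure \<Rightarrow> ('a \<Rightarrow> 'c) \<Rightarrow> 'e measure \<Rightarrow> ('a \<Rightarrow> 'e) \<Rightarrow> bool"
where
  "cond_indep_var M NU U NV V NW W \<longleftrightarrow>
     (let G = vimage_algebra (space M) W NW in
       \<forall>A\<in>sets NU. \<forall>B\<in>sets NV. AE \<omega> in M.
         real_cond_exp M G (\<lambda>\<omega>. indicator A (U \<omega>) * indicator B (V \<omega>)) \<omega> =
         real_cond_exp M G (\<lambda>\<omega>. indicator A (U \<omega>)) \<omega> *
         real_cond_exp M G (\<lambda>\<omega>. indicator B (V \<omega>)) \<omega>)"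

definition bc_couplings ::
  "nat \<Rightarrow> (nat \<Rightarrow> real ^ 'd) measure \<Rightarrow> (nat \<Rightarrow> real ^ 'd) measure
    \<Rightarrow> ((nat \<Rightarrow> real ^ 'd) \<times> (nat \<Rightarrow> real ^ 'd)) measure set" where
  "bc_couplings T \<mu> \<nu> = {\<pi> \<in> couplings \<mu> \<nu>. \<forall>t\<in>{1..<T}.
     cond_indep_var \<pi>
       (path_space t) (\<lambda>\<omega>. restrict (snd \<omega>) {1..t})
       (\<Pi>\<^sub>M s\<in>{t<..T}. borel) (\<lambda>\<omega>. restrict (fst \<omega>) {t<..T})
       (path_space t) (\<lambda>\<omega>. restrict (fst \<omega>) {1..t}) \<and>
     cond_indep_var \<pi>
       (path_space t) (\<lambda>\<omega>. restrict (fst \<omega>) {1..t})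
       (\<Pi>\<^sub>M s\<in>{t<..T}. borel) (\<lambda>\<omega>. restrict (snd \<omega>) {t<..T})
       (path_space t) (\<lambda>\<omega>. restrict (snd \<omega>) {1..t})}"

definition adapted_wasserstein ::
  "nat \<Rightarrow> real \<Rightarrow> (nat \<Rightarrow> real ^ 'd) measure \<Rightarrow> (nat \<Rightarrow> real ^ 'd) measure \<Rightarrow> ennreal" where
  "adapted_wasserstein T p \<mu> \<nu> =
     epowr (INF \<pi>\<in>bc_couplings T \<mu> \<nu>.
       \<integral>\<^sup>+ (x, y). ennreal (\<Sum>t=1..T. norm (x t - y t) powr p) \<partial>\<pi>) (1 / p)"

text \<open>\<open>\<kappa>\<close> is a version of the regular conditional law of \<open>X\<^sub>t\<^sub>+\<^sub>1\<close> given \<open>X\<^sub>1\<^sub>:\<^sub>t\<close> under \<open>\<mu>\<close>.\<close>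

definition is_cond_law ::
  "(nat \<Rightarrow> real ^ 'd) measure \<Rightarrow> nat \<Rightarrow> ((nat \<Rightarrow> real ^ 'd) \<Rightarrow> (real ^ 'd) measure) \<Rightarrow> bool" where
  "is_cond_law \<mu> t \<kappa> \<longleftrightarrow>
     \<kappa> \<in> path_space t \<rightarrow>\<^sub>M prob_algebra borel \<and>
     (\<forall>A\<in>sets (path_space t). \<forall>B\<in>sets borel.
        emeasure \<mu> {x \<in> space \<mu>. restrict x {1..t} \<in> A \<and> x (Suc t) \<in> B} =
        (\<integral>\<^sup>+ x. indicator A (restrict x {1..t}) * emeasure (\<kappa> (restrict x {1..t})) B \<partial>\<mu>))"

text \<open>
  A fixed version. Conditional laws exist and are almost surely unique because \<open>\<real>\<^sup>d\<close> is Polish, and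
  the modulus of continuity below does not depend on the version.
\<close>

definition cond_law ::
  "(nat \<Rightarrow> real ^ 'd) measure \<Rightarrow> nat \<Rightarrow> (nat \<Rightarrow> real ^ 'd) \<Rightarrow> (real ^ 'd) measure" where
  "cond_law \<mu> t = (SOME \<kappa>. is_cond_law \<mu> t \<kappa>)"

text \<open>
  The joint laws of pairs \<open>X, Y \<sim> \<mu>\<close> are the couplings of \<open>\<mu>\<close> with itself. The radius \<open>\<delta>\<close> is an
  \<^typ>\<open>ennreal\<close> because the iterated moduli feed values of moduli back into it.
\<close>

definition modulus :: "real \<Rightarrow> (nat \<Rightarrow> real ^ 'd) measure \<Rightarrow> nat \<Rightarrow> ennreal \<Rightarrow> ennreal" where
  "modulus p \<mu> t \<delta> =
     (SUP \<pi>\<in>{\<pi> \<in> couplings \<mu> \<mu>.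
              epowr (\<integral>\<^sup>+ (x, y). ennreal (path_dist t x y powr p) \<partial>\<pi>) (1 / p) < \<delta>}.
        epowr (\<integral>\<^sup>+ (x, y). epowr
          (wasserstein dist p (cond_law \<mu> t (restrict x {1..t})) (cond_law \<mu> t (restrict y {1..t})))
          p \<partial>\<pi>) (1 / p))"

fun iter_modulus :: "real \<Rightarrow> (nat \<Rightarrow> real ^ 'd) measure \<Rightarrow> nat \<Rightarrow> ennreal \<Rightarrow> ennreal" where
  "iter_modulus p \<mu> t \<sigma> =
     (if t = 0 then \<sigma> else modulus p \<mu> t (\<Sum>s<t. iter_modulus p \<mu> s \<sigma>))"

declare iter_modulus.simps [simp del]

definition holder_kernels ::
  "nat \<Rightarrow> real \<Rightarrow> real \<Rightarrow> real \<Rightarrow> (nat \<Rightarrow> real ^ 'd) measure set" where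
  "holder_kernels T p \<alpha> L =
     {\<mu> \<in> space (prob_algebra (path_space T)).
        (\<integral>\<^sup>+ x. ennreal (path_norm T x powr p) \<partial>\<mu>) < \<top> \<and>
        (\<forall>t\<in>{1..<T}. \<exists>\<kappa>. is_cond_law \<mu> t \<kappa> \<and>
           (\<forall>x\<in>space (path_space t). \<forall>y\<in>space (path_space t).
              wasserstein dist p (\<kappa> x) (\<kappa> y) \<le> ennreal (L * path_dist t x y powr \<alpha>)))}"

end

theory Submission
  imports Defs
begin

text \<open>
  Cut space into cells of mesh proportional to \<open>\<sigma>\<close> and label each time step of a path by the cell
  visited. A bicausal coupling of \<open>\<mu>\<close> and \<open>\<nu>\<close> is built step by step. Given the label histories
  \<open>c\<close>, \<open>c'\<close> of the two sides, the pair of next labels is drawn from a maximal coupling of the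
  conditional laws of the labels given \<open>c\<close> and given \<open>c'\<close>; given the labels, the two sides draw
  their next positions independently. On one side with past \<open>x\<close>, position and label are obtained
  from an independent \<open>z \<sim> \<mu>\<close> conditioned on having label history \<open>c\<close>: a nearly optimal coupling
  of the conditional laws given \<open>x\<close> and given \<open>z\<close> provides the position and, from its second
  component, the label. Hence positions follow the conditional law given the past \<open>x\<close> alone, whatever
  the labels, which makes the coupling bicausal.

  The pair of \<open>x\<close> and \<open>z\<close> is a coupling of \<open>\<mu>\<close> with itself, so the distance from a position to the
  cell of its label is controlled by the modulus of continuity at the previously accumulated error,
  which leads to the iterated moduli. While the label histories agree, both positions are near the
  same cell. Maximality of the label couplings bounds the probability of disagreement by \<open>2 ^ T\<close> times the
  probability that an arbitrary coupling of \<open>\<mu>\<close> and \<open>\<nu>\<close> puts the two paths into different cells,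
  and for a suitably shifted grid this is at most a multiple of the transport cost divided by \<open>\<sigma>\<close>.
  In the Hoelder case \<open>\<sigma>\<close> is chosen to balance the two terms.
\<close>

section \<open>Powers and \<open>L\<^sup>p\<close> norms of extended nonnegative functions\<close>

text \<open>Near-optimal couplings of the kernels must depend measurably on the two pasts, and the
  two sides may exchange information only in ways that bicausality tolerates. Labels serve both
  purposes: they are countable, so couplings of their laws can be chosen freely, and the law of the
  next label given a history does not depend on the position, so the sides interact through labels
  alone. Conditioning \<open>z\<close> on the whole history gives the labels of each side the law of
  the cells visited by a path under \<mu> or \<nu>; this makes their disagreement comparable with a
  coupling of \<mu> and \<nu>. The factor \<open>2 ^ T\<close> solves the recursion e' \<le> d + 2 e
  for the disagreement. Cell radius and defect of optimality accumulate to at most 3/8 of \<sigma>,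
  and the zeroth term \<sigma> of the iterated moduli absorbs this, since the first step has no past
  and spends no modulus. The core estimate allows arbitrary versions of the kernels and arbitrary
  numbers in place of the moduli; part (b) can thus use the Hoelder continuous versions directly,
  while \<open>modulus\<close> refers to a fixed version. The weight (1 + \<sigma>)^p / \<sigma>
  arises by enlarging 1 / \<sigma>.\<close>

lemma epowr_top [simp]: "epowr \<top> r = \<top>"
  by (simp add: epowr_def)

lemma epowr_ennreal: "0 \<le> x \<Longrightarrow> epowr (ennreal x) r = ennreal (x powr r)"
  by (simp add: epowr_def)

lemma epowr_0 [simp]: "epowr 0 r = 0"
  by (simp add: epowr_def)

lemma epowr_1_right [simp]: "epowr x 1 = x"
  by (cases x) (simp_all add: epowr_ennreal)

lemma epowr_epowr: "epowr (epowr x r) s = epowr x (r * s)"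
  by (cases x) (simp_all add: epowr_ennreal powr_powr)

lemma epowr_inverse [simp]:
  assumes "r \<noteq> 0"
  shows "epowr (epowr x r) (1 / r) = x" and "epowr (epowr x (1 / r)) r = x"
  using assms by (simp_all add: epowr_epowr)

lemma epowr_mono: "x \<le> y \<Longrightarrow> 0 \<le> r \<Longrightarrow> epowr x r \<le> epowr y r"
  by (cases x; cases y) (auto simp: epowr_ennreal top_unique intro!: ennreal_leI powr_mono2)

lemma epowr_mult: "0 < r \<Longrightarrow> epowr (x * y) r = epowr x r * epowr y r"
proof (cases x; cases y)
  fix a b :: real assume "0 \<le> a" "x = ennreal a" "0 \<le> b" "y = ennreal b"
  then show ?thesis by (simp add: epowr_ennreal powr_mult flip: ennreal_mult)
next
  fix a :: real assume *: "0 < r" "0 \<le> a" "x = ennreal a" "y = \<top>"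
  then show ?thesis
    by (cases "a = 0") (auto simp: epowr_ennreal ennreal_mult_top)
next
  fix a :: real assume *: "0 < r" "0 \<le> a" "y = ennreal a" "x = \<top>"
  then show ?thesis
    by (cases "a = 0") (auto simp: epowr_ennreal ennreal_top_mult)
qed simp

lemma epowr_eq_0_iff [simp]: "epowr x r = 0 \<longleftrightarrow> x = 0"
  by (cases x) (auto simp: epowr_ennreal)

lemma epowr_less_top_iff [simp]: "epowr x r < \<top> \<longleftrightarrow> x < \<top>"
  by (cases x) (auto simp: epowr_ennreal)

lemma borel_measurable_epowr [measurable]:
  assumes [measurable]: "f \<in> borel_measurable M"
  shows "(\<lambda>x. epowr (f x) r) \<in> borel_measurable M"
proof -
  have "{x \<in> space M. f x = \<top>} = f -` {\<top>} \<inter> space M" by auto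
  then have [measurable]: "Measurable.pred M (\<lambda>x. f x = \<top>)"
    using measurable_sets[OF assms, of "{\<top>}"] by (simp add: pred_def)
  have "(\<lambda>x. enn2real (f x) powr r) \<in> borel_measurable M"
    by (intro powr_real_measurable) measurable
  then show ?thesis
    unfolding epowr_def by measurable
qed

text \<open>Values in \<open>ennreal\<close> free Minkowski's inequality from integrability
  conditions. Monotonicity (\<open>Lnorm_mono\<close>) asks for no measurability either, so
  Wasserstein distances of kernels can be integrated without showing that they are measurable in the
  pasts.\<close>

definition Lnorm :: "real \<Rightarrow> 'a measure \<Rightarrow> ('a \<Rightarrow> ennreal) \<Rightarrow> ennreal" where
  "Lnorm p M f = epowr (\<integral>\<^sup>+x. epowr (f x) p \<partial>M) (1 / p)"

lemma epowr_Lnorm: "p > 0 \<Longrightarrow> epowr (Lnorm p M f) p = (\<integral>\<^sup>+x. epowr (f x) p \<partial>M)"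
  by (simp add: Lnorm_def)

lemma Lnorm_le_iff:
  assumes "p > 0"
  shows "Lnorm p M f \<le> c \<longleftrightarrow> (\<integral>\<^sup>+x. epowr (f x) p \<partial>M) \<le> epowr c p"
proof
  assume "Lnorm p M f \<le> c"
  from epowr_mono[OF this, of p] assms show "(\<integral>\<^sup>+x. epowr (f x) p \<partial>M) \<le> epowr c p"
    by (simp add: epowr_Lnorm)
next
  assume "(\<integral>\<^sup>+x. epowr (f x) p \<partial>M) \<le> epowr c p"
  from epowr_mono[OF this, of "1 / p"] assms show "Lnorm p M f \<le> c"
    by (simp add: Lnorm_def)
qed

lemma Lnorm_mono_AE:
  assumes "p \<ge> 0" "AE x in M. f x \<le> g x" shows "Lnorm p M f \<le> Lnorm p M g"
  unfolding Lnorm_def using assms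
  by (intro epowr_mono nn_integral_mono_AE) (auto intro: epowr_mono)

lemma Lnorm_mono:
  assumes "p \<ge> 0" "\<And>x. x \<in> space M \<Longrightarrow> f x \<le> g x" shows "Lnorm p M f \<le> Lnorm p M g"
  unfolding Lnorm_def using assms by (intro epowr_mono nn_integral_mono) auto

lemma (in prob_space) Lnorm_const: "p > 0 \<Longrightarrow> Lnorm p M (\<lambda>_. c) = c"
  by (simp add: Lnorm_def emeasure_space_1)

text \<open>Convexity of the \<open>p\<close>-th power at the points \<open>f / a\<close> and
  \<open>g / b\<close> with weights \<open>a / (a + b)\<close> and \<open>b / (a + b)\<close>,
  cleared of denominators. The free numbers \<open>a\<close> and \<open>b\<close> will be the two
  norms, up to a small increment.\<close>

lemma powr_convex_combination:
  fixes a b f g p :: real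
  assumes "a > 0" "b > 0" "f \<ge> 0" "g \<ge> 0" "p \<ge> 1"
  shows "(f + g) powr p \<le> (a + b) powr (p - 1) * (a powr (1 - p) * f powr p + b powr (1 - p) * g powr p)"
proof -
  have pos: "(f + g) powr p \<le> (a + b) powr (p - 1) * (a powr (1 - p) * f powr p + b powr (1 - p) * g powr p)"
    if "f > 0" "g > 0" for f g :: real
  proof -
    have "1 - b / (a + b) = a / (a + b)" using assms by (simp add: field_simps)
    then have "(a / (a + b) * (f / a) + b / (a + b) * (g / b)) powr p
          \<le> a / (a + b) * (f / a) powr p + b / (a + b) * (g / b) powr p"
      using convex_onD[OF powr_convex[OF \<open>p \<ge> 1\<close>], of "b / (a + b)" "f / a" "g / b"] assms that
        \<open>1 - b / (a + b) = a / (a + b)\<close> by (simp add: divide_le_eq)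
    also have "a / (a + b) * (f / a) + b / (a + b) * (g / b) = (f + g) / (a + b)"
      using assms by (simp add: add_divide_distrib)
    also have "((f + g) / (a + b)) powr p = (f + g) powr p / (a + b) powr p"
      using assms that by (simp add: powr_divide)
    finally have "(f + g) powr p / (a + b) powr p \<le> (a / a powr p * f powr p + b / b powr p * g powr p) / (a + b)"
      using assms that by (simp add: powr_divide) (simp add: add_divide_distrib mult.commute)
    then have "(f + g) powr p \<le> (a + b) powr p / (a + b) * (a / a powr p * f powr p + b / b powr p * g powr p)"
      using assms by (simp add: divide_simps mult_ac)
    also have "\<dots> = (a + b) powr (p - 1) * (a powr (1 - p) * f powr p + b powr (1 - p) * g powr p)"
      using assms by (simp add: powr_diff)
    finally show ?thesis .
  qed
  \<comment> \<open>A vanishing summand leaves a single term, and the bound reduces to monotonicity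
    of the power \<open>p - 1\<close>.\<close>
  have one: "f powr p \<le> (a + b) powr (p - 1) * (a powr (1 - p) * f powr p)" if "a > 0" "b \<ge> 0" for a b f :: real
  proof -
    have "1 = a powr (p - 1) * a powr (1 - p)" using that by (simp flip: powr_add)
    also have "\<dots> \<le> (a + b) powr (p - 1) * a powr (1 - p)"
      using that assms by (intro mult_right_mono powr_mono2) auto
    finally have "1 * f powr p \<le> ((a + b) powr (p - 1) * a powr (1 - p)) * f powr p"
      by (intro mult_right_mono) auto
    then show ?thesis by (simp add: mult_ac)
  qed
  consider "f > 0" "g > 0" | "f = 0" | "g = 0" using assms by linarith
  then show ?thesis
  proof cases
    case 1 then show ?thesis by (rule pos)
  next
    case 2 with one[of b a g] assms show ?thesis by (simp add: add.commute)
  next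
    case 3 with one[of a b f] assms show ?thesis by simp
  qed
qed

lemma epowr_convex_combination:
  assumes "a > 0" "b > 0" "p \<ge> 1"
  shows "epowr (f + g) p \<le> ennreal ((a + b) powr (p - 1)) *
     (ennreal (a powr (1 - p)) * epowr f p + ennreal (b powr (1 - p)) * epowr g p)"
proof (cases f; cases g)
  fix u v :: real assume *: "0 \<le> u" "f = ennreal u" "0 \<le> v" "g = ennreal v"
  have "epowr (f + g) p = ennreal ((u + v) powr p)"
    using * by (simp add: epowr_ennreal flip: ennreal_plus)
  also have "\<dots> \<le> ennreal ((a + b) powr (p - 1) * (a powr (1 - p) * u powr p + b powr (1 - p) * v powr p))"
    using * assms by (intro ennreal_leI powr_convex_combination) auto
  also have "\<dots> = ennreal ((a + b) powr (p - 1)) *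
     (ennreal (a powr (1 - p)) * epowr f p + ennreal (b powr (1 - p)) * epowr g p)"
    using * by (simp add: epowr_ennreal ennreal_mult)
  finally show ?thesis .
qed (use assms in \<open>auto simp: ennreal_mult_top\<close>)

text \<open>The convexity of the \<open>p\<close>-th power is integrated with weights proportional to the two norms.\<close>

theorem Lnorm_add:
  assumes p: "p \<ge> 1" and f [measurable]: "f \<in> borel_measurable M" and g [measurable]: "g \<in> borel_measurable M"
  shows "Lnorm p M (\<lambda>x. f x + g x) \<le> Lnorm p M f + Lnorm p M g"
proof (rule ennreal_le_epsilon)
  fix e :: real assume e: "e > 0" and fin: "Lnorm p M f + Lnorm p M g < \<top>"
  obtain a' where a': "Lnorm p M f = ennreal a'" "a' \<ge> 0" using fin by (cases "Lnorm p M f") auto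
  obtain b' where b': "Lnorm p M g = ennreal b'" "b' \<ge> 0" using fin by (cases "Lnorm p M g") auto
  \<comment> \<open>The increments keep both weights positive even if a norm vanishes; together they
    account for the final \<open>e\<close>.\<close>
  define a where "a = a' + e / 2"
  define b where "b = b' + e / 2"
  have ab: "a > 0" "b > 0" using e a' b' by (auto simp: a_def b_def)
  have If: "(\<integral>\<^sup>+x. epowr (f x) p \<partial>M) \<le> ennreal (a powr p)"
    using Lnorm_le_iff[of p M f "ennreal a"] p a' e ab by (simp add: epowr_ennreal) (simp add: a_def)
  have Ig: "(\<integral>\<^sup>+x. epowr (g x) p \<partial>M) \<le> ennreal (b powr p)"
    using Lnorm_le_iff[of p M g "ennreal b"] p b' e ab by (simp add: epowr_ennreal) (simp add: b_def)
  have "(\<integral>\<^sup>+x. epowr (f x + g x) p \<partial>M) \<le> (\<integral>\<^sup>+x. ennreal ((a + b) powr (p - 1)) *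
     (ennreal (a powr (1 - p)) * epowr (f x) p + ennreal (b powr (1 - p)) * epowr (g x) p) \<partial>M)"
    using ab p by (intro nn_integral_mono epowr_convex_combination)
  also have "\<dots> = ennreal ((a + b) powr (p - 1)) *
     (ennreal (a powr (1 - p)) * (\<integral>\<^sup>+x. epowr (f x) p \<partial>M) + ennreal (b powr (1 - p)) * (\<integral>\<^sup>+x. epowr (g x) p \<partial>M))"
    by (simp add: nn_integral_cmult nn_integral_add)
  also have "\<dots> \<le> ennreal ((a + b) powr (p - 1)) *
     (ennreal (a powr (1 - p)) * ennreal (a powr p) + ennreal (b powr (1 - p)) * ennreal (b powr p))"
    by (intro mult_left_mono add_mono If Ig) auto
  also have "\<dots> = ennreal ((a + b) powr (p - 1) * (a + b))"
    using ab by (simp flip: ennreal_mult ennreal_plus powr_add)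
  also have "\<dots> = epowr (ennreal (a + b)) p"
    using ab by (simp add: epowr_ennreal powr_diff del: ennreal_plus)
  finally have "Lnorm p M (\<lambda>x. f x + g x) \<le> ennreal (a + b)"
    using p by (simp add: Lnorm_le_iff)
  also have "\<dots> = Lnorm p M f + Lnorm p M g + ennreal e"
    using a' b' e by (simp add: a_def b_def flip: ennreal_plus)
  finally show "Lnorm p M (\<lambda>x. f x + g x) \<le> Lnorm p M f + Lnorm p M g + ennreal e" .
qed

lemma Lnorm_sum:
  assumes p: "p \<ge> 1" and "finite I" and "\<And>i. i \<in> I \<Longrightarrow> f i \<in> borel_measurable M"
  shows "Lnorm p M (\<lambda>x. \<Sum>i\<in>I. f i x) \<le> (\<Sum>i\<in>I. Lnorm p M (f i))"
  using assms(2,3)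
proof (induction I)
  case empty
  then show ?case by (simp add: Lnorm_def)
next
  case (insert i I)
  have "Lnorm p M (\<lambda>x. \<Sum>i\<in>insert i I. f i x) = Lnorm p M (\<lambda>x. f i x + (\<Sum>i\<in>I. f i x))"
    using insert by simp
  also have "\<dots> \<le> Lnorm p M (f i) + Lnorm p M (\<lambda>x. \<Sum>i\<in>I. f i x)"
    using insert by (intro Lnorm_add p borel_measurable_sum) auto
  also have "\<dots> \<le> Lnorm p M (f i) + (\<Sum>i\<in>I. Lnorm p M (f i))"
    using insert by (intro add_left_mono) auto
  finally show ?case using insert by simp
qed

lemma (in prob_space) Lnorm_add_const:
  assumes "p \<ge> 1" "f \<in> borel_measurable M"
  shows "Lnorm p M (\<lambda>x. f x + c) \<le> Lnorm p M f + c"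
  using Lnorm_add[of p f M "\<lambda>_. c"] Lnorm_const[of p c] assms by simp

text \<open>Jensen's inequality: the concave power is bounded by its tangent at \<open>s powr p\<close>.\<close>

lemma (in prob_space) Lnorm_epowr_le:
  assumes p: "p > 0" and \<alpha>: "0 < \<alpha>" "\<alpha> \<le> 1" and f [measurable]: "f \<in> borel_measurable M"
    and s: "s > 0" and le: "Lnorm p M f \<le> ennreal s"
  shows "Lnorm p M (\<lambda>x. epowr (f x) \<alpha>) \<le> ennreal (s powr \<alpha>)"
proof -
  define S where "S = s powr p"
  have S: "S > 0" using s by (simp add: S_def)
  have pt: "epowr y \<alpha> \<le> ennreal (\<alpha> * S powr (\<alpha> - 1)) * y + ennreal ((1 - \<alpha>) * S powr \<alpha>)" for y
  proof (cases y)
    case (real r)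
    have "r powr \<alpha> \<le> \<alpha> * S powr (\<alpha> - 1) * r + (1 - \<alpha>) * S powr \<alpha>"
    proof (cases "r = 0")
      case False
      then have r: "r > 0" using real by simp
      \<comment> \<open>The weighted inequality between arithmetic and geometric mean is the tangent
        inequality multiplied by \<open>S powr (1 - \<alpha>)\<close>.\<close>
      have "r powr \<alpha> * S powr (1 - \<alpha>) \<le> \<alpha> * r + (1 - \<alpha>) * S"
        using Youngs_inequality_0[of \<alpha> "1 - \<alpha>" r S] \<alpha> r S by simp
      then have "r powr \<alpha> * S powr (1 - \<alpha>) * S powr (\<alpha> - 1) \<le> (\<alpha> * r + (1 - \<alpha>) * S) * S powr (\<alpha> - 1)"
        by (intro mult_right_mono) auto
      then show ?thesis
        using S by (simp add: powr_diff divide_simps) (simp add: algebra_simps)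
    qed (use \<alpha> in auto)
    then have "ennreal (r powr \<alpha>) \<le> ennreal (\<alpha> * S powr (\<alpha> - 1) * r + (1 - \<alpha>) * S powr \<alpha>)"
      by (rule ennreal_leI)
    also have "\<dots> = ennreal (\<alpha> * S powr (\<alpha> - 1)) * y + ennreal ((1 - \<alpha>) * S powr \<alpha>)"
      using real \<alpha> by (simp add: ennreal_mult)
    finally show ?thesis using real by (simp add: epowr_ennreal)
  next
    case top
    then show ?thesis using \<alpha> S by (simp add: ennreal_mult_top)
  qed
  have "(\<integral>\<^sup>+x. epowr (epowr (f x) \<alpha>) p \<partial>M) = (\<integral>\<^sup>+x. epowr (epowr (f x) p) \<alpha> \<partial>M)"
    by (simp add: epowr_epowr mult.commute)
  also have "\<dots> \<le> (\<integral>\<^sup>+x. ennreal (\<alpha> * S powr (\<alpha> - 1)) * epowr (f x) p + ennreal ((1 - \<alpha>) * S powr \<alpha>) \<partial>M)"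
    by (intro nn_integral_mono pt)
  also have "\<dots> = ennreal (\<alpha> * S powr (\<alpha> - 1)) * (\<integral>\<^sup>+x. epowr (f x) p \<partial>M) + ennreal ((1 - \<alpha>) * S powr \<alpha>)"
    by (simp add: nn_integral_add nn_integral_cmult emeasure_space_1)
  also have "\<dots> \<le> ennreal (\<alpha> * S powr (\<alpha> - 1)) * ennreal S + ennreal ((1 - \<alpha>) * S powr \<alpha>)"
    using le p s by (intro add_right_mono mult_left_mono) (auto simp: Lnorm_le_iff epowr_ennreal S_def)
  also have "\<dots> = ennreal (S powr \<alpha>)"
    using S \<alpha> by (simp add: powr_diff algebra_simps flip: ennreal_mult ennreal_plus)
  also have "\<dots> = epowr (ennreal (s powr \<alpha>)) p"
    using s by (simp add: S_def epowr_ennreal powr_powr mult.commute)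
  finally show ?thesis using p by (simp add: Lnorm_le_iff)
qed

section \<open>Regular conditional laws\<close>

text \<open>A version of the conditional law of \<open>Y\<close> given \<open>X\<close>. The
  identity is required for all nonnegative measurable functions of the pair, the form in which
  kernels are composed later; \<open>cond_kernelI\<close> recovers it from rectangles.\<close>

definition cond_kernel ::
  "'w measure \<Rightarrow> 'a measure \<Rightarrow> ('w \<Rightarrow> 'a) \<Rightarrow> 'b measure \<Rightarrow> ('w \<Rightarrow> 'b) \<Rightarrow> ('a \<Rightarrow> 'b measure) \<Rightarrow> bool" where
  "cond_kernel P M X N Y \<kappa> \<longleftrightarrow> \<kappa> \<in> M \<rightarrow>\<^sub>M prob_algebra N \<and>
     (\<forall>f\<in>borel_measurable (M \<Otimes>\<^sub>M N).
        (\<integral>\<^sup>+\<omega>. f (X \<omega>, Y \<omega>) \<partial>P) = (\<integral>\<^sup>+\<omega>. \<integral>\<^sup>+y. f (X \<omega>, y) \<partial>\<kappa> (X \<omega>) \<partial>P))"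

lemma nn_integral_kernel_measurable [measurable (raw)]:
  assumes "K \<in> M \<rightarrow>\<^sub>M prob_algebra N" "(\<lambda>(x, y). f x y) \<in> borel_measurable (M \<Otimes>\<^sub>M N)"
  shows "(\<lambda>x. \<integral>\<^sup>+y. f x y \<partial>K x) \<in> borel_measurable M"
  using nn_integral_measurable_subprob_algebra2[OF assms(2) measurable_prob_algebraD[OF assms(1)]] .

lemma emeasure_kernel_measurable:
  assumes "K \<in> M \<rightarrow>\<^sub>M prob_algebra N" "A \<in> sets N"
  shows "(\<lambda>x. emeasure (K x) A) \<in> borel_measurable M"
  using measurable_emeasure_kernel[OF measurable_prob_algebraD[OF assms(1)] assms(2)] .

lemma kernelD:
  assumes "K \<in> M \<rightarrow>\<^sub>M prob_algebra N" "x \<in> space M"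
  shows "prob_space (K x)" "sets (K x) = sets N" "space (K x) = space N"
  using measurable_space[OF assms] by (auto simp: space_prob_algebra dest: sets_eq_imp_space_eq)

text \<open>Two monotone class arguments: Dynkin's lemma extends the identity from the generator
  \<open>G\<close> to all of \<open>sets N\<close>; after that the joint law \<open>L\<close> of
  \<open>X\<close> and \<open>Y\<close> and the law \<open>R\<close> obtained by sampling from the
  kernel agree on rectangles, hence everywhere.\<close>

lemma cond_kernelI:
  assumes "prob_space P" and X [measurable]: "X \<in> P \<rightarrow>\<^sub>M M" and Y [measurable]: "Y \<in> P \<rightarrow>\<^sub>M N"
    and G: "sets N = sigma_sets (space N) G" "Int_stable G" "G \<subseteq> Pow (space N)"
    and \<kappa> [measurable]: "\<kappa> \<in> M \<rightarrow>\<^sub>M prob_algebra N"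
    and rect: "\<And>A B. A \<in> sets M \<Longrightarrow> B \<in> G \<Longrightarrow>
      emeasure P {\<omega>\<in>space P. X \<omega> \<in> A \<and> Y \<omega> \<in> B} =
      (\<integral>\<^sup>+\<omega>. indicator A (X \<omega>) * emeasure (\<kappa> (X \<omega>)) B \<partial>P)"
  shows "cond_kernel P M X N Y \<kappa>"
proof -
  interpret P: prob_space P by fact
  have [measurable]: "(\<lambda>x. emeasure (\<kappa> x) B) \<in> borel_measurable M" if "B \<in> sets N" for B
    using emeasure_kernel_measurable[OF \<kappa> that] .
  have \<kappa>X: "prob_space (\<kappa> (X \<omega>))" "sets (\<kappa> (X \<omega>)) = sets N" "space (\<kappa> (X \<omega>)) = space N"
    if "\<omega> \<in> space P" for \<omega>
    using kernelD[OF \<kappa> measurable_space[OF X that]] by auto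
  have ext: "emeasure P {\<omega>\<in>space P. X \<omega> \<in> A \<and> Y \<omega> \<in> B} =
      (\<integral>\<^sup>+\<omega>. indicator A (X \<omega>) * emeasure (\<kappa> (X \<omega>)) B \<partial>P)" (is "?L B = ?R B")
    if A [measurable]: "A \<in> sets M" and B: "B \<in> sets N" for A B
    using G(2,3) B[unfolded G(1)]
  proof (induction B rule: sigma_sets_induct_disjoint)
    case (basic B)
    then show ?case by (rule rect[OF A])
  next
    case empty
    show ?case by simp
  next
    case (compl B)
    have B [measurable]: "B \<in> sets N" using compl(1) G(1) by simp
    have "?L (space N - B) = emeasure P ({\<omega>\<in>space P. X \<omega> \<in> A} - {\<omega>\<in>space P. X \<omega> \<in> A \<and> Y \<omega> \<in> B})"
      using measurable_space[OF Y] by (intro arg_cong[where f = "emeasure P"]) auto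
    also have "\<dots> = emeasure P {\<omega>\<in>space P. X \<omega> \<in> A} - ?L B"
      by (intro emeasure_Diff) auto
    also have "emeasure P {\<omega>\<in>space P. X \<omega> \<in> A} = (\<integral>\<^sup>+\<omega>. indicator A (X \<omega>) \<partial>P)"
    proof -
      have "(\<integral>\<^sup>+\<omega>. indicator A (X \<omega>) \<partial>P) = (\<integral>\<^sup>+\<omega>. indicator {\<omega>\<in>space P. X \<omega> \<in> A} \<omega> \<partial>P)"
        by (intro nn_integral_cong) (auto split: split_indicator)
      then show ?thesis by simp
    qed
    also have "\<dots> - ?L B = (\<integral>\<^sup>+\<omega>. indicator A (X \<omega>) - indicator A (X \<omega>) * emeasure (\<kappa> (X \<omega>)) B \<partial>P)"
      unfolding compl(2)
    proof (rule nn_integral_diff[symmetric])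
      show "(\<integral>\<^sup>+ \<omega>. indicator A (X \<omega>) * emeasure (\<kappa> (X \<omega>)) B \<partial>P) \<noteq> \<infinity>"
        unfolding compl(2)[symmetric] by simp
      show "AE \<omega> in P. indicator A (X \<omega>) * emeasure (\<kappa> (X \<omega>)) B \<le> (indicator A (X \<omega>) :: ennreal)"
        using \<kappa>X by (intro AE_I2) (auto simp: indicator_def subprob_space.subprob_emeasure_le_1 prob_space_imp_subprob_space)
    qed measurable
    also have "\<dots> = ?R (space N - B)"
    proof (intro nn_integral_cong)
      fix \<omega> assume \<omega>: "\<omega> \<in> space P"
      interpret K: prob_space "\<kappa> (X \<omega>)" using \<kappa>X[OF \<omega>] by simp
      have "emeasure (\<kappa> (X \<omega>)) (space N - B) = 1 - emeasure (\<kappa> (X \<omega>)) B"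
        using \<kappa>X[OF \<omega>] K.emeasure_space_1 emeasure_compl[of B "\<kappa> (X \<omega>)"] B by auto
      then show "indicator A (X \<omega>) - indicator A (X \<omega>) * emeasure (\<kappa> (X \<omega>)) B =
          indicator A (X \<omega>) * emeasure (\<kappa> (X \<omega>)) (space N - B)"
        by (auto simp: indicator_def)
    qed
    finally show ?case .
  next
    case (union B)
    have B [measurable]: "\<And>i. B i \<in> sets N" using union(2) G(1) by auto
    have "?L (\<Union>i. B i) = emeasure P (\<Union>i. {\<omega>\<in>space P. X \<omega> \<in> A \<and> Y \<omega> \<in> B i})"
      by (intro arg_cong[where f = "emeasure P"]) auto
    also have "\<dots> = (\<Sum>i. ?L (B i))"
      using union(1) by (intro suminf_emeasure[symmetric]) (auto simp: disjoint_family_on_def)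
    also have "\<dots> = (\<integral>\<^sup>+\<omega>. (\<Sum>i. indicator A (X \<omega>) * emeasure (\<kappa> (X \<omega>)) (B i)) \<partial>P)"
      unfolding union(3) by (intro nn_integral_suminf[symmetric]) measurable
    also have "\<dots> = ?R (\<Union>i. B i)"
    proof (intro nn_integral_cong)
      fix \<omega> assume \<omega>: "\<omega> \<in> space P"
      show "(\<Sum>i. indicator A (X \<omega>) * emeasure (\<kappa> (X \<omega>)) (B i)) = indicator A (X \<omega>) * emeasure (\<kappa> (X \<omega>)) (\<Union>i. B i)"
        using \<kappa>X[OF \<omega>] union(1) B by (subst suminf_emeasure[symmetric]) auto
    qed
    finally show ?case .
  qed
  define L where "L = distr P (M \<Otimes>\<^sub>M N) (\<lambda>\<omega>. (X \<omega>, Y \<omega>))"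
  define R where "R = P \<bind> (\<lambda>\<omega>. distr (\<kappa> (X \<omega>)) (M \<Otimes>\<^sub>M N) (\<lambda>y. (X \<omega>, y)))"
  have kern [measurable]: "(\<lambda>\<omega>. distr (\<kappa> (X \<omega>)) (M \<Otimes>\<^sub>M N) (\<lambda>y. (X \<omega>, y))) \<in> P \<rightarrow>\<^sub>M prob_algebra (M \<Otimes>\<^sub>M N)"
    by measurable
  have int_R: "(\<integral>\<^sup>+z. f z \<partial>R) = (\<integral>\<^sup>+\<omega>. \<integral>\<^sup>+y. f (X \<omega>, y) \<partial>\<kappa> (X \<omega>) \<partial>P)"
    if [measurable]: "f \<in> borel_measurable (M \<Otimes>\<^sub>M N)" for f
  proof -
    have "(\<integral>\<^sup>+z. f z \<partial>R) = (\<integral>\<^sup>+\<omega>. \<integral>\<^sup>+z. f z \<partial>distr (\<kappa> (X \<omega>)) (M \<Otimes>\<^sub>M N) (\<lambda>y. (X \<omega>, y)) \<partial>P)"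
      unfolding R_def by (rule nn_integral_bind[OF that measurable_prob_algebraD[OF kern]])
    also have "\<dots> = (\<integral>\<^sup>+\<omega>. \<integral>\<^sup>+y. f (X \<omega>, y) \<partial>\<kappa> (X \<omega>) \<partial>P)"
    proof (intro nn_integral_cong nn_integral_distr)
      fix \<omega> assume "\<omega> \<in> space P"
      then show "Pair (X \<omega>) \<in> \<kappa> (X \<omega>) \<rightarrow>\<^sub>M M \<Otimes>\<^sub>M N"
        using \<kappa>X(2) measurable_space[OF X] by (simp cong: measurable_cong_sets)
    qed measurable
    finally show ?thesis .
  qed
  have sR: "sets R = sets (M \<Otimes>\<^sub>M N)"
    unfolding R_def by (rule sets_bind) (auto simp: P.not_empty)
  have "L = R"
  proof (rule measure_eqI_generator_eq[OF Int_stable_pair_measure_generator[of M N], where \<Omega> = "space M \<times> space N" and A = "\<lambda>_. space M \<times> space N"])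
    fix E assume "E \<in> {a \<times> b |a b. a \<in> sets M \<and> b \<in> sets N}"
    then obtain A B where E: "E = A \<times> B" and [measurable]: "A \<in> sets M" "B \<in> sets N" by auto
    have "emeasure L E = emeasure P {\<omega>\<in>space P. X \<omega> \<in> A \<and> Y \<omega> \<in> B}"
      unfolding L_def E by (subst emeasure_distr) (auto intro!: arg_cong[where f = "emeasure P"])
    also have "\<dots> = (\<integral>\<^sup>+\<omega>. indicator A (X \<omega>) * emeasure (\<kappa> (X \<omega>)) B \<partial>P)"
      by (rule ext) auto
    also have "\<dots> = (\<integral>\<^sup>+\<omega>. \<integral>\<^sup>+y. indicator E (X \<omega>, y) \<partial>\<kappa> (X \<omega>) \<partial>P)"
    proof (intro nn_integral_cong)
      fix \<omega> assume "\<omega> \<in> space P"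
      then show "indicator A (X \<omega>) * emeasure (\<kappa> (X \<omega>)) B = (\<integral>\<^sup>+y. indicator E (X \<omega>, y) \<partial>\<kappa> (X \<omega>))"
        using \<kappa>X(2)[of \<omega>] by (cases "X \<omega> \<in> A") (simp_all add: E indicator_times)
    qed
    also have "\<dots> = (\<integral>\<^sup>+z. indicator E z \<partial>R)"
      unfolding E by (intro int_R[symmetric]) auto
    also have "\<dots> = emeasure R E"
      using sR by (intro nn_integral_indicator) (auto simp: E)
    finally show "emeasure L E = emeasure R E" .
  next
    show "emeasure L (space M \<times> space N) \<noteq> \<infinity>"
      unfolding L_def by (subst emeasure_distr) auto
    show "{a \<times> b |a b. a \<in> sets M \<and> b \<in> sets N} \<subseteq> Pow (space M \<times> space N)"
      using pair_measure_closed by blast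
  qed (auto simp: sR L_def sets_pair_measure)
  then show ?thesis
    unfolding cond_kernel_def
  proof (intro conjI \<kappa> ballI)
    fix f :: "_ \<Rightarrow> ennreal" assume [measurable]: "f \<in> borel_measurable (M \<Otimes>\<^sub>M N)"
    have "(\<integral>\<^sup>+\<omega>. f (X \<omega>, Y \<omega>) \<partial>P) = (\<integral>\<^sup>+z. f z \<partial>L)"
      unfolding L_def by (subst nn_integral_distr) auto
    with int_R \<open>L = R\<close> show "(\<integral>\<^sup>+\<omega>. f (X \<omega>, Y \<omega>) \<partial>P) = (\<integral>\<^sup>+\<omega>. \<integral>\<^sup>+y. f (X \<omega>, y) \<partial>\<kappa> (X \<omega>) \<partial>P)"
      by simp
  qed
qed

text \<open>On the set where \<open>g < f\<close> the hypothesis contradicts strict monotonicity of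
  the integral unless that set is null. Finiteness of the integral of \<open>g\<close> is what makes
  the comparison strict.\<close>

lemma AE_le_if_nn_integral_le:
  assumes [measurable]: "f \<in> borel_measurable M" "g \<in> borel_measurable M"
    and fin: "(\<integral>\<^sup>+x. g x \<partial>M) < \<infinity>"
    and le: "\<And>A. A \<in> sets M \<Longrightarrow> (\<integral>\<^sup>+x. f x * indicator A x \<partial>M) \<le> (\<integral>\<^sup>+x. g x * indicator A x \<partial>M)"
  shows "AE x in M. f x \<le> g x"
proof (rule ccontr)
  define A where "A = {x\<in>space M. g x < f x}"
  have A [measurable]: "A \<in> sets M" by (auto simp: A_def)
  assume nle: "\<not> (AE x in M. f x \<le> g x)"
  have "\<not> (AE x in M. f x * indicator A x \<le> g x * indicator A x)"
  proof
    assume "AE x in M. f x * indicator A x \<le> g x * indicator A x"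
    with AE_space have "AE x in M. f x \<le> g x"
    proof eventually_elim
      case (elim x)
      then show ?case by (cases "x \<in> A") (auto simp: A_def)
    qed
    with nle show False ..
  qed
  moreover have "(\<integral>\<^sup>+x. g x * indicator A x \<partial>M) \<noteq> \<infinity>"
  proof -
    have "(\<integral>\<^sup>+x. g x * indicator A x \<partial>M) \<le> (\<integral>\<^sup>+x. g x \<partial>M)"
      by (intro nn_integral_mono) (auto simp: indicator_def)
    then show ?thesis using fin by (auto simp: top_unique)
  qed
  ultimately have "(\<integral>\<^sup>+x. g x * indicator A x \<partial>M) < (\<integral>\<^sup>+x. f x * indicator A x \<partial>M)"
    by (intro nn_integral_less) (auto simp: A_def indicator_def intro: less_imp_le)
  with le[OF A] show False by simp
qed


text \<open>On the rationals, \<open>g\<close> is a distribution function up to right continuity.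
  The infimum \<open>H\<close> over rationals strictly to the right restores right continuity and
  keeps the limits at both ends.\<close>

lemma interval_measure_of_rational_values:
  fixes g :: "real \<Rightarrow> ennreal"
  assumes le1: "\<And>q. q \<in> \<rat> \<Longrightarrow> g q \<le> 1"
    and mono: "\<And>q r. q \<in> \<rat> \<Longrightarrow> r \<in> \<rat> \<Longrightarrow> q \<le> r \<Longrightarrow> g q \<le> g r"
    and inf: "(INF n. g (- real n)) = 0" and sup: "1 \<le> (SUP n. g (real n))"
  defines "H \<equiv> (\<lambda>y. INF q\<in>{q\<in>\<rat>. y < q}. g q)"
  shows "real_distribution (interval_measure (\<lambda>y. enn2real (H y)))"
    and "emeasure (interval_measure (\<lambda>y. enn2real (H y))) {..y} = H y"
proof -
  have H1: "H y \<le> 1" for y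
  proof -
    obtain q where "q \<in> \<rat>" "y < q" using Rats_dense_in_real[of y "y + 1"] by auto
    then have "H y \<le> g q" unfolding H_def by (intro INF_lower) auto
    also have "\<dots> \<le> 1" using le1 \<open>q \<in> \<rat>\<close> by auto
    finally show ?thesis .
  qed
  then have Hfin: "H y < \<top>" for y by (rule le_less_trans) simp
  then have F: "ennreal (enn2real (H y)) = H y" for y by simp
  have F_leI: "enn2real (H y) \<le> c" if "H y \<le> ennreal c" "0 \<le> c" for y c
    using enn2real_mono[OF that(1)] that(2) by simp
  have Hmono: "H y \<le> H z" if "y \<le> z" for y z
    unfolding H_def using that by (intro INF_superset_mono) auto
  have Fmono: "enn2real (H y) \<le> enn2real (H z)" if "y \<le> z" for y z
    using Hmono[OF that] Hfin by (intro enn2real_mono) auto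
  have Fcont: "continuous (at_right a) (\<lambda>y. enn2real (H y))" for a
  proof (subst continuous_at_right_real_increasing)
    show "\<forall>e>0. \<exists>d>0. enn2real (H (a + d)) - enn2real (H a) < e"
    proof (intro allI impI)
      fix e :: real assume e: "e > 0"
      have "H a < H a + ennreal (e / 2)" using Hfin[of a] e by (cases "H a") auto
      then obtain q where q: "q \<in> \<rat>" "a < q" "g q < H a + ennreal (e / 2)"
        unfolding H_def by (auto simp: INF_less_iff)
      \<comment> \<open>The midpoint still lies to the left of \<open>q\<close>, a rational at which
        the infimum defining \<open>H a\<close> is nearly attained.\<close>
      have "H (a + (q - a) / 2) \<le> g q"
        unfolding H_def using q by (intro INF_lower) (auto simp: field_simps)
      also have "\<dots> \<le> H a + ennreal (e / 2)" using q by simp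
      also have "\<dots> = ennreal (enn2real (H a) + e / 2)" using e by (simp add: F)
      finally have "enn2real (H (a + (q - a) / 2)) \<le> enn2real (H a) + e / 2"
        using e by (intro F_leI) auto
      with q e show "\<exists>d>0. enn2real (H (a + d)) - enn2real (H a) < e"
        by (intro exI[of _ "(q - a) / 2"]) auto
    qed
  qed (rule Fmono)
  have bot: "((\<lambda>y. enn2real (H y)) \<longlongrightarrow> 0) at_bot"
  proof (rule tendstoI)
    fix e :: real assume e: "e > 0"
    then have "(INF n. g (- real n)) < ennreal e" using inf by simp
    then obtain n where n: "g (- real n) < ennreal e" by (auto simp: INF_less_iff)
    have "enn2real (H y) < e" if "y < - real n" for y
    proof -
      have "H y \<le> g (- real n)" unfolding H_def using that by (intro INF_lower) auto
      then have "H y < ennreal e" using n by (rule le_less_trans)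
      then show ?thesis using e Hfin F by (metis enn2real_nonneg ennreal_less_iff)
    qed
    then show "\<forall>\<^sub>F y in at_bot. dist (enn2real (H y)) 0 < e"
      by (auto simp: eventually_at_bot_dense)
  qed
  have top: "((\<lambda>y. enn2real (H y)) \<longlongrightarrow> 1) at_top"
  proof (rule tendstoI)
    fix e :: real assume e: "e > 0"
    have "ennreal (1 - e) < (SUP n. g (real n))"
      using e sup by (intro less_le_trans[OF _ sup]) (auto simp: ennreal_less_one_iff)
    then obtain n where n: "ennreal (1 - e) < g (real n)" by (auto simp: less_SUP_iff)
    have "\<bar>enn2real (H y) - 1\<bar> < e" if "real n < y" for y
    proof -
      have "g (real n) \<le> H y" unfolding H_def using that by (intro INF_greatest mono) auto
      with n have "ennreal (1 - e) < ennreal (enn2real (H y))" unfolding F by (rule less_le_trans)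
      then have "1 - e < enn2real (H y)"
        by (meson ennreal_leI not_le)
      moreover have "enn2real (H y) \<le> 1" using H1[of y] by (intro F_leI) auto
      ultimately show ?thesis by simp
    qed
    then show "\<forall>\<^sub>F y in at_top. dist (enn2real (H y)) 1 < e"
      by (auto simp: eventually_at_top_dense dist_real_def)
  qed
  show "real_distribution (interval_measure (\<lambda>y. enn2real (H y)))"
    by (rule real_distribution_interval_measure[OF Fmono Fcont bot top])
  show "emeasure (interval_measure (\<lambda>y. enn2real (H y))) {..y} = H y"
    using emeasure_interval_measure_Iic[OF Fmono Fcont bot, of y] F by simp
qed

text \<open>Conditional distribution functions from Radon-Nikodym densities: \<open>G y\<close> is
  the density of \<open>A \<mapsto> P (X \<in> A, Y \<le> y)\<close> with respect to the law of
  \<open>X\<close>. Each required relation holds almost surely, and restricted to rational arguments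
  there are only countably many of them, so they hold simultaneously outside a null set.\<close>

lemma cond_kernel_real_exists:
  assumes "prob_space P" and X [measurable]: "X \<in> P \<rightarrow>\<^sub>M M" and Y [measurable]: "Y \<in> borel_measurable P"
  shows "\<exists>\<kappa>. cond_kernel P M X (borel :: real measure) Y \<kappa>"
proof -
  interpret P: prob_space P by fact
  define m where "m = distr P M X"
  have sm [measurable_cong, simp]: "sets m = sets M" and spm [simp]: "space m = space M" by (auto simp: m_def)
  interpret m: prob_space m unfolding m_def by (rule P.prob_space_distr) fact
  define \<nu> where "\<nu> y = distr (density P (\<lambda>\<omega>. indicator {..y} (Y \<omega>))) M X" for y
  define G where "G y = RN_deriv m (\<nu> y)" for y
  have [measurable]: "G y \<in> borel_measurable M" for y
    using borel_measurable_RN_deriv[of m "\<nu> y"] by (simp add: G_def cong: measurable_cong_sets)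
  have em_m: "emeasure m A = emeasure P {\<omega>\<in>space P. X \<omega> \<in> A}" if "A \<in> sets M" for A
    unfolding m_def using that by (subst emeasure_distr) (auto intro!: arg_cong[where f = "emeasure P"])
  have em_\<nu>: "emeasure (\<nu> y) A = emeasure P {\<omega>\<in>space P. X \<omega> \<in> A \<and> Y \<omega> \<le> y}" if [measurable]: "A \<in> sets M" for A y
  proof -
    have "emeasure (\<nu> y) A = (\<integral>\<^sup>+\<omega>. indicator {..y} (Y \<omega>) * indicator (X -` A \<inter> space P) \<omega> \<partial>P)"
      unfolding \<nu>_def by (subst emeasure_distr) (auto simp: emeasure_density)
    also have "\<dots> = (\<integral>\<^sup>+\<omega>. indicator {\<omega>\<in>space P. X \<omega> \<in> A \<and> Y \<omega> \<le> y} \<omega> \<partial>P)"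
      by (intro nn_integral_cong) (auto split: split_indicator)
    finally show ?thesis by simp
  qed
  have int_G: "(\<integral>\<^sup>+x. G y x * indicator A x \<partial>m) = emeasure P {\<omega>\<in>space P. X \<omega> \<in> A \<and> Y \<omega> \<le> y}"
    if [measurable]: "A \<in> sets M" for A y
  proof -
    have "absolutely_continuous m (\<nu> y)"
    proof (unfold absolutely_continuous_def, safe)
      fix A assume A: "A \<in> null_sets m"
      then have [measurable]: "A \<in> sets M" by auto
      have "emeasure (\<nu> y) A \<le> emeasure m A"
        by (subst em_\<nu>, simp, subst em_m, simp, intro emeasure_mono) auto
      with A show "A \<in> null_sets (\<nu> y)" by (auto simp: null_sets_def \<nu>_def)
    qed
    then have "density m (G y) = \<nu> y"
      unfolding G_def by (rule m.density_RN_deriv) (simp add: \<nu>_def)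
    then have "emeasure (\<nu> y) A = emeasure (density m (G y)) A" by simp
    also have "\<dots> = (\<integral>\<^sup>+x. G y x * indicator A x \<partial>m)"
      by (rule emeasure_density) auto
    finally show ?thesis by (simp add: em_\<nu>)
  qed
  have fin: "(\<integral>\<^sup>+x. G y x \<partial>m) < \<infinity>" for y
  proof -
    have "(\<integral>\<^sup>+x. G y x \<partial>m) = (\<integral>\<^sup>+x. G y x * indicator (space M) x \<partial>m)"
      by (intro nn_integral_cong) auto
    also have "\<dots> < \<infinity>" by (subst int_G) (auto simp: less_top[symmetric])
    finally show ?thesis .
  qed
  have G_mono: "AE x in m. G q x \<le> G r x" if "q \<le> r" for q r
  proof (rule AE_le_if_nn_integral_le)
    fix A assume "A \<in> sets m"
    then show "(\<integral>\<^sup>+x. G q x * indicator A x \<partial>m) \<le> (\<integral>\<^sup>+x. G r x * indicator A x \<partial>m)"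
      using that by (simp add: int_G) (intro emeasure_mono, auto)
  next
    show "(\<integral>\<^sup>+x. G r x \<partial>m) < \<infinity>" by (rule fin)
  qed auto
  have G_le1: "AE x in m. G q x \<le> 1" for q
  proof (rule AE_le_if_nn_integral_le)
    fix A assume A: "A \<in> sets m"
    then have "(\<integral>\<^sup>+x. G q x * indicator A x \<partial>m) \<le> emeasure m A"
      by (simp add: int_G em_m) (intro emeasure_mono, auto)
    then show "(\<integral>\<^sup>+x. G q x * indicator A x \<partial>m) \<le> (\<integral>\<^sup>+x. 1 * indicator A x \<partial>m)"
      using A by simp
  qed (auto simp: m.emeasure_space_1[simplified])
  have G_inf: "AE x in m. (INF n. G (- real n) x) \<le> 0"
  proof (rule AE_le_if_nn_integral_le)
    fix A assume A [measurable]: "A \<in> sets m"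
    have "(\<integral>\<^sup>+x. (INF n. G (- real n) x) * indicator A x \<partial>m) \<le> emeasure P {\<omega>\<in>space P. X \<omega> \<in> A \<and> Y \<omega> \<le> - real n}" for n
      using A by (subst int_G[symmetric]) (auto intro!: nn_integral_mono mult_right_mono INF_lower)
    moreover have "(\<lambda>n. emeasure P {\<omega>\<in>space P. X \<omega> \<in> A \<and> Y \<omega> \<le> - real n}) \<longlonglongrightarrow>
        emeasure P (\<Inter>n. {\<omega>\<in>space P. X \<omega> \<in> A \<and> Y \<omega> \<le> - real n})"
      using A by (intro Lim_emeasure_decseq) (auto simp: decseq_def)
    moreover have "(\<Inter>n. {\<omega>\<in>space P. X \<omega> \<in> A \<and> Y \<omega> \<le> - real n}) = {}"
    proof (rule equals0I)
      fix \<omega> assume *: "\<omega> \<in> (\<Inter>n. {\<omega>\<in>space P. X \<omega> \<in> A \<and> Y \<omega> \<le> - real n})"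
      obtain n where "real n > - Y \<omega>" using reals_Archimedean2 by blast
      moreover have "Y \<omega> \<le> - real n" using * by blast
      ultimately show False by simp
    qed
    ultimately have "(\<integral>\<^sup>+x. (INF n. G (- real n) x) * indicator A x \<partial>m) \<le> 0"
      by (intro LIMSEQ_le_const) auto
    then show "(\<integral>\<^sup>+x. (INF n. G (- real n) x) * indicator A x \<partial>m) \<le> (\<integral>\<^sup>+x. 0 * indicator A x \<partial>m)"
      by simp
  qed auto
  have G_sup: "AE x in m. 1 \<le> (SUP n. G (real n) x)"
  proof -
    \<comment> \<open>Truncation at 1 provides the finite integral that the comparison principle
      asks for.\<close>
    have "AE x in m. 1 \<le> min 1 (SUP n. G (real n) x)"
    proof (rule AE_le_if_nn_integral_le)
      show "(\<integral>\<^sup>+x. min 1 (SUP n. G (real n) x) \<partial>m) < \<infinity>"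
        by (rule le_less_trans[OF nn_integral_mono[of _ _ "\<lambda>_. 1"]]) (auto simp: m.emeasure_space_1[simplified])
      fix A assume A [measurable]: "A \<in> sets m"
      have "emeasure P {\<omega>\<in>space P. X \<omega> \<in> A \<and> Y \<omega> \<le> real n} \<le> (\<integral>\<^sup>+x. min 1 (SUP n. G (real n) x) * indicator A x \<partial>m)" for n
        using A G_le1[of "real n"]
        by (subst int_G[symmetric]) (auto intro!: nn_integral_mono_AE mult_right_mono SUP_upper elim!: eventually_mono)
      moreover have "(\<lambda>n. emeasure P {\<omega>\<in>space P. X \<omega> \<in> A \<and> Y \<omega> \<le> real n}) \<longlonglongrightarrow>
          emeasure P (\<Union>n. {\<omega>\<in>space P. X \<omega> \<in> A \<and> Y \<omega> \<le> real n})"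
        using A by (intro Lim_emeasure_incseq) (auto simp: incseq_def)
      moreover have "(\<Union>n. {\<omega>\<in>space P. X \<omega> \<in> A \<and> Y \<omega> \<le> real n}) = {\<omega>\<in>space P. X \<omega> \<in> A}"
        using real_arch_simple by auto
      ultimately have "emeasure m A \<le> (\<integral>\<^sup>+x. min 1 (SUP n. G (real n) x) * indicator A x \<partial>m)"
        using A by (intro LIMSEQ_le_const2) (auto simp: em_m)
      then show "(\<integral>\<^sup>+x. 1 * indicator A x \<partial>m) \<le> (\<integral>\<^sup>+x. min 1 (SUP n. G (real n) x) * indicator A x \<partial>m)"
        using A by simp
    qed auto
    then show ?thesis by auto
  qed
  \<comment> \<open>The points at which all countably many conditions hold. At the others a point
    mass at 0 serves as the kernel.\<close>
  define N where "N x \<longleftrightarrow> (\<forall>q\<in>\<rat>. G q x \<le> 1 \<and> (\<forall>r\<in>\<rat>. q \<le> r \<longrightarrow> G q x \<le> G r x)) \<and>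
      (INF n. G (- real n) x) \<le> 0 \<and> 1 \<le> (SUP n. G (real n) x)" for x
  have AE_N: "AE x in m. N x"
    unfolding N_def using G_inf G_sup G_le1 G_mono
    by (auto simp: AE_ball_countable[OF countable_rat] countable_rat)
  have [measurable]: "Measurable.pred M N"
  proof -
    have Rats: "(\<forall>q\<in>\<rat>. R q) \<longleftrightarrow> (\<forall>q. R (of_rat q))" for R :: "real \<Rightarrow> bool"
      by (auto simp: Rats_def)
    show ?thesis unfolding N_def Rats by measurable
  qed
  define H where "H x y = (INF q\<in>{q\<in>\<rat>. y < q}. G q x)" for x y
  have [measurable]: "(\<lambda>x. H x y) \<in> borel_measurable M" for y
    unfolding H_def by (intro borel_measurable_INF countable_subset[OF _ countable_rat]) auto
  define \<kappa> where "\<kappa> x = (if N x then interval_measure (\<lambda>y. enn2real (H x y)) else return borel (0::real))" for x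
  have good: "real_distribution (interval_measure (\<lambda>y. enn2real (H x y)))"
      "emeasure (interval_measure (\<lambda>y. enn2real (H x y))) {..y} = H x y" if "N x" for x y
    unfolding H_def using that
    by (intro interval_measure_of_rational_values[of "\<lambda>q. G q x"]; auto simp: N_def)+
  have ps: "prob_space (\<kappa> x)" for x
    using good(1)[of x] by (auto simp: \<kappa>_def prob_space_return real_distribution_def)
  have em\<kappa>: "emeasure (\<kappa> x) {..y} = (if N x then H x y else indicator {..y} 0)" for x y
    using good(2)[of x y] by (auto simp: \<kappa>_def)
  have gen: "sets (borel :: real measure) = sigma_sets UNIV (range atMost)"
    by (simp add: borel_eq_atMost)
  have IS: "Int_stable (range (atMost :: real \<Rightarrow> _))"
    by (auto simp: Int_stable_def)
  have \<kappa>_meas: "\<kappa> \<in> M \<rightarrow>\<^sub>M prob_algebra borel"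
  proof (rule measurable_prob_algebra_generated[OF gen IS])
    fix A assume "A \<in> range (atMost :: real \<Rightarrow> _)"
    then obtain y where "A = {..y}" by auto
    then show "(\<lambda>x. emeasure (\<kappa> x) A) \<in> borel_measurable M"
      by (simp add: em\<kappa>)
  qed (use ps in \<open>auto simp: \<kappa>_def split: if_splits\<close>)
  have "cond_kernel P M X borel Y \<kappa>"
  proof (rule cond_kernelI[OF \<open>prob_space P\<close> X Y _ IS _ \<kappa>_meas])
    fix A and B :: "real set" assume A [measurable]: "A \<in> sets M" and "B \<in> range atMost"
    then obtain y where B: "B = {..y}" by auto
    have "(\<integral>\<^sup>+\<omega>. indicator A (X \<omega>) * emeasure (\<kappa> (X \<omega>)) B \<partial>P) = (\<integral>\<^sup>+x. indicator A x * emeasure (\<kappa> x) B \<partial>m)"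
      unfolding m_def B em\<kappa> by (subst nn_integral_distr) auto
    also have "\<dots> = (\<integral>\<^sup>+x. H x y * indicator A x \<partial>m)"
      using AE_N by (intro nn_integral_cong_AE) (auto simp: B em\<kappa> mult.commute elim!: eventually_mono)
    also have "\<dots> = emeasure P {\<omega>\<in>space P. X \<omega> \<in> A \<and> Y \<omega> \<le> y}"
    \<comment> \<open>Upper bound: rationals \<open>q\<close> decreasing to \<open>y\<close>, with
      continuity of \<open>P\<close> from above. Lower bound: almost surely
      \<open>G y \<le> G q\<close> for all rational \<open>q > y\<close> at once.\<close>
    proof (rule antisym)
      have "(\<integral>\<^sup>+x. H x y * indicator A x \<partial>m) \<le> emeasure P {\<omega>\<in>space P. X \<omega> \<in> A \<and> Y \<omega> \<le> y + inverse (Suc n)}" for n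
      proof -
        obtain q where q: "q \<in> \<rat>" "y < q" "q < y + inverse (Suc n)"
          using Rats_dense_in_real[of y "y + inverse (Suc n)"] by auto
        have "(\<integral>\<^sup>+x. H x y * indicator A x \<partial>m) \<le> (\<integral>\<^sup>+x. G q x * indicator A x \<partial>m)"
          using q by (intro nn_integral_mono mult_right_mono) (auto simp: H_def intro!: INF_lower)
        also have "\<dots> \<le> emeasure P {\<omega>\<in>space P. X \<omega> \<in> A \<and> Y \<omega> \<le> y + inverse (Suc n)}"
          using q by (subst int_G) (auto intro!: emeasure_mono)
        finally show ?thesis .
      qed
      moreover have "(\<lambda>n. emeasure P {\<omega>\<in>space P. X \<omega> \<in> A \<and> Y \<omega> \<le> y + inverse (Suc n)}) \<longlonglongrightarrow>
          emeasure P (\<Inter>n. {\<omega>\<in>space P. X \<omega> \<in> A \<and> Y \<omega> \<le> y + inverse (Suc n)})"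
      proof (intro Lim_emeasure_decseq)
        show "decseq (\<lambda>n. {\<omega>\<in>space P. X \<omega> \<in> A \<and> Y \<omega> \<le> y + inverse (Suc n)})"
          unfolding decseq_def
        proof (safe, simp)
          fix k n :: nat and \<omega> assume "k \<le> n" "Y \<omega> \<le> y + inverse (1 + real n)"
          moreover have "inverse (1 + real n) \<le> inverse (1 + real k)"
            using \<open>k \<le> n\<close> by (intro le_imp_inverse_le) auto
          ultimately show "Y \<omega> \<le> y + inverse (1 + real k)" by linarith
        qed
      qed auto
      moreover have "(\<Inter>n. {\<omega>\<in>space P. X \<omega> \<in> A \<and> Y \<omega> \<le> y + inverse (Suc n)}) = {\<omega>\<in>space P. X \<omega> \<in> A \<and> Y \<omega> \<le> y}"
      proof (intro set_eqI iffI)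
        fix \<omega> assume *: "\<omega> \<in> (\<Inter>n. {\<omega>\<in>space P. X \<omega> \<in> A \<and> Y \<omega> \<le> y + inverse (Suc n)})"
        have "(\<lambda>n. y + inverse (real (Suc n))) \<longlonglongrightarrow> y"
          using LIMSEQ_inverse_real_of_nat_add[of y] by simp
        then have "Y \<omega> \<le> y" using * by (intro LIMSEQ_le_const) auto
        with * show "\<omega> \<in> {\<omega>\<in>space P. X \<omega> \<in> A \<and> Y \<omega> \<le> y}" by auto
      qed (auto intro: order_trans)
      ultimately show "(\<integral>\<^sup>+x. H x y * indicator A x \<partial>m) \<le> emeasure P {\<omega>\<in>space P. X \<omega> \<in> A \<and> Y \<omega> \<le> y}"
        by (intro LIMSEQ_le_const) auto
    next
      have "AE x in m. \<forall>q\<in>{q\<in>\<rat>. y < q}. G y x \<le> G q x"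
        using G_mono by (subst AE_ball_countable) (auto intro: countable_subset[OF _ countable_rat])
      then have "AE x in m. G y x * indicator A x \<le> H x y * indicator A x"
        by eventually_elim (auto simp: H_def intro!: mult_right_mono INF_greatest)
      then have "(\<integral>\<^sup>+x. G y x * indicator A x \<partial>m) \<le> (\<integral>\<^sup>+x. H x y * indicator A x \<partial>m)"
        by (rule nn_integral_mono_AE)
      then show "emeasure P {\<omega>\<in>space P. X \<omega> \<in> A \<and> Y \<omega> \<le> y} \<le> (\<integral>\<^sup>+x. H x y * indicator A x \<partial>m)"
        by (simp add: int_G)
    qed
    finally show "emeasure P {\<omega>\<in>space P. X \<omega> \<in> A \<and> Y \<omega> \<in> B} =
        (\<integral>\<^sup>+\<omega>. indicator A (X \<omega>) * emeasure (\<kappa> (X \<omega>)) B \<partial>P)"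
      by (simp add: B)
  qed (auto simp: gen)
  then show ?thesis by blast
qed


text \<open>Induction on the coordinates: the new coordinate is conditioned on \<open>X\<close>
  together with the earlier ones, and the two kernels are composed.\<close>

lemma cond_kernel_PiM_exists:
  fixes Y :: "'i \<Rightarrow> 'w \<Rightarrow> real"
  assumes "finite I" "prob_space P" and X [measurable]: "X \<in> P \<rightarrow>\<^sub>M M"
    and Y: "\<And>i. i \<in> I \<Longrightarrow> Y i \<in> borel_measurable P"
  shows "\<exists>\<kappa>. cond_kernel P M X (\<Pi>\<^sub>M i\<in>I. borel) (\<lambda>\<omega>. \<lambda>i\<in>I. Y i \<omega>) \<kappa>"
  using assms(1) Y
proof (induction I)
  case empty
  have sp: "space (\<Pi>\<^sub>M i\<in>{}. borel :: real measure) = {\<lambda>_. undefined}" by (simp add: space_PiM)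
  have "cond_kernel P M X (\<Pi>\<^sub>M i\<in>{}. borel) (\<lambda>\<omega>. \<lambda>i\<in>{}. Y i \<omega>) (\<lambda>_. return (\<Pi>\<^sub>M i\<in>{}. borel) (\<lambda>_. undefined))"
    unfolding cond_kernel_def
  proof safe
    show "(\<lambda>_. return (\<Pi>\<^sub>M i\<in>{}. borel) (\<lambda>_. undefined)) \<in> M \<rightarrow>\<^sub>M prob_algebra (\<Pi>\<^sub>M i\<in>{}. borel :: real measure)"
      by (intro measurable_const) (auto simp: space_prob_algebra sp intro!: prob_space_return)
    fix f :: "_ \<times> ('i \<Rightarrow> real) \<Rightarrow> ennreal" assume [measurable]: "f \<in> borel_measurable (M \<Otimes>\<^sub>M (\<Pi>\<^sub>M i\<in>{}. borel :: real measure))"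
    show "(\<integral>\<^sup>+ \<omega>. f (X \<omega>, \<lambda>i\<in>{}. Y i \<omega>) \<partial>P) = (\<integral>\<^sup>+ \<omega>. \<integral>\<^sup>+ y. f (X \<omega>, y) \<partial>return (\<Pi>\<^sub>M i\<in>{}. borel) (\<lambda>_. undefined) \<partial>P)"
    proof (intro nn_integral_cong)
      fix \<omega> assume "\<omega> \<in> space P"
      then show "f (X \<omega>, \<lambda>i\<in>{}. Y i \<omega>) = (\<integral>\<^sup>+ y. f (X \<omega>, y) \<partial>return (\<Pi>\<^sub>M i\<in>{}. borel) (\<lambda>_. undefined))"
        using measurable_space[OF X] by (subst nn_integral_return) (auto simp: sp restrict_def)
    qed
  qed
  then show ?case by blast
next
  case (insert i I)
  let ?N = "\<Pi>\<^sub>M i\<in>I. borel :: real measure" and ?N' = "\<Pi>\<^sub>M i\<in>insert i I. borel :: real measure"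
  let ?Y = "\<lambda>\<omega>. \<lambda>i\<in>I. Y i \<omega>"
  have [measurable]: "Y i \<in> borel_measurable P" and [measurable]: "?Y \<in> P \<rightarrow>\<^sub>M ?N"
    using insert.prems by (auto intro!: measurable_restrict)
  obtain \<kappa> where \<kappa>: "cond_kernel P M X ?N ?Y \<kappa>"
    using insert.IH insert.prems by blast
  obtain \<kappa>' where \<kappa>': "cond_kernel P (M \<Otimes>\<^sub>M ?N) (\<lambda>\<omega>. (X \<omega>, ?Y \<omega>)) borel (Y i) \<kappa>'"
    using cond_kernel_real_exists[OF \<open>prob_space P\<close>, of "\<lambda>\<omega>. (X \<omega>, ?Y \<omega>)" "M \<Otimes>\<^sub>M ?N" "Y i"] by auto
  have [measurable]: "\<kappa> \<in> M \<rightarrow>\<^sub>M prob_algebra ?N" "\<kappa>' \<in> M \<Otimes>\<^sub>M ?N \<rightarrow>\<^sub>M prob_algebra borel"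
    using \<kappa> \<kappa>' by (auto simp: cond_kernel_def)
  have upd [measurable]: "(\<lambda>(v, u). v(i := u)) \<in> ?N \<Otimes>\<^sub>M borel \<rightarrow>\<^sub>M ?N'"
    using measurable_add_dim[of i I "\<lambda>_. borel"] by simp
  have upd' [measurable]: "(\<lambda>u. v(i := u)) \<in> borel \<rightarrow>\<^sub>M ?N'" if "v \<in> space ?N" for v
    using measurable_compose[OF measurable_Pair1'[OF that] upd] by simp
  define K where "K x = \<kappa> x \<bind> (\<lambda>v. distr (\<kappa>' (x, v)) ?N' (\<lambda>u. v(i := u)))" for x
  have inner [measurable]: "(\<lambda>(x, v). distr (\<kappa>' (x, v)) ?N' (\<lambda>u. v(i := u))) \<in> M \<Otimes>\<^sub>M ?N \<rightarrow>\<^sub>M prob_algebra ?N'"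
  proof (subst case_prod_beta', rule measurable_distr_prob_space2)
    show "(\<lambda>z. \<kappa>' (fst z, snd z)) \<in> M \<Otimes>\<^sub>M ?N \<rightarrow>\<^sub>M prob_algebra borel" by simp
    have "(\<lambda>z. (\<lambda>(v, u). v(i := u)) (snd (fst z), snd z)) \<in> (M \<Otimes>\<^sub>M ?N) \<Otimes>\<^sub>M borel \<rightarrow>\<^sub>M ?N'"
      by (rule measurable_compose[OF _ upd]) measurable
    then show "(\<lambda>(z, u). (snd z)(i := u)) \<in> (M \<Otimes>\<^sub>M ?N) \<Otimes>\<^sub>M borel \<rightarrow>\<^sub>M ?N'"
      by (simp add: case_prod_beta')
  qed
  have K [measurable]: "K \<in> M \<rightarrow>\<^sub>M prob_algebra ?N'"
    unfolding K_def by measurable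
  have intK: "(\<integral>\<^sup>+y. f y \<partial>K x) = (\<integral>\<^sup>+v. \<integral>\<^sup>+u. f (v(i := u)) \<partial>\<kappa>' (x, v) \<partial>\<kappa> x)"
    if f [measurable]: "f \<in> borel_measurable ?N'" and x: "x \<in> space M" for f x
  proof -
    have sx: "sets (\<kappa> x) = sets ?N" "space (\<kappa> x) = space ?N" using kernelD(2,3)[of \<kappa> M ?N x] x by auto
    have "(\<lambda>v. distr (\<kappa>' (x, v)) ?N' (\<lambda>u. v(i := u))) \<in> \<kappa> x \<rightarrow>\<^sub>M prob_algebra ?N'"
      using measurable_compose[OF measurable_Pair1'[OF x] inner] sx by (simp cong: measurable_cong_sets)
    then have "(\<integral>\<^sup>+y. f y \<partial>K x) = (\<integral>\<^sup>+v. \<integral>\<^sup>+y. f y \<partial>distr (\<kappa>' (x, v)) ?N' (\<lambda>u. v(i := u)) \<partial>\<kappa> x)"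
      unfolding K_def by (intro nn_integral_bind[OF f] measurable_prob_algebraD)
    also have "\<dots> = (\<integral>\<^sup>+v. \<integral>\<^sup>+u. f (v(i := u)) \<partial>\<kappa>' (x, v) \<partial>\<kappa> x)"
    proof (intro nn_integral_cong nn_integral_distr)
      fix v assume "v \<in> space (\<kappa> x)"
      then have "v \<in> space ?N" using sx by simp
      moreover from this have "sets (\<kappa>' (x, v)) = sets borel"
        using x by (intro kernelD(2)[of \<kappa>' "M \<Otimes>\<^sub>M ?N"]) (auto simp: space_pair_measure)
      ultimately show "(\<lambda>u. v(i := u)) \<in> \<kappa>' (x, v) \<rightarrow>\<^sub>M ?N'"
        using upd' by (simp cong: measurable_cong_sets)
    qed simp
    finally show ?thesis .
  qed
  have "cond_kernel P M X ?N' (\<lambda>\<omega>. \<lambda>i\<in>insert i I. Y i \<omega>) K"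
    unfolding cond_kernel_def
  proof (intro conjI K ballI)
    fix f :: "_ \<Rightarrow> ennreal" assume [measurable]: "f \<in> borel_measurable (M \<Otimes>\<^sub>M ?N')"
    have [measurable]: "(\<lambda>z. f (fst (fst z), (snd (fst z))(i := snd z))) \<in> borel_measurable ((M \<Otimes>\<^sub>M ?N) \<Otimes>\<^sub>M borel)"
    proof -
      have "(\<lambda>z. (\<lambda>(v, u). v(i := u)) (snd (fst z), snd z)) \<in> (M \<Otimes>\<^sub>M ?N) \<Otimes>\<^sub>M borel \<rightarrow>\<^sub>M ?N'"
        by (rule measurable_compose[OF _ upd]) measurable
      then have "(\<lambda>z. (fst (fst z), (snd (fst z))(i := snd z))) \<in> (M \<Otimes>\<^sub>M ?N) \<Otimes>\<^sub>M borel \<rightarrow>\<^sub>M M \<Otimes>\<^sub>M ?N'"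
        by simp
      then show ?thesis by (rule measurable_compose) simp
    qed
    have "(\<integral>\<^sup>+\<omega>. f (X \<omega>, \<lambda>i\<in>insert i I. Y i \<omega>) \<partial>P) = (\<integral>\<^sup>+\<omega>. f (X \<omega>, (?Y \<omega>)(i := Y i \<omega>)) \<partial>P)"
      using insert.hyps by (intro nn_integral_cong arg_cong[where f = f]) (auto simp: restrict_def fun_eq_iff)
    also have "\<dots> = (\<integral>\<^sup>+\<omega>. \<integral>\<^sup>+u. f (X \<omega>, (?Y \<omega>)(i := u)) \<partial>\<kappa>' (X \<omega>, ?Y \<omega>) \<partial>P)"
      using \<kappa>'[unfolded cond_kernel_def, THEN conjunct2, rule_format, of "\<lambda>z. f (fst (fst z), (snd (fst z))(i := snd z))"]
      by simp
    also have "\<dots> = (\<integral>\<^sup>+\<omega>. \<integral>\<^sup>+v. \<integral>\<^sup>+u. f (X \<omega>, v(i := u)) \<partial>\<kappa>' (X \<omega>, v) \<partial>\<kappa> (X \<omega>) \<partial>P)"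
      using \<kappa>[unfolded cond_kernel_def, THEN conjunct2, rule_format, of "\<lambda>z. \<integral>\<^sup>+u. f (fst z, (snd z)(i := u)) \<partial>\<kappa>' z"]
      by (simp add: case_prod_beta')
    also have "\<dots> = (\<integral>\<^sup>+\<omega>. \<integral>\<^sup>+y. f (X \<omega>, y) \<partial>K (X \<omega>) \<partial>P)"
      using measurable_space[OF X] by (intro nn_integral_cong intK[symmetric]) auto
    finally show "(\<integral>\<^sup>+\<omega>. f (X \<omega>, \<lambda>i\<in>insert i I. Y i \<omega>) \<partial>P) = (\<integral>\<^sup>+\<omega>. \<integral>\<^sup>+y. f (X \<omega>, y) \<partial>K (X \<omega>) \<partial>P)" .
  qed
  then show ?case by blast
qed

lemma cond_kernel_vec_exists:
  assumes "prob_space P" and X [measurable]: "X \<in> P \<rightarrow>\<^sub>M M"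
    and Y [measurable]: "Y \<in> P \<rightarrow>\<^sub>M (borel :: (real ^ 'd) measure)"
  shows "\<exists>\<kappa>. cond_kernel P M X borel Y \<kappa>"
proof -
  let ?N = "\<Pi>\<^sub>M i\<in>(UNIV :: 'd set). borel :: real measure"
  have [measurable]: "(\<lambda>\<omega>. Y \<omega> $ i) \<in> borel_measurable P" for i
    by (rule measurable_compose[OF Y]) (intro borel_measurable_continuous_onI continuous_intros)
  obtain \<kappa> where \<kappa>: "cond_kernel P M X ?N (\<lambda>\<omega>. \<lambda>i\<in>UNIV. Y \<omega> $ i) \<kappa>"
    using cond_kernel_PiM_exists[OF _ \<open>prob_space P\<close> X, of "UNIV :: 'd set" "\<lambda>i \<omega>. Y \<omega> $ i"] by auto
  have [measurable]: "\<kappa> \<in> M \<rightarrow>\<^sub>M prob_algebra ?N" using \<kappa> by (simp add: cond_kernel_def)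
  have vec [measurable]: "(\<lambda>y. \<chi> i. y i) \<in> ?N \<rightarrow>\<^sub>M (borel :: (real ^ 'd) measure)"
    unfolding borel_measurable_euclidean_space[of "\<lambda>y. \<chi> i. y i"] by (auto simp: Basis_vec_def inner_axis)
  have "cond_kernel P M X borel Y (\<lambda>x. distr (\<kappa> x) borel (\<lambda>y. \<chi> i. y i))"
    unfolding cond_kernel_def
  proof (intro conjI ballI)
    show "(\<lambda>x. distr (\<kappa> x) borel (\<lambda>y. \<chi> i. y i)) \<in> M \<rightarrow>\<^sub>M prob_algebra (borel :: (real ^ 'd) measure)"
      by measurable
    fix f :: "_ \<times> (real ^ 'd) \<Rightarrow> ennreal" assume [measurable]: "f \<in> borel_measurable (M \<Otimes>\<^sub>M borel)"
    have "(\<integral>\<^sup>+\<omega>. f (X \<omega>, Y \<omega>) \<partial>P) = (\<integral>\<^sup>+\<omega>. \<integral>\<^sup>+y. f (X \<omega>, \<chi> i. y i) \<partial>\<kappa> (X \<omega>) \<partial>P)"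
      using \<kappa>[unfolded cond_kernel_def, THEN conjunct2, rule_format, of "\<lambda>z. f (fst z, \<chi> i. snd z i)"]
      by simp
    also have "\<dots> = (\<integral>\<^sup>+\<omega>. \<integral>\<^sup>+y. f (X \<omega>, y) \<partial>distr (\<kappa> (X \<omega>)) borel (\<lambda>y. \<chi> i. y i) \<partial>P)"
    proof (intro nn_integral_cong)
      fix \<omega> assume "\<omega> \<in> space P"
      then have "X \<omega> \<in> space M" using measurable_space[OF X] by auto
      then have "(\<lambda>y. \<chi> i. y i) \<in> \<kappa> (X \<omega>) \<rightarrow>\<^sub>M (borel :: (real ^ 'd) measure)" "(\<lambda>y. f (X \<omega>, y)) \<in> borel_measurable borel"
        using kernelD(2)[of \<kappa> M ?N "X \<omega>"] vec by (simp_all cong: measurable_cong_sets)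
      then show "(\<integral>\<^sup>+y. f (X \<omega>, \<chi> i. y i) \<partial>\<kappa> (X \<omega>)) = (\<integral>\<^sup>+y. f (X \<omega>, y) \<partial>distr (\<kappa> (X \<omega>)) borel (\<lambda>y. \<chi> i. y i))"
        by (simp add: nn_integral_distr)
    qed
    finally show "(\<integral>\<^sup>+\<omega>. f (X \<omega>, Y \<omega>) \<partial>P) =
      (\<integral>\<^sup>+\<omega>. \<integral>\<^sup>+y. f (X \<omega>, y) \<partial>distr (\<kappa> (X \<omega>)) borel (\<lambda>y. \<chi> i. y i) \<partial>P)" .
  qed
  then show ?thesis by blast
qed

section \<open>Couplings and elementary conditioning\<close>

lemma couplingsD:
  assumes "\<pi> \<in> couplings \<mu> \<nu>"
  shows "sets \<pi> = sets (\<mu> \<Otimes>\<^sub>M \<nu>)" "space \<pi> = space \<mu> \<times> space \<nu>"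
    "distr \<pi> \<mu> fst = \<mu>" "distr \<pi> \<nu> snd = \<nu>" "fst \<in> \<pi> \<rightarrow>\<^sub>M \<mu>" "snd \<in> \<pi> \<rightarrow>\<^sub>M \<nu>"
  using assms sets_eq_imp_space_eq[of \<pi> "\<mu> \<Otimes>\<^sub>M \<nu>"]
  by (auto simp: couplings_def space_pair_measure cong: measurable_cong_sets)

lemma nn_integral_coupling_fst:
  assumes "\<pi> \<in> couplings \<mu> \<nu>" "f \<in> borel_measurable \<mu>"
  shows "(\<integral>\<^sup>+w. f (fst w) \<partial>\<pi>) = (\<integral>\<^sup>+x. f x \<partial>\<mu>)"
  using nn_integral_distr[of fst \<pi> \<mu> f] couplingsD[OF assms(1)] assms(2) by simp

lemma nn_integral_coupling_snd:
  assumes "\<pi> \<in> couplings \<mu> \<nu>" "f \<in> borel_measurable \<nu>"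
  shows "(\<integral>\<^sup>+w. f (snd w) \<partial>\<pi>) = (\<integral>\<^sup>+x. f x \<partial>\<nu>)"
  using nn_integral_distr[of snd \<pi> \<nu> f] couplingsD[OF assms(1)] assms(2) by simp

lemma Lnorm_coupling_fst:
  "\<pi> \<in> couplings \<mu> \<nu> \<Longrightarrow> f \<in> borel_measurable \<mu> \<Longrightarrow> Lnorm p \<pi> (\<lambda>w. f (fst w)) = Lnorm p \<mu> f"
  unfolding Lnorm_def by (subst nn_integral_coupling_fst[symmetric]) auto

lemma Lnorm_coupling_snd:
  "\<pi> \<in> couplings \<mu> \<nu> \<Longrightarrow> f \<in> borel_measurable \<nu> \<Longrightarrow> Lnorm p \<pi> (\<lambda>w. f (snd w)) = Lnorm p \<nu> f"
  unfolding Lnorm_def by (subst nn_integral_coupling_snd[symmetric]) auto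

lemma AE_coupling_fst:
  assumes \<pi>: "\<pi> \<in> couplings \<mu> \<nu>" and P: "AE x in \<mu>. P x" shows "AE w in \<pi>. P (fst w)"
proof (rule AE_distrD[of fst \<pi> \<mu> P])
  show "fst \<in> \<pi> \<rightarrow>\<^sub>M \<mu>" using couplingsD[OF \<pi>] by simp
  show "AE x in distr \<pi> \<mu> fst. P x" unfolding couplingsD(3)[OF \<pi>] by (rule P)
qed

lemma AE_coupling_snd:
  assumes \<pi>: "\<pi> \<in> couplings \<mu> \<nu>" and P: "AE x in \<nu>. P x" shows "AE w in \<pi>. P (snd w)"
proof (rule AE_distrD[of snd \<pi> \<nu> P])
  show "snd \<in> \<pi> \<rightarrow>\<^sub>M \<nu>" using couplingsD[OF \<pi>] by simp
  show "AE x in distr \<pi> \<nu> snd. P x" unfolding couplingsD(4)[OF \<pi>] by (rule P)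
qed

lemma prob_space_coupling:
  assumes "\<pi> \<in> couplings \<mu> \<nu>" "prob_space \<mu>" shows "prob_space \<pi>"
proof
  have "emeasure \<pi> (space \<pi>) = (\<integral>\<^sup>+w. (\<lambda>_. 1) (fst w) \<partial>\<pi>)" by simp
  also have "\<dots> = (\<integral>\<^sup>+x. 1 \<partial>\<mu>)" by (rule nn_integral_coupling_fst[OF assms(1)]) simp
  finally show "emeasure \<pi> (space \<pi>) = 1" using prob_space.emeasure_space_1[OF assms(2)] by simp
qed

lemma couplingsI:
  assumes sets: "sets \<pi> = sets (\<mu> \<Otimes>\<^sub>M \<nu>)"
    and "\<And>A. A \<in> sets \<mu> \<Longrightarrow> (\<integral>\<^sup>+w. indicator A (fst w) \<partial>\<pi>) = emeasure \<mu> A"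
    and "\<And>A. A \<in> sets \<nu> \<Longrightarrow> (\<integral>\<^sup>+w. indicator A (snd w) \<partial>\<pi>) = emeasure \<nu> A"
  shows "\<pi> \<in> couplings \<mu> \<nu>"
proof -
  note [measurable_cong] = sets
  have "distr \<pi> \<mu> fst = \<mu>"
  proof (rule measure_eqI)
    fix A assume "A \<in> sets (distr \<pi> \<mu> fst)"
    then have A [measurable]: "A \<in> sets \<mu>" by simp
    have "emeasure (distr \<pi> \<mu> fst) A = (\<integral>\<^sup>+x. indicator A x \<partial>distr \<pi> \<mu> fst)" by simp
    also have "\<dots> = (\<integral>\<^sup>+w. indicator A (fst w) \<partial>\<pi>)" by (subst nn_integral_distr) auto
    finally show "emeasure (distr \<pi> \<mu> fst) A = emeasure \<mu> A" using assms(2)[OF A] by simp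
  qed simp
  moreover have "distr \<pi> \<nu> snd = \<nu>"
  proof (rule measure_eqI)
    fix A assume "A \<in> sets (distr \<pi> \<nu> snd)"
    then have A [measurable]: "A \<in> sets \<nu>" by simp
    have "emeasure (distr \<pi> \<nu> snd) A = (\<integral>\<^sup>+x. indicator A x \<partial>distr \<pi> \<nu> snd)" by simp
    also have "\<dots> = (\<integral>\<^sup>+w. indicator A (snd w) \<partial>\<pi>)" by (subst nn_integral_distr) auto
    finally show "emeasure (distr \<pi> \<nu> snd) A = emeasure \<nu> A" using assms(3)[OF A] by simp
  qed simp
  ultimately show ?thesis using sets by (simp add: couplings_def)
qed

lemma pair_measure_in_couplings:
  assumes "prob_space \<mu>" "prob_space \<nu>" shows "\<mu> \<Otimes>\<^sub>M \<nu> \<in> couplings \<mu> \<nu>"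
proof -
  interpret \<mu>: prob_space \<mu> by fact
  interpret \<nu>: prob_space \<nu> by fact
  interpret pair_prob_space \<mu> \<nu> ..
  show ?thesis
  proof (rule couplingsI)
    fix A assume [measurable]: "A \<in> sets \<mu>"
    show "(\<integral>\<^sup>+w. indicator A (fst w) \<partial>(\<mu> \<Otimes>\<^sub>M \<nu>)) = emeasure \<mu> A"
      by (subst \<nu>.nn_integral_fst[symmetric]) (auto simp: \<nu>.emeasure_space_1)
  next
    fix A assume [measurable]: "A \<in> sets \<nu>"
    show "(\<integral>\<^sup>+w. indicator A (snd w) \<partial>(\<mu> \<Otimes>\<^sub>M \<nu>)) = emeasure \<nu> A"
      by (subst \<nu>.nn_integral_fst[symmetric]) (auto simp: \<mu>.emeasure_space_1)
  qed simp
qed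

lemma wasserstein_le:
  assumes "p > 0" "\<pi> \<in> couplings \<mu> \<nu>" and "\<And>x y. 0 \<le> \<rho> x y"
  shows "wasserstein \<rho> p \<mu> \<nu> \<le> Lnorm p \<pi> (\<lambda>(x, y). ennreal (\<rho> x y))"
proof -
  have "(\<lambda>(x, y). ennreal (\<rho> x y powr p)) = (\<lambda>w. epowr (case w of (x, y) \<Rightarrow> ennreal (\<rho> x y)) p)"
    using assms(3) by (auto simp: fun_eq_iff epowr_ennreal)
  then show ?thesis
    unfolding wasserstein_def Lnorm_def using assms(1,2)
    by (intro epowr_mono) (auto intro!: INF_lower2)
qed

lemma le_wasserstein:
  assumes p: "p > 0" and \<rho>: "\<And>x y. 0 \<le> \<rho> x y"
    and le: "\<And>\<pi>. \<pi> \<in> couplings \<mu> \<nu> \<Longrightarrow> c \<le> Lnorm p \<pi> (\<lambda>(x, y). ennreal (\<rho> x y))"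
  shows "c \<le> wasserstein \<rho> p \<mu> \<nu>"
proof -
  have eq: "(\<lambda>(x, y). ennreal (\<rho> x y powr p)) = (\<lambda>w. epowr (case w of (x, y) \<Rightarrow> ennreal (\<rho> x y)) p)"
    using \<rho> by (auto simp: fun_eq_iff epowr_ennreal)
  have "epowr c p \<le> (INF \<pi>\<in>couplings \<mu> \<nu>. \<integral>\<^sup>+ (x, y). ennreal (\<rho> x y powr p) \<partial>\<pi>)"
  proof (rule INF_greatest)
    fix \<pi> assume "\<pi> \<in> couplings \<mu> \<nu>"
    from epowr_mono[OF le[OF this], of p] p
    show "epowr c p \<le> (\<integral>\<^sup>+ (x, y). ennreal (\<rho> x y powr p) \<partial>\<pi>)"
      by (simp add: epowr_Lnorm eq)
  qed
  then have "epowr (epowr c p) (1 / p) \<le> wasserstein \<rho> p \<mu> \<nu>"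
    unfolding wasserstein_def using p by (intro epowr_mono) auto
  then show ?thesis using p by simp
qed

section \<open>Elementary conditioning on countable labels\<close>

lemma nn_integral_split_countable:
  fixes k :: "'a \<Rightarrow> 'g :: countable"
  assumes [measurable]: "k \<in> M \<rightarrow>\<^sub>M count_space UNIV" "h \<in> borel_measurable M"
  shows "(\<integral>\<^sup>+\<omega>. h \<omega> \<partial>M) = (\<integral>\<^sup>+a. (\<integral>\<^sup>+\<omega>. h \<omega> * indicator {a} (k \<omega>) \<partial>M) \<partial>count_space UNIV)"
proof -
  have "(\<integral>\<^sup>+a. (\<integral>\<^sup>+\<omega>. h \<omega> * indicator {a} (k \<omega>) \<partial>M) \<partial>count_space UNIV) =
        (\<integral>\<^sup>+\<omega>. (\<integral>\<^sup>+a. h \<omega> * indicator {a} (k \<omega>) \<partial>count_space UNIV) \<partial>M)"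
    by (rule nn_integral_count_space_nn_integral[symmetric]) auto
  also have "\<dots> = (\<integral>\<^sup>+\<omega>. h \<omega> \<partial>M)"
  proof (intro nn_integral_cong)
    fix \<omega>
    have "(\<integral>\<^sup>+a. h \<omega> * indicator {a} (k \<omega>) \<partial>count_space UNIV) = (\<integral>\<^sup>+a. h \<omega> * indicator {k \<omega>} a \<partial>count_space UNIV)"
      by (intro nn_integral_cong) (auto split: split_indicator)
    also have "\<dots> = h \<omega>" by (simp add: nn_integral_cmult)
    finally show "(\<integral>\<^sup>+a. h \<omega> * indicator {a} (k \<omega>) \<partial>count_space UNIV) = h \<omega>" .
  qed
  finally show ?thesis by simp
qed

text \<open>Elementary conditioning on \<open>h = a\<close>, with the unconditioned measure when that event is null.\<close>

definition cond_on :: "'a measure \<Rightarrow> ('a \<Rightarrow> 'g) \<Rightarrow> 'g \<Rightarrow> 'a measure" where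
  "cond_on M h a = (if emeasure M (h -` {a} \<inter> space M) = 0 then M else uniform_measure M (h -` {a} \<inter> space M))"

lemma sets_cond_on [simp, measurable_cong]: "sets (cond_on M h a) = sets M"
  by (simp add: cond_on_def)

lemma space_cond_on [simp]: "space (cond_on M h a) = space M"
  by (simp add: cond_on_def)

lemma (in prob_space) prob_space_cond_on: "prob_space (cond_on M h a)"
  unfolding cond_on_def using prob_space_axioms
  by (auto intro!: prob_space_uniform_measure)

lemma (in prob_space) nn_integral_cond_on:
  assumes [measurable]: "h \<in> M \<rightarrow>\<^sub>M count_space UNIV" "f \<in> borel_measurable M"
  shows "(\<integral>\<^sup>+\<omega>. f \<omega> \<partial>cond_on M h a) * emeasure M (h -` {a} \<inter> space M) = (\<integral>\<^sup>+\<omega>. f \<omega> * indicator {a} (h \<omega>) \<partial>M)"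
proof -
  let ?A = "h -` {a} \<inter> space M"
  have A [measurable]: "?A \<in> sets M" by simp
  have eq: "(\<integral>\<^sup>+\<omega>. f \<omega> * indicator {a} (h \<omega>) \<partial>M) = (\<integral>\<^sup>+\<omega>. f \<omega> * indicator ?A \<omega> \<partial>M)"
    by (intro nn_integral_cong) (auto split: split_indicator)
  show ?thesis
  proof (cases "emeasure M ?A = 0")
    case True
    then have "AE \<omega> in M. \<omega> \<notin> ?A" by (intro AE_not_in) (auto simp: null_sets_def)
    then have "(\<integral>\<^sup>+\<omega>. f \<omega> * indicator ?A \<omega> \<partial>M) = (\<integral>\<^sup>+\<omega>. 0 \<partial>M)"
      by (intro nn_integral_cong_AE) auto
    then show ?thesis using True eq by simp
  next
    case False
    then have "(\<integral>\<^sup>+\<omega>. f \<omega> \<partial>cond_on M h a) = (\<integral>\<^sup>+\<omega>. f \<omega> * indicator ?A \<omega> \<partial>M) / emeasure M ?A"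
      by (simp add: cond_on_def nn_integral_uniform_measure)
    then show ?thesis
      using False by (simp add: eq ennreal_divide_times ennreal_divide_self less_top[symmetric])
  qed
qed

text \<open>Tower property: drawing a label from its law and then a point given that label
  reproduces \<open>M\<close>. Both sides are split by the value of \<open>h\<close>, and null
  values contribute zero to either of them.\<close>

lemma (in prob_space) nn_integral_cond_on_mixture:
  fixes h :: "'a \<Rightarrow> 'g :: countable"
  assumes h [measurable]: "h \<in> M \<rightarrow>\<^sub>M count_space UNIV" and g: "\<And>a. g a \<in> borel_measurable M"
  shows "(\<integral>\<^sup>+x. (\<integral>\<^sup>+z. g (h x) z \<partial>cond_on M h (h x)) \<partial>M) = (\<integral>\<^sup>+z. g (h z) z \<partial>M)"
proof -
  have [measurable]: "(\<lambda>x. \<integral>\<^sup>+z. g (h x) z \<partial>cond_on M h (h x)) \<in> borel_measurable M"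
    by (rule measurable_compose[OF h]) simp
  have [measurable]: "(\<lambda>z. g (h z) z) \<in> borel_measurable M"
    by (rule measurable_compose_countable[OF g h])
  note [measurable] = g
  have "(\<integral>\<^sup>+x. (\<integral>\<^sup>+z. g (h x) z \<partial>cond_on M h (h x)) * indicator {a} (h x) \<partial>M)
      = (\<integral>\<^sup>+z. g (h z) z * indicator {a} (h z) \<partial>M)" for a
  proof -
    have "(\<integral>\<^sup>+x. (\<integral>\<^sup>+z. g (h x) z \<partial>cond_on M h (h x)) * indicator {a} (h x) \<partial>M)
        = (\<integral>\<^sup>+x. (\<integral>\<^sup>+z. g a z \<partial>cond_on M h a) * indicator (h -` {a} \<inter> space M) x \<partial>M)"
      by (intro nn_integral_cong) (auto split: split_indicator)
    also have "\<dots> = (\<integral>\<^sup>+z. g a z \<partial>cond_on M h a) * emeasure M (h -` {a} \<inter> space M)"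
      by (subst nn_integral_cmult_indicator) auto
    also have "\<dots> = (\<integral>\<^sup>+z. g a z * indicator {a} (h z) \<partial>M)"
      by (rule nn_integral_cond_on) auto
    also have "\<dots> = (\<integral>\<^sup>+z. g (h z) z * indicator {a} (h z) \<partial>M)"
      by (intro nn_integral_cong) (auto split: split_indicator)
    finally show ?thesis .
  qed
  then show ?thesis
    by (subst (1 2) nn_integral_split_countable[OF h]) auto
qed

text \<open>The tower property for the indicator of a mismatch of labels, which vanishes on the
  diagonal. Only an almost sure statement is possible, as conditioning on a null label returns
  \<open>M\<close> itself.\<close>

lemma (in prob_space) AE_cond_on_eq:
  fixes h :: "'a \<Rightarrow> 'g :: countable"
  assumes h [measurable]: "h \<in> M \<rightarrow>\<^sub>M count_space UNIV"
  shows "AE x in M. AE z in cond_on M h (h x). h z = h x"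
proof -
  have "(\<integral>\<^sup>+x. (\<integral>\<^sup>+z. indicator (- {h x}) (h z) \<partial>cond_on M h (h x)) \<partial>M) = (\<integral>\<^sup>+z. indicator (- {h z}) (h z) \<partial>M)"
    by (rule nn_integral_cond_on_mixture[where g = "\<lambda>a z. indicator (- {a}) (h z)"]) auto
  then have "(\<integral>\<^sup>+x. (\<integral>\<^sup>+z. indicator (- {h x}) (h z) \<partial>cond_on M h (h x)) \<partial>M) = 0" by simp
  then have "AE x in M. (\<integral>\<^sup>+z. indicator (- {h x}) (h z) \<partial>cond_on M h (h x)) = 0"
    by (subst (asm) nn_integral_0_iff_AE) (auto intro!: measurable_compose[OF h])
  then show ?thesis
  proof eventually_elim
    case (elim x)
    then have "AE z in cond_on M h (h x). (indicator (- {h x}) (h z) :: ennreal) = 0"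
      by (subst (asm) nn_integral_0_iff_AE) auto
    then show ?case by eventually_elim (auto split: split_indicator_asm)
  qed
qed

lemma measurable_cond_on:
  assumes K [measurable]: "K \<in> M \<rightarrow>\<^sub>M prob_algebra N" and h [measurable]: "h \<in> N \<rightarrow>\<^sub>M count_space UNIV"
  shows "(\<lambda>x. cond_on (K x) h a) \<in> M \<rightarrow>\<^sub>M prob_algebra N"
proof (rule measurable_prob_algebraI)
  fix x assume x: "x \<in> space M"
  interpret prob_space "K x" by (rule kernelD(1)[OF K x])
  show "prob_space (cond_on (K x) h a)" by (rule prob_space_cond_on)
next
  let ?A = "h -` {a} \<inter> space N"
  have A [measurable]: "?A \<in> sets N" by simp
  have [measurable]: "(\<lambda>x. emeasure (K x) B) \<in> borel_measurable M" if "B \<in> sets N" for B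
    by (rule emeasure_kernel_measurable[OF K that])
  show "(\<lambda>x. cond_on (K x) h a) \<in> M \<rightarrow>\<^sub>M subprob_algebra N"
  proof (rule measurable_subprob_algebra)
    fix x assume x: "x \<in> space M"
    interpret prob_space "K x" by (rule kernelD(1)[OF K x])
    show "subprob_space (cond_on (K x) h a)" by (intro prob_space_imp_subprob_space prob_space_cond_on)
    show "sets (cond_on (K x) h a) = sets N" using kernelD(2)[OF K x] by simp
  next
    fix B assume B [measurable]: "B \<in> sets N"
    have "(\<lambda>x. if emeasure (K x) ?A = 0 then emeasure (K x) B else emeasure (K x) (?A \<inter> B) / emeasure (K x) ?A) \<in> borel_measurable M"
      by measurable
    also have "?this \<longleftrightarrow> (\<lambda>x. emeasure (cond_on (K x) h a) B) \<in> borel_measurable M"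
    proof (rule measurable_cong)
      fix x assume x: "x \<in> space M"
      show "(if emeasure (K x) ?A = 0 then emeasure (K x) B else emeasure (K x) (?A \<inter> B) / emeasure (K x) ?A) = emeasure (cond_on (K x) h a) B"
        using kernelD[OF K x] by (simp add: cond_on_def)
    qed
    finally show "(\<lambda>x. emeasure (cond_on (K x) h a) B) \<in> borel_measurable M" .
  qed
qed

lemma nn_integral_bind_pair_kernel:
  assumes F: "F \<in> space (prob_algebra S)"
    and K1 [measurable]: "K1 \<in> S \<rightarrow>\<^sub>M prob_algebra N1" and K2 [measurable]: "K2 \<in> S \<rightarrow>\<^sub>M prob_algebra N2"
    and f [measurable]: "f \<in> borel_measurable (N1 \<Otimes>\<^sub>M N2)"
  shows "(\<integral>\<^sup>+w. f w \<partial>(F \<bind> (\<lambda>s. K1 s \<Otimes>\<^sub>M K2 s))) = (\<integral>\<^sup>+s. \<integral>\<^sup>+u. \<integral>\<^sup>+v. f (u, v) \<partial>K2 s \<partial>K1 s \<partial>F)"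
proof -
  have [measurable]: "(\<lambda>s. K1 s \<Otimes>\<^sub>M K2 s) \<in> S \<rightarrow>\<^sub>M prob_algebra (N1 \<Otimes>\<^sub>M N2)" by (rule measurable_pair_prob) auto
  have sF: "sets F = sets S" "space F = space S" using F by (auto simp: space_prob_algebra dest: sets_eq_imp_space_eq)
  have "(\<integral>\<^sup>+w. f w \<partial>(F \<bind> (\<lambda>s. K1 s \<Otimes>\<^sub>M K2 s))) = (\<integral>\<^sup>+s. \<integral>\<^sup>+w. f w \<partial>(K1 s \<Otimes>\<^sub>M K2 s) \<partial>F)"
    by (rule nn_integral_bind[OF f measurable_prob_algebraD]) (simp cong: measurable_cong_sets add: sF)
  also have "\<dots> = (\<integral>\<^sup>+s. \<integral>\<^sup>+u. \<integral>\<^sup>+v. f (u, v) \<partial>K2 s \<partial>K1 s \<partial>F)"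
  proof (rule nn_integral_cong)
    fix s assume "s \<in> space F"
    then have s: "s \<in> space S" by (simp add: sF)
    interpret K2: prob_space "K2 s" using kernelD(1)[OF K2 s] .
    show "(\<integral>\<^sup>+w. f w \<partial>(K1 s \<Otimes>\<^sub>M K2 s)) = (\<integral>\<^sup>+u. \<integral>\<^sup>+v. f (u, v) \<partial>K2 s \<partial>K1 s)"
      using kernelD(2)[OF K1 s] kernelD(2)[OF K2 s] f
      by (intro K2.nn_integral_fst[symmetric]) (simp cong: measurable_cong_sets sets_pair_measure_cong)
  qed
  finally show ?thesis .
qed

text \<open>Gluing along labels: a label pair is drawn from \<open>F\<close>, and given it the two
  points are drawn independently, each conditioned on its own label. Countability of the labels
  keeps the conditioning elementary.\<close>

definition lift_coupling ::
  "('g \<times> 'h) measure \<Rightarrow> 'a measure \<Rightarrow> ('a \<Rightarrow> 'g) \<Rightarrow> 'b measure \<Rightarrow> ('b \<Rightarrow> 'h) \<Rightarrow> ('a \<times> 'b) measure" where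
  "lift_coupling F M h N k = F \<bind> (\<lambda>s. cond_on M h (fst s) \<Otimes>\<^sub>M cond_on N k (snd s))"

context
  fixes M :: "'a measure" and N :: "'b measure" and h :: "'a \<Rightarrow> 'g :: countable" and k :: "'b \<Rightarrow> 'h :: countable" and F
  assumes M: "prob_space M" and N: "prob_space N"
    and h [measurable]: "h \<in> M \<rightarrow>\<^sub>M count_space UNIV" and k [measurable]: "k \<in> N \<rightarrow>\<^sub>M count_space UNIV"
    and F: "F \<in> couplings (distr M (count_space UNIV) h) (distr N (count_space UNIV) k)"
begin

interpretation M: prob_space M by (rule M)
interpretation N: prob_space N by (rule N)

lemma discrete_coupling_sets: "sets F = UNIV" "space F = UNIV" "prob_space F"
proof -
  have "sets F = sets (count_space (UNIV :: 'g set) \<Otimes>\<^sub>M count_space (UNIV :: 'h set))"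
    unfolding couplingsD(1)[OF F] by (rule sets_pair_measure_cong) simp_all
  then show "sets F = UNIV" by (subst (asm) pair_measure_countable) auto
  then show "space F = UNIV" by (metis UNIV_I sets.sets_into_space top.extremum_uniqueI)
  show "prob_space F" by (rule prob_space_coupling[OF F M.prob_space_distr[OF h]])
qed

lemma nn_integral_lift_coupling:
  assumes f [measurable]: "f \<in> borel_measurable (M \<Otimes>\<^sub>M N)"
  shows "(\<integral>\<^sup>+w. f w \<partial>lift_coupling F M h N k) =
    (\<integral>\<^sup>+s. \<integral>\<^sup>+u. \<integral>\<^sup>+v. f (u, v) \<partial>cond_on N k (snd s) \<partial>cond_on M h (fst s) \<partial>F)"
  unfolding lift_coupling_def
proof (rule nn_integral_bind_pair_kernel[OF _ _ _ f, where S = "count_space UNIV"])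
  show "F \<in> space (prob_algebra (count_space UNIV))"
    using discrete_coupling_sets by (simp add: space_prob_algebra)
qed (auto simp: measurable_count_space_eq1 space_prob_algebra M.prob_space_cond_on N.prob_space_cond_on)

text \<open>Each marginal of \<open>F\<close> is the law of the labels of that side, so the tower
  property returns \<open>M\<close> and \<open>N\<close>.\<close>

lemma lift_coupling_in_couplings: "lift_coupling F M h N k \<in> couplings M N"
proof (rule couplingsI)
  show "sets (lift_coupling F M h N k) = sets (M \<Otimes>\<^sub>M N)"
    unfolding lift_coupling_def using discrete_coupling_sets
    by (intro sets_bind) (auto cong: sets_pair_measure_cong)
  note [measurable_cong] = discrete_coupling_sets(1)
  have [simp]: "emeasure (cond_on N k b) (space N) = 1" for b
    using prob_space.emeasure_space_1[OF N.prob_space_cond_on[of k b]] by simp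
  have [simp]: "emeasure (cond_on M h b) (space M) = 1" for b
    using prob_space.emeasure_space_1[OF M.prob_space_cond_on[of h b]] by simp
  fix A assume A [measurable]: "A \<in> sets M"
  have "(\<integral>\<^sup>+w. indicator A (fst w) \<partial>lift_coupling F M h N k) =
      (\<integral>\<^sup>+s. (\<lambda>a. \<integral>\<^sup>+u. indicator A u \<partial>cond_on M h a) (fst s) \<partial>F)"
    by (subst nn_integral_lift_coupling) auto
  also have "\<dots> = (\<integral>\<^sup>+a. \<integral>\<^sup>+u. indicator A u \<partial>cond_on M h a \<partial>distr M (count_space UNIV) h)"
    by (rule nn_integral_coupling_fst[OF F]) simp
  also have "\<dots> = (\<integral>\<^sup>+x. \<integral>\<^sup>+u. indicator A u \<partial>cond_on M h (h x) \<partial>M)"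
    by (rule nn_integral_distr) auto
  also have "\<dots> = (\<integral>\<^sup>+u. indicator A u \<partial>M)"
    by (rule M.nn_integral_cond_on_mixture) auto
  finally show "(\<integral>\<^sup>+w. indicator A (fst w) \<partial>lift_coupling F M h N k) = emeasure M A" by simp
next
  note [measurable_cong] = discrete_coupling_sets(1)
  have [simp]: "emeasure (cond_on M h b) (space M) = 1" for b
    using prob_space.emeasure_space_1[OF M.prob_space_cond_on[of h b]] by simp
  fix A assume A [measurable]: "A \<in> sets N"
  have "(\<integral>\<^sup>+w. indicator A (snd w) \<partial>lift_coupling F M h N k) =
      (\<integral>\<^sup>+s. (\<lambda>a. \<integral>\<^sup>+u. indicator A u \<partial>cond_on N k a) (snd s) \<partial>F)"
    by (subst nn_integral_lift_coupling) auto
  also have "\<dots> = (\<integral>\<^sup>+a. \<integral>\<^sup>+u. indicator A u \<partial>cond_on N k a \<partial>distr N (count_space UNIV) k)"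
    by (rule nn_integral_coupling_snd[OF F]) simp
  also have "\<dots> = (\<integral>\<^sup>+x. \<integral>\<^sup>+u. indicator A u \<partial>cond_on N k (k x) \<partial>N)"
    by (rule nn_integral_distr) auto
  also have "\<dots> = (\<integral>\<^sup>+u. indicator A u \<partial>N)"
    by (rule N.nn_integral_cond_on_mixture) auto
  finally show "(\<integral>\<^sup>+w. indicator A (snd w) \<partial>lift_coupling F M h N k) = emeasure N A" by simp
qed

text \<open>A point drawn given a label almost surely carries that label, so a cost that sees only
  labels may be evaluated under \<open>F\<close>.\<close>

lemma nn_integral_lift_coupling_discrete:
  fixes f :: "'g \<times> 'h \<Rightarrow> ennreal"
  shows "(\<integral>\<^sup>+w. f (h (fst w), k (snd w)) \<partial>lift_coupling F M h N k) = (\<integral>\<^sup>+s. f s \<partial>F)"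
proof -
  have ae_h: "AE s in F. AE u in cond_on M h (fst s). h u = fst s"
  proof -
    have "AE x in M. AE u in cond_on M h (h x). h u = h x"
      by (rule M.AE_cond_on_eq) fact
    then have "AE a in distr M (count_space UNIV) h. AE u in cond_on M h a. h u = a"
      by (subst AE_distr_iff) auto
    from AE_coupling_fst[OF F this] show ?thesis .
  qed
  have ae_k: "AE s in F. AE u in cond_on N k (snd s). k u = snd s"
  proof -
    have "AE x in N. AE u in cond_on N k (k x). k u = k x"
      by (rule N.AE_cond_on_eq) fact
    then have "AE a in distr N (count_space UNIV) k. AE u in cond_on N k a. k u = a"
      by (subst AE_distr_iff) auto
    from AE_coupling_snd[OF F this] show ?thesis .
  qed
  have [measurable]: "(\<lambda>w. f (h (fst w), k (snd w))) \<in> borel_measurable (M \<Otimes>\<^sub>M N)"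
  proof -
    have "(\<lambda>w. (h (fst w), k (snd w))) \<in> M \<Otimes>\<^sub>M N \<rightarrow>\<^sub>M count_space UNIV \<Otimes>\<^sub>M count_space UNIV" by measurable
    also have "count_space (UNIV :: 'g set) \<Otimes>\<^sub>M count_space (UNIV :: 'h set) = count_space UNIV"
      by (simp add: pair_measure_countable)
    finally show ?thesis by (rule measurable_compose) simp
  qed
  have "(\<integral>\<^sup>+w. f (h (fst w), k (snd w)) \<partial>lift_coupling F M h N k) =
     (\<integral>\<^sup>+s. \<integral>\<^sup>+u. \<integral>\<^sup>+v. f (h u, k v) \<partial>cond_on N k (snd s) \<partial>cond_on M h (fst s) \<partial>F)"
    by (subst nn_integral_lift_coupling) auto
  also have "\<dots> = (\<integral>\<^sup>+s. f s \<partial>F)"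
  proof (rule nn_integral_cong_AE)
    from ae_h ae_k show "AE s in F. (\<integral>\<^sup>+u. \<integral>\<^sup>+v. f (h u, k v) \<partial>cond_on N k (snd s) \<partial>cond_on M h (fst s)) = f s"
    proof eventually_elim
      case (elim s)
      have "(\<integral>\<^sup>+u. \<integral>\<^sup>+v. f (h u, k v) \<partial>cond_on N k (snd s) \<partial>cond_on M h (fst s)) =
            (\<integral>\<^sup>+u. \<integral>\<^sup>+v. f (h u, snd s) \<partial>cond_on N k (snd s) \<partial>cond_on M h (fst s))"
        using elim(2) by (intro nn_integral_cong nn_integral_cong_AE) auto
      also have "\<dots> = (\<integral>\<^sup>+u. f (h u, snd s) \<partial>cond_on M h (fst s))"
        using prob_space.emeasure_space_1[OF N.prob_space_cond_on[of k "snd s"]] by simp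
      also have "\<dots> = (\<integral>\<^sup>+u. f s \<partial>cond_on M h (fst s))"
        using elim(1) by (intro nn_integral_cong_AE) auto
      finally show ?case
        using prob_space.emeasure_space_1[OF M.prob_space_cond_on[of h "fst s"]] by simp
    qed
  qed
  finally show ?thesis .
qed

end

section \<open>Measurable near-optimal couplings of kernels\<close>

lemma measurable_pair_count_space2:
  fixes f :: "'a \<times> 'g :: countable \<Rightarrow> 'b"
  assumes "\<And>y. (\<lambda>x. f (x, y)) \<in> N \<rightarrow>\<^sub>M K"
  shows "f \<in> N \<Otimes>\<^sub>M count_space UNIV \<rightarrow>\<^sub>M K"
proof -
  have "(\<lambda>w. (\<lambda>y w. f (fst w, y)) (snd w) w) \<in> N \<Otimes>\<^sub>M count_space UNIV \<rightarrow>\<^sub>M K"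
    by (rule measurable_compose_countable) (auto intro: measurable_compose[OF measurable_fst assms])
  then show ?thesis by simp
qed

lemma uniform_01_threshold:
  fixes q l :: real
  assumes "0 < q" "0 \<le> l" "l \<le> q"
  shows "emeasure (uniform_measure lborel {0..1}) {v. v * q \<le> l} = ennreal (l / q)"
proof -
  have *: "{v. v * q \<le> l} = {..l / q}" using assms by (auto simp: field_simps)
  have "{0..1} \<inter> {..l / q} = {0..l / q}" using assms by (auto simp: field_simps)
  then show ?thesis unfolding * using assms divide_ennreal[of "l / q" 1] by (simp add: emeasure_uniform_measure)
qed

text \<open>
  A kernel is rounded to a law on finitely many points: a sample \<open>u\<close> in cell \<open>n\<close> keeps its label
  with the probability that rounds the mass of that cell down to a multiple of \<open>1 / k\<close>, and
  loses it otherwise. The law of the label then depends only on the list of rounded masses, of which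
  there are countably many, so that labels can be coupled without any measurable selection.
\<close>

lemma kernel_discretization:
  fixes \<kappa> :: "'a \<Rightarrow> 'e :: euclidean_space measure" and p B \<epsilon> :: real
  assumes \<kappa> [measurable]: "\<kappa> \<in> M \<rightarrow>\<^sub>M prob_algebra borel" and p: "p \<ge> 1" and \<epsilon>: "\<epsilon> > 0" and B: "B \<ge> 0"
  defines "U \<equiv> uniform_measure lborel {0..1::real}"
  obtains G :: "'a \<Rightarrow> 'e \<times> real \<Rightarrow> nat option" and pt :: "nat option \<Rightarrow> 'e" and cls :: "'a \<Rightarrow> int list"
  where "(\<lambda>(x, w). G x w) \<in> M \<Otimes>\<^sub>M (borel \<Otimes>\<^sub>M borel) \<rightarrow>\<^sub>M count_space UNIV" "cls \<in> M \<rightarrow>\<^sub>M count_space UNIV"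
    "\<And>x z. x \<in> space M \<Longrightarrow> z \<in> space M \<Longrightarrow> cls x = cls z \<Longrightarrow>
       distr (\<kappa> x \<Otimes>\<^sub>M U) (count_space UNIV) (G x) = distr (\<kappa> z \<Otimes>\<^sub>M U) (count_space UNIV) (G z)"
    "\<And>x. x \<in> space M \<Longrightarrow> AE u in \<kappa> x. norm u \<le> B \<Longrightarrow>
       Lnorm p (\<kappa> x \<Otimes>\<^sub>M U) (\<lambda>w. ennreal (dist (fst w) (pt (G x w)))) \<le> ennreal \<epsilon>"
proof -
  define \<epsilon>1 where "\<epsilon>1 = \<epsilon> / 2"
  have \<epsilon>1: "\<epsilon>1 > 0" using \<epsilon> by (simp add: \<epsilon>1_def)
  have "compact (cball (0::'e) B)" by simp
  then obtain K where K: "finite K" "cball (0::'e) B \<subseteq> (\<Union>x\<in>K. ball x \<epsilon>1)"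
    using \<epsilon>1 unfolding compact_eq_totally_bounded by meson
  obtain a where a: "set a = K" using finite_list[OF K(1)] by auto
  define N where "N = length a"
  \<comment> \<open>The first ball of the finite net that contains \<open>u\<close>. The value
    \<open>N\<close> collects the points outside all balls, so there are at most
    \<open>N + 1\<close> cells.\<close>
  define Q where "Q u = (LEAST n. N \<le> n \<or> u \<in> ball (a ! n) \<epsilon>1)" for u
  have [measurable]: "Q \<in> borel \<rightarrow>\<^sub>M count_space UNIV"
  proof -
    have "{u. N \<le> n \<or> u \<in> ball (a ! n) \<epsilon>1} = (if N \<le> n then UNIV else ball (a ! n) \<epsilon>1)" for n by auto
    then have "Measurable.pred borel (\<lambda>u. N \<le> n \<or> u \<in> ball (a ! n) \<epsilon>1)" for n
      by (simp add: pred_def)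
    then show ?thesis unfolding Q_def by (rule measurable_Least)
  qed
  have QN: "Q u \<le> N" for u unfolding Q_def by (rule Least_le) simp
  have Qb: "Q u < N \<and> dist (a ! Q u) u < \<epsilon>1" if u: "norm u \<le> B" for u
  proof -
    obtain c where "c \<in> K" "u \<in> ball c \<epsilon>1" using K(2) u by auto
    then obtain n where n: "n < N" "u \<in> ball (a ! n) \<epsilon>1"
      using a by (auto simp: N_def in_set_conv_nth)
    then have "Q u \<le> n" unfolding Q_def by (intro Least_le) simp
    moreover have "N \<le> Q u \<or> u \<in> ball (a ! Q u) \<epsilon>1"
      unfolding Q_def by (rule LeastI_ex) auto
    ultimately show ?thesis using n by auto
  qed
  \<comment> \<open>Rounding loses mass at most \<open>(N + 1) / k\<close>, and a lost point costs
    at most \<open>B\<close>; this \<open>k\<close> makes the contribution to the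
    \<open>p\<close>-norm at most \<open>\<epsilon>1\<close>.\<close>
  obtain k0 :: nat where k0: "B powr p * real (Suc N) / \<epsilon>1 powr p < real k0"
    using reals_Archimedean2 by blast
  define k where "k = Suc k0"
  have k: "k > 0" "B powr p * (real (Suc N) / real k) \<le> \<epsilon>1 powr p"
  proof -
    have "B powr p * real (Suc N) / \<epsilon>1 powr p \<le> real k" using k0 by (simp add: k_def)
    then show "B powr p * (real (Suc N) / real k) \<le> \<epsilon>1 powr p"
      using \<epsilon>1 by (simp add: k_def divide_simps mult_ac)
  qed (simp add: k_def)
  define q where "q x n = measure (\<kappa> x) (Q -` {n})" for x n
  define cls where "cls x = map (\<lambda>n. \<lfloor>real k * q x n\<rfloor>) [0..<Suc N]" for x
  define l where "l x n = real_of_int \<lfloor>real k * q x n\<rfloor> / real k" for x n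
  have Qset [measurable]: "Q -` {n} \<in> sets borel" for n
    using measurable_sets[of Q borel "count_space UNIV" "{n}"] by simp
  have q_meas [measurable]: "(\<lambda>x. q x n) \<in> borel_measurable M" for n
    unfolding q_def by measurable
  have q0: "0 \<le> q x n" for x n by (simp add: q_def)
  have l0: "0 \<le> l x n" and lq: "l x n \<le> q x n" and ql: "q x n - l x n \<le> 1 / real k" for x n
  proof -
    show "0 \<le> l x n" using q0[of x n] k by (simp add: l_def)
    show "l x n \<le> q x n" using k by (simp add: l_def divide_simps mult.commute)
    have "real k * q x n - 1 \<le> real_of_int \<lfloor>real k * q x n\<rfloor>" by linarith
    then show "q x n - l x n \<le> 1 / real k" using k by (simp add: l_def divide_simps mult.commute, linarith)
  qed
  \<comment> \<open>The uniform variable passes the test in cell \<open>n\<close> with probability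
    \<open>l x n / q x n\<close>. Writing the test as a product instead of a quotient also covers
    cells of mass zero.\<close>
  define G where "G x w = (if snd w * q x (Q (fst w)) \<le> l x (Q (fst w)) then Some (Q (fst w)) else None)" for x and w :: "'e \<times> real"
  \<comment> \<open>A lost label is represented by the origin, at distance at most \<open>B\<close>
    from almost every sample.\<close>
  define pt where "pt g = (case g of None \<Rightarrow> 0 | Some n \<Rightarrow> if n < N then a ! n else 0)" for g
  have qQ [measurable]: "(\<lambda>z. q (fst z) (Q (fst (snd z)))) \<in> borel_measurable (M \<Otimes>\<^sub>M (borel \<Otimes>\<^sub>M (borel :: real measure)))"
    by (rule measurable_compose_countable[where f = "\<lambda>n z. q (fst z) n"]) measurable
  have lQ [measurable]: "(\<lambda>z. l (fst z) (Q (fst (snd z)))) \<in> borel_measurable (M \<Otimes>\<^sub>M (borel \<Otimes>\<^sub>M (borel :: real measure)))"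
    unfolding l_def using qQ by measurable
  have G_meas [measurable]: "(\<lambda>(x, w). G x w) \<in> M \<Otimes>\<^sub>M (borel \<Otimes>\<^sub>M borel) \<rightarrow>\<^sub>M count_space UNIV"
    unfolding G_def case_prod_beta' by measurable
  have cls_meas: "cls \<in> M \<rightarrow>\<^sub>M count_space UNIV"
  proof -
    have fl: "(\<lambda>x. \<lfloor>real k * q x n\<rfloor>) \<in> M \<rightarrow>\<^sub>M count_space UNIV" for n by measurable
    have "{x\<in>space M. cls x = c} = {x\<in>space M. length c = Suc N \<and> (\<forall>n\<in>{..N}. \<lfloor>real k * q x n\<rfloor> = c ! n)}" for c
      by (auto simp: cls_def list_eq_iff_nth_eq simp del: upt_Suc)
    moreover have "{x\<in>space M. length c = Suc N \<and> (\<forall>n\<in>{..N}. \<lfloor>real k * q x n\<rfloor> = c ! n)} \<in> sets M" for c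
      using fl by measurable
    ultimately show ?thesis
      by (subst measurable_count_space_eq2_countable) (auto simp: vimage_def Int_def conj_commute)
  qed
  interpret U: prob_space U unfolding U_def by (rule prob_space_uniform_measure) auto
  have sU [measurable_cong, simp]: "sets U = sets borel" and spU [simp]: "space U = UNIV" by (auto simp: U_def)
  have lawSome: "emeasure (\<kappa> x \<Otimes>\<^sub>M U) {w. G x w = Some n} = ennreal (l x n)" if x: "x \<in> space M" for x n
  proof -
    interpret \<kappa>: prob_space "\<kappa> x" using kernelD(1)[OF \<kappa> x] .
    have sx [simp]: "sets (\<kappa> x) = sets borel" "space (\<kappa> x) = UNIV" using kernelD(2,3)[OF \<kappa> x] by auto
    have "{w. G x w = Some n} = (Q -` {n}) \<times> {v. v * q x n \<le> l x n}"
      by (auto simp: G_def split: if_splits)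
    then have "emeasure (\<kappa> x \<Otimes>\<^sub>M U) {w. G x w = Some n} = emeasure (\<kappa> x) (Q -` {n}) * emeasure U {v. v * q x n \<le> l x n}"
      by (simp add: U.emeasure_pair_measure_Times)
    also have "\<dots> = ennreal (q x n) * emeasure U {v. v * q x n \<le> l x n}"
      by (simp add: q_def \<kappa>.emeasure_eq_measure)
    also have "\<dots> = ennreal (l x n)"
    proof (cases "q x n = 0")
      case True
      then have "l x n = 0" using l0[of x n] lq[of x n] by simp
      then show ?thesis using True by simp
    next
      case False
      then have "q x n > 0" using q0[of x n] by simp
      moreover from this have "emeasure U {v. v * q x n \<le> l x n} = ennreal (l x n / q x n)"
        unfolding U_def using l0[of x n] lq[of x n] by (intro uniform_01_threshold)
      ultimately show ?thesis using l0[of x n] by (simp flip: ennreal_mult)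
    qed
    finally show ?thesis .
  qed
  have Gx [measurable]: "G x \<in> \<kappa> x \<Otimes>\<^sub>M U \<rightarrow>\<^sub>M count_space UNIV" if x: "x \<in> space M" for x
  proof -
    have eq: "sets (\<kappa> x \<Otimes>\<^sub>M U) = sets (borel \<Otimes>\<^sub>M borel)"
      using kernelD(2)[OF \<kappa> x] by (intro sets_pair_measure_cong) auto
    show ?thesis
      unfolding measurable_cong_sets[OF eq refl]
      using measurable_compose[OF measurable_Pair1'[OF x] G_meas] by simp
  qed
  have spx: "space (\<kappa> x \<Otimes>\<^sub>M U) = UNIV" and ps: "prob_space (\<kappa> x \<Otimes>\<^sub>M U)" if x: "x \<in> space M" for x
  proof -
    interpret \<kappa>: prob_space "\<kappa> x" using kernelD(1)[OF \<kappa> x] .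
    interpret pair_prob_space "\<kappa> x" U ..
    show "space (\<kappa> x \<Otimes>\<^sub>M U) = UNIV" using kernelD(3)[OF \<kappa> x] by (simp add: space_pair_measure)
    show "prob_space (\<kappa> x \<Otimes>\<^sub>M U)" by unfold_locales
  qed
  have lawNone: "emeasure (\<kappa> x \<Otimes>\<^sub>M U) {w. G x w = None} = 1 - (\<Sum>n. ennreal (l x n))" if x: "x \<in> space M" for x
  proof -
    interpret P: prob_space "\<kappa> x \<Otimes>\<^sub>M U" by (rule ps[OF x])
    have [measurable]: "{w. G x w = Some n} \<in> sets (\<kappa> x \<Otimes>\<^sub>M U)" for n
      using measurable_sets[OF Gx[OF x], of "{Some n}"] by (simp add: spx[OF x] vimage_def)
    then have range: "range (\<lambda>n. {w. G x w = Some n}) \<subseteq> sets (\<kappa> x \<Otimes>\<^sub>M U)" by blast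
    have "emeasure (\<kappa> x \<Otimes>\<^sub>M U) (\<Union>n. {w. G x w = Some n}) = (\<Sum>n. ennreal (l x n))"
    proof -
      from range have "(\<Sum>n. emeasure (\<kappa> x \<Otimes>\<^sub>M U) {w. G x w = Some n}) = emeasure (\<kappa> x \<Otimes>\<^sub>M U) (\<Union>n. {w. G x w = Some n})"
        by (rule suminf_emeasure) (auto simp: disjoint_family_on_def)
      then show ?thesis by (simp add: lawSome[OF x])
    qed
    moreover have "{w. G x w = None} = space (\<kappa> x \<Otimes>\<^sub>M U) - (\<Union>n. {w. G x w = Some n})"
      by (auto simp: spx[OF x])
    ultimately show ?thesis
      using emeasure_compl[OF sets.countable_UN[OF range]] P.emeasure_finite[of "\<Union>n. {w. G x w = Some n}"] by (simp add: P.emeasure_space_1)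
  qed
  have same_law: "distr (\<kappa> x \<Otimes>\<^sub>M U) (count_space UNIV) (G x) = distr (\<kappa> z \<Otimes>\<^sub>M U) (count_space UNIV) (G z)"
    if x: "x \<in> space M" and z: "z \<in> space M" and eq: "cls x = cls z" for x z
  proof (rule measure_eqI_countable[where A = UNIV])
    have ll: "l x n = l z n" for n
    proof (cases "n \<le> N")
      case True
      then have "n < Suc N" by simp
      with arg_cong[OF eq, of "\<lambda>c. c ! n"] show ?thesis
        unfolding cls_def l_def by (simp del: upt_Suc)
    next
      case False
      then have "Q -` {n} = {}" using QN by auto
      then show ?thesis by (simp add: l_def q_def)
    qed
    fix g :: "nat option"
    have v: "G x -` {g} = {w. G x w = g}" for x g by auto
    show "emeasure (distr (\<kappa> x \<Otimes>\<^sub>M U) (count_space UNIV) (G x)) {g} = emeasure (distr (\<kappa> z \<Otimes>\<^sub>M U) (count_space UNIV) (G z)) {g}"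
      using x z by (cases g) (simp_all add: emeasure_distr spx v lawSome lawNone ll)
  qed auto
  have cost: "Lnorm p (\<kappa> x \<Otimes>\<^sub>M U) (\<lambda>w. ennreal (dist (fst w) (pt (G x w)))) \<le> ennreal \<epsilon>"
    if x: "x \<in> space M" and bd: "AE u in \<kappa> x. norm u \<le> B" for x
  proof -
    interpret \<kappa>: prob_space "\<kappa> x" using kernelD(1)[OF \<kappa> x] .
    interpret P: prob_space "\<kappa> x \<Otimes>\<^sub>M U" by (rule ps[OF x])
    have \<kappa>UNIV: "space (\<kappa> x) = UNIV" using kernelD(3)[OF \<kappa> x] by simp
    have Qx [measurable]: "Q -` {n} \<in> sets (\<kappa> x)" for n using kernelD(2)[OF \<kappa> x] by simp
    have sumq: "(\<Sum>n\<le>N. q x n) = 1"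
    proof -
      have "(\<Sum>n\<le>N. q x n) = measure (\<kappa> x) (\<Union>n\<in>{..N}. Q -` {n})"
        unfolding q_def by (intro \<kappa>.finite_measure_finite_Union[symmetric]) (auto simp: disjoint_family_on_def)
      also have "(\<Union>n\<in>{..N}. Q -` {n}) = space (\<kappa> x)" using QN by (auto simp: \<kappa>UNIV)
      finally show ?thesis using \<kappa>.prob_space by simp
    qed
    have "1 - real (Suc N) / real k \<le> (\<Sum>n\<le>N. l x n)"
    proof -
      have "(\<Sum>n\<le>N. q x n - l x n) \<le> (\<Sum>n\<le>N. 1 / real k)" by (intro sum_mono ql)
      then show ?thesis using sumq by (simp add: sum_subtractf)
    qed
    moreover have "ennreal (\<Sum>n\<le>N. l x n) \<le> (\<Sum>n. ennreal (l x n))"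
    proof -
      have "ennreal (\<Sum>n\<le>N. l x n) = (\<Sum>n\<le>N. ennreal (l x n))"
        by (rule sum_ennreal[symmetric]) (rule l0)
      also have "\<dots> \<le> (\<Sum>n. ennreal (l x n))"
        by (rule sum_le_suminf[OF summableI]) simp_all
      finally show ?thesis .
    qed
    ultimately have "ennreal (1 - real (Suc N) / real k) \<le> (\<Sum>n. ennreal (l x n))"
      by (metis ennreal_leI order_trans)
    then have "1 - (\<Sum>n. ennreal (l x n)) \<le> 1 - ennreal (1 - real (Suc N) / real k)"
      by (intro ennreal_minus_mono order_refl)
    also have "\<dots> \<le> ennreal (real (Suc N) / real k)"
      by (cases "1 - real (Suc N) / real k \<ge> 0")
        (auto simp: ennreal_neg ennreal_minus simp flip: ennreal_1 intro!: ennreal_leI)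
    finally have None_le: "emeasure (\<kappa> x \<Otimes>\<^sub>M U) {w. G x w = None} \<le> ennreal (real (Suc N) / real k)"
      by (simp add: lawNone[OF x])
    have Nset [measurable]: "{w. G x w = None} \<in> sets (\<kappa> x \<Otimes>\<^sub>M U)"
      using measurable_sets[OF Gx[OF x], of "{None}"] by (simp add: spx[OF x] vimage_def)
    have "AE w in \<kappa> x \<Otimes>\<^sub>M U. norm (fst w) \<le> B"
      using AE_coupling_fst[OF pair_measure_in_couplings[OF \<kappa>.prob_space_axioms U.prob_space_axioms] bd] .
    then have "AE w in \<kappa> x \<Otimes>\<^sub>M U. ennreal (dist (fst w) (pt (G x w))) \<le> ennreal B * indicator {w. G x w = None} w + ennreal \<epsilon>1"
    proof eventually_elim
      case (elim w)
      show ?case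
      proof (cases "G x w")
        case None
        then show ?thesis using elim B \<epsilon>1 by (simp add: pt_def flip: ennreal_plus)
      next
        case (Some n)
        then have "n = Q (fst w)" by (auto simp: G_def split: if_splits)
        then show ?thesis using Some Qb[OF elim] by (auto simp: pt_def dist_commute intro!: ennreal_leI)
      qed
    qed
    then have "Lnorm p (\<kappa> x \<Otimes>\<^sub>M U) (\<lambda>w. ennreal (dist (fst w) (pt (G x w)))) \<le>
        Lnorm p (\<kappa> x \<Otimes>\<^sub>M U) (\<lambda>w. ennreal B * indicator {w. G x w = None} w + ennreal \<epsilon>1)"
      using p by (intro Lnorm_mono_AE) auto
    also have "\<dots> \<le> Lnorm p (\<kappa> x \<Otimes>\<^sub>M U) (\<lambda>w. ennreal B * indicator {w. G x w = None} w) + ennreal \<epsilon>1"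
      using p by (intro P.Lnorm_add_const) auto
    also have "\<dots> \<le> ennreal \<epsilon>1 + ennreal \<epsilon>1"
    proof (intro add_right_mono, subst Lnorm_le_iff)
      have "(\<integral>\<^sup>+w. epowr (ennreal B * indicator {w. G x w = None} w) p \<partial>(\<kappa> x \<Otimes>\<^sub>M U)) =
            (\<integral>\<^sup>+w. ennreal (B powr p) * indicator {w. G x w = None} w \<partial>(\<kappa> x \<Otimes>\<^sub>M U))"
        using B by (intro nn_integral_cong) (auto simp: epowr_ennreal split: split_indicator)
      also have "\<dots> = ennreal (B powr p) * emeasure (\<kappa> x \<Otimes>\<^sub>M U) {w. G x w = None}"
        by (rule nn_integral_cmult_indicator[OF Nset])
      also have "\<dots> \<le> ennreal (B powr p) * ennreal (real (Suc N) / real k)"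
        by (intro mult_left_mono None_le) simp
      also have "\<dots> \<le> epowr (ennreal \<epsilon>1) p"
        using k \<epsilon>1 by (simp add: epowr_ennreal ennreal_leI flip: ennreal_mult)
      finally show "(\<integral>\<^sup>+w. epowr (ennreal B * indicator {w. G x w = None} w) p \<partial>(\<kappa> x \<Otimes>\<^sub>M U)) \<le> epowr (ennreal \<epsilon>1) p" .
    qed (use p in simp)
    also have "\<dots> = ennreal \<epsilon>" using \<epsilon>1 by (simp add: \<epsilon>1_def flip: ennreal_plus)
    finally show ?thesis .
  qed
  show thesis
    by (rule that[OF G_meas cls_meas same_law cost])
qed


lemma near_minimizer_exists:
  fixes f :: "'a \<Rightarrow> ennreal" and \<epsilon> :: real
  assumes "A \<noteq> {}" "\<epsilon> > 0"
  shows "\<exists>a\<in>A. \<forall>b\<in>A. f a \<le> f b + ennreal \<epsilon>"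
proof (cases "(INF a\<in>A. f a) = \<infinity>")
  case True
  then have "f b = \<top>" if "b \<in> A" for b
    using INF_lower[OF that, of f] by (simp add: top_unique)
  then show ?thesis using assms by auto
next
  case False
  then obtain a where a: "a \<in> A" "f a < (INF a\<in>A. f a) + ennreal \<epsilon>"
    using INF_approx_ennreal[OF \<open>\<epsilon> > 0\<close> refl] by blast
  have "f a \<le> f b + ennreal \<epsilon>" if "b \<in> A" for b
    using a(2) add_right_mono[OF INF_lower[OF that, of f], of "ennreal \<epsilon>"] by (simp add: order.strict_implies_order order_less_le_trans)
  with a(1) show ?thesis by blast
qed

lemma dist_triangle_ennreal4:
  fixes u w a b :: "'e :: metric_space"
  shows "ennreal (dist u w) \<le> ennreal (dist u a) + ennreal (dist a b) + ennreal (dist w b)"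
proof -
  have "dist u w \<le> dist u a + dist a b + dist w b"
    using dist_triangle[of u w a] dist_triangle[of a w b] by (simp add: dist_commute)
  then show ?thesis by (simp flip: ennreal_plus)
qed

text \<open>The laws of the labels range over countably many possibilities, so a near-optimal
  coupling may be picked arbitrarily for each pair of them and the result is still measurable;
  lifting it to points gives \<open>\<Gamma>\<close>. Passing between points and labels changes
  transport costs little in both directions, so near-optimality for labels carries over to the
  kernels.\<close>

theorem near_optimal_couplings:
  fixes \<kappa> :: "'a \<Rightarrow> 'e :: euclidean_space measure" and p B \<epsilon> :: real
  assumes \<kappa> [measurable]: "\<kappa> \<in> M \<rightarrow>\<^sub>M prob_algebra borel" and p: "p \<ge> 1" and \<epsilon>: "\<epsilon> > 0" and B: "B \<ge> 0"
  obtains \<Gamma> where "\<Gamma> \<in> M \<Otimes>\<^sub>M M \<rightarrow>\<^sub>M prob_algebra (borel \<Otimes>\<^sub>M borel)"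
    "\<And>x z. x \<in> space M \<Longrightarrow> z \<in> space M \<Longrightarrow> \<Gamma> (x, z) \<in> couplings (\<kappa> x) (\<kappa> z)"
    "\<And>x z. x \<in> space M \<Longrightarrow> z \<in> space M \<Longrightarrow> AE u in \<kappa> x. norm u \<le> B \<Longrightarrow> AE u in \<kappa> z. norm u \<le> B \<Longrightarrow>
       Lnorm p (\<Gamma> (x, z)) (\<lambda>(u, w). ennreal (dist u w)) \<le> wasserstein dist p (\<kappa> x) (\<kappa> z) + ennreal \<epsilon>"
proof -
  \<comment> \<open>Five errors of size \<open>\<delta>\<close>: one rounding on each side for
    \<open>\<Gamma>\<close>, one on each side for the competing coupling, and the near-optimality of
    \<open>opt\<close>.\<close>
  define \<delta> where "\<delta> = \<epsilon> / 5"
  have \<delta>: "\<delta> > 0" using \<epsilon> by (simp add: \<delta>_def)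
  define U where "U = uniform_measure lborel {0..1::real}"
  interpret U: prob_space U unfolding U_def by (rule prob_space_uniform_measure) auto
  have sU [measurable_cong, simp]: "sets U = sets borel" and spU [simp]: "space U = UNIV" by (auto simp: U_def)
  obtain G :: "'a \<Rightarrow> 'e \<times> real \<Rightarrow> nat option" and pt :: "nat option \<Rightarrow> 'e" and cls :: "'a \<Rightarrow> int list"
    where G [measurable]: "(\<lambda>(x, w). G x w) \<in> M \<Otimes>\<^sub>M (borel \<Otimes>\<^sub>M borel) \<rightarrow>\<^sub>M count_space UNIV"
    and cls [measurable]: "cls \<in> M \<rightarrow>\<^sub>M count_space UNIV"
    and same: "\<And>x z. x \<in> space M \<Longrightarrow> z \<in> space M \<Longrightarrow> cls x = cls z \<Longrightarrow>
       distr (\<kappa> x \<Otimes>\<^sub>M U) (count_space UNIV) (G x) = distr (\<kappa> z \<Otimes>\<^sub>M U) (count_space UNIV) (G z)"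
    and cost: "\<And>x. x \<in> space M \<Longrightarrow> AE u in \<kappa> x. norm u \<le> B \<Longrightarrow>
       Lnorm p (\<kappa> x \<Otimes>\<^sub>M U) (\<lambda>w. ennreal (dist (fst w) (pt (G x w)))) \<le> ennreal \<delta>"
    by (rule kernel_discretization[OF \<kappa> p \<delta> B, folded U_def]) (rule that)
  define \<kappa>U where "\<kappa>U x = \<kappa> x \<Otimes>\<^sub>M U" for x
  have \<kappa>U [measurable]: "\<kappa>U \<in> M \<rightarrow>\<^sub>M prob_algebra (borel \<Otimes>\<^sub>M borel)"
    unfolding \<kappa>U_def by (intro measurable_pair_prob \<kappa> measurable_const) (simp add: space_prob_algebra U.prob_space_axioms)
  define b where "b x = distr (\<kappa>U x) (count_space UNIV) (G x)" for x
  have Gx: "G x \<in> borel \<Otimes>\<^sub>M borel \<rightarrow>\<^sub>M count_space UNIV" if "x \<in> space M" for x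
    using measurable_compose[OF measurable_Pair1'[OF that] G] by simp
  have Gx' [measurable]: "G x \<in> \<kappa>U x \<rightarrow>\<^sub>M count_space UNIV" if "x \<in> space M" for x
    using Gx[OF that] kernelD(2)[OF \<kappa>U that] by (simp cong: measurable_cong_sets)
  have prob_\<kappa>U: "prob_space (\<kappa>U x)" if "x \<in> space M" for x using kernelD(1)[OF \<kappa>U that] .
  have prob_b: "prob_space (b x)" if "x \<in> space M" for x
    unfolding b_def using prob_\<kappa>U[OF that] Gx'[OF that] by (rule prob_space.prob_space_distr)
  define near where "near b1 b2 F \<longleftrightarrow> F \<in> couplings b1 b2 \<and> (\<forall>F'\<in>couplings b1 b2.
      Lnorm p F (\<lambda>s. ennreal (dist (pt (fst s)) (pt (snd s)))) \<le> Lnorm p F' (\<lambda>s. ennreal (dist (pt (fst s)) (pt (snd s)))) + ennreal \<delta>)" for b1 b2 F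
  define opt where "opt b1 b2 = (SOME F. near b1 b2 F)" for b1 b2
  have near: "near (b x) (b z) (opt (b x) (b z))" if "x \<in> space M" "z \<in> space M" for x z
  proof -
    have "couplings (b x) (b z) \<noteq> {}"
      using pair_measure_in_couplings[OF prob_b prob_b, of x z] that by auto
    from near_minimizer_exists[OF this \<delta>, of "\<lambda>F. Lnorm p F (\<lambda>s. ennreal (dist (pt (fst s)) (pt (snd s))))"] have "\<exists>F. near (b x) (b z) F"
      unfolding near_def by blast
    then show ?thesis unfolding opt_def by (rule someI_ex)
  qed
  \<comment> \<open>Evaluating at a representative of the class exhibits \<open>opt\<close> as a
    function of a countable pair of classes, hence as measurable.\<close>
  define rep where "rep c = (SOME x. x \<in> space M \<and> cls x = c)" for c
  have b_rep: "b (rep (cls x)) = b x" if "x \<in> space M" for x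
  proof -
    have "rep (cls x) \<in> space M \<and> cls (rep (cls x)) = cls x"
      unfolding rep_def using that by (intro someI_ex[of "\<lambda>y. y \<in> space M \<and> cls y = cls x"]) blast
    with same[of "rep (cls x)" x] that show ?thesis by (simp add: b_def \<kappa>U_def)
  qed
  have opt_props: "sets (opt (b x) (b z)) = UNIV" "space (opt (b x) (b z)) = UNIV" "prob_space (opt (b x) (b z))"
    "opt (b x) (b z) \<in> couplings (distr (\<kappa>U x) (count_space UNIV) (G x)) (distr (\<kappa>U z) (count_space UNIV) (G z))"
    if x: "x \<in> space M" and z: "z \<in> space M" for x z
  proof -
    show *: "opt (b x) (b z) \<in> couplings (distr (\<kappa>U x) (count_space UNIV) (G x)) (distr (\<kappa>U z) (count_space UNIV) (G z))"
      using near[OF x z] by (simp add: near_def b_def)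
    show "sets (opt (b x) (b z)) = UNIV" "space (opt (b x) (b z)) = UNIV" "prob_space (opt (b x) (b z))"
      using discrete_coupling_sets[OF prob_\<kappa>U[OF x] prob_\<kappa>U[OF z] Gx'[OF x] Gx'[OF z] *] by auto
  qed
  have opt_meas: "(\<lambda>(x, z). opt (b x) (b z)) \<in> M \<Otimes>\<^sub>M M \<rightarrow>\<^sub>M prob_algebra (count_space UNIV)"
  proof -
    have clsp: "(\<lambda>s. (cls (fst s), cls (snd s))) \<in> M \<Otimes>\<^sub>M M \<rightarrow>\<^sub>M count_space UNIV"
    proof -
      have "(\<lambda>s. (cls (fst s), cls (snd s))) \<in> M \<Otimes>\<^sub>M M \<rightarrow>\<^sub>M count_space UNIV \<Otimes>\<^sub>M count_space UNIV" by measurable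
      then show ?thesis by (subst (asm) pair_measure_countable) auto
    qed
    have "(\<lambda>s. opt (b (rep (cls (fst s)))) (b (rep (cls (snd s))))) \<in> M \<Otimes>\<^sub>M M \<rightarrow>\<^sub>M prob_algebra (count_space UNIV)"
    proof (cases "space M = {}")
      case True
      then have "space (M \<Otimes>\<^sub>M M) = {}" by (simp add: space_pair_measure)
      then show ?thesis by (auto simp: measurable_def)
    next
      case False
      then have "space (prob_algebra (count_space (UNIV :: (nat option \<times> nat option) set))) \<noteq> {}"
        using opt_props by (force simp: space_prob_algebra)
      then obtain \<Delta> where \<Delta>: "\<Delta> \<in> space (prob_algebra (count_space (UNIV :: (nat option \<times> nat option) set)))" by auto
      \<comment> \<open>Pairs of lists that are not classes of points receive a fixed
        \<open>\<Delta>\<close>, because the chosen coupling is known to be a probability measure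
        only for genuine label laws.\<close>
      define f where "f c = (if \<exists>x\<in>space M. \<exists>z\<in>space M. c = (cls x, cls z) then opt (b (rep (fst c))) (b (rep (snd c))) else \<Delta>)" for c
      have "f \<in> count_space UNIV \<rightarrow>\<^sub>M prob_algebra (count_space UNIV)"
        using \<Delta> opt_props by (auto simp: f_def measurable_count_space_eq1 b_rep space_prob_algebra)
      from measurable_compose[OF clsp this] show ?thesis
        by (rule measurable_cong[THEN iffD1, rotated]) (auto simp: f_def space_pair_measure)
    qed
    then show ?thesis
      by (rule measurable_cong[THEN iffD1, rotated]) (auto simp: space_pair_measure b_rep)
  qed
  \<comment> \<open>The lift couples points together with the uniform variables that decide about
    their labels; \<open>\<Gamma>\<close> forgets these variables.\<close>
  define J where "J = (\<lambda>(x, z). lift_coupling (opt (b x) (b z)) (\<kappa>U x) (G x) (\<kappa>U z) (G z))"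
  have J_coupling: "J (x, z) \<in> couplings (\<kappa>U x) (\<kappa>U z)" if "x \<in> space M" "z \<in> space M" for x z
    unfolding J_def prod.case using that by (intro lift_coupling_in_couplings prob_\<kappa>U Gx' opt_props)
  let ?BB = "(borel :: 'e measure) \<Otimes>\<^sub>M (borel :: real measure)"
  \<comment> \<open>The labelling \<open>G x\<close> itself varies with \<open>x\<close>. Appending
    the label as an extra coordinate turns this into conditioning on the fixed map
    \<open>snd\<close>, which \<open>measurable_cond_on\<close> handles.\<close>
  have cond_meas: "(\<lambda>x. cond_on (\<kappa>U x) (G x) a) \<in> M \<rightarrow>\<^sub>M prob_algebra ?BB" for a
  proof -
    have "(\<lambda>x. distr (cond_on (distr (\<kappa>U x) (?BB \<Otimes>\<^sub>M count_space UNIV) (\<lambda>w. (w, G x w))) snd a) ?BB fst) \<in> M \<rightarrow>\<^sub>M prob_algebra ?BB"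
    proof (rule measurable_distr_prob_space2[where M = "?BB \<Otimes>\<^sub>M count_space UNIV"])
      show "(\<lambda>x. cond_on (distr (\<kappa>U x) (?BB \<Otimes>\<^sub>M count_space UNIV) (\<lambda>w. (w, G x w))) snd a) \<in> M \<rightarrow>\<^sub>M prob_algebra (?BB \<Otimes>\<^sub>M count_space UNIV)"
      proof (rule measurable_cond_on)
        have "(\<lambda>(x, w). (w, (\<lambda>(x, w). G x w) (x, w))) \<in> M \<Otimes>\<^sub>M ?BB \<rightarrow>\<^sub>M ?BB \<Otimes>\<^sub>M count_space UNIV"
          by measurable
        then show "(\<lambda>x. distr (\<kappa>U x) (?BB \<Otimes>\<^sub>M count_space UNIV) (\<lambda>w. (w, G x w))) \<in> M \<rightarrow>\<^sub>M prob_algebra (?BB \<Otimes>\<^sub>M count_space UNIV)"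
          by (intro measurable_distr_prob_space2[OF \<kappa>U]) simp
      qed simp
    qed simp
    then show ?thesis
    proof (rule measurable_cong[THEN iffD1, rotated])
      fix x assume x: "x \<in> space M"
      interpret prob_space "\<kappa>U x" by (rule prob_\<kappa>U[OF x])
      note [measurable_cong] = kernelD(2)[OF \<kappa>U x]
      have Gm [measurable]: "G x \<in> ?BB \<rightarrow>\<^sub>M count_space UNIV" by (rule Gx[OF x])
      have sp: "space (\<kappa>U x) = UNIV" using kernelD(3)[OF \<kappa>U x] by (simp add: space_pair_measure)
      define D where "D = distr (\<kappa>U x) (?BB \<Otimes>\<^sub>M count_space UNIV) (\<lambda>w. (w, G x w))"
      have mD: "(\<lambda>w. (w, G x w)) \<in> \<kappa>U x \<rightarrow>\<^sub>M ?BB \<Otimes>\<^sub>M count_space UNIV" by measurable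
      have emD: "emeasure D E = emeasure (\<kappa>U x) {w. (w, G x w) \<in> E}" if "E \<in> sets (?BB \<Otimes>\<^sub>M count_space UNIV)" for E
        unfolding D_def using that mD by (simp add: emeasure_distr sp vimage_def)
      have s1: "snd -` {a} \<inter> space D \<in> sets (?BB \<Otimes>\<^sub>M count_space UNIV)"
      proof -
        have "snd -` {a} \<inter> space D = snd -` {a} \<inter> space (?BB \<Otimes>\<^sub>M count_space UNIV)" by (simp add: D_def)
        then show ?thesis by (simp add: measurable_sets)
      qed
      show "distr (cond_on (distr (\<kappa>U x) (?BB \<Otimes>\<^sub>M count_space UNIV) (\<lambda>w. (w, G x w))) snd a) ?BB fst = cond_on (\<kappa>U x) (G x) a"
        unfolding D_def[symmetric]
      proof (rule measure_eqI)
        fix A assume "A \<in> sets (distr (cond_on D snd a) ?BB fst)"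
        then have A [measurable]: "A \<in> sets ?BB" by simp
        have sD: "sets D = sets (?BB \<Otimes>\<^sub>M count_space UNIV)" "space D = UNIV" by (auto simp: D_def space_pair_measure)
        note [measurable_cong] = sD(1)
        have fA [measurable]: "fst -` A \<in> sets D"
          using measurable_sets[of fst D ?BB A] sD by (simp cong: measurable_cong_sets)
        have sa [measurable]: "snd -` {a} \<in> sets D"
          using s1 sD by simp
        have "emeasure (distr (cond_on D snd a) ?BB fst) A = emeasure (cond_on D snd a) (fst -` A)"
          using sD by (subst emeasure_distr) (auto cong: measurable_cong_sets)
        also have "\<dots> = (if emeasure D (snd -` {a}) = 0 then emeasure D (fst -` A) else emeasure D (snd -` {a} \<inter> fst -` A) / emeasure D (snd -` {a}))"
          using sD(2) by (simp add: cond_on_def)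
        also have "\<dots> = (if emeasure (\<kappa>U x) (G x -` {a}) = 0 then emeasure (\<kappa>U x) A else emeasure (\<kappa>U x) (G x -` {a} \<inter> A) / emeasure (\<kappa>U x) (G x -` {a}))"
        proof -
          have "emeasure D (snd -` {a} \<inter> fst -` A) = emeasure (\<kappa>U x) (G x -` {a} \<inter> A)"
            using sets.Int[OF sa fA] sD(1) by (subst emD) (auto intro!: arg_cong[where f = "emeasure (\<kappa>U x)"])
          moreover have "emeasure D (snd -` {a}) = emeasure (\<kappa>U x) (G x -` {a})"
            using sa sD(1) by (subst emD) (auto intro!: arg_cong[where f = "emeasure (\<kappa>U x)"])
          moreover have "emeasure D (fst -` A) = emeasure (\<kappa>U x) A"
            using fA sD(1) by (subst emD) (auto intro!: arg_cong[where f = "emeasure (\<kappa>U x)"])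
          ultimately show ?thesis by simp
        qed
        also have "\<dots> = emeasure (cond_on (\<kappa>U x) (G x) a) A"
          using measurable_sets[OF Gx'[OF x], of "{a}"] A kernelD(2)[OF \<kappa>U x] sp by (simp add: cond_on_def)
        finally show "emeasure (distr (cond_on D snd a) ?BB fst) A = emeasure (cond_on (\<kappa>U x) (G x) a) A" .
      qed (simp add: kernelD(2)[OF \<kappa>U x])
    qed
  qed
  have J_meas: "J \<in> M \<Otimes>\<^sub>M M \<rightarrow>\<^sub>M prob_algebra (?BB \<Otimes>\<^sub>M ?BB)"
    unfolding J_def lift_coupling_def case_prod_beta'
  proof (rule measurable_bind_prob_space2)
    show "(\<lambda>s. opt (b (fst s)) (b (snd s))) \<in> M \<Otimes>\<^sub>M M \<rightarrow>\<^sub>M prob_algebra (count_space UNIV)"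
      using opt_meas by (simp add: case_prod_beta')
    let ?h = "\<lambda>s. cond_on (\<kappa>U (fst (fst s))) (G (fst (fst s))) (fst (snd s)) \<Otimes>\<^sub>M cond_on (\<kappa>U (snd (fst s))) (G (snd (fst s))) (snd (snd s))"
    have "?h \<in> (M \<Otimes>\<^sub>M M) \<Otimes>\<^sub>M count_space UNIV \<rightarrow>\<^sub>M prob_algebra (?BB \<Otimes>\<^sub>M ?BB)"
    proof (rule measurable_pair_count_space2)
      fix g :: "nat option \<times> nat option"
      have "(\<lambda>s. cond_on (\<kappa>U (fst s)) (G (fst s)) (fst g)) \<in> M \<Otimes>\<^sub>M M \<rightarrow>\<^sub>M prob_algebra ?BB"
        "(\<lambda>s. cond_on (\<kappa>U (snd s)) (G (snd s)) (snd g)) \<in> M \<Otimes>\<^sub>M M \<rightarrow>\<^sub>M prob_algebra ?BB"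
        by (rule measurable_compose[OF measurable_fst cond_meas], rule measurable_compose[OF measurable_snd cond_meas])
      from measurable_pair_prob[OF this] show "(\<lambda>s. ?h (s, g)) \<in> M \<Otimes>\<^sub>M M \<rightarrow>\<^sub>M prob_algebra (?BB \<Otimes>\<^sub>M ?BB)"
        by simp
    qed
    then show "(\<lambda>(s, g). cond_on (\<kappa>U (fst s)) (G (fst s)) (fst g) \<Otimes>\<^sub>M cond_on (\<kappa>U (snd s)) (G (snd s)) (snd g))
        \<in> (M \<Otimes>\<^sub>M M) \<Otimes>\<^sub>M count_space UNIV \<rightarrow>\<^sub>M prob_algebra (?BB \<Otimes>\<^sub>M ?BB)"
      by (simp add: case_prod_beta')
  qed
  define \<Gamma> where "\<Gamma> s = distr (J s) (borel \<Otimes>\<^sub>M borel) (\<lambda>w. (fst (fst w), fst (snd w)))" for s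
  have proj [measurable]: "(\<lambda>w. (fst (fst w), fst (snd w))) \<in> ?BB \<Otimes>\<^sub>M ?BB \<rightarrow>\<^sub>M borel \<Otimes>\<^sub>M borel" by measurable
  have \<Gamma>_meas: "\<Gamma> \<in> M \<Otimes>\<^sub>M M \<rightarrow>\<^sub>M prob_algebra (borel \<Otimes>\<^sub>M borel)"
    unfolding \<Gamma>_def by (rule measurable_compose[OF J_meas measurable_distr_prob_space[OF proj]])
  have int_\<Gamma>: "(\<integral>\<^sup>+w. f w \<partial>\<Gamma> (x, z)) = (\<integral>\<^sup>+w. f (fst (fst w), fst (snd w)) \<partial>J (x, z))"
    if f: "f \<in> borel_measurable (borel \<Otimes>\<^sub>M borel)" and "x \<in> space M" "z \<in> space M" for f x z
  proof -
    have "sets (J (x, z)) = sets (?BB \<Otimes>\<^sub>M ?BB)"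
      using kernelD(2)[OF J_meas] that by (simp add: space_pair_measure)
    then show ?thesis unfolding \<Gamma>_def using f proj
      by (subst nn_integral_distr) (auto cong: measurable_cong_sets)
  qed
  have int_\<kappa>U: "(\<integral>\<^sup>+w. f (fst w) \<partial>\<kappa>U x) = (\<integral>\<^sup>+u. f u \<partial>\<kappa> x)" if f: "f \<in> borel_measurable borel" and x: "x \<in> space M" for f x
    unfolding \<kappa>U_def using f kernelD[OF \<kappa> x]
    by (intro nn_integral_coupling_fst[OF pair_measure_in_couplings]) (auto simp: U.prob_space_axioms cong: measurable_cong_sets)
  have \<Gamma>_coupling: "\<Gamma> (x, z) \<in> couplings (\<kappa> x) (\<kappa> z)" if x: "x \<in> space M" and z: "z \<in> space M" for x z
  proof (rule couplingsI)
    note sx = kernelD(2)[OF \<kappa> x] and sz = kernelD(2)[OF \<kappa> z]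
    show "sets (\<Gamma> (x, z)) = sets (\<kappa> x \<Otimes>\<^sub>M \<kappa> z)"
      unfolding \<Gamma>_def using sx sz by (simp cong: sets_pair_measure_cong)
    fix A assume A: "A \<in> sets (\<kappa> x)"
    then have [measurable]: "A \<in> sets borel" using sx by simp
    have "(\<integral>\<^sup>+w. indicator A (fst w) \<partial>\<Gamma> (x, z)) = (\<integral>\<^sup>+w. indicator A (fst (fst w)) \<partial>J (x, z))"
      by (subst int_\<Gamma>[OF _ x z]) auto
    also have "\<dots> = (\<integral>\<^sup>+u. indicator A (fst u) \<partial>\<kappa>U x)"
      by (rule nn_integral_coupling_fst[OF J_coupling[OF x z], of "\<lambda>w. indicator A (fst w)"])
        (simp cong: measurable_cong_sets add: kernelD(2)[OF \<kappa>U x])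
    also have "\<dots> = emeasure (\<kappa> x) A" using A by (subst int_\<kappa>U[OF _ x]) auto
    finally show "(\<integral>\<^sup>+w. indicator A (fst w) \<partial>\<Gamma> (x, z)) = emeasure (\<kappa> x) A" .
  next
    note sx = kernelD(2)[OF \<kappa> x] and sz = kernelD(2)[OF \<kappa> z]
    fix A assume A: "A \<in> sets (\<kappa> z)"
    then have [measurable]: "A \<in> sets borel" using sz by simp
    have "(\<integral>\<^sup>+w. indicator A (snd w) \<partial>\<Gamma> (x, z)) = (\<integral>\<^sup>+w. indicator A (fst (snd w)) \<partial>J (x, z))"
      by (subst int_\<Gamma>[OF _ x z]) auto
    also have "\<dots> = (\<integral>\<^sup>+u. indicator A (fst u) \<partial>\<kappa>U z)"
      by (rule nn_integral_coupling_snd[OF J_coupling[OF x z], of "\<lambda>w. indicator A (fst w)"])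
        (simp cong: measurable_cong_sets add: kernelD(2)[OF \<kappa>U z])
    also have "\<dots> = emeasure (\<kappa> z) A" using A by (subst int_\<kappa>U[OF _ z]) auto
    finally show "(\<integral>\<^sup>+w. indicator A (snd w) \<partial>\<Gamma> (x, z)) = emeasure (\<kappa> z) A" .
  qed
  let ?c = "\<lambda>x w. ennreal (dist (fst w) (pt (G x w)))"
  have c_meas: "?c x \<in> borel_measurable (\<kappa>U x)" if x: "x \<in> space M" for x
  proof -
    have [measurable]: "(\<lambda>w. pt (G x w)) \<in> ?BB \<rightarrow>\<^sub>M borel" by (rule measurable_compose[OF Gx[OF x]]) simp
    show ?thesis by (simp cong: measurable_cong_sets add: kernelD(2)[OF \<kappa>U x])
  qed
  have \<Gamma>_cost: "Lnorm p (\<Gamma> (x, z)) (\<lambda>(u, w). ennreal (dist u w)) \<le> wasserstein dist p (\<kappa> x) (\<kappa> z) + ennreal \<epsilon>"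
    if x: "x \<in> space M" and z: "z \<in> space M" and bx: "AE u in \<kappa> x. norm u \<le> B" and bz: "AE u in \<kappa> z. norm u \<le> B" for x z
  proof -
    let ?F = "opt (b x) (b z)"
    let ?d = "\<lambda>s. ennreal (dist (pt (fst s)) (pt (snd s)))"
    have costx: "Lnorm p (\<kappa>U x) (?c x) \<le> ennreal \<delta>" and costz: "Lnorm p (\<kappa>U z) (?c z) \<le> ennreal \<delta>"
      using cost[OF x bx] cost[OF z bz] by (simp_all add: \<kappa>U_def)
    have triangle: "Lnorm p P (\<lambda>w. ennreal (dist (f w) (g w))) \<le> Lnorm p P cx + Lnorm p P cd + Lnorm p P cz"
      if "\<And>w. ennreal (dist (f w) (g w)) \<le> cx w + cd w + cz w"
        and m: "cx \<in> borel_measurable P" "cd \<in> borel_measurable P" "cz \<in> borel_measurable P"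
      for P :: "'w measure" and f g :: "'w \<Rightarrow> 'e" and cx cd cz
    proof -
      have "Lnorm p P (\<lambda>w. ennreal (dist (f w) (g w))) \<le> Lnorm p P (\<lambda>w. cx w + cd w + cz w)"
        using p that(1) by (intro Lnorm_mono) auto
      also have "\<dots> \<le> Lnorm p P (\<lambda>w. cx w + cd w) + Lnorm p P cz"
        using m by (intro Lnorm_add p) auto
      also have "\<dots> \<le> Lnorm p P cx + Lnorm p P cd + Lnorm p P cz"
        using m by (intro add_right_mono Lnorm_add p) auto
      finally show ?thesis .
    qed
    have Jc: "J (x, z) \<in> couplings (\<kappa>U x) (\<kappa>U z)" by (rule J_coupling[OF x z])
    have discJ: "Lnorm p (J (x, z)) (\<lambda>w. ?d (G x (fst w), G z (snd w))) = Lnorm p ?F ?d"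
      unfolding Lnorm_def J_def prod.case
      by (subst nn_integral_lift_coupling_discrete[OF prob_\<kappa>U[OF x] prob_\<kappa>U[OF z] Gx'[OF x] Gx'[OF z] opt_props(4)[OF x z],
            of "\<lambda>s. epowr (?d s) p"]) simp
    have "Lnorm p (\<Gamma> (x, z)) (\<lambda>(u, w). ennreal (dist u w)) = Lnorm p (J (x, z)) (\<lambda>w. ennreal (dist (fst (fst w)) (fst (snd w))))"
      unfolding Lnorm_def by (subst int_\<Gamma>[OF _ x z]) (auto simp: case_prod_beta')
    also have "\<dots> \<le> Lnorm p (J (x, z)) (\<lambda>w. ?c x (fst w)) + Lnorm p (J (x, z)) (\<lambda>w. ?d (G x (fst w), G z (snd w))) + Lnorm p (J (x, z)) (\<lambda>w. ?c z (snd w))"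
    proof (rule triangle)
      fix w
      show "ennreal (dist (fst (fst w)) (fst (snd w))) \<le> ?c x (fst w) + ?d (G x (fst w), G z (snd w)) + ?c z (snd w)"
        unfolding fst_conv snd_conv by (rule dist_triangle_ennreal4)
    next
      show "(\<lambda>w. ?c x (fst w)) \<in> borel_measurable (J (x, z))" "(\<lambda>w. ?c z (snd w)) \<in> borel_measurable (J (x, z))"
        by (rule measurable_compose[OF couplingsD(5)[OF Jc] c_meas[OF x]], rule measurable_compose[OF couplingsD(6)[OF Jc] c_meas[OF z]])
      have "(\<lambda>w. pt (G x (fst w))) \<in> J (x, z) \<rightarrow>\<^sub>M borel" "(\<lambda>w. pt (G z (snd w))) \<in> J (x, z) \<rightarrow>\<^sub>M borel"
        using measurable_compose[OF couplingsD(5)[OF Jc] Gx'[OF x]] measurable_compose[OF couplingsD(6)[OF Jc] Gx'[OF z]]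
        by (auto intro: measurable_compose[of _ _ "count_space UNIV"])
      then show "(\<lambda>w. ?d (G x (fst w), G z (snd w))) \<in> borel_measurable (J (x, z))" by simp
    qed
    also have "\<dots> \<le> ennreal \<delta> + Lnorm p ?F ?d + ennreal \<delta>"
      using costx costz
      by (intro add_mono) (auto simp: discJ[simplified] Lnorm_coupling_fst[OF Jc c_meas[OF x]] Lnorm_coupling_snd[OF Jc c_meas[OF z]])
    finally have up: "Lnorm p (\<Gamma> (x, z)) (\<lambda>(u, w). ennreal (dist u w)) \<le> ennreal \<delta> + Lnorm p ?F ?d + ennreal \<delta>" .
    have "Lnorm p (\<Gamma> (x, z)) (\<lambda>(u, w). ennreal (dist u w)) - ennreal \<epsilon> \<le> wasserstein dist p (\<kappa> x) (\<kappa> z)"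
    proof (rule le_wasserstein)
      fix \<gamma> assume \<gamma>: "\<gamma> \<in> couplings (\<kappa> x) (\<kappa> z)"
      interpret \<gamma>: prob_space \<gamma> by (rule prob_space_coupling[OF \<gamma> kernelD(1)[OF \<kappa> x]])
      interpret UU: pair_prob_space U U ..
      interpret \<gamma>UU: pair_prob_space \<gamma> "U \<Otimes>\<^sub>M U" ..
      \<comment> \<open>An arbitrary coupling \<open>\<gamma>\<close> of the two kernels, enriched
        by independent uniform variables, induces the coupling \<open>F'\<close> of the label laws,
        a competitor of \<open>opt\<close>.\<close>
      define R where "R = \<gamma> \<Otimes>\<^sub>M (U \<Otimes>\<^sub>M U)"
      have R: "R \<in> couplings \<gamma> (U \<Otimes>\<^sub>M U)"
        unfolding R_def by (rule pair_measure_in_couplings) unfold_locales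
      have s\<gamma> [measurable_cong]: "sets \<gamma> = sets (borel \<Otimes>\<^sub>M borel)"
        using couplingsD(1)[OF \<gamma>] kernelD(2)[OF \<kappa> x] kernelD(2)[OF \<kappa> z] by (simp cong: sets_pair_measure_cong)
      have sR [measurable_cong]: "sets R = sets ((borel \<Otimes>\<^sub>M borel) \<Otimes>\<^sub>M (borel \<Otimes>\<^sub>M borel))"
        unfolding R_def by (intro sets_pair_measure_cong s\<gamma>) simp_all
      let ?l = "\<lambda>w. (fst (fst w), fst (snd w))" and ?r = "\<lambda>w. (snd (fst w), snd (snd w))"
      have l [measurable]: "?l \<in> R \<rightarrow>\<^sub>M ?BB" and r [measurable]: "?r \<in> R \<rightarrow>\<^sub>M ?BB" by measurable
      have law_l: "distr R (\<kappa>U x) ?l = \<kappa>U x"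
      proof -
        have "\<kappa>U x = distr \<gamma> (\<kappa> x) fst \<Otimes>\<^sub>M distr (U \<Otimes>\<^sub>M U) U fst"
          unfolding \<kappa>U_def using couplingsD(3)[OF \<gamma>] couplingsD(3)[OF pair_measure_in_couplings[OF U.prob_space_axioms U.prob_space_axioms]] by simp
        also have "\<dots> = distr R (\<kappa> x \<Otimes>\<^sub>M U) (\<lambda>(v, w). (fst v, fst w))"
          unfolding R_def
        proof (rule pair_measure_distr)
          show "sigma_finite_measure (distr (U \<Otimes>\<^sub>M U) U fst)"
            using couplingsD(3)[OF pair_measure_in_couplings[OF U.prob_space_axioms U.prob_space_axioms]] U.sigma_finite_measure_axioms by simp
        qed (simp_all add: couplingsD(5)[OF \<gamma>])
        finally show ?thesis by (simp add: \<kappa>U_def case_prod_beta')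
      qed
      have law_r: "distr R (\<kappa>U z) ?r = \<kappa>U z"
      proof -
        have "\<kappa>U z = distr \<gamma> (\<kappa> z) snd \<Otimes>\<^sub>M distr (U \<Otimes>\<^sub>M U) U snd"
          unfolding \<kappa>U_def using couplingsD(4)[OF \<gamma>] couplingsD(4)[OF pair_measure_in_couplings[OF U.prob_space_axioms U.prob_space_axioms]] by simp
        also have "\<dots> = distr R (\<kappa> z \<Otimes>\<^sub>M U) (\<lambda>(v, w). (snd v, snd w))"
          unfolding R_def
        proof (rule pair_measure_distr)
          show "sigma_finite_measure (distr (U \<Otimes>\<^sub>M U) U snd)"
            using couplingsD(4)[OF pair_measure_in_couplings[OF U.prob_space_axioms U.prob_space_axioms]] U.sigma_finite_measure_axioms by simp
        qed (simp_all add: couplingsD(6)[OF \<gamma>])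
        finally show ?thesis by (simp add: \<kappa>U_def case_prod_beta')
      qed
      have int_l: "(\<integral>\<^sup>+w. f (?l w) \<partial>R) = (\<integral>\<^sup>+w. f w \<partial>\<kappa>U x)" if "f \<in> borel_measurable (\<kappa>U x)" for f
        using nn_integral_distr[of ?l R "\<kappa>U x" f] that l kernelD(2)[OF \<kappa>U x] law_l by (simp cong: measurable_cong_sets)
      have int_r: "(\<integral>\<^sup>+w. f (?r w) \<partial>R) = (\<integral>\<^sup>+w. f w \<partial>\<kappa>U z)" if "f \<in> borel_measurable (\<kappa>U z)" for f
        using nn_integral_distr[of ?r R "\<kappa>U z" f] that r kernelD(2)[OF \<kappa>U z] law_r by (simp cong: measurable_cong_sets)
      let ?g = "\<lambda>w. (G x (?l w), G z (?r w))"
      have Gl [measurable]: "(\<lambda>w. G x (?l w)) \<in> R \<rightarrow>\<^sub>M count_space UNIV" by (rule measurable_compose[OF l Gx[OF x]])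
      have Gr [measurable]: "(\<lambda>w. G z (?r w)) \<in> R \<rightarrow>\<^sub>M count_space UNIV" by (rule measurable_compose[OF r Gx[OF z]])
      have g [measurable]: "?g \<in> R \<rightarrow>\<^sub>M count_space UNIV \<Otimes>\<^sub>M count_space UNIV" by measurable
      define F' where "F' = distr R (count_space UNIV \<Otimes>\<^sub>M count_space UNIV) ?g"
      have int_F': "(\<integral>\<^sup>+s. f s \<partial>F') = (\<integral>\<^sup>+w. f (?g w) \<partial>R)" for f
        unfolding F'_def
        by (rule nn_integral_distr[OF g]) (subst pair_measure_countable, auto)
      have sb: "sets (b y) = UNIV" for y by (simp add: b_def)
      have F': "F' \<in> couplings (b x) (b z)"
      proof (rule couplingsI)
        show "sets F' = sets (b x \<Otimes>\<^sub>M b z)" unfolding F'_def sets_distr by (rule sets_pair_measure_cong) (simp_all add: sb)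
        fix A :: "nat option set"
        have "(\<integral>\<^sup>+s. indicator A (fst s) \<partial>F') = (\<integral>\<^sup>+w. indicator A (G x w) \<partial>\<kappa>U x)"
          unfolding int_F' fst_conv by (rule int_l) (rule measurable_compose[OF Gx'[OF x]], simp)
        also have "\<dots> = (\<integral>\<^sup>+g. indicator A g \<partial>b x)"
          unfolding b_def by (rule nn_integral_distr[symmetric, OF Gx'[OF x]]) simp
        finally show "(\<integral>\<^sup>+s. indicator A (fst s) \<partial>F') = emeasure (b x) A" by (simp add: sb)
        have "(\<integral>\<^sup>+s. indicator A (snd s) \<partial>F') = (\<integral>\<^sup>+w. indicator A (G z w) \<partial>\<kappa>U z)"
          unfolding int_F' snd_conv by (rule int_r) (rule measurable_compose[OF Gx'[OF z]], simp)
        also have "\<dots> = (\<integral>\<^sup>+g. indicator A g \<partial>b z)"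
          unfolding b_def by (rule nn_integral_distr[symmetric, OF Gx'[OF z]]) simp
        finally show "(\<integral>\<^sup>+s. indicator A (snd s) \<partial>F') = emeasure (b z) A" by (simp add: sb)
      qed
      have "Lnorm p F' ?d = Lnorm p R (\<lambda>w. ennreal (dist (pt (G x (?l w))) (pt (G z (?r w)))))"
        unfolding Lnorm_def int_F' by simp
      also have "\<dots> \<le> Lnorm p R (\<lambda>w. ?c x (?l w)) + Lnorm p R (\<lambda>w. ennreal (dist (fst (fst w)) (snd (fst w)))) + Lnorm p R (\<lambda>w. ?c z (?r w))"
      proof (rule triangle)
        fix w :: "('e \<times> 'e) \<times> real \<times> real"
        show "ennreal (dist (pt (G x (?l w))) (pt (G z (?r w)))) \<le> ?c x (?l w) + ennreal (dist (fst (fst w)) (snd (fst w))) + ?c z (?r w)"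
          using dist_triangle_ennreal4[of "pt (G x (?l w))" "pt (G z (?r w))" "fst (fst w)" "snd (fst w)"]
          by (simp add: dist_commute)
      next
        have "?l \<in> R \<rightarrow>\<^sub>M \<kappa>U x" "?r \<in> R \<rightarrow>\<^sub>M \<kappa>U z"
          using l r kernelD(2)[OF \<kappa>U x] kernelD(2)[OF \<kappa>U z] by (simp_all cong: measurable_cong_sets)
        then show "(\<lambda>w. ?c x (?l w)) \<in> borel_measurable R" "(\<lambda>w. ?c z (?r w)) \<in> borel_measurable R"
          using measurable_compose[OF _ c_meas[OF x], of ?l R] measurable_compose[OF _ c_meas[OF z], of ?r R] by auto
      qed measurable
      also have "Lnorm p R (\<lambda>w. ?c x (?l w)) = Lnorm p (\<kappa>U x) (?c x)"
        unfolding Lnorm_def using int_l[of "\<lambda>w. epowr (?c x w) p"] c_meas[OF x] by simp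
      also have "Lnorm p R (\<lambda>w. ?c z (?r w)) = Lnorm p (\<kappa>U z) (?c z)"
        unfolding Lnorm_def using int_r[of "\<lambda>w. epowr (?c z w) p"] c_meas[OF z] by simp
      also have "Lnorm p R (\<lambda>w. ennreal (dist (fst (fst w)) (snd (fst w)))) = Lnorm p \<gamma> (\<lambda>w. ennreal (dist (fst w) (snd w)))"
        by (rule Lnorm_coupling_fst[OF R]) measurable
      finally have "Lnorm p F' ?d \<le> ennreal \<delta> + Lnorm p \<gamma> (\<lambda>w. ennreal (dist (fst w) (snd w))) + ennreal \<delta>"
        using costx costz by (meson add_mono order_refl order_trans)
      moreover have "Lnorm p ?F ?d \<le> Lnorm p F' ?d + ennreal \<delta>"
        using near[OF x z] F' by (simp add: near_def)
      ultimately have "Lnorm p ?F ?d \<le> ennreal \<delta> + Lnorm p \<gamma> (\<lambda>w. ennreal (dist (fst w) (snd w))) + ennreal \<delta> + ennreal \<delta>"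
        by (meson add_right_mono order_trans)
      with up have "Lnorm p (\<Gamma> (x, z)) (\<lambda>(u, w). ennreal (dist u w)) \<le>
          ennreal \<delta> + (ennreal \<delta> + Lnorm p \<gamma> (\<lambda>w. ennreal (dist (fst w) (snd w))) + ennreal \<delta> + ennreal \<delta>) + ennreal \<delta>"
        by (meson add_left_mono add_right_mono order_trans)
      also have "\<dots> = Lnorm p \<gamma> (\<lambda>w. ennreal (dist (fst w) (snd w))) + (ennreal \<delta> + ennreal \<delta> + ennreal \<delta> + ennreal \<delta> + ennreal \<delta>)"
        by (simp only: ac_simps)
      also have "ennreal \<delta> + ennreal \<delta> + ennreal \<delta> + ennreal \<delta> + ennreal \<delta> = ennreal \<epsilon>"
        using \<delta> by (simp add: \<delta>_def flip: ennreal_plus)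
      finally show "Lnorm p (\<Gamma> (x, z)) (\<lambda>(u, w). ennreal (dist u w)) - ennreal \<epsilon> \<le> Lnorm p \<gamma> (\<lambda>(u, w). ennreal (dist u w))"
        by (simp add: ennreal_minus_le_iff case_prod_beta' add.commute)
    qed (use p in auto)
    then show ?thesis by (simp add: ennreal_minus_le_iff add.commute)
  qed
  show thesis by (rule that[OF \<Gamma>_meas \<Gamma>_coupling \<Gamma>_cost])
qed

declare One_nat_def [simp del]

section \<open>Paths and their labels\<close>

lemma space_path_space: "space (path_space t) = (\<Pi>\<^sub>E s\<in>{1..t}. UNIV)"
  by (simp add: path_space_def space_PiM)

lemma path_space_0: "space (path_space 0) = {\<lambda>_. undefined}"
  by (simp add: space_path_space)

lemma measurable_path_component [measurable]:
  "s \<in> {1..t} \<Longrightarrow> (\<lambda>x. x s) \<in> path_space t \<rightarrow>\<^sub>M borel"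
  unfolding path_space_def by (rule measurable_component_singleton)

lemma measurable_path_restrict:
  "s \<le> t \<Longrightarrow> (\<lambda>x. restrict x {1..s}) \<in> path_space t \<rightarrow>\<^sub>M path_space s"
  unfolding path_space_def by (rule measurable_restrict_subset) auto

lemma measurable_path_upd:
  "(\<lambda>w. (fst w)(Suc t := snd w)) \<in> path_space t \<Otimes>\<^sub>M borel \<rightarrow>\<^sub>M path_space (Suc t)"
proof -
  have "insert (Suc t) {1..t} = {1..Suc t}" by auto
  then show ?thesis
    using measurable_add_dim[of "Suc t" "{1..t}" "\<lambda>_. borel"] by (simp add: path_space_def case_prod_beta')
qed

lemma measurable_path_upd_const:
  "x \<in> space (path_space t) \<Longrightarrow> (\<lambda>u. x(Suc t := u)) \<in> borel \<rightarrow>\<^sub>M path_space (Suc t)"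
  using measurable_compose[OF measurable_Pair1' measurable_path_upd, of x t] by simp

lemma restrict_path [simp]: "x \<in> space (path_space t) \<Longrightarrow> restrict x {1..t} = x"
  by (auto simp: space_path_space)

lemma restrict_path_upd: "x \<in> space (path_space t) \<Longrightarrow> s \<le> t \<Longrightarrow> restrict (x(Suc t := u)) {1..s} = restrict x {1..s}"
  by (auto simp: restrict_def fun_eq_iff)

lemma restrict_in_path_space: "restrict x {1..t} \<in> space (path_space t)"
  by (simp add: space_path_space)

lemma path_upd_in_path_space: "x \<in> space (path_space t) \<Longrightarrow> x(Suc t := u) \<in> space (path_space (Suc t))"
  by (auto simp: space_path_space PiE_iff extensional_def)

lemma path_restrict_upd: "x \<in> space (path_space T) \<Longrightarrow> t < T \<Longrightarrow> (restrict x {1..t})(Suc t := x (Suc t)) = restrict x {1..Suc t}"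
  by (auto simp: restrict_def fun_eq_iff)

text \<open>Lists put label histories of all lengths into one countable type. Times start at 1 and
  list positions at 0, so entry \<open>s\<close> belongs to time \<open>Suc s\<close>.\<close>

definition hist :: "(nat \<Rightarrow> 'e \<Rightarrow> nat) \<Rightarrow> nat \<Rightarrow> (nat \<Rightarrow> 'e) \<Rightarrow> nat list" where
  "hist Q t x = map (\<lambda>s. Q s (x s)) [1..<Suc t]"

lemma hist_0 [simp]: "hist Q 0 x = []"
  by (simp add: hist_def)

lemma hist_Suc: "hist Q (Suc t) x = hist Q t x @ [Q (Suc t) (x (Suc t))]"
  by (simp add: hist_def)

lemma length_hist [simp]: "length (hist Q t x) = t"
  by (simp add: hist_def)

lemma hist_restrict [simp]: "t \<le> s \<Longrightarrow> hist Q t (restrict x {1..s}) = hist Q t x"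
  by (auto simp: hist_def)

lemma hist_upd [simp]: "t < s \<Longrightarrow> hist Q t (x(s := u)) = hist Q t x"
  by (auto simp: hist_def)

lemma take_hist: "t \<le> s \<Longrightarrow> take t (hist Q s x) = hist Q t x"
  by (intro nth_equalityI) (simp_all add: hist_def del: upt_Suc)

lemma nth_hist: "s < t \<Longrightarrow> hist Q t x ! s = Q (Suc s) (x (Suc s))"
  by (simp add: hist_def One_nat_def del: upt_Suc)

lemma measurable_hist:
  assumes Q: "\<And>s. Q s \<in> borel \<rightarrow>\<^sub>M count_space UNIV" and "t \<le> T"
  shows "hist Q t \<in> path_space T \<rightarrow>\<^sub>M count_space UNIV"
  using \<open>t \<le> T\<close>
proof (induction t)
  case 0
  have "hist Q 0 = (\<lambda>_. [])" by (simp add: fun_eq_iff)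
  then show ?case by simp
next
  case (Suc t)
  have 1: "(\<lambda>x. Q (Suc t) (x (Suc t))) \<in> path_space T \<rightarrow>\<^sub>M count_space UNIV"
    using Suc.prems by (intro measurable_compose[OF measurable_path_component Q]) auto
  have "(\<lambda>x. (hist Q t x, Q (Suc t) (x (Suc t)))) \<in> path_space T \<rightarrow>\<^sub>M count_space UNIV \<Otimes>\<^sub>M count_space UNIV"
    using Suc.IH Suc.prems 1 by simp
  then have "(\<lambda>x. (\<lambda>(c, a). c @ [a]) (hist Q t x, Q (Suc t) (x (Suc t)))) \<in> path_space T \<rightarrow>\<^sub>M count_space UNIV"
    by (rule measurable_compose) (subst pair_measure_countable, auto)
  then show ?case by (simp add: hist_Suc[abs_def])
qed

lemma measurable_pair_count_space1:
  fixes f :: "'g :: countable \<times> 'a \<Rightarrow> 'b"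
  assumes "\<And>y. (\<lambda>x. f (y, x)) \<in> N \<rightarrow>\<^sub>M K"
  shows "f \<in> count_space UNIV \<Otimes>\<^sub>M N \<rightarrow>\<^sub>M K"
  by (rule measurable_pair_measure_countable1) (auto intro: assms)

text \<open>One side of the construction. Measurability and marginals of \<open>\<Gamma>\<close>
  determine the laws and the causal structure; the cost of \<open>\<Gamma>\<close> enters in
  \<open>labelled_cost\<close>.\<close>

locale quantized =
  fixes T :: nat and \<mu> :: "(nat \<Rightarrow> real ^ 'd :: finite) measure"
    and \<kappa> :: "nat \<Rightarrow> (nat \<Rightarrow> real ^ 'd) \<Rightarrow> (real ^ 'd) measure"
    and Q :: "nat \<Rightarrow> real ^ 'd \<Rightarrow> nat"
    and \<Gamma> :: "nat \<Rightarrow> (nat \<Rightarrow> real ^ 'd) \<times> (nat \<Rightarrow> real ^ 'd) \<Rightarrow> ((real ^ 'd) \<times> (real ^ 'd)) measure"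
  assumes \<mu>: "\<mu> \<in> space (prob_algebra (path_space T))"
    and cond: "\<And>t. t < T \<Longrightarrow> cond_kernel \<mu> (path_space t) (\<lambda>x. restrict x {1..t}) borel (\<lambda>x. x (Suc t)) (\<kappa> t)"
    and Q [measurable]: "\<And>s. Q s \<in> borel \<rightarrow>\<^sub>M count_space UNIV"
    and \<Gamma> [measurable]: "\<And>t. t < T \<Longrightarrow> \<Gamma> t \<in> path_space t \<Otimes>\<^sub>M path_space t \<rightarrow>\<^sub>M prob_algebra (borel \<Otimes>\<^sub>M borel)"
    and \<Gamma>_couplings: "\<And>t x z. t < T \<Longrightarrow> x \<in> space (path_space t) \<Longrightarrow> z \<in> space (path_space t) \<Longrightarrow>
       \<Gamma> t (x, z) \<in> couplings (\<kappa> t x) (\<kappa> t z)"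
begin

sublocale prob_space \<mu> using \<mu> by (simp add: space_prob_algebra)

lemma sets_\<mu> [measurable_cong]: "sets \<mu> = sets (path_space T)"
  using \<mu> by (simp add: space_prob_algebra)

lemma space_\<mu>: "space \<mu> = space (path_space T)"
  using sets_\<mu> by (rule sets_eq_imp_space_eq)

lemma \<kappa> [measurable]: "t < T \<Longrightarrow> \<kappa> t \<in> path_space t \<rightarrow>\<^sub>M prob_algebra borel"
  using cond by (auto simp: cond_kernel_def)

lemma hist_meas [measurable]: "t \<le> T \<Longrightarrow> hist Q t \<in> \<mu> \<rightarrow>\<^sub>M count_space UNIV"
  using measurable_hist[OF Q, of t T] by (simp cong: measurable_cong_sets add: sets_\<mu>)

text \<open>Law of the auxiliary path \<open>z\<close> given that its label history is
  \<open>c\<close>.\<close>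

definition cm :: "nat \<Rightarrow> nat list \<Rightarrow> (nat \<Rightarrow> real ^ 'd) measure" where
  "cm t c = cond_on \<mu> (hist Q t) c"

lemma prob_cm: "prob_space (cm t c)"
  unfolding cm_def by (rule prob_space_cond_on)

lemma sets_cm [simp, measurable_cong]: "sets (cm t c) = sets \<mu>"
  by (simp add: cm_def)

lemma space_cm [simp]: "space (cm t c) = space (path_space T)"
  by (simp add: cm_def space_\<mu>)

lemma restrict_meas [measurable]: "t \<le> T \<Longrightarrow> (\<lambda>z. restrict z {1..t}) \<in> \<mu> \<rightarrow>\<^sub>M path_space t"
  using measurable_path_restrict[of t T] by (simp cong: measurable_cong_sets add: sets_\<mu>)

lemma component_meas [measurable]: "t < T \<Longrightarrow> (\<lambda>z. z (Suc t)) \<in> \<mu> \<rightarrow>\<^sub>M borel"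
  using measurable_path_component[of "Suc t" T] by (simp cong: measurable_cong_sets add: sets_\<mu>)

lemma nn_integral_\<mu>_kernel:
  assumes t: "t < T" and f: "f \<in> borel_measurable (path_space t \<Otimes>\<^sub>M borel)"
  shows "(\<integral>\<^sup>+z. f (restrict z {1..t}, z (Suc t)) \<partial>\<mu>) = (\<integral>\<^sup>+z. \<integral>\<^sup>+w. f (restrict z {1..t}, w) \<partial>\<kappa> t (restrict z {1..t}) \<partial>\<mu>)"
  using cond[OF t] f by (auto simp: cond_kernel_def)

text \<open>The label history is a function of the first \<open>t\<close> positions, so conditioning
  on it leaves the conditional law of the next position unchanged. The identity is multiplied by the
  probability of \<open>c\<close>, which is cancelled at the end; for a null history it is the
  identity under \<open>\<mu>\<close>.\<close>

lemma nn_integral_cm_kernel: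
  assumes t: "t < T" and f [measurable]: "f \<in> borel_measurable (path_space t \<Otimes>\<^sub>M borel)"
  shows "(\<integral>\<^sup>+z. f (restrict z {1..t}, z (Suc t)) \<partial>cm t c) = (\<integral>\<^sup>+z. \<integral>\<^sup>+w. f (restrict z {1..t}, w) \<partial>\<kappa> t (restrict z {1..t}) \<partial>cm t c)"
proof (cases "emeasure \<mu> (hist Q t -` {c} \<inter> space \<mu>) = 0")
  case True
  then show ?thesis using nn_integral_\<mu>_kernel[OF assms] by (simp add: cm_def cond_on_def)
next
  case False
  have tT: "t \<le> T" using t by simp
  note [measurable] = restrict_meas[OF tT] component_meas[OF t] hist_meas[OF tT] \<kappa>[OF t]
  have hm [measurable]: "hist Q t \<in> path_space t \<rightarrow>\<^sub>M count_space UNIV"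
    by (rule measurable_hist[OF Q]) simp
  have "(\<integral>\<^sup>+z. f (restrict z {1..t}, z (Suc t)) \<partial>cm t c) * emeasure \<mu> (hist Q t -` {c} \<inter> space \<mu>)
      = (\<integral>\<^sup>+z. f (restrict z {1..t}, z (Suc t)) * indicator {c} (hist Q t z) \<partial>\<mu>)"
    unfolding cm_def by (rule nn_integral_cond_on) measurable
  also have "\<dots> = (\<integral>\<^sup>+z. (\<lambda>w. f w * indicator {c} (hist Q t (fst w))) (restrict z {1..t}, z (Suc t)) \<partial>\<mu>)"
    by simp
  also have "\<dots> = (\<integral>\<^sup>+z. \<integral>\<^sup>+w. f (restrict z {1..t}, w) * indicator {c} (hist Q t z) \<partial>\<kappa> t (restrict z {1..t}) \<partial>\<mu>)"
  proof (subst nn_integral_\<mu>_kernel[OF t])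
    show "(\<lambda>w. f w * indicator {c} (hist Q t (fst w))) \<in> borel_measurable (path_space t \<Otimes>\<^sub>M borel)"
      by measurable
  qed simp
  also have "\<dots> = (\<integral>\<^sup>+z. (\<integral>\<^sup>+w. f (restrict z {1..t}, w) \<partial>\<kappa> t (restrict z {1..t})) * indicator {c} (hist Q t z) \<partial>\<mu>)"
  proof (rule nn_integral_cong)
    fix z :: "nat \<Rightarrow> real ^ 'd"
    have "(\<lambda>w. f (restrict z {1..t}, w)) \<in> borel_measurable (\<kappa> t (restrict z {1..t}))"
      using kernelD(2)[OF \<kappa>[OF t] restrict_in_path_space, of z] measurable_compose[OF measurable_Pair1'[OF restrict_in_path_space, of z] f]
      by (simp cong: measurable_cong_sets)
    then show "(\<integral>\<^sup>+w. f (restrict z {1..t}, w) * indicator {c} (hist Q t z) \<partial>\<kappa> t (restrict z {1..t})) =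
        (\<integral>\<^sup>+w. f (restrict z {1..t}, w) \<partial>\<kappa> t (restrict z {1..t})) * indicator {c} (hist Q t z)"
      by (rule nn_integral_multc)
  qed
  also have "\<dots> = (\<integral>\<^sup>+z. \<integral>\<^sup>+w. f (restrict z {1..t}, w) \<partial>\<kappa> t (restrict z {1..t}) \<partial>cm t c) * emeasure \<mu> (hist Q t -` {c} \<inter> space \<mu>)"
    unfolding cm_def by (rule nn_integral_cond_on[symmetric]) measurable
  finally have eq: "(\<integral>\<^sup>+z. f (restrict z {1..t}, z (Suc t)) \<partial>cm t c) * emeasure \<mu> (hist Q t -` {c} \<inter> space \<mu>) =
      (\<integral>\<^sup>+z. \<integral>\<^sup>+w. f (restrict z {1..t}, w) \<partial>\<kappa> t (restrict z {1..t}) \<partial>cm t c) * emeasure \<mu> (hist Q t -` {c} \<inter> space \<mu>)" .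
  have "a = b" if "a * e = b * e" "e \<noteq> 0" "e \<noteq> \<top>" for a b e :: ennreal
  proof -
    note cancel = ennreal_mult_divide_eq[OF that(2) that(3)]
    have "a = a * e / e" by (rule cancel[symmetric])
    also have "\<dots> = b * e / e" by (rule arg_cong[OF that(1)])
    also have "\<dots> = b" by (rule cancel)
    finally show ?thesis .
  qed
  from this[OF eq False emeasure_finite] show ?thesis .
qed

text \<open>Joint law of next position and next label at past \<open>x\<close> and label history
  \<open>c\<close>: in a draw from \<open>\<Gamma>\<close> the first component is the position, and
  the cell of the second is the label. Below, \<open>m\<close> is the law of the next label and
  \<open>R\<close> the law of the position given the label \<open>a\<close>.\<close>

definition V :: "nat \<Rightarrow> nat list \<Rightarrow> (nat \<Rightarrow> real ^ 'd) \<Rightarrow> ((real ^ 'd) \<times> nat) measure" where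
  "V t c x = cm t c \<bind> (\<lambda>z. distr (\<Gamma> t (x, restrict z {1..t})) (borel \<Otimes>\<^sub>M count_space UNIV) (\<lambda>w. (fst w, Q (Suc t) (snd w))))"

definition m :: "nat \<Rightarrow> nat list \<Rightarrow> nat measure" where
  "m t c = distr (cm t c) (count_space UNIV) (\<lambda>z. Q (Suc t) (z (Suc t)))"

definition R :: "nat \<Rightarrow> nat list \<Rightarrow> nat \<Rightarrow> (nat \<Rightarrow> real ^ 'd) \<Rightarrow> (real ^ 'd) measure" where
  "R t c a x = distr (cond_on (V t c x) snd a) borel fst"

lemma sets_m [simp]: "sets (m t c) = UNIV"
  by (simp add: m_def)

lemma prob_m: "t < T \<Longrightarrow> prob_space (m t c)"
  unfolding m_def by (intro prob_space.prob_space_distr[OF prob_cm]) measurable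

lemma V_meas: assumes t: "t < T" shows "V t c \<in> path_space t \<rightarrow>\<^sub>M prob_algebra (borel \<Otimes>\<^sub>M count_space UNIV)"
  unfolding V_def
proof (rule measurable_bind_prob_space2[where N = "path_space T"])
  show "(\<lambda>x. cm t c) \<in> path_space t \<rightarrow>\<^sub>M prob_algebra (path_space T)"
    by (rule measurable_const) (simp add: space_prob_algebra prob_cm sets_\<mu>)
  have tT: "t \<le> T" using t by simp
  have "(\<lambda>p. (fst p, restrict (snd p) {1..t})) \<in> path_space t \<Otimes>\<^sub>M path_space T \<rightarrow>\<^sub>M path_space t \<Otimes>\<^sub>M path_space t"
    by (intro measurable_Pair measurable_fst measurable_compose[OF measurable_snd measurable_path_restrict[OF tT]])
  from measurable_compose[OF this \<Gamma>[OF t]]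
  have "(\<lambda>p. distr (\<Gamma> t (fst p, restrict (snd p) {1..t})) (borel \<Otimes>\<^sub>M count_space UNIV) (\<lambda>w. (fst w, Q (Suc t) (snd w))))
    \<in> path_space t \<Otimes>\<^sub>M path_space T \<rightarrow>\<^sub>M prob_algebra (borel \<Otimes>\<^sub>M count_space UNIV)"
    by (rule measurable_compose[OF _ measurable_distr_prob_space]) measurable
  then show "(\<lambda>(x, y). distr (\<Gamma> t (x, restrict y {1..t})) (borel \<Otimes>\<^sub>M count_space UNIV) (\<lambda>w. (fst w, Q (Suc t) (snd w))))
    \<in> path_space t \<Otimes>\<^sub>M path_space T \<rightarrow>\<^sub>M prob_algebra (borel \<Otimes>\<^sub>M count_space UNIV)"
    by (simp add: case_prod_beta')
qed

lemma R_meas: assumes t: "t < T" shows "R t c a \<in> path_space t \<rightarrow>\<^sub>M prob_algebra borel"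
proof -
  have "(\<lambda>x. distr (cond_on (V t c x) snd a) borel fst) \<in> path_space t \<rightarrow>\<^sub>M prob_algebra borel"
    by (rule measurable_compose[OF measurable_cond_on[OF V_meas[OF t]] measurable_distr_prob_space]) measurable
  then show ?thesis by (simp add: R_def[abs_def])
qed

lemma nn_integral_V:
  assumes t: "t < T" and x: "x \<in> space (path_space t)" and f [measurable]: "f \<in> borel_measurable (borel \<Otimes>\<^sub>M count_space UNIV)"
  shows "(\<integral>\<^sup>+w. f w \<partial>V t c x) = (\<integral>\<^sup>+z. \<integral>\<^sup>+w. f (fst w, Q (Suc t) (snd w)) \<partial>\<Gamma> t (x, restrict z {1..t}) \<partial>cm t c)"
proof -
  have tT: "t \<le> T" using t by simp
  have Gx: "(\<lambda>z. \<Gamma> t (x, restrict z {1..t})) \<in> cm t c \<rightarrow>\<^sub>M prob_algebra (borel \<Otimes>\<^sub>M borel)"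
    using measurable_compose[OF measurable_compose[OF restrict_meas[OF tT] measurable_Pair1'[OF x]] \<Gamma>[OF t]]
    by (simp cong: measurable_cong_sets)
  have pr [measurable]: "(\<lambda>w. (fst w, Q (Suc t) (snd w))) \<in> borel \<Otimes>\<^sub>M borel \<rightarrow>\<^sub>M borel \<Otimes>\<^sub>M count_space UNIV"
    by measurable
  have "(\<integral>\<^sup>+w. f w \<partial>V t c x) = (\<integral>\<^sup>+z. \<integral>\<^sup>+w. f w \<partial>distr (\<Gamma> t (x, restrict z {1..t})) (borel \<Otimes>\<^sub>M count_space UNIV) (\<lambda>w. (fst w, Q (Suc t) (snd w))) \<partial>cm t c)"
    unfolding V_def
    by (rule nn_integral_bind[OF f measurable_prob_algebraD[OF measurable_compose[OF Gx measurable_distr_prob_space[OF pr]]]])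
  also have "\<dots> = (\<integral>\<^sup>+z. \<integral>\<^sup>+w. f (fst w, Q (Suc t) (snd w)) \<partial>\<Gamma> t (x, restrict z {1..t}) \<partial>cm t c)"
  proof (intro nn_integral_cong nn_integral_distr)
    fix z assume "z \<in> space (cm t c)"
    from kernelD(2)[OF Gx this] show "(\<lambda>w. (fst w, Q (Suc t) (snd w))) \<in> \<Gamma> t (x, restrict z {1..t}) \<rightarrow>\<^sub>M borel \<Otimes>\<^sub>M count_space UNIV"
      using pr by (simp cong: measurable_cong_sets)
  qed simp
  finally show ?thesis .
qed

text \<open>The second component of \<open>\<Gamma>\<close> follows the kernel at \<open>z\<close>,
  and averaging over \<open>z\<close> gives the next position of \<open>z\<close> itself. Thus the
  label law depends on \<open>c\<close> only, which allows the labels of both sides to be coupled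
  before any position is drawn.\<close>

lemma law_snd_V:
  assumes t: "t < T" and x: "x \<in> space (path_space t)"
  shows "(\<integral>\<^sup>+w. f (snd w) \<partial>V t c x) = (\<integral>\<^sup>+a. f a \<partial>m t c)"
proof -
  have "(\<integral>\<^sup>+w. f (snd w) \<partial>V t c x) = (\<integral>\<^sup>+z. \<integral>\<^sup>+w. f (Q (Suc t) (snd w)) \<partial>\<Gamma> t (x, restrict z {1..t}) \<partial>cm t c)"
    by (subst nn_integral_V[OF t x]) auto
  also have "\<dots> = (\<integral>\<^sup>+z. \<integral>\<^sup>+w. f (Q (Suc t) w) \<partial>\<kappa> t (restrict z {1..t}) \<partial>cm t c)"
  proof (rule nn_integral_cong)
    fix z
    have "(\<lambda>w. f (Q (Suc t) w)) \<in> borel_measurable (\<kappa> t (restrict z {1..t}))"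
      using kernelD(2)[OF \<kappa>[OF t] restrict_in_path_space, of z] measurable_compose[OF Q, of f borel "Suc t"]
      by (simp cong: measurable_cong_sets)
    then show "(\<integral>\<^sup>+w. f (Q (Suc t) (snd w)) \<partial>\<Gamma> t (x, restrict z {1..t})) = (\<integral>\<^sup>+w. f (Q (Suc t) w) \<partial>\<kappa> t (restrict z {1..t}))"
      by (rule nn_integral_coupling_snd[OF \<Gamma>_couplings[OF t x restrict_in_path_space]])
  qed
  also have "\<dots> = (\<integral>\<^sup>+z. f (Q (Suc t) (z (Suc t))) \<partial>cm t c)"
    using nn_integral_cm_kernel[OF t, of "\<lambda>w. f (Q (Suc t) (snd w))" c] by simp
  also have "\<dots> = (\<integral>\<^sup>+a. f a \<partial>m t c)"
    unfolding m_def using t by (subst nn_integral_distr) auto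
  finally show ?thesis .
qed

text \<open>Drawing the label from \<open>m\<close> and the position from \<open>R\<close> is a
  disintegration of \<open>V\<close>, again by the tower property.\<close>

lemma nn_integral_R:
  assumes t: "t < T" and x: "x \<in> space (path_space t)" and f [measurable]: "f \<in> borel_measurable (borel \<Otimes>\<^sub>M count_space UNIV)"
  shows "(\<integral>\<^sup>+a. \<integral>\<^sup>+u. f (u, a) \<partial>R t c a x \<partial>m t c) =
    (\<integral>\<^sup>+z. \<integral>\<^sup>+w. f (fst w, Q (Suc t) (snd w)) \<partial>\<Gamma> t (x, restrict z {1..t}) \<partial>cm t c)"
proof -
  interpret V: prob_space "V t c x" by (rule kernelD(1)[OF V_meas[OF t] x])
  have sV [measurable_cong]: "sets (V t c x) = sets (borel \<Otimes>\<^sub>M count_space UNIV)" by (rule kernelD(2)[OF V_meas[OF t] x])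
  have "(\<integral>\<^sup>+a. \<integral>\<^sup>+u. f (u, a) \<partial>R t c a x \<partial>m t c) = (\<integral>\<^sup>+w. (\<lambda>a. \<integral>\<^sup>+u. f (u, a) \<partial>R t c a x) (snd w) \<partial>V t c x)"
    by (rule law_snd_V[OF t x, symmetric])
  also have "\<dots> = (\<integral>\<^sup>+w. \<integral>\<^sup>+v. f (fst v, snd w) \<partial>cond_on (V t c x) snd (snd w) \<partial>V t c x)"
    unfolding R_def by (intro nn_integral_cong nn_integral_distr) auto
  also have "\<dots> = (\<integral>\<^sup>+w. f (fst w, snd w) \<partial>V t c x)"
    by (rule V.nn_integral_cond_on_mixture[where g = "\<lambda>a v. f (fst v, a)"]) auto
  finally show ?thesis using nn_integral_V[OF t x f] by simp
qed

text \<open>The first component of \<open>\<Gamma>\<close> follows the kernel at \<open>x\<close>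
  for every \<open>z\<close>, so after averaging over the label the history \<open>c\<close> leaves
  no trace. This is the source of causality.\<close>

lemma nn_integral_R_\<kappa>:
  assumes t: "t < T" and x: "x \<in> space (path_space t)" and f [measurable]: "f \<in> borel_measurable borel"
  shows "(\<integral>\<^sup>+a. \<integral>\<^sup>+u. f u \<partial>R t c a x \<partial>m t c) = (\<integral>\<^sup>+u. f u \<partial>\<kappa> t x)"
proof -
  have "(\<integral>\<^sup>+a. \<integral>\<^sup>+u. f u \<partial>R t c a x \<partial>m t c) = (\<integral>\<^sup>+z. \<integral>\<^sup>+w. f (fst w) \<partial>\<Gamma> t (x, restrict z {1..t}) \<partial>cm t c)"
    using nn_integral_R[OF t x, of "\<lambda>w. f (fst w)"] by simp
  also have "\<dots> = (\<integral>\<^sup>+z. \<integral>\<^sup>+w. f w \<partial>\<kappa> t x \<partial>cm t c)"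
    using kernelD(2)[OF \<kappa>[OF t] x]
    by (intro nn_integral_cong nn_integral_coupling_fst[OF \<Gamma>_couplings[OF t x restrict_in_path_space]]) (simp cong: measurable_cong_sets)
  also have "\<dots> = (\<integral>\<^sup>+u. f u \<partial>\<kappa> t x)"
    using prob_space.emeasure_space_1[OF prob_cm[of t c]] by simp
  finally show ?thesis .
qed

end

section \<open>The coupled chain\<close>

text \<open>The couplings \<open>r\<close> of the label laws are arbitrary at this stage:
  bicausality holds for each choice. Maximality is added in
  \<open>two_sided_maximal\<close>.\<close>

locale two_sided = X: quantized T \<mu> \<kappa> Q \<Gamma> + Y: quantized T \<nu> \<kappa>' Q \<Gamma>'
  for T :: nat and \<mu> \<nu> :: "(nat \<Rightarrow> real ^ 'd :: finite) measure" and \<kappa> \<kappa>' Q \<Gamma> \<Gamma>' +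
  fixes r :: "nat \<Rightarrow> nat list \<Rightarrow> nat list \<Rightarrow> (nat \<times> nat) measure"
  assumes r: "\<And>t c c'. t < T \<Longrightarrow> r t c c' \<in> couplings (X.m t c) (Y.m t c')"
begin

definition H :: "nat \<Rightarrow> ((nat list \<times> nat list) \<times> (nat \<Rightarrow> real ^ 'd) \<times> (nat \<Rightarrow> real ^ 'd)) measure" where
  "H t = count_space UNIV \<Otimes>\<^sub>M (path_space t \<Otimes>\<^sub>M path_space t)"

definition extend where
  "extend t h ab uv = ((fst (fst h) @ [fst ab], snd (fst h) @ [snd ab]),
     ((fst (snd h))(Suc t := fst uv), (snd (snd h))(Suc t := snd uv)))"
  for h :: "(nat list \<times> nat list) \<times> (nat \<Rightarrow> real ^ 'd) \<times> (nat \<Rightarrow> real ^ 'd)" and ab :: "nat \<times> nat"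
    and uv :: "(real ^ 'd) \<times> (real ^ 'd)"

definition step where
  "step t h = r t (fst (fst h)) (snd (fst h)) \<bind> (\<lambda>ab.
     distr (X.R t (fst (fst h)) (fst ab) (fst (snd h)) \<Otimes>\<^sub>M Y.R t (snd (fst h)) (snd ab) (snd (snd h)))
       (H (Suc t)) (extend t h ab))"

text \<open>Law of the state at time \<open>t\<close>, consisting of both label histories and both
  paths. The chain starts with empty histories; the only path over \<open>{1..0}\<close> is
  constantly \<open>undefined\<close>.\<close>

primrec P where
  "P 0 = return (H 0) (([], []), (\<lambda>_. undefined, \<lambda>_. undefined))"
| "P (Suc t) = P t \<bind> step t"

lemma space_H: "space (H t) = UNIV \<times> (space (path_space t) \<times> space (path_space t))"
  by (simp add: H_def space_pair_measure)

lemma H_measurable: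
  "(\<lambda>h. fst (fst h)) \<in> H t \<rightarrow>\<^sub>M count_space UNIV" "(\<lambda>h. snd (fst h)) \<in> H t \<rightarrow>\<^sub>M count_space UNIV"
  "(\<lambda>h. fst (snd h)) \<in> H t \<rightarrow>\<^sub>M path_space t" "(\<lambda>h. snd (snd h)) \<in> H t \<rightarrow>\<^sub>M path_space t"
  unfolding H_def
     apply (rule measurable_compose[OF measurable_fst], simp)
    apply (rule measurable_compose[OF measurable_fst], simp)
   apply (rule measurable_compose[OF measurable_snd measurable_fst])
  apply (rule measurable_compose[OF measurable_snd measurable_snd])
  done

lemma r_props:
  assumes t: "t < T"
  shows "sets (r t c c') = UNIV" "space (r t c c') = UNIV" "prob_space (r t c c')" "r t c c' \<in> space (prob_algebra (count_space UNIV))"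
proof -
  have "sets (r t c c') = sets (count_space (UNIV :: nat set) \<Otimes>\<^sub>M count_space (UNIV :: nat set))"
    unfolding couplingsD(1)[OF r[OF t]] by (rule sets_pair_measure_cong) simp_all
  then show *: "sets (r t c c') = UNIV" by (subst (asm) pair_measure_countable) auto
  then show "space (r t c c') = UNIV" by (metis UNIV_I sets.sets_into_space top.extremum_uniqueI)
  show **: "prob_space (r t c c')" by (rule prob_space_coupling[OF r[OF t] X.prob_m[OF t]])
  show "r t c c' \<in> space (prob_algebra (count_space UNIV))" using * ** by (simp add: space_prob_algebra)
qed

lemma extend_meas: "(\<lambda>p. extend t (cc, fst p) ab (snd p)) \<in> (path_space t \<Otimes>\<^sub>M path_space t) \<Otimes>\<^sub>M (borel \<Otimes>\<^sub>M borel) \<rightarrow>\<^sub>M H (Suc t)"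
proof -
  have 1: "(\<lambda>p. (fst (fst p))(Suc t := fst (snd p))) \<in> (path_space t \<Otimes>\<^sub>M path_space t) \<Otimes>\<^sub>M (borel \<Otimes>\<^sub>M borel) \<rightarrow>\<^sub>M path_space (Suc t)"
    using measurable_compose[OF _ measurable_path_upd, of "\<lambda>p. (fst (fst p), fst (snd p))" "(path_space t \<Otimes>\<^sub>M path_space t) \<Otimes>\<^sub>M (borel \<Otimes>\<^sub>M borel)" t]
    by simp
  have 2: "(\<lambda>p. (snd (fst p))(Suc t := snd (snd p))) \<in> (path_space t \<Otimes>\<^sub>M path_space t) \<Otimes>\<^sub>M (borel \<Otimes>\<^sub>M borel) \<rightarrow>\<^sub>M path_space (Suc t)"
    using measurable_compose[OF _ measurable_path_upd, of "\<lambda>p. (snd (fst p), snd (snd p))" "(path_space t \<Otimes>\<^sub>M path_space t) \<Otimes>\<^sub>M (borel \<Otimes>\<^sub>M borel)" t]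
    by simp
  show ?thesis unfolding extend_def H_def fst_conv snd_conv
    by (intro measurable_Pair measurable_const 1 2) simp
qed

lemma extend_meas2: 
  assumes "h \<in> space (H t)" shows "extend t h ab \<in> borel \<Otimes>\<^sub>M borel \<rightarrow>\<^sub>M H (Suc t)"
proof -
  have "snd h \<in> space (path_space t \<Otimes>\<^sub>M path_space t)" using assms by (auto simp: space_H space_pair_measure)
  from measurable_compose[OF measurable_Pair1'[OF this] extend_meas, of "fst h" ab] show ?thesis by simp
qed

lemma step_meas: assumes t: "t < T" shows "step t \<in> H t \<rightarrow>\<^sub>M prob_algebra (H (Suc t))"
  unfolding H_def[of t]
proof (rule measurable_pair_count_space1)
  fix cc :: "nat list \<times> nat list"
  let ?N = "path_space t \<Otimes>\<^sub>M path_space t :: ((nat \<Rightarrow> real ^ 'd) \<times> (nat \<Rightarrow> real ^ 'd)) measure"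
  have "(\<lambda>xy. distr (X.R t (fst cc) (fst ab) (fst xy) \<Otimes>\<^sub>M Y.R t (snd cc) (snd ab) (snd xy)) (H (Suc t)) (extend t (cc, xy) ab))
      \<in> ?N \<rightarrow>\<^sub>M prob_algebra (H (Suc t))" for ab
  proof (rule measurable_distr_prob_space2[where M = "borel \<Otimes>\<^sub>M borel"])
    show "(\<lambda>xy. X.R t (fst cc) (fst ab) (fst xy) \<Otimes>\<^sub>M Y.R t (snd cc) (snd ab) (snd xy)) \<in> ?N \<rightarrow>\<^sub>M prob_algebra (borel \<Otimes>\<^sub>M borel)"
      by (intro measurable_pair_prob measurable_compose[OF measurable_fst X.R_meas[OF t]] measurable_compose[OF measurable_snd Y.R_meas[OF t]])
    show "(\<lambda>(xy, uv). extend t (cc, xy) ab uv) \<in> ?N \<Otimes>\<^sub>M (borel \<Otimes>\<^sub>M borel) \<rightarrow>\<^sub>M H (Suc t)"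
      using extend_meas by (simp add: case_prod_beta')
  qed
  then have "(\<lambda>(xy, ab). distr (X.R t (fst cc) (fst ab) (fst xy) \<Otimes>\<^sub>M Y.R t (snd cc) (snd ab) (snd xy)) (H (Suc t)) (extend t (cc, xy) ab))
      \<in> ?N \<Otimes>\<^sub>M count_space UNIV \<rightarrow>\<^sub>M prob_algebra (H (Suc t))"
    by (intro measurable_pair_count_space2) simp
  then show "(\<lambda>xy. step t (cc, xy)) \<in> ?N \<rightarrow>\<^sub>M prob_algebra (H (Suc t))"
    unfolding step_def fst_conv snd_conv
    by (intro measurable_bind_prob_space2[where N = "count_space UNIV"] measurable_const r_props(4)[OF t])
qed

lemma P_prob: "t \<le> T \<Longrightarrow> P t \<in> space (prob_algebra (H t))"
proof (induction t)
  case 0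
  show ?case by (auto simp: space_prob_algebra space_H path_space_0 intro!: prob_space_return)
next
  case (Suc t)
  then have "t < T" "P t \<in> space (prob_algebra (H t))" by auto
  then show ?case
    using prob_space_bind'[OF _ step_meas[of t]] sets_bind'[OF _ step_meas[of t]] by (simp add: space_prob_algebra)
qed

lemma P_props: 
  assumes "t \<le> T" shows "prob_space (P t)" "sets (P t) = sets (H t)" "space (P t) = space (H t)"
  using P_prob[OF assms] by (auto simp: space_prob_algebra dest: sets_eq_imp_space_eq)

lemma P_spaceD:
  assumes "h \<in> space (P t)" "t < T"
  shows "fst (snd h) \<in> space (path_space t)" "snd (snd h) \<in> space (path_space t)"
  using assms(1) unfolding P_props(3)[OF less_imp_le[OF assms(2)]] space_H by auto

lemma nn_integral_step:
  assumes t: "t < T" and h: "h \<in> space (H t)" and f [measurable]: "f \<in> borel_measurable (H (Suc t))"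
  shows "(\<integral>\<^sup>+k. f k \<partial>step t h) = (\<integral>\<^sup>+ab. \<integral>\<^sup>+u. \<integral>\<^sup>+v. f (extend t h ab (u, v))
     \<partial>Y.R t (snd (fst h)) (snd ab) (snd (snd h)) \<partial>X.R t (fst (fst h)) (fst ab) (fst (snd h)) \<partial>r t (fst (fst h)) (snd (fst h)))"
proof -
  have xy: "fst (snd h) \<in> space (path_space t)" "snd (snd h) \<in> space (path_space t)" using h by (auto simp: space_H)
  note RX = kernelD[OF X.R_meas[OF t] xy(1)] and RY = kernelD[OF Y.R_meas[OF t] xy(2)]
  have seq: "sets (X.R t c a (fst (snd h)) \<Otimes>\<^sub>M Y.R t c' b (snd (snd h))) = sets (borel \<Otimes>\<^sub>M borel)" for c c' a b
    by (intro sets_pair_measure_cong RX RY)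
  have pp: "prob_space (X.R t c a (fst (snd h)) \<Otimes>\<^sub>M Y.R t c' b (snd (snd h)))" for c c' a b
  proof -
    interpret RX: prob_space "X.R t c a (fst (snd h))" by (rule RX)
    interpret RY: prob_space "Y.R t c' b (snd (snd h))" by (rule RY)
    interpret pair_prob_space "X.R t c a (fst (snd h))" "Y.R t c' b (snd (snd h))" ..
    show ?thesis by unfold_locales
  qed
  have em: "extend t h ab \<in> X.R t c a (fst (snd h)) \<Otimes>\<^sub>M Y.R t c' b (snd (snd h)) \<rightarrow>\<^sub>M H (Suc t)" for ab c c' a b
    unfolding measurable_cong_sets[OF seq refl] by (rule extend_meas2[OF h])
  have k: "(\<lambda>ab. distr (X.R t (fst (fst h)) (fst ab) (fst (snd h)) \<Otimes>\<^sub>M Y.R t (snd (fst h)) (snd ab) (snd (snd h))) (H (Suc t)) (extend t h ab))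
     \<in> r t (fst (fst h)) (snd (fst h)) \<rightarrow>\<^sub>M subprob_algebra (H (Suc t))"
    unfolding measurable_def using em pp
    by (auto simp: r_props[OF t] space_subprob_algebra intro!: prob_space_imp_subprob_space prob_space.prob_space_distr)
  have "(\<integral>\<^sup>+k. f k \<partial>step t h) = (\<integral>\<^sup>+ab. \<integral>\<^sup>+k. f k \<partial>distr (X.R t (fst (fst h)) (fst ab) (fst (snd h)) \<Otimes>\<^sub>M Y.R t (snd (fst h)) (snd ab) (snd (snd h))) (H (Suc t)) (extend t h ab) \<partial>r t (fst (fst h)) (snd (fst h)))"
    unfolding step_def by (rule nn_integral_bind[OF f k])
  also have "\<dots> = (\<integral>\<^sup>+ab. \<integral>\<^sup>+uv. f (extend t h ab uv) \<partial>(X.R t (fst (fst h)) (fst ab) (fst (snd h)) \<Otimes>\<^sub>M Y.R t (snd (fst h)) (snd ab) (snd (snd h))) \<partial>r t (fst (fst h)) (snd (fst h)))"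
    by (intro nn_integral_cong nn_integral_distr em) simp
  also have "\<dots> = (\<integral>\<^sup>+ab. \<integral>\<^sup>+u. \<integral>\<^sup>+v. f (extend t h ab (u, v))
     \<partial>Y.R t (snd (fst h)) (snd ab) (snd (snd h)) \<partial>X.R t (fst (fst h)) (fst ab) (fst (snd h)) \<partial>r t (fst (fst h)) (snd (fst h)))"
  proof (rule nn_integral_cong)
    fix ab :: "nat \<times> nat"
    interpret RY: prob_space "Y.R t (snd (fst h)) (snd ab) (snd (snd h))" by (rule RY)
    show "(\<integral>\<^sup>+uv. f (extend t h ab uv) \<partial>(X.R t (fst (fst h)) (fst ab) (fst (snd h)) \<Otimes>\<^sub>M Y.R t (snd (fst h)) (snd ab) (snd (snd h)))) =
       (\<integral>\<^sup>+u. \<integral>\<^sup>+v. f (extend t h ab (u, v)) \<partial>Y.R t (snd (fst h)) (snd ab) (snd (snd h)) \<partial>X.R t (fst (fst h)) (fst ab) (fst (snd h)))"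
      by (rule RY.nn_integral_fst[symmetric]) (rule measurable_compose[OF em f])
  qed
  finally show ?thesis .
qed

lemma nn_integral_P_Suc:
  assumes t: "t < T" and f: "f \<in> borel_measurable (H (Suc t))"
  shows "(\<integral>\<^sup>+k. f k \<partial>P (Suc t)) = (\<integral>\<^sup>+h. \<integral>\<^sup>+ab. \<integral>\<^sup>+u. \<integral>\<^sup>+v. f (extend t h ab (u, v))
     \<partial>Y.R t (snd (fst h)) (snd ab) (snd (snd h)) \<partial>X.R t (fst (fst h)) (fst ab) (fst (snd h)) \<partial>r t (fst (fst h)) (snd (fst h)) \<partial>P t)"
proof -
  have "step t \<in> P t \<rightarrow>\<^sub>M prob_algebra (H (Suc t))"
    unfolding measurable_cong_sets[OF P_props(2)[OF less_imp_le[OF t]] refl] by (rule step_meas[OF t])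
  then have "(\<integral>\<^sup>+k. f k \<partial>P (Suc t)) = (\<integral>\<^sup>+h. \<integral>\<^sup>+k. f k \<partial>step t h \<partial>P t)"
    unfolding P.simps by (intro nn_integral_bind[OF f] measurable_prob_algebraD)
  also have "\<dots> = (\<integral>\<^sup>+h. \<integral>\<^sup>+ab. \<integral>\<^sup>+u. \<integral>\<^sup>+v. f (extend t h ab (u, v))
     \<partial>Y.R t (snd (fst h)) (snd ab) (snd (snd h)) \<partial>X.R t (fst (fst h)) (fst ab) (fst (snd h)) \<partial>r t (fst (fst h)) (snd (fst h)) \<partial>P t)"
    using P_props(3)[OF less_imp_le[OF t]] by (intro nn_integral_cong nn_integral_step[OF t _ f]) auto
  finally show ?thesis .
qed

text \<open>The other side integrates to 1 and the first marginal of \<open>r\<close> is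
  \<open>m\<close>. So position and label of this side follow \<open>V\<close>, whatever the state
  of the other side.\<close>

lemma step_X:
  assumes t: "t < T" and x: "x \<in> space (path_space t)" and y: "y \<in> space (path_space t)"
    and f [measurable]: "f \<in> borel_measurable (borel \<Otimes>\<^sub>M count_space UNIV)"
  shows "(\<integral>\<^sup>+ab. \<integral>\<^sup>+u. \<integral>\<^sup>+v. f (u, fst ab) \<partial>Y.R t c' (snd ab) y \<partial>X.R t c (fst ab) x \<partial>r t c c')
    = (\<integral>\<^sup>+w. f w \<partial>X.V t c x)"
proof -
  have "(\<integral>\<^sup>+ab. \<integral>\<^sup>+u. \<integral>\<^sup>+v. f (u, fst ab) \<partial>Y.R t c' (snd ab) y \<partial>X.R t c (fst ab) x \<partial>r t c c') =
        (\<integral>\<^sup>+ab. \<integral>\<^sup>+u. f (u, fst ab) \<partial>X.R t c (fst ab) x \<partial>r t c c')"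
    using prob_space.emeasure_space_1[OF kernelD(1)[OF Y.R_meas[OF t] y]] by simp
  also have "\<dots> = (\<integral>\<^sup>+a. \<integral>\<^sup>+u. f (u, a) \<partial>X.R t c a x \<partial>X.m t c)"
    by (rule nn_integral_coupling_fst[OF r[OF t]]) (simp add: measurable_def)
  also have "\<dots> = (\<integral>\<^sup>+w. f w \<partial>X.V t c x)"
    using X.nn_integral_R[OF t x f] X.nn_integral_V[OF t x f] by simp
  finally show ?thesis .
qed

lemma step_Y:
  assumes t: "t < T" and x: "x \<in> space (path_space t)" and y: "y \<in> space (path_space t)"
    and f [measurable]: "f \<in> borel_measurable (borel \<Otimes>\<^sub>M count_space UNIV)"
  shows "(\<integral>\<^sup>+ab. \<integral>\<^sup>+u. \<integral>\<^sup>+v. f (v, snd ab) \<partial>Y.R t c' (snd ab) y \<partial>X.R t c (fst ab) x \<partial>r t c c')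
    = (\<integral>\<^sup>+w. f w \<partial>Y.V t c' y)"
proof -
  have "(\<integral>\<^sup>+ab. \<integral>\<^sup>+u. \<integral>\<^sup>+v. f (v, snd ab) \<partial>Y.R t c' (snd ab) y \<partial>X.R t c (fst ab) x \<partial>r t c c') =
        (\<integral>\<^sup>+ab. \<integral>\<^sup>+v. f (v, snd ab) \<partial>Y.R t c' (snd ab) y \<partial>r t c c')"
    using prob_space.emeasure_space_1[OF kernelD(1)[OF X.R_meas[OF t] x]] by simp
  also have "\<dots> = (\<integral>\<^sup>+a. \<integral>\<^sup>+u. f (u, a) \<partial>Y.R t c' a y \<partial>Y.m t c')"
    by (rule nn_integral_coupling_snd[OF r[OF t]]) (simp add: measurable_def)
  also have "\<dots> = (\<integral>\<^sup>+w. f w \<partial>Y.V t c' y)"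
    using Y.nn_integral_R[OF t y f] Y.nn_integral_V[OF t y f] by simp
  finally show ?thesis .
qed

text \<open>The factor \<open>g\<close> tests both past paths at once and thereby records
  independence from the past of the other side; the case \<open>g = 1\<close> will show that labels
  and positions of one side form a chain of their own.\<close>

lemma nn_integral_P_Suc_X:
  assumes t: "t < T" and g: "g \<in> borel_measurable (path_space t \<Otimes>\<^sub>M path_space t)"
    and f: "f \<in> borel_measurable (count_space UNIV \<Otimes>\<^sub>M path_space (Suc t))"
  shows "(\<integral>\<^sup>+h. g (restrict (fst (snd h)) {1..t}, restrict (snd (snd h)) {1..t}) * f (fst (fst h), fst (snd h)) \<partial>P (Suc t))
    = (\<integral>\<^sup>+h. g (snd h) * (\<integral>\<^sup>+w. f (fst (fst h) @ [snd w], (fst (snd h))(Suc t := fst w)) \<partial>X.V t (fst (fst h)) (fst (snd h))) \<partial>P t)"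
proof -
  have rs: "(\<lambda>x. restrict x {1..t}) \<in> path_space (Suc t) \<rightarrow>\<^sub>M path_space t" by (rule measurable_path_restrict) simp
  have gm: "(\<lambda>h. g (restrict (fst (snd h)) {1..t}, restrict (snd (snd h)) {1..t})) \<in> borel_measurable (H (Suc t))"
    by (rule measurable_compose[OF _ g], intro measurable_Pair measurable_compose[OF _ rs] H_measurable)
  have fm: "(\<lambda>h. f (fst (fst h), fst (snd h))) \<in> borel_measurable (H (Suc t))"
    by (rule measurable_compose[OF _ f]) (intro measurable_Pair H_measurable)
  show ?thesis
  proof (subst nn_integral_P_Suc[OF t])
    show "(\<lambda>h. g (restrict (fst (snd h)) {1..t}, restrict (snd (snd h)) {1..t}) * f (fst (fst h), fst (snd h))) \<in> borel_measurable (H (Suc t))"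
      using gm fm by simp
    show "(\<integral>\<^sup>+h. \<integral>\<^sup>+ab. \<integral>\<^sup>+u. \<integral>\<^sup>+v. g (restrict (fst (snd (extend t h ab (u, v)))) {1..t}, restrict (snd (snd (extend t h ab (u, v)))) {1..t}) *
         f (fst (fst (extend t h ab (u, v))), fst (snd (extend t h ab (u, v))))
       \<partial>Y.R t (snd (fst h)) (snd ab) (snd (snd h)) \<partial>X.R t (fst (fst h)) (fst ab) (fst (snd h)) \<partial>r t (fst (fst h)) (snd (fst h)) \<partial>P t)
      = (\<integral>\<^sup>+h. g (snd h) * (\<integral>\<^sup>+w. f (fst (fst h) @ [snd w], (fst (snd h))(Suc t := fst w)) \<partial>X.V t (fst (fst h)) (fst (snd h))) \<partial>P t)"
    proof (rule nn_integral_cong)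
      fix h assume "h \<in> space (P t)"
      then have x: "fst (snd h) \<in> space (path_space t)" and y: "snd (snd h) \<in> space (path_space t)"
        by (rule P_spaceD[OF _ t])+
      define f' where "f' w = g (snd h) * f (fst (fst h) @ [snd w], (fst (snd h))(Suc t := fst w))" for w
      have fm': "(\<lambda>w. f (fst (fst h) @ [snd w], (fst (snd h))(Suc t := fst w))) \<in> borel_measurable (borel \<Otimes>\<^sub>M count_space UNIV)"
        by (rule measurable_compose[OF _ f], intro measurable_Pair measurable_compose[OF measurable_fst measurable_path_upd_const[OF x]]) measurable
      then have f'm: "f' \<in> borel_measurable (borel \<Otimes>\<^sub>M count_space UNIV)" unfolding f'_def by simp
      have "(\<integral>\<^sup>+ab. \<integral>\<^sup>+u. \<integral>\<^sup>+v. f' (u, fst ab) \<partial>Y.R t (snd (fst h)) (snd ab) (snd (snd h)) \<partial>X.R t (fst (fst h)) (fst ab) (fst (snd h)) \<partial>r t (fst (fst h)) (snd (fst h)))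
         = (\<integral>\<^sup>+w. f' w \<partial>X.V t (fst (fst h)) (fst (snd h)))"
        by (rule step_X[OF t x y f'm])
      also have "\<dots> = g (snd h) * (\<integral>\<^sup>+w. f (fst (fst h) @ [snd w], (fst (snd h))(Suc t := fst w)) \<partial>X.V t (fst (fst h)) (fst (snd h)))"
        unfolding f'_def by (rule nn_integral_cmult) (simp add: fm' measurable_cong_sets[OF kernelD(2)[OF X.V_meas[OF t] x] refl])
      finally show "(\<integral>\<^sup>+ab. \<integral>\<^sup>+u. \<integral>\<^sup>+v. g (restrict (fst (snd (extend t h ab (u, v)))) {1..t}, restrict (snd (snd (extend t h ab (u, v)))) {1..t}) *
         f (fst (fst (extend t h ab (u, v))), fst (snd (extend t h ab (u, v))))
       \<partial>Y.R t (snd (fst h)) (snd ab) (snd (snd h)) \<partial>X.R t (fst (fst h)) (fst ab) (fst (snd h)) \<partial>r t (fst (fst h)) (snd (fst h))) =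
         g (snd h) * (\<integral>\<^sup>+w. f (fst (fst h) @ [snd w], (fst (snd h))(Suc t := fst w)) \<partial>X.V t (fst (fst h)) (fst (snd h)))"
        using x y by (simp add: f'_def extend_def restrict_path_upd)
    qed
  qed
qed

lemma nn_integral_P_Suc_Y:
  assumes t: "t < T" and g: "g \<in> borel_measurable (path_space t \<Otimes>\<^sub>M path_space t)"
    and f: "f \<in> borel_measurable (count_space UNIV \<Otimes>\<^sub>M path_space (Suc t))"
  shows "(\<integral>\<^sup>+h. g (restrict (fst (snd h)) {1..t}, restrict (snd (snd h)) {1..t}) * f (snd (fst h), snd (snd h)) \<partial>P (Suc t))
    = (\<integral>\<^sup>+h. g (snd h) * (\<integral>\<^sup>+w. f (snd (fst h) @ [snd w], (snd (snd h))(Suc t := fst w)) \<partial>Y.V t (snd (fst h)) (snd (snd h))) \<partial>P t)"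
proof -
  have rs: "(\<lambda>x. restrict x {1..t}) \<in> path_space (Suc t) \<rightarrow>\<^sub>M path_space t" by (rule measurable_path_restrict) simp
  have gm: "(\<lambda>h. g (restrict (fst (snd h)) {1..t}, restrict (snd (snd h)) {1..t})) \<in> borel_measurable (H (Suc t))"
    by (rule measurable_compose[OF _ g], intro measurable_Pair measurable_compose[OF _ rs] H_measurable)
  have fm: "(\<lambda>h. f (snd (fst h), snd (snd h))) \<in> borel_measurable (H (Suc t))"
    by (rule measurable_compose[OF _ f]) (intro measurable_Pair H_measurable)
  show ?thesis
  proof (subst nn_integral_P_Suc[OF t])
    show "(\<lambda>h. g (restrict (fst (snd h)) {1..t}, restrict (snd (snd h)) {1..t}) * f (snd (fst h), snd (snd h))) \<in> borel_measurable (H (Suc t))"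
      using gm fm by simp
    show "(\<integral>\<^sup>+h. \<integral>\<^sup>+ab. \<integral>\<^sup>+u. \<integral>\<^sup>+v. g (restrict (fst (snd (extend t h ab (u, v)))) {1..t}, restrict (snd (snd (extend t h ab (u, v)))) {1..t}) *
         f (snd (fst (extend t h ab (u, v))), snd (snd (extend t h ab (u, v))))
       \<partial>Y.R t (snd (fst h)) (snd ab) (snd (snd h)) \<partial>X.R t (fst (fst h)) (fst ab) (fst (snd h)) \<partial>r t (fst (fst h)) (snd (fst h)) \<partial>P t)
      = (\<integral>\<^sup>+h. g (snd h) * (\<integral>\<^sup>+w. f (snd (fst h) @ [snd w], (snd (snd h))(Suc t := fst w)) \<partial>Y.V t (snd (fst h)) (snd (snd h))) \<partial>P t)"
    proof (rule nn_integral_cong)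
      fix h assume "h \<in> space (P t)"
      then have x: "fst (snd h) \<in> space (path_space t)" and y: "snd (snd h) \<in> space (path_space t)"
        by (rule P_spaceD[OF _ t])+
      define f' where "f' w = g (snd h) * f (snd (fst h) @ [snd w], (snd (snd h))(Suc t := fst w))" for w
      have fm': "(\<lambda>w. f (snd (fst h) @ [snd w], (snd (snd h))(Suc t := fst w))) \<in> borel_measurable (borel \<Otimes>\<^sub>M count_space UNIV)"
        by (rule measurable_compose[OF _ f], intro measurable_Pair measurable_compose[OF measurable_fst measurable_path_upd_const[OF y]]) measurable
      then have f'm: "f' \<in> borel_measurable (borel \<Otimes>\<^sub>M count_space UNIV)" unfolding f'_def by simp
      have "(\<integral>\<^sup>+ab. \<integral>\<^sup>+u. \<integral>\<^sup>+v. f' (v, snd ab) \<partial>Y.R t (snd (fst h)) (snd ab) (snd (snd h)) \<partial>X.R t (fst (fst h)) (fst ab) (fst (snd h)) \<partial>r t (fst (fst h)) (snd (fst h)))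
         = (\<integral>\<^sup>+w. f' w \<partial>Y.V t (snd (fst h)) (snd (snd h)))"
        by (rule step_Y[OF t x y f'm])
      also have "\<dots> = g (snd h) * (\<integral>\<^sup>+w. f (snd (fst h) @ [snd w], (snd (snd h))(Suc t := fst w)) \<partial>Y.V t (snd (fst h)) (snd (snd h)))"
        unfolding f'_def by (rule nn_integral_cmult) (simp add: fm' measurable_cong_sets[OF kernelD(2)[OF Y.V_meas[OF t] y] refl])
      finally show "(\<integral>\<^sup>+ab. \<integral>\<^sup>+u. \<integral>\<^sup>+v. g (restrict (fst (snd (extend t h ab (u, v)))) {1..t}, restrict (snd (snd (extend t h ab (u, v)))) {1..t}) *
         f (snd (fst (extend t h ab (u, v))), snd (snd (extend t h ab (u, v))))
       \<partial>Y.R t (snd (fst h)) (snd ab) (snd (snd h)) \<partial>X.R t (fst (fst h)) (fst ab) (fst (snd h)) \<partial>r t (fst (fst h)) (snd (fst h))) =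
         g (snd h) * (\<integral>\<^sup>+w. f (snd (fst h) @ [snd w], (snd (snd h))(Suc t := fst w)) \<partial>Y.V t (snd (fst h)) (snd (snd h)))"
        using x y by (simp add: f'_def extend_def restrict_path_upd)
    qed
  qed
qed

lemma nn_integral_P_Suc_labels:
  assumes t: "t < T"
  shows "(\<integral>\<^sup>+h. f (fst h) \<partial>P (Suc t)) = (\<integral>\<^sup>+h. \<integral>\<^sup>+ab. f (fst (fst h) @ [fst ab], snd (fst h) @ [snd ab]) \<partial>r t (fst (fst h)) (snd (fst h)) \<partial>P t)"
proof (subst nn_integral_P_Suc[OF t])
  show "(\<lambda>h. f (fst h)) \<in> borel_measurable (H (Suc t))"
    unfolding H_def by (rule measurable_compose[OF measurable_fst]) simp
  show "(\<integral>\<^sup>+h. \<integral>\<^sup>+ab. \<integral>\<^sup>+u. \<integral>\<^sup>+v. f (fst (extend t h ab (u, v)))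
       \<partial>Y.R t (snd (fst h)) (snd ab) (snd (snd h)) \<partial>X.R t (fst (fst h)) (fst ab) (fst (snd h)) \<partial>r t (fst (fst h)) (snd (fst h)) \<partial>P t)
    = (\<integral>\<^sup>+h. \<integral>\<^sup>+ab. f (fst (fst h) @ [fst ab], snd (fst h) @ [snd ab]) \<partial>r t (fst (fst h)) (snd (fst h)) \<partial>P t)"
  proof (rule nn_integral_cong)
    fix h assume "h \<in> space (P t)"
    then have "fst (snd h) \<in> space (path_space t)" "snd (snd h) \<in> space (path_space t)"
      by (rule P_spaceD[OF _ t])+
    then show "(\<integral>\<^sup>+ab. \<integral>\<^sup>+u. \<integral>\<^sup>+v. f (fst (extend t h ab (u, v)))
       \<partial>Y.R t (snd (fst h)) (snd ab) (snd (snd h)) \<partial>X.R t (fst (fst h)) (fst ab) (fst (snd h)) \<partial>r t (fst (fst h)) (snd (fst h)))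
      = (\<integral>\<^sup>+ab. f (fst (fst h) @ [fst ab], snd (fst h) @ [snd ab]) \<partial>r t (fst (fst h)) (snd (fst h)))"
      using prob_space.emeasure_space_1[OF kernelD(1)[OF X.R_meas[OF t]]]
        prob_space.emeasure_space_1[OF kernelD(1)[OF Y.R_meas[OF t]]]
      by (simp add: extend_def)
  qed
qed

end

section \<open>Bicausality\<close>

text \<open>The function \<open>g\<close> is a conditional probability of \<open>V \<in> B\<close>
  given \<open>W\<close> that stays valid in the presence of \<open>U\<close>. Taking
  \<open>A\<close> to be the whole space identifies it, and pulling the \<open>W\<close>-measurable
  factor out of the conditional expectation gives the factorisation.\<close>

lemma cond_indep_varI:
  assumes M: "prob_space M" and U [measurable]: "U \<in> M \<rightarrow>\<^sub>M NU" and V [measurable]: "V \<in> M \<rightarrow>\<^sub>M NV" and W [measurable]: "W \<in> M \<rightarrow>\<^sub>M NW"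
    and factor: "\<And>B. B \<in> sets NV \<Longrightarrow> \<exists>g\<in>borel_measurable NW. (\<forall>x\<in>space NW. g x \<le> 1) \<and>
      (\<forall>A\<in>sets NU. \<forall>S\<in>sets NW. (\<integral>\<^sup>+\<omega>. indicator S (W \<omega>) * indicator A (U \<omega>) * indicator B (V \<omega>) \<partial>M) =
         (\<integral>\<^sup>+\<omega>. indicator S (W \<omega>) * indicator A (U \<omega>) * g (W \<omega>) \<partial>M))"
  shows "cond_indep_var M NU U NV V NW W"
  unfolding cond_indep_var_def Let_def
proof (intro ballI)
  interpret prob_space M by (rule M)
  define G where "G = vimage_algebra (space M) W NW"
  have Wsp: "W \<in> space M \<rightarrow> space NW" using measurable_space[OF W] by auto
  have sub: "subalgebra M G"
    unfolding subalgebra_def G_def sets_vimage_algebra2[OF Wsp] using measurable_sets[OF W] by auto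
  interpret G: finite_measure_subalgebra M G by unfold_locales (rule sub)
  have WG [measurable]: "W \<in> G \<rightarrow>\<^sub>M NW"
    unfolding G_def by (rule measurable_vimage_algebra1[OF Wsp])
  fix A B assume A [measurable]: "A \<in> sets NU" and B [measurable]: "B \<in> sets NV"
  obtain g where g [measurable]: "g \<in> borel_measurable NW" and g1: "\<And>x. x \<in> space NW \<Longrightarrow> g x \<le> 1"
    and fac: "\<And>A S. A \<in> sets NU \<Longrightarrow> S \<in> sets NW \<Longrightarrow>
      (\<integral>\<^sup>+\<omega>. indicator S (W \<omega>) * indicator A (U \<omega>) * indicator B (V \<omega>) \<partial>M) =
         (\<integral>\<^sup>+\<omega>. indicator S (W \<omega>) * indicator A (U \<omega>) * g (W \<omega>) \<partial>M)"
    using factor[OF B] by blast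
  define gr where "gr x = enn2real (g x)" for x
  have gr [measurable]: "gr \<in> borel_measurable NW" unfolding gr_def by measurable
  have gr_eq: "ennreal (gr (W \<omega>)) = g (W \<omega>)" and gr1: "gr (W \<omega>) \<le> 1" and gr0: "0 \<le> gr (W \<omega>)" if "\<omega> \<in> space M" for \<omega>
  proof -
    have *: "g (W \<omega>) \<le> 1" using g1 measurable_space[OF W that] by simp
    show "ennreal (gr (W \<omega>)) = g (W \<omega>)" unfolding gr_def using le_less_trans[OF *, of \<top>] by simp
    show "gr (W \<omega>) \<le> 1" unfolding gr_def using enn2real_mono[OF *] by simp
    show "0 \<le> gr (W \<omega>)" by (simp add: gr_def)
  qed
  have int_bounded: "integrable M f" if "f \<in> borel_measurable M" "\<And>\<omega>. \<omega> \<in> space M \<Longrightarrow> 0 \<le> f \<omega> \<and> f \<omega> \<le> 1" for f :: "_ \<Rightarrow> real"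
    using that by (intro integrable_const_bound[of _ 1]) auto
  have iA: "integrable M (\<lambda>\<omega>. indicator A (U \<omega>) :: real)" and iB: "integrable M (\<lambda>\<omega>. indicator B (V \<omega>) :: real)"
    and iAB: "integrable M (\<lambda>\<omega>. indicator A (U \<omega>) * indicator B (V \<omega>) :: real)"
    and ig: "integrable M (\<lambda>\<omega>. gr (W \<omega>))" and igA: "integrable M (\<lambda>\<omega>. gr (W \<omega>) * indicator A (U \<omega>))"
    using gr1 gr0 by (auto intro!: int_bounded simp: indicator_def)
  have key: "(\<integral>\<omega>\<in>S. indicator A' (U \<omega>) * indicator B (V \<omega>) \<partial>M) = (\<integral>\<omega>\<in>S. gr (W \<omega>) * indicator A' (U \<omega>) \<partial>M)"
    if S: "S \<in> sets G" and A' [measurable]: "A' \<in> sets NU" for S A'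
  proof -
    obtain S' where S' [measurable]: "S' \<in> sets NW" and SS: "S = W -` S' \<inter> space M"
      using S unfolding G_def sets_vimage_algebra2[OF Wsp] by blast
    have "(\<integral>\<omega>\<in>S. indicator A' (U \<omega>) * indicator B (V \<omega>) \<partial>M) =
        enn2real (\<integral>\<^sup>+\<omega>. ennreal (indicator S \<omega> *\<^sub>R (indicator A' (U \<omega>) * indicator B (V \<omega>))) \<partial>M)"
      unfolding set_lebesgue_integral_def SS by (intro integral_eq_nn_integral) auto
    also have "(\<integral>\<^sup>+\<omega>. ennreal (indicator S \<omega> *\<^sub>R (indicator A' (U \<omega>) * indicator B (V \<omega>))) \<partial>M)
        = (\<integral>\<^sup>+\<omega>. indicator S' (W \<omega>) * indicator A' (U \<omega>) * indicator B (V \<omega>) \<partial>M)"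
      unfolding SS by (intro nn_integral_cong) (auto split: split_indicator)
    also have "\<dots> = (\<integral>\<^sup>+\<omega>. indicator S' (W \<omega>) * indicator A' (U \<omega>) * g (W \<omega>) \<partial>M)"
      by (rule fac) auto
    also have "\<dots> = (\<integral>\<^sup>+\<omega>. ennreal (indicator S \<omega> *\<^sub>R (gr (W \<omega>) * indicator A' (U \<omega>))) \<partial>M)"
      unfolding SS by (intro nn_integral_cong) (auto simp: gr_eq split: split_indicator)
    also have "enn2real \<dots> = (\<integral>\<omega>\<in>S. gr (W \<omega>) * indicator A' (U \<omega>) \<partial>M)"
      unfolding set_lebesgue_integral_def SS using gr0
      by (intro integral_eq_nn_integral[symmetric]) auto
    finally show ?thesis .
  qed
  have E1: "AE \<omega> in M. real_cond_exp M G (\<lambda>\<omega>. indicator B (V \<omega>)) \<omega> = gr (W \<omega>)"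
  proof (rule G.real_cond_exp_charact)
    fix S assume "S \<in> sets G"
    from key[OF this sets.top] show "(\<integral>\<omega>\<in>S. indicator B (V \<omega>) \<partial>M) = (\<integral>\<omega>\<in>S. gr (W \<omega>) \<partial>M)"
      using measurable_space[OF U] unfolding set_lebesgue_integral_def
      by (simp cong: Bochner_Integration.integral_cong)
  qed (auto intro: iB ig)
  have E2: "AE \<omega> in M. real_cond_exp M G (\<lambda>\<omega>. indicator A (U \<omega>) * indicator B (V \<omega>)) \<omega> =
      real_cond_exp M G (\<lambda>\<omega>. gr (W \<omega>) * indicator A (U \<omega>)) \<omega>"
  proof (rule G.real_cond_exp_charact)
    fix S assume S: "S \<in> sets G"
    show "(\<integral>\<omega>\<in>S. indicator A (U \<omega>) * indicator B (V \<omega>) \<partial>M) = (\<integral>\<omega>\<in>S. real_cond_exp M G (\<lambda>\<omega>. gr (W \<omega>) * indicator A (U \<omega>)) \<omega> \<partial>M)"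
      using key[OF S A] G.real_cond_exp_intA[OF igA S] by simp
  qed (auto intro: iAB igA G.real_cond_exp_int(1))
  have E3: "AE \<omega> in M. real_cond_exp M G (\<lambda>\<omega>. gr (W \<omega>) * indicator A (U \<omega>)) \<omega> = gr (W \<omega>) * real_cond_exp M G (\<lambda>\<omega>. indicator A (U \<omega>)) \<omega>"
    by (rule G.real_cond_exp_mult) (auto intro: igA)
  from E1 E2 E3 show "AE \<omega> in M. real_cond_exp M (vimage_algebra (space M) W NW) (\<lambda>\<omega>. indicator A (U \<omega>) * indicator B (V \<omega>)) \<omega> =
       real_cond_exp M (vimage_algebra (space M) W NW) (\<lambda>\<omega>. indicator A (U \<omega>)) \<omega> *
       real_cond_exp M (vimage_algebra (space M) W NW) (\<lambda>\<omega>. indicator B (V \<omega>)) \<omega>"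
    unfolding G_def[symmetric] by eventually_elim simp
qed

text \<open>Causality in one direction, abstracted so that both halves of bicausality come from one
  proof with the roles of \<open>a\<close> and \<open>b\<close> exchanged. \<open>chain_step\<close>
  says that, given both pasts, the next position of \<open>a\<close> follows the kernel at the past
  of \<open>a\<close> alone.\<close>

locale causal_chain =
  fixes T :: nat and J :: "nat \<Rightarrow> 'w measure" and a b :: "'w \<Rightarrow> nat \<Rightarrow> real ^ 'd :: finite"
    and \<kappa> :: "nat \<Rightarrow> (nat \<Rightarrow> real ^ 'd) \<Rightarrow> (real ^ 'd) measure"
  assumes a [measurable]: "\<And>t. t \<le> T \<Longrightarrow> a \<in> J t \<rightarrow>\<^sub>M path_space t"
    and b [measurable]: "\<And>t. t \<le> T \<Longrightarrow> b \<in> J t \<rightarrow>\<^sub>M path_space t"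
    and \<kappa> [measurable]: "\<And>t. t < T \<Longrightarrow> \<kappa> t \<in> path_space t \<rightarrow>\<^sub>M prob_algebra borel"
    and J: "\<And>t. t \<le> T \<Longrightarrow> prob_space (J t)"
    and chain_step: "\<And>t g f. t < T \<Longrightarrow> g \<in> borel_measurable (path_space t \<Otimes>\<^sub>M path_space t) \<Longrightarrow> f \<in> borel_measurable (path_space (Suc t)) \<Longrightarrow>
       (\<integral>\<^sup>+w. g (restrict (a w) {1..t}, restrict (b w) {1..t}) * f (a w) \<partial>J (Suc t)) =
       (\<integral>\<^sup>+w. g (a w, b w) * (\<integral>\<^sup>+u. f ((a w)(Suc t := u)) \<partial>\<kappa> t (a w)) \<partial>J t)"
begin

lemma kernel_average_measurable:
  assumes t: "t < T" and f: "f \<in> borel_measurable (path_space (Suc t))"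
  shows "(\<lambda>x. \<integral>\<^sup>+u. f (x(Suc t := u)) \<partial>\<kappa> t x) \<in> borel_measurable (path_space t)"
  by (rule nn_integral_kernel_measurable[OF \<kappa>[OF t]])
    (use measurable_compose[OF measurable_path_upd f] in \<open>simp add: case_prod_beta'\<close>)

text \<open>Induction on the horizon \<open>s\<close>: integrating out the last position turns
  \<open>\<psi>\<close> into a function of one position less, which is still bounded by 1 and still
  depends on \<open>a\<close> only.\<close>

lemma factor:
  assumes "t \<le> s" "s \<le> T" "\<psi> \<in> borel_measurable (path_space s)" "\<And>x. x \<in> space (path_space s) \<Longrightarrow> \<psi> x \<le> 1"
  shows "\<exists>g\<in>borel_measurable (path_space t). (\<forall>x\<in>space (path_space t). g x \<le> 1) \<and>
    (\<forall>\<phi>\<in>borel_measurable (path_space t \<Otimes>\<^sub>M path_space t).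
       (\<integral>\<^sup>+w. \<phi> (restrict (a w) {1..t}, restrict (b w) {1..t}) * \<psi> (a w) \<partial>J s) = (\<integral>\<^sup>+w. \<phi> (a w, b w) * g (a w) \<partial>J t))"
  using assms
proof (induction s arbitrary: \<psi> rule: dec_induct)
  case base
  show ?case
  proof (intro bexI[of _ \<psi>] conjI ballI)
    fix \<phi> :: "(nat \<Rightarrow> real ^ 'd) \<times> (nat \<Rightarrow> real ^ 'd) \<Rightarrow> ennreal"
    show "(\<integral>\<^sup>+w. \<phi> (restrict (a w) {1..t}, restrict (b w) {1..t}) * \<psi> (a w) \<partial>J t) = (\<integral>\<^sup>+w. \<phi> (a w, b w) * \<psi> (a w) \<partial>J t)"
      using measurable_space[OF a[OF base(1)]] measurable_space[OF b[OF base(1)]]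
      by (intro nn_integral_cong) simp
  qed (use base in auto)
next
  case (step s)
  have s: "s < T" using step.prems by simp
  define \<psi>' where "\<psi>' x = (\<integral>\<^sup>+u. \<psi> (x(Suc s := u)) \<partial>\<kappa> s x)" for x
  have m: "\<psi>' \<in> borel_measurable (path_space s)"
    unfolding \<psi>'_def by (rule kernel_average_measurable[OF s step.prems(2)])
  have le1: "\<psi>' x \<le> 1" if x: "x \<in> space (path_space s)" for x
  proof -
    interpret K: prob_space "\<kappa> s x" by (rule kernelD(1)[OF \<kappa>[OF s] x])
    have "\<psi>' x \<le> (\<integral>\<^sup>+u. 1 \<partial>\<kappa> s x)"
      unfolding \<psi>'_def by (intro nn_integral_mono step.prems(3) path_upd_in_path_space x)
    then show ?thesis by (simp add: K.emeasure_space_1)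
  qed
  obtain g where g: "g \<in> borel_measurable (path_space t)" "\<forall>x\<in>space (path_space t). g x \<le> 1"
    "\<And>\<phi>. \<phi> \<in> borel_measurable (path_space t \<Otimes>\<^sub>M path_space t) \<Longrightarrow>
       (\<integral>\<^sup>+w. \<phi> (restrict (a w) {1..t}, restrict (b w) {1..t}) * \<psi>' (a w) \<partial>J s) = (\<integral>\<^sup>+w. \<phi> (a w, b w) * g (a w) \<partial>J t)"
    using step.IH[OF less_imp_le[OF s] m le1] by blast
  show ?case
  proof (intro bexI[of _ g] conjI ballI g(1) g(2)[rule_format])
    fix \<phi> :: "(nat \<Rightarrow> real ^ 'd) \<times> (nat \<Rightarrow> real ^ 'd) \<Rightarrow> ennreal" assume \<phi>: "\<phi> \<in> borel_measurable (path_space t \<Otimes>\<^sub>M path_space t)"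
    have "(\<lambda>p. (restrict (fst p) {1..t}, restrict (snd p) {1..t})) \<in> path_space s \<Otimes>\<^sub>M path_space s \<rightarrow>\<^sub>M path_space t \<Otimes>\<^sub>M path_space t"
      using step.hyps by (intro measurable_Pair measurable_compose[OF _ measurable_path_restrict]) auto
    from measurable_compose[OF this \<phi>]
    have \<phi>': "(\<lambda>p. \<phi> (restrict (fst p) {1..t}, restrict (snd p) {1..t})) \<in> borel_measurable (path_space s \<Otimes>\<^sub>M path_space s)" .
    have rr: "restrict (restrict x {1..s}) {1..t} = restrict x {1..t}" for x :: "nat \<Rightarrow> real ^ 'd"
      using step.hyps(1) by (simp add: min_absorb2)
    have "(\<integral>\<^sup>+w. \<phi> (restrict (a w) {1..t}, restrict (b w) {1..t}) * \<psi> (a w) \<partial>J (Suc s)) =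
          (\<integral>\<^sup>+w. \<phi> (restrict (a w) {1..t}, restrict (b w) {1..t}) * \<psi>' (a w) \<partial>J s)"
      unfolding \<psi>'_def using chain_step[OF s \<phi>' step.prems(2)] by (simp only: rr fst_conv snd_conv)
    then show "(\<integral>\<^sup>+w. \<phi> (restrict (a w) {1..t}, restrict (b w) {1..t}) * \<psi> (a w) \<partial>J (Suc s)) = (\<integral>\<^sup>+w. \<phi> (a w, b w) * g (a w) \<partial>J t)"
      using g(3)[OF \<phi>] by simp
  qed
qed

lemma consistent:
  assumes "t \<le> s" "s \<le> T" "\<phi> \<in> borel_measurable (path_space t \<Otimes>\<^sub>M path_space t)"
  shows "(\<integral>\<^sup>+w. \<phi> (restrict (a w) {1..t}, restrict (b w) {1..t}) \<partial>J s) = (\<integral>\<^sup>+w. \<phi> (a w, b w) \<partial>J t)"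
  using assms
proof (induction s rule: dec_induct)
  case base
  show ?case
    using measurable_space[OF a[OF base(1)]] measurable_space[OF b[OF base(1)]]
    by (intro nn_integral_cong) simp
next
  case (step s)
  have s: "s < T" using step.prems by simp
  have "(\<lambda>p. (restrict (fst p) {1..t}, restrict (snd p) {1..t})) \<in> path_space s \<Otimes>\<^sub>M path_space s \<rightarrow>\<^sub>M path_space t \<Otimes>\<^sub>M path_space t"
    using step.hyps by (intro measurable_Pair measurable_compose[OF _ measurable_path_restrict]) auto
  from measurable_compose[OF this step.prems(2)]
  have \<phi>': "(\<lambda>p. \<phi> (restrict (fst p) {1..t}, restrict (snd p) {1..t})) \<in> borel_measurable (path_space s \<Otimes>\<^sub>M path_space s)" .
  have "(\<integral>\<^sup>+w. \<phi> (restrict (a w) {1..t}, restrict (b w) {1..t}) \<partial>J (Suc s)) =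
        (\<integral>\<^sup>+w. \<phi> (restrict (a w) {1..t}, restrict (b w) {1..t}) * (\<integral>\<^sup>+u. 1 \<partial>\<kappa> s (a w)) \<partial>J s)"
    using chain_step[OF s \<phi>', of "\<lambda>_. 1"] step.hyps(1) by (simp add: min_absorb2)
  also have "\<dots> = (\<integral>\<^sup>+w. \<phi> (restrict (a w) {1..t}, restrict (b w) {1..t}) \<partial>J s)"
  proof (rule nn_integral_cong)
    fix w assume "w \<in> space (J s)"
    then have "a w \<in> space (path_space s)" using s by (intro measurable_space[OF a]) auto
    then show "\<phi> (restrict (a w) {1..t}, restrict (b w) {1..t}) * (\<integral>\<^sup>+u. 1 \<partial>\<kappa> s (a w)) = \<phi> (restrict (a w) {1..t}, restrict (b w) {1..t})"
      using prob_space.emeasure_space_1[OF kernelD(1)[OF \<kappa>[OF s]]] by simp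
  qed
  also have "\<dots> = (\<integral>\<^sup>+w. \<phi> (a w, b w) \<partial>J t)"
    by (rule step.IH) (use s step.prems in auto)
  finally show ?case .
qed

text \<open>Both laws are built from the same kernels, one position at a time.\<close>

lemma law:
  assumes \<mu>: "\<mu> \<in> space (prob_algebra (path_space T))"
    and cond: "\<And>t. t < T \<Longrightarrow> cond_kernel \<mu> (path_space t) (\<lambda>x. restrict x {1..t}) borel (\<lambda>x. x (Suc t)) (\<kappa> t)"
    and "t \<le> T" "f \<in> borel_measurable (path_space t)"
  shows "(\<integral>\<^sup>+w. f (a w) \<partial>J t) = (\<integral>\<^sup>+z. f (restrict z {1..t}) \<partial>\<mu>)"
  using assms(3,4)
proof (induction t arbitrary: f)
  case 0
  interpret \<mu>: prob_space \<mu> using \<mu> by (simp add: space_prob_algebra)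
  interpret J0: prob_space "J 0" by (rule J) simp
  have "(\<integral>\<^sup>+w. f (a w) \<partial>J 0) = (\<integral>\<^sup>+w. f (\<lambda>_. undefined) \<partial>J 0)"
    using measurable_space[OF a[of 0]] by (intro nn_integral_cong) (simp add: path_space_0)
  then show ?case by (simp add: J0.emeasure_space_1 \<mu>.emeasure_space_1 restrict_def)
next
  case (Suc t)
  have t: "t < T" using Suc.prems by simp
  have "(\<integral>\<^sup>+w. f (a w) \<partial>J (Suc t)) = (\<integral>\<^sup>+w. (\<integral>\<^sup>+u. f ((a w)(Suc t := u)) \<partial>\<kappa> t (a w)) \<partial>J t)"
    using chain_step[OF t, of "\<lambda>_. 1" f] Suc.prems by simp
  also have "\<dots> = (\<integral>\<^sup>+z. (\<integral>\<^sup>+u. f ((restrict z {1..t})(Suc t := u)) \<partial>\<kappa> t (restrict z {1..t})) \<partial>\<mu>)"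
    using t Suc.prems by (intro Suc.IH kernel_average_measurable) auto
  also have "\<dots> = (\<integral>\<^sup>+z. f ((restrict z {1..t})(Suc t := z (Suc t))) \<partial>\<mu>)"
    using cond[OF t, unfolded cond_kernel_def, THEN conjunct2, rule_format,
        OF measurable_compose[OF measurable_path_upd Suc.prems(2)]]
    by (simp only: fst_conv snd_conv)
  also have "\<dots> = (\<integral>\<^sup>+z. f (restrict z {1..Suc t}) \<partial>\<mu>)"
    using \<mu> t by (intro nn_integral_cong arg_cong[where f = f] path_restrict_upd[of _ T])
      (auto simp: space_prob_algebra dest: sets_eq_imp_space_eq)
  finally show ?case .
qed

text \<open>\<open>factor\<close> for the indicator of the future event, with the result carried
  back to time \<open>T\<close> by \<open>consistent\<close>. The conclusion has the shape expected
  by \<open>cond_indep_varI\<close>.\<close>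

lemma future_factor:
  assumes t: "t \<le> T" and B: "B \<in> sets (\<Pi>\<^sub>M s\<in>{t<..T}. borel)"
  shows "\<exists>g\<in>borel_measurable (path_space t). (\<forall>x\<in>space (path_space t). g x \<le> 1) \<and>
    (\<forall>A\<in>sets (path_space t). \<forall>S\<in>sets (path_space t).
       (\<integral>\<^sup>+w. indicator S (restrict (a w) {1..t}) * indicator A (restrict (b w) {1..t}) * indicator B (restrict (a w) {t<..T}) \<partial>J T) =
       (\<integral>\<^sup>+w. indicator S (restrict (a w) {1..t}) * indicator A (restrict (b w) {1..t}) * g (restrict (a w) {1..t}) \<partial>J T))"
proof -
  have "(\<lambda>x. restrict x {t<..T}) \<in> path_space T \<rightarrow>\<^sub>M (\<Pi>\<^sub>M s\<in>{t<..T}. borel)"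
    unfolding path_space_def by (rule measurable_restrict_subset) auto
  then have Bm: "(\<lambda>x. indicator B (restrict x {t<..T}) :: ennreal) \<in> borel_measurable (path_space T)"
    by (rule measurable_compose) (use B in simp)
  have B1: "indicator B (restrict x {t<..T}) \<le> (1 :: ennreal)" for x by (simp add: indicator_def)
  obtain g where g [measurable]: "g \<in> borel_measurable (path_space t)"
    and g1: "\<forall>x\<in>space (path_space t). g x \<le> 1"
    and fac: "\<And>\<phi>. \<phi> \<in> borel_measurable (path_space t \<Otimes>\<^sub>M path_space t) \<Longrightarrow>
       (\<integral>\<^sup>+w. \<phi> (restrict (a w) {1..t}, restrict (b w) {1..t}) * indicator B (restrict (a w) {t<..T}) \<partial>J T) = (\<integral>\<^sup>+w. \<phi> (a w, b w) * g (a w) \<partial>J t)"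
    using factor[OF t order_refl Bm B1] by blast
  show ?thesis
  proof (intro bexI[of _ g] conjI ballI g g1[rule_format])
    fix A S :: "(nat \<Rightarrow> real ^ 'd) set" assume [measurable]: "A \<in> sets (path_space t)" "S \<in> sets (path_space t)"
    define \<phi> :: "(nat \<Rightarrow> real ^ 'd) \<times> (nat \<Rightarrow> real ^ 'd) \<Rightarrow> ennreal" where "\<phi> p = indicator S (fst p) * indicator A (snd p)" for p
    have [measurable]: "\<phi> \<in> borel_measurable (path_space t \<Otimes>\<^sub>M path_space t)" unfolding \<phi>_def by measurable
    have "(\<integral>\<^sup>+w. \<phi> (restrict (a w) {1..t}, restrict (b w) {1..t}) * indicator B (restrict (a w) {t<..T}) \<partial>J T) =
        (\<integral>\<^sup>+w. (\<lambda>p. \<phi> p * g (fst p)) (a w, b w) \<partial>J t)"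
      by (subst fac) auto
    also have "\<dots> = (\<integral>\<^sup>+w. (\<lambda>p. \<phi> p * g (fst p)) (restrict (a w) {1..t}, restrict (b w) {1..t}) \<partial>J T)"
      by (rule consistent[OF t order_refl, symmetric]) measurable
    finally show "(\<integral>\<^sup>+w. indicator S (restrict (a w) {1..t}) * indicator A (restrict (b w) {1..t}) * indicator B (restrict (a w) {t<..T}) \<partial>J T) =
       (\<integral>\<^sup>+w. indicator S (restrict (a w) {1..t}) * indicator A (restrict (b w) {1..t}) * g (restrict (a w) {1..t}) \<partial>J T)"
      by (simp add: \<phi>_def)
  qed
qed

end

lemma (in quantized) nn_integral_V_\<kappa>:
  assumes t: "t < T" and x: "x \<in> space (path_space t)" and f [measurable]: "f \<in> borel_measurable borel"
  shows "(\<integral>\<^sup>+w. f (fst w) \<partial>V t c x) = (\<integral>\<^sup>+u. f u \<partial>\<kappa> t x)"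
proof -
  have m: "(\<lambda>w. f (fst w)) \<in> borel_measurable (borel \<Otimes>\<^sub>M count_space UNIV)" by measurable
  show ?thesis
    using nn_integral_R[OF t x m, of c] nn_integral_V[OF t x m, of c] nn_integral_R_\<kappa>[OF t x f, of c]
    by (simp only: fst_conv)
qed

context two_sided
begin

lemma P_measurable:
  assumes "t \<le> T"
  shows "(\<lambda>h. fst (fst h)) \<in> P t \<rightarrow>\<^sub>M count_space UNIV" "(\<lambda>h. snd (fst h)) \<in> P t \<rightarrow>\<^sub>M count_space UNIV"
  "(\<lambda>h. fst (snd h)) \<in> P t \<rightarrow>\<^sub>M path_space t" "(\<lambda>h. snd (snd h)) \<in> P t \<rightarrow>\<^sub>M path_space t"
  unfolding measurable_cong_sets[OF P_props(2)[OF assms] refl] by (rule H_measurable)+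

sublocale XC: causal_chain T P "\<lambda>h. fst (snd h)" "\<lambda>h. snd (snd h)" \<kappa>
proof (rule causal_chain.intro)
  fix t and g :: "(nat \<Rightarrow> real ^ 'd) \<times> (nat \<Rightarrow> real ^ 'd) \<Rightarrow> ennreal" and f :: "(nat \<Rightarrow> real ^ 'd) \<Rightarrow> ennreal"
  assume t: "t < T" and g: "g \<in> borel_measurable (path_space t \<Otimes>\<^sub>M path_space t)" and f: "f \<in> borel_measurable (path_space (Suc t))"
  have "(\<integral>\<^sup>+h. g (restrict (fst (snd h)) {1..t}, restrict (snd (snd h)) {1..t}) * f (fst (snd h)) \<partial>P (Suc t))
    = (\<integral>\<^sup>+h. g (snd h) * (\<integral>\<^sup>+w. f ((fst (snd h))(Suc t := fst w)) \<partial>X.V t (fst (fst h)) (fst (snd h))) \<partial>P t)"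
    using nn_integral_P_Suc_X[OF t g measurable_compose[OF measurable_snd f]] by (simp only: snd_conv)
  also have "\<dots> = (\<integral>\<^sup>+h. g (snd h) * (\<integral>\<^sup>+u. f ((fst (snd h))(Suc t := u)) \<partial>\<kappa> t (fst (snd h))) \<partial>P t)"
  proof (rule nn_integral_cong)
    fix h assume h: "h \<in> space (P t)"
    have x: "fst (snd h) \<in> space (path_space t)" by (rule P_spaceD[OF h t])
    have fm: "(\<lambda>u. f ((fst (snd h))(Suc t := u))) \<in> borel_measurable borel"
      by (rule measurable_compose[OF measurable_path_upd_const[OF x] f])
    have "(\<integral>\<^sup>+w. f ((fst (snd h))(Suc t := fst w)) \<partial>X.V t (fst (fst h)) (fst (snd h))) = (\<integral>\<^sup>+u. f ((fst (snd h))(Suc t := u)) \<partial>\<kappa> t (fst (snd h)))"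
      by (rule X.nn_integral_V_\<kappa>[OF t x fm])
    then show "g (snd h) * (\<integral>\<^sup>+w. f ((fst (snd h))(Suc t := fst w)) \<partial>X.V t (fst (fst h)) (fst (snd h))) =
       g (snd h) * (\<integral>\<^sup>+u. f ((fst (snd h))(Suc t := u)) \<partial>\<kappa> t (fst (snd h)))" by simp
  qed
  finally show "(\<integral>\<^sup>+h. g (restrict (fst (snd h)) {1..t}, restrict (snd (snd h)) {1..t}) * f (fst (snd h)) \<partial>P (Suc t)) =
    (\<integral>\<^sup>+h. g (fst (snd h), snd (snd h)) * (\<integral>\<^sup>+u. f ((fst (snd h))(Suc t := u)) \<partial>\<kappa> t (fst (snd h))) \<partial>P t)" by simp
qed (rule P_measurable(3,4) P_props(1) X.\<kappa>, assumption)+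

sublocale YC: causal_chain T P "\<lambda>h. snd (snd h)" "\<lambda>h. fst (snd h)" \<kappa>'
proof (rule causal_chain.intro)
  fix t and g :: "(nat \<Rightarrow> real ^ 'd) \<times> (nat \<Rightarrow> real ^ 'd) \<Rightarrow> ennreal" and f :: "(nat \<Rightarrow> real ^ 'd) \<Rightarrow> ennreal"
  assume t: "t < T" and g: "g \<in> borel_measurable (path_space t \<Otimes>\<^sub>M path_space t)" and f: "f \<in> borel_measurable (path_space (Suc t))"
  have g': "(\<lambda>p. g (snd p, fst p)) \<in> borel_measurable (path_space t \<Otimes>\<^sub>M path_space t)"
    by (rule measurable_compose[OF _ g]) measurable
  have "(\<integral>\<^sup>+h. g (restrict (snd (snd h)) {1..t}, restrict (fst (snd h)) {1..t}) * f (snd (snd h)) \<partial>P (Suc t))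
    = (\<integral>\<^sup>+h. g (snd (snd h), fst (snd h)) * (\<integral>\<^sup>+w. f ((snd (snd h))(Suc t := fst w)) \<partial>Y.V t (snd (fst h)) (snd (snd h))) \<partial>P t)"
    using nn_integral_P_Suc_Y[OF t g' measurable_compose[OF measurable_snd f]] by (simp only: fst_conv snd_conv)
  also have "\<dots> = (\<integral>\<^sup>+h. g (snd (snd h), fst (snd h)) * (\<integral>\<^sup>+u. f ((snd (snd h))(Suc t := u)) \<partial>\<kappa>' t (snd (snd h))) \<partial>P t)"
  proof (rule nn_integral_cong)
    fix h assume h: "h \<in> space (P t)"
    have y: "snd (snd h) \<in> space (path_space t)" by (rule P_spaceD[OF h t])
    have fm: "(\<lambda>u. f ((snd (snd h))(Suc t := u))) \<in> borel_measurable borel"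
      by (rule measurable_compose[OF measurable_path_upd_const[OF y] f])
    have "(\<integral>\<^sup>+w. f ((snd (snd h))(Suc t := fst w)) \<partial>Y.V t (snd (fst h)) (snd (snd h))) = (\<integral>\<^sup>+u. f ((snd (snd h))(Suc t := u)) \<partial>\<kappa>' t (snd (snd h)))"
      by (rule Y.nn_integral_V_\<kappa>[OF t y fm])
    then show "g (snd (snd h), fst (snd h)) * (\<integral>\<^sup>+w. f ((snd (snd h))(Suc t := fst w)) \<partial>Y.V t (snd (fst h)) (snd (snd h))) =
       g (snd (snd h), fst (snd h)) * (\<integral>\<^sup>+u. f ((snd (snd h))(Suc t := u)) \<partial>\<kappa>' t (snd (snd h)))" by simp
  qed
  finally show "(\<integral>\<^sup>+h. g (restrict (snd (snd h)) {1..t}, restrict (fst (snd h)) {1..t}) * f (snd (snd h)) \<partial>P (Suc t)) =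
    (\<integral>\<^sup>+h. g (snd (snd h), fst (snd h)) * (\<integral>\<^sup>+u. f ((snd (snd h))(Suc t := u)) \<partial>\<kappa>' t (snd (snd h))) \<partial>P t)" .
qed (rule P_measurable(3,4) P_props(1) Y.\<kappa>, assumption)+

definition \<pi> where "\<pi> = distr (P T) (path_space T \<Otimes>\<^sub>M path_space T) snd"

lemma snd_P: "snd \<in> P T \<rightarrow>\<^sub>M path_space T \<Otimes>\<^sub>M path_space T"
  unfolding measurable_cong_sets[OF P_props(2)[OF order_refl] refl] H_def by (rule measurable_snd)

lemma nn_integral_\<pi>:
  "f \<in> borel_measurable (path_space T \<Otimes>\<^sub>M path_space T) \<Longrightarrow> (\<integral>\<^sup>+w. f w \<partial>\<pi>) = (\<integral>\<^sup>+h. f (snd h) \<partial>P T)"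
  unfolding \<pi>_def by (rule nn_integral_distr[OF snd_P]) simp

lemma sets_\<pi>: "sets \<pi> = sets (path_space T \<Otimes>\<^sub>M path_space T)"
  by (simp add: \<pi>_def)

lemma prob_\<pi>: "prob_space \<pi>"
  unfolding \<pi>_def by (rule prob_space.prob_space_distr[OF P_props(1)[OF order_refl] snd_P])

lemma \<pi>_couplings: "\<pi> \<in> couplings \<mu> \<nu>"
proof (rule couplingsI)
  show "sets \<pi> = sets (\<mu> \<Otimes>\<^sub>M \<nu>)" unfolding sets_\<pi> by (rule sets_pair_measure_cong[symmetric]) (rule X.sets_\<mu> Y.sets_\<mu>)+
  fix A assume A: "A \<in> sets \<mu>"
  then have [measurable]: "A \<in> sets (path_space T)" by (simp add: X.sets_\<mu>)
  have "(\<integral>\<^sup>+w. indicator A (fst w) \<partial>\<pi>) = (\<integral>\<^sup>+h. indicator A (fst (snd h)) \<partial>P T)"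
    by (rule nn_integral_\<pi>) measurable
  also have "\<dots> = (\<integral>\<^sup>+z. indicator A (restrict z {1..T}) \<partial>\<mu>)"
    by (rule XC.law[OF X.\<mu> X.cond]) auto
  also have "\<dots> = (\<integral>\<^sup>+z. indicator A z \<partial>\<mu>)"
    by (intro nn_integral_cong) (simp add: X.space_\<mu>)
  finally show "(\<integral>\<^sup>+w. indicator A (fst w) \<partial>\<pi>) = emeasure \<mu> A" using A by simp
next
  fix A assume A: "A \<in> sets \<nu>"
  then have [measurable]: "A \<in> sets (path_space T)" by (simp add: Y.sets_\<mu>)
  have "(\<integral>\<^sup>+w. indicator A (snd w) \<partial>\<pi>) = (\<integral>\<^sup>+h. indicator A (snd (snd h)) \<partial>P T)"
    by (rule nn_integral_\<pi>) measurable
  also have "\<dots> = (\<integral>\<^sup>+z. indicator A (restrict z {1..T}) \<partial>\<nu>)"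
    by (rule YC.law[OF Y.\<mu> Y.cond]) auto
  also have "\<dots> = (\<integral>\<^sup>+z. indicator A z \<partial>\<nu>)"
    by (intro nn_integral_cong) (simp add: Y.space_\<mu>)
  finally show "(\<integral>\<^sup>+w. indicator A (snd w) \<partial>\<pi>) = emeasure \<nu> A" using A by simp
qed

theorem \<pi>_bicausal: "\<pi> \<in> bc_couplings T \<mu> \<nu>"
  unfolding bc_couplings_def
proof (safe intro!: \<pi>_couplings)
  fix t assume "t \<in> {1..<T}"
  then have t: "t \<le> T" by simp
  have rt: "(\<lambda>x. restrict x {1..t}) \<in> path_space T \<rightarrow>\<^sub>M path_space t" by (rule measurable_path_restrict[OF t])
  have rf: "(\<lambda>x. restrict x {t<..T}) \<in> path_space T \<rightarrow>\<^sub>M (\<Pi>\<^sub>M s\<in>{t<..T}. borel)"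
    unfolding path_space_def by (rule measurable_restrict_subset) auto
  note [measurable] = measurable_compose[OF measurable_fst rt] measurable_compose[OF measurable_snd rt]
    measurable_compose[OF measurable_fst rf] measurable_compose[OF measurable_snd rf]
  note [measurable_cong] = sets_\<pi>
  show "cond_indep_var \<pi> (path_space t) (\<lambda>\<omega>. restrict (snd \<omega>) {1..t}) (\<Pi>\<^sub>M s\<in>{t<..T}. borel) (\<lambda>\<omega>. restrict (fst \<omega>) {t<..T})
       (path_space t) (\<lambda>\<omega>. restrict (fst \<omega>) {1..t})"
  proof (rule cond_indep_varI[OF prob_\<pi>])
    fix B assume B [measurable]: "B \<in> sets (\<Pi>\<^sub>M s\<in>{t<..T}. borel :: (real ^ 'd) measure)"
    from XC.future_factor[OF t B] obtain g where g [measurable]: "g \<in> borel_measurable (path_space t)"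
      and g1: "\<forall>x\<in>space (path_space t). g x \<le> 1" and fac: "\<And>A S. A \<in> sets (path_space t) \<Longrightarrow> S \<in> sets (path_space t) \<Longrightarrow>
         (\<integral>\<^sup>+w. indicator S (restrict (fst (snd w)) {1..t}) * indicator A (restrict (snd (snd w)) {1..t}) * indicator B (restrict (fst (snd w)) {t<..T}) \<partial>P T) =
         (\<integral>\<^sup>+w. indicator S (restrict (fst (snd w)) {1..t}) * indicator A (restrict (snd (snd w)) {1..t}) * g (restrict (fst (snd w)) {1..t}) \<partial>P T)"
      by blast
    show "\<exists>g\<in>borel_measurable (path_space t). (\<forall>x\<in>space (path_space t). g x \<le> 1) \<and>
      (\<forall>A\<in>sets (path_space t). \<forall>S\<in>sets (path_space t).
         (\<integral>\<^sup>+\<omega>. indicator S (restrict (fst \<omega>) {1..t}) * indicator A (restrict (snd \<omega>) {1..t}) * indicator B (restrict (fst \<omega>) {t<..T}) \<partial>\<pi>) =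
         (\<integral>\<^sup>+\<omega>. indicator S (restrict (fst \<omega>) {1..t}) * indicator A (restrict (snd \<omega>) {1..t}) * g (restrict (fst \<omega>) {1..t}) \<partial>\<pi>))"
    proof (intro bexI[of _ g] conjI ballI g g1[rule_format])
      fix A S :: "(nat \<Rightarrow> real ^ 'd) set" assume [measurable]: "A \<in> sets (path_space t)" "S \<in> sets (path_space t)"
      show "(\<integral>\<^sup>+\<omega>. indicator S (restrict (fst \<omega>) {1..t}) * indicator A (restrict (snd \<omega>) {1..t}) * indicator B (restrict (fst \<omega>) {t<..T}) \<partial>\<pi>) =
         (\<integral>\<^sup>+\<omega>. indicator S (restrict (fst \<omega>) {1..t}) * indicator A (restrict (snd \<omega>) {1..t}) * g (restrict (fst \<omega>) {1..t}) \<partial>\<pi>)"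
        by (subst (1 2) nn_integral_\<pi>) (measurable, rule fac, auto)
    qed
  qed measurable
  show "cond_indep_var \<pi> (path_space t) (\<lambda>\<omega>. restrict (fst \<omega>) {1..t}) (\<Pi>\<^sub>M s\<in>{t<..T}. borel) (\<lambda>\<omega>. restrict (snd \<omega>) {t<..T})
       (path_space t) (\<lambda>\<omega>. restrict (snd \<omega>) {1..t})"
  proof (rule cond_indep_varI[OF prob_\<pi>])
    fix B assume B [measurable]: "B \<in> sets (\<Pi>\<^sub>M s\<in>{t<..T}. borel :: (real ^ 'd) measure)"
    from YC.future_factor[OF t B] obtain g where g [measurable]: "g \<in> borel_measurable (path_space t)"
      and g1: "\<forall>x\<in>space (path_space t). g x \<le> 1" and fac: "\<And>A S. A \<in> sets (path_space t) \<Longrightarrow> S \<in> sets (path_space t) \<Longrightarrow>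
         (\<integral>\<^sup>+w. indicator S (restrict (snd (snd w)) {1..t}) * indicator A (restrict (fst (snd w)) {1..t}) * indicator B (restrict (snd (snd w)) {t<..T}) \<partial>P T) =
         (\<integral>\<^sup>+w. indicator S (restrict (snd (snd w)) {1..t}) * indicator A (restrict (fst (snd w)) {1..t}) * g (restrict (snd (snd w)) {1..t}) \<partial>P T)"
      by blast
    show "\<exists>g\<in>borel_measurable (path_space t). (\<forall>x\<in>space (path_space t). g x \<le> 1) \<and>
      (\<forall>A\<in>sets (path_space t). \<forall>S\<in>sets (path_space t).
         (\<integral>\<^sup>+\<omega>. indicator S (restrict (snd \<omega>) {1..t}) * indicator A (restrict (fst \<omega>) {1..t}) * indicator B (restrict (snd \<omega>) {t<..T}) \<partial>\<pi>) =
         (\<integral>\<^sup>+\<omega>. indicator S (restrict (snd \<omega>) {1..t}) * indicator A (restrict (fst \<omega>) {1..t}) * g (restrict (snd \<omega>) {1..t}) \<partial>\<pi>))"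
    proof (intro bexI[of _ g] conjI ballI g g1[rule_format])
      fix A S :: "(nat \<Rightarrow> real ^ 'd) set" assume [measurable]: "A \<in> sets (path_space t)" "S \<in> sets (path_space t)"
      show "(\<integral>\<^sup>+\<omega>. indicator S (restrict (snd \<omega>) {1..t}) * indicator A (restrict (fst \<omega>) {1..t}) * indicator B (restrict (snd \<omega>) {t<..T}) \<partial>\<pi>) =
         (\<integral>\<^sup>+\<omega>. indicator S (restrict (snd \<omega>) {1..t}) * indicator A (restrict (fst \<omega>) {1..t}) * g (restrict (snd \<omega>) {1..t}) \<partial>\<pi>)"
        by (subst (1 2) nn_integral_\<pi>) (measurable, rule fac, auto)
    qed
  qed measurable
qed

end

section \<open>Elementary bounds for path distances, moduli and Wasserstein distances\<close>

lemma path_dist_nonneg [simp]: "0 \<le> path_dist t x y"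
  by (simp add: path_dist_def)

lemma path_dist_le_sum: "path_dist t x y \<le> (\<Sum>s\<in>{1..t}. dist (x s) (y s))"
  unfolding path_dist_def dist_norm by (rule L2_set_le_sum) simp

lemma dist_le_path_dist: "s \<in> {1..t} \<Longrightarrow> dist (x s) (y s) \<le> path_dist t x y"
  unfolding path_dist_def dist_norm by (rule member_le_L2_set) auto

lemma modulus_ge:
  assumes \<pi>: "\<pi> \<in> couplings \<mu> \<mu>"
    and d: "Lnorm p \<pi> (\<lambda>w. ennreal (path_dist t (fst w) (snd w))) < \<delta>"
  shows "Lnorm p \<pi> (\<lambda>w. wasserstein dist p (cond_law \<mu> t (restrict (fst w) {1..t})) (cond_law \<mu> t (restrict (snd w) {1..t}))) \<le> modulus p \<mu> t \<delta>"
proof -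
  have "epowr (\<integral>\<^sup>+ (x, y). ennreal (path_dist t x y powr p) \<partial>\<pi>) (1 / p) < \<delta>"
    using d by (simp add: Lnorm_def epowr_ennreal case_prod_beta')
  with \<pi> show ?thesis
    unfolding modulus_def Lnorm_def by (intro SUP_upper2[of \<pi>]) (auto simp: case_prod_beta')
qed

text \<open>The diagonal coupling has cost zero. This serves the first step, where both pasts are
  empty and the two kernels coincide.\<close>

lemma wasserstein_self:
  fixes \<kappa> :: "'e :: euclidean_space measure"
  assumes p: "p > 0" and \<kappa>: "prob_space \<kappa>" "sets \<kappa> = sets borel"
  shows "wasserstein dist p \<kappa> \<kappa> = 0"
proof -
  note [measurable_cong] = \<kappa>(2)
  define D where "D = distr \<kappa> (\<kappa> \<Otimes>\<^sub>M \<kappa>) (\<lambda>u. (u, u))"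
  have d: "(\<lambda>u. (u, u)) \<in> \<kappa> \<rightarrow>\<^sub>M \<kappa> \<Otimes>\<^sub>M \<kappa>" by measurable
  have "D \<in> couplings \<kappa> \<kappa>"
    by (rule couplingsI) (simp_all add: D_def nn_integral_distr[OF d])
  then have "wasserstein dist p \<kappa> \<kappa> \<le> Lnorm p D (\<lambda>(x, y). ennreal (dist x y))"
    by (rule wasserstein_le[OF p]) simp
  also have "\<dots> = epowr (\<integral>\<^sup>+u. epowr (ennreal (dist u u)) p \<partial>\<kappa>) (1 / p)"
    unfolding Lnorm_def D_def by (subst nn_integral_distr[OF d]) (auto simp: case_prod_beta')
  finally show ?thesis using p by simp
qed

lemma le_diff_add_ennreal: "a \<le> a - b + (b :: ennreal)"
proof (cases "b \<le> a")
  case True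
  then show ?thesis by (simp add: diff_add_cancel_ennreal)
next
  case False
  then have "a \<le> b" by simp
  then show ?thesis by (rule add_increasing[OF zero_le])
qed

section \<open>Distance between positions and labels\<close>

text \<open>Label history and path of one side form an autonomous chain, because \<open>V\<close>
  refers to this side only. Its law \<open>A t\<close> will be a projection of
  \<open>P t\<close>.\<close>

locale labelled = quantized T \<mu> \<kappa> Q \<Gamma>
  for T :: nat and \<mu> :: "(nat \<Rightarrow> real ^ 'd :: finite) measure" and \<kappa> Q \<Gamma> +
  fixes A :: "nat \<Rightarrow> (nat list \<times> (nat \<Rightarrow> real ^ 'd)) measure"
  assumes A: "\<And>t. t \<le> T \<Longrightarrow> A t \<in> space (prob_algebra (count_space UNIV \<Otimes>\<^sub>M path_space t))"
    and A_0: "\<And>f. f \<in> borel_measurable (count_space UNIV \<Otimes>\<^sub>M path_space 0) \<Longrightarrow> (\<integral>\<^sup>+w. f w \<partial>A 0) = f ([], \<lambda>_. undefined)"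
    and A_Suc: "\<And>t f. t < T \<Longrightarrow> f \<in> borel_measurable (count_space UNIV \<Otimes>\<^sub>M path_space (Suc t)) \<Longrightarrow>
      (\<integral>\<^sup>+w. f w \<partial>A (Suc t)) = (\<integral>\<^sup>+w. \<integral>\<^sup>+v. f (fst w @ [snd v], (snd w)(Suc t := fst v)) \<partial>V t (fst w) (snd w) \<partial>A t)"
begin

lemma A_props:
  assumes "t \<le> T"
  shows "prob_space (A t)" "sets (A t) = sets (count_space UNIV \<Otimes>\<^sub>M path_space t)" "space (A t) = UNIV \<times> space (path_space t)"
  using A[OF assms] sets_eq_imp_space_eq[of "A t" "count_space UNIV \<Otimes>\<^sub>M path_space t"]
  by (auto simp: space_prob_algebra space_pair_measure)

lemma A_spaceD: "w \<in> space (A t) \<Longrightarrow> t \<le> T \<Longrightarrow> snd w \<in> space (path_space t)"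
  by (subst (asm) A_props(3)) auto

lemma A_fst: "t \<le> T \<Longrightarrow> fst \<in> A t \<rightarrow>\<^sub>M count_space UNIV"
  unfolding measurable_cong_sets[OF A_props(2) refl] by simp

lemma nn_integral_label_mixture:
  assumes t: "t \<le> T" and F: "\<And>c. F c \<in> borel_measurable \<mu>"
  shows "(\<integral>\<^sup>+z. (\<integral>\<^sup>+z'. F (hist Q t z) z' \<partial>cm t (hist Q t z)) \<partial>\<mu>) = (\<integral>\<^sup>+z. F (hist Q t z) z \<partial>\<mu>)"
  unfolding cm_def by (rule nn_integral_cond_on_mixture[OF hist_meas[OF t] F])

text \<open>Given a history \<open>c\<close>, the next label is distributed like the next cell of a
  path under \<open>\<mu>\<close> that has history \<open>c\<close>. Hence the labels evolve like
  the cells visited by such a path, although they need not be the cells of the simulated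
  path.\<close>

lemma label_law:
  assumes "t \<le> T"
  shows "(\<integral>\<^sup>+w. f (fst w) \<partial>A t) = (\<integral>\<^sup>+z. f (hist Q t z) \<partial>\<mu>)"
  using assms
proof (induction t arbitrary: f)
  case 0
  have "(\<lambda>w. f (fst w)) \<in> borel_measurable (count_space UNIV \<Otimes>\<^sub>M path_space 0)"
    by (rule measurable_compose[OF measurable_fst]) simp
  have "(\<integral>\<^sup>+w. f (fst w) \<partial>A 0) = f []"
    using A_0[OF \<open>(\<lambda>w. f (fst w)) \<in> borel_measurable (count_space UNIV \<Otimes>\<^sub>M path_space 0)\<close>] by (simp only: fst_conv)
  then show ?case by (simp only: hist_0 nn_integral_const emeasure_space_1 mult_1_right)
next
  case (Suc t)
  have t: "t < T" using Suc.prems by simp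
  have "(\<lambda>w. f (fst w)) \<in> borel_measurable (count_space UNIV \<Otimes>\<^sub>M path_space (Suc t))"
    by (rule measurable_compose[OF measurable_fst]) simp
  from A_Suc[OF t this]
  have "(\<integral>\<^sup>+w. f (fst w) \<partial>A (Suc t)) = (\<integral>\<^sup>+w. \<integral>\<^sup>+v. f (fst w @ [snd v]) \<partial>V t (fst w) (snd w) \<partial>A t)" by simp
  also have "\<dots> = (\<integral>\<^sup>+w. \<integral>\<^sup>+a. f (fst w @ [a]) \<partial>m t (fst w) \<partial>A t)"
    by (rule nn_integral_cong, rule law_snd_V[OF t], rule A_spaceD[OF _ less_imp_le[OF t]])
  also have "\<dots> = (\<integral>\<^sup>+z. \<integral>\<^sup>+a. f (hist Q t z @ [a]) \<partial>m t (hist Q t z) \<partial>\<mu>)"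
    by (rule Suc.IH) (use t in simp)
  also have "\<dots> = (\<integral>\<^sup>+z. \<integral>\<^sup>+z'. f (hist Q t z @ [Q (Suc t) (z' (Suc t))]) \<partial>cm t (hist Q t z) \<partial>\<mu>)"
  proof (intro nn_integral_cong)
    fix z
    have "(\<lambda>z. Q (Suc t) (z (Suc t))) \<in> cm t (hist Q t z) \<rightarrow>\<^sub>M count_space UNIV"
      using measurable_compose[OF component_meas[OF t] Q] by (simp cong: measurable_cong_sets)
    then show "(\<integral>\<^sup>+a. f (hist Q t z @ [a]) \<partial>m t (hist Q t z)) = (\<integral>\<^sup>+z'. f (hist Q t z @ [Q (Suc t) (z' (Suc t))]) \<partial>cm t (hist Q t z))"
      unfolding m_def by (subst nn_integral_distr) auto
  qed
  also have "\<dots> = (\<integral>\<^sup>+z. f (hist Q t z @ [Q (Suc t) (z (Suc t))]) \<partial>\<mu>)"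
  proof (rule nn_integral_label_mixture)
    fix c
    show "(\<lambda>z. f (c @ [Q (Suc t) (z (Suc t))])) \<in> borel_measurable \<mu>"
      by (rule measurable_compose[OF measurable_compose[OF component_meas[OF t] Q]]) simp
  qed (use t in simp)
  finally show ?case by (simp add: hist_Suc)
qed

lemma AE_label:
  assumes t: "t \<le> T" and "AE z in \<mu>. Pr (hist Q t z)"
  shows "AE w in A t. Pr (fst w)"
proof -
  have m: "(\<lambda>w. indicator {c. \<not> Pr c} (fst w) :: ennreal) \<in> borel_measurable (A t)"
    by (rule measurable_compose[OF A_fst[OF t]]) simp
  have "(\<integral>\<^sup>+w. indicator {c. \<not> Pr c} (fst w) \<partial>A t) = (\<integral>\<^sup>+z. indicator {c. \<not> Pr c} (hist Q t z) \<partial>\<mu>)"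
    by (rule label_law[OF t])
  also have "\<dots> = (\<integral>\<^sup>+z. 0 \<partial>\<mu>)"
    using assms(2) by (intro nn_integral_cong_AE) (auto elim!: eventually_mono)
  finally have "(\<integral>\<^sup>+w. indicator {c. \<not> Pr c} (fst w) \<partial>A t) = 0" by simp
  then have "AE w in A t. indicator {c. \<not> Pr c} (fst w) = (0::ennreal)"
    using m by (subst (asm) nn_integral_0_iff_AE) auto
  then show ?thesis by eventually_elim (auto simp: indicator_def split: if_splits)
qed

lemma AE_length: "t \<le> T \<Longrightarrow> AE w in A t. length (fst w) = t"
  by (rule AE_label) auto

lemma path_law:
  assumes "t \<le> T" "f \<in> borel_measurable (path_space t)"
  shows "(\<integral>\<^sup>+w. f (snd w) \<partial>A t) = (\<integral>\<^sup>+z. f (restrict z {1..t}) \<partial>\<mu>)"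
  using assms
proof (induction t arbitrary: f)
  case 0
  have "(\<lambda>w. f (snd w)) \<in> borel_measurable (count_space UNIV \<Otimes>\<^sub>M path_space 0)"
    by (rule measurable_compose[OF measurable_snd]) (use 0 in simp)
  have "(\<integral>\<^sup>+w. f (snd w) \<partial>A 0) = f (\<lambda>_. undefined)"
    using A_0[OF \<open>(\<lambda>w. f (snd w)) \<in> borel_measurable (count_space UNIV \<Otimes>\<^sub>M path_space 0)\<close>] by (simp only: snd_conv)
  moreover have "restrict z {1..0::nat} = (\<lambda>_. undefined)" for z :: "nat \<Rightarrow> real ^ 'd" by (simp add: restrict_def)
  ultimately show ?case by (simp only: nn_integral_const emeasure_space_1 mult_1_right)
next
  case (Suc t)
  have t: "t < T" using Suc.prems by simp
  have fm: "(\<lambda>u. f (x(Suc t := u))) \<in> borel_measurable borel" if "x \<in> space (path_space t)" for x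
    by (rule measurable_compose[OF measurable_path_upd_const[OF that] Suc.prems(2)])
  have fm': "(\<lambda>x. \<integral>\<^sup>+u. f (x(Suc t := u)) \<partial>\<kappa> t x) \<in> borel_measurable (path_space t)"
    by (rule nn_integral_kernel_measurable[OF \<kappa>[OF t]], unfold case_prod_beta',
        rule measurable_compose[OF measurable_path_upd Suc.prems(2)])
  have "(\<integral>\<^sup>+w. f (snd w) \<partial>A (Suc t)) = (\<integral>\<^sup>+w. \<integral>\<^sup>+v. f ((snd w)(Suc t := fst v)) \<partial>V t (fst w) (snd w) \<partial>A t)"
    using A_Suc[OF t measurable_compose[OF measurable_snd Suc.prems(2)]] by (simp only: snd_conv)
  also have "\<dots> = (\<integral>\<^sup>+w. \<integral>\<^sup>+u. f ((snd w)(Suc t := u)) \<partial>\<kappa> t (snd w) \<partial>A t)"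
    by (rule nn_integral_cong, rule nn_integral_V_\<kappa>[OF t _ fm]; rule A_spaceD[OF _ less_imp_le[OF t]])
  also have "\<dots> = (\<integral>\<^sup>+z. \<integral>\<^sup>+u. f ((restrict z {1..t})(Suc t := u)) \<partial>\<kappa> t (restrict z {1..t}) \<partial>\<mu>)"
    by (rule Suc.IH[OF _ fm']) (use t in simp)
  also have "\<dots> = (\<integral>\<^sup>+z. f ((restrict z {1..t})(Suc t := z (Suc t))) \<partial>\<mu>)"
    using nn_integral_\<mu>_kernel[OF t measurable_compose[OF measurable_path_upd Suc.prems(2)]]
    by (simp only: fst_conv snd_conv)
  also have "\<dots> = (\<integral>\<^sup>+z. f (restrict z {1..Suc t}) \<partial>\<mu>)"
    using t by (intro nn_integral_cong arg_cong[where f = f] path_restrict_upd[of _ T]) (simp add: space_\<mu>)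
  finally show ?case .
qed

text \<open>Later steps integrate to 1 because \<open>V\<close> is a probability measure. Truncating
  the list recovers the earlier history only almost surely, as \<open>A t\<close> lives on lists of
  all lengths.\<close>

lemma A_consistent:
  assumes "t \<le> s" "s \<le> T" "f \<in> borel_measurable (count_space UNIV \<Otimes>\<^sub>M path_space t)"
  shows "(\<integral>\<^sup>+w. f (take t (fst w), restrict (snd w) {1..t}) \<partial>A s) = (\<integral>\<^sup>+w. f w \<partial>A t)"
  using assms
proof (induction s rule: dec_induct)
  case base
  have "AE w in A t. f (take t (fst w), restrict (snd w) {1..t}) = f w"
    using AE_length[OF base(1)] AE_space by eventually_elim (use A_props(3)[OF base(1)] in auto)
  then show ?case by (rule nn_integral_cong_AE)
next
  case (step s)
  have s: "s < T" using step.prems by simp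
  have rm: "(\<lambda>x. restrict x {1..t}) \<in> path_space (Suc s) \<rightarrow>\<^sub>M path_space t"
    by (rule measurable_path_restrict) (use step in simp)
  have "(\<lambda>w. (take t (fst w), restrict (snd w) {1..t})) \<in> count_space (UNIV :: nat list set) \<Otimes>\<^sub>M path_space (Suc s) \<rightarrow>\<^sub>M count_space UNIV \<Otimes>\<^sub>M path_space t"
    by (intro measurable_Pair measurable_compose[OF measurable_snd rm] measurable_compose[OF measurable_fst]) simp
  from A_Suc[OF s measurable_compose[OF this step.prems(2)]]
  have "(\<integral>\<^sup>+w. f (take t (fst w), restrict (snd w) {1..t}) \<partial>A (Suc s)) =
      (\<integral>\<^sup>+w. \<integral>\<^sup>+v. f (take t (fst w @ [snd v]), restrict ((snd w)(Suc s := fst v)) {1..t}) \<partial>V s (fst w) (snd w) \<partial>A s)"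
    by (simp only: fst_conv snd_conv)
  also have "\<dots> = (\<integral>\<^sup>+w. f (take t (fst w), restrict (snd w) {1..t}) \<partial>A s)"
  proof (rule nn_integral_cong_AE)
    show "AE w in A s. (\<integral>\<^sup>+v. f (take t (fst w @ [snd v]), restrict ((snd w)(Suc s := fst v)) {1..t}) \<partial>V s (fst w) (snd w)) =
        f (take t (fst w), restrict (snd w) {1..t})"
      using AE_length[OF less_imp_le[OF s]] AE_space
    proof eventually_elim
      case (elim w)
      have x: "snd w \<in> space (path_space s)" by (rule A_spaceD[OF elim(2) less_imp_le[OF s]])
      interpret V: prob_space "V s (fst w) (snd w)" by (rule kernelD(1)[OF V_meas[OF s] x])
      have "take t (fst w @ [a]) = take t (fst w)" for a using elim step.hyps by simp
      moreover have "restrict ((snd w)(Suc s := u)) {1..t} = restrict (snd w) {1..t}" for u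
        by (rule restrict_path_upd[OF x]) (use step.hyps in simp)
      ultimately show ?case by (simp only: nn_integral_const V.emeasure_space_1 mult_1_right)
    qed
  qed
  also have "\<dots> = (\<integral>\<^sup>+w. f w \<partial>A t)"
    by (rule step.IH) (use s step.prems in auto)
  finally show ?case .
qed

text \<open>The simulated path together with a path drawn given its first \<open>t\<close> labels:
  the pair on which step \<open>t\<close> operates, completed to the full horizon so that it can
  serve as a coupling in \<open>modulus\<close>.\<close>

definition \<Theta> :: "nat \<Rightarrow> ((nat \<Rightarrow> real ^ 'd) \<times> (nat \<Rightarrow> real ^ 'd)) measure" where
  "\<Theta> t = A T \<bind> (\<lambda>w. distr (cm t (take t (fst w))) (path_space T \<Otimes>\<^sub>M path_space T) (\<lambda>z. (snd w, z)))"

lemma \<Theta>_kernel: "(\<lambda>w. distr (cm t (take t (fst w))) (path_space T \<Otimes>\<^sub>M path_space T) (\<lambda>z. (snd w, z))) \<in> A T \<rightarrow>\<^sub>M prob_algebra (path_space T \<Otimes>\<^sub>M path_space T)"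
  unfolding measurable_cong_sets[OF A_props(2)[OF order_refl] refl]
proof (rule measurable_pair_count_space1)
  fix c
  show "(\<lambda>x. distr (cm t (take t (fst (c, x)))) (path_space T \<Otimes>\<^sub>M path_space T) (\<lambda>z. (snd (c, x), z))) \<in> path_space T \<rightarrow>\<^sub>M prob_algebra (path_space T \<Otimes>\<^sub>M path_space T)"
    unfolding fst_conv snd_conv
  proof (rule measurable_distr_prob_space2[where M = "path_space T"])
    show "(\<lambda>x. cm t (take t c)) \<in> path_space T \<rightarrow>\<^sub>M prob_algebra (path_space T)"
      by (rule measurable_const) (simp add: space_prob_algebra prob_cm sets_\<mu>)
  qed simp
qed

lemma nn_integral_\<Theta>:
  assumes f: "f \<in> borel_measurable (path_space T \<Otimes>\<^sub>M path_space T)"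
  shows "(\<integral>\<^sup>+w. f w \<partial>\<Theta> t) = (\<integral>\<^sup>+w. \<integral>\<^sup>+z. f (snd w, z) \<partial>cm t (take t (fst w)) \<partial>A T)"
proof -
  have "(\<integral>\<^sup>+w. f w \<partial>\<Theta> t) = (\<integral>\<^sup>+w. \<integral>\<^sup>+v. f v \<partial>distr (cm t (take t (fst w))) (path_space T \<Otimes>\<^sub>M path_space T) (\<lambda>z. (snd w, z)) \<partial>A T)"
    unfolding \<Theta>_def by (rule nn_integral_bind[OF f measurable_prob_algebraD[OF \<Theta>_kernel]])
  also have "\<dots> = (\<integral>\<^sup>+w. \<integral>\<^sup>+z. f (snd w, z) \<partial>cm t (take t (fst w)) \<partial>A T)"
  proof (rule nn_integral_cong)
    fix w assume "w \<in> space (A T)"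
    then have "snd w \<in> space (path_space T)" by (rule A_spaceD) simp
    then have "(\<lambda>z. (snd w, z)) \<in> cm t (take t (fst w)) \<rightarrow>\<^sub>M path_space T \<Otimes>\<^sub>M path_space T"
      using measurable_Pair1'[of "snd w" "path_space T" "path_space T"] by (simp cong: measurable_cong_sets add: sets_\<mu>)
    then show "(\<integral>\<^sup>+v. f v \<partial>distr (cm t (take t (fst w))) (path_space T \<Otimes>\<^sub>M path_space T) (\<lambda>z. (snd w, z))) = (\<integral>\<^sup>+z. f (snd w, z) \<partial>cm t (take t (fst w)))"
      by (rule nn_integral_distr) (use f in simp)
  qed
  finally show ?thesis .
qed

lemma sets_\<Theta>: "sets (\<Theta> t) = sets (path_space T \<Otimes>\<^sub>M path_space T)"
  unfolding \<Theta>_def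
  by (rule sets_bind) (auto simp: prob_space.not_empty[OF A_props(1)[OF order_refl]])

text \<open>The first marginal is \<open>path_law\<close>. For the second, the labels have the law
  of the label history under \<open>\<mu>\<close>, so drawing a path given them reproduces
  \<open>\<mu>\<close> by the tower property.\<close>

lemma \<Theta>_couplings:
  assumes t: "t \<le> T" shows "\<Theta> t \<in> couplings \<mu> \<mu>"
proof (rule couplingsI)
  show "sets (\<Theta> t) = sets (\<mu> \<Otimes>\<^sub>M \<mu>)"
    unfolding sets_\<Theta> by (rule sets_pair_measure_cong[symmetric]) (rule sets_\<mu>)+
  fix B assume B: "B \<in> sets \<mu>"
  then have B' [measurable]: "B \<in> sets (path_space T)" by (simp add: sets_\<mu>)
  have "(\<integral>\<^sup>+w. indicator B (fst w) \<partial>\<Theta> t) = (\<integral>\<^sup>+w. \<integral>\<^sup>+z. indicator B (snd w) \<partial>cm t (take t (fst w)) \<partial>A T)"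
    by (subst nn_integral_\<Theta>) simp_all
  also have "\<dots> = (\<integral>\<^sup>+w. indicator B (snd w) \<partial>A T)"
    using prob_space.emeasure_space_1[OF prob_cm] by simp
  also have "\<dots> = (\<integral>\<^sup>+z. indicator B (restrict z {1..T}) \<partial>\<mu>)"
    by (rule path_law) auto
  also have "\<dots> = (\<integral>\<^sup>+z. indicator B z \<partial>\<mu>)"
    by (intro nn_integral_cong) (simp add: space_\<mu>)
  finally show "(\<integral>\<^sup>+w. indicator B (fst w) \<partial>\<Theta> t) = emeasure \<mu> B" using B by simp
  have "(\<integral>\<^sup>+w. indicator B (snd w) \<partial>\<Theta> t) = (\<integral>\<^sup>+w. \<integral>\<^sup>+z. indicator B z \<partial>cm t (take t (fst w)) \<partial>A T)"
    by (subst nn_integral_\<Theta>) simp_all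
  also have "\<dots> = (\<integral>\<^sup>+z'. \<integral>\<^sup>+z. indicator B z \<partial>cm t (take t (hist Q T z')) \<partial>\<mu>)"
    by (rule label_law) simp
  also have "\<dots> = (\<integral>\<^sup>+z'. \<integral>\<^sup>+z. indicator B z \<partial>cm t (hist Q t z') \<partial>\<mu>)"
    by (simp only: take_hist[OF t])
  also have "\<dots> = (\<integral>\<^sup>+z. indicator B z \<partial>\<mu>)"
    by (rule nn_integral_label_mixture[OF t]) (use B in simp)
  finally show "(\<integral>\<^sup>+w. indicator B (snd w) \<partial>\<Theta> t) = emeasure \<mu> B" using B by simp
qed

lemma AE_\<Theta>_labels:
  assumes t: "t \<le> T"
  shows "AE w in A T. AE z in cm t (take t (fst w)). hist Q t z = take t (fst w)"
proof (rule AE_label[OF order_refl])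
  show "AE z in \<mu>. AE z' in cm t (take t (hist Q T z)). hist Q t z' = take t (hist Q T z)"
    unfolding take_hist[OF t] cm_def by (rule AE_cond_on_eq[OF hist_meas[OF t]])
qed

end

text \<open>\<open>\<epsilon>\<close> is the defect of optimality of \<open>\<Gamma>\<close>,
  \<open>\<eta>\<close> the radius of the cells and \<open>q\<close> their representatives.
  \<open>h\<close> abstracts the iterated moduli through \<open>continuity\<close>, which Hoelder
  bounds satisfy as well. The condition on \<open>\<sigma>\<close> leaves room for the strict
  inequality in the premise of \<open>continuity\<close>.\<close>

locale labelled_cost = labelled T \<mu> \<kappa> Q \<Gamma> A
  for T :: nat and \<mu> :: "(nat \<Rightarrow> real ^ 'd :: finite) measure" and \<kappa> Q \<Gamma> A +
  fixes p \<epsilon> \<eta> B \<sigma> :: real and q :: "nat \<Rightarrow> nat \<Rightarrow> real ^ 'd" and h :: "nat \<Rightarrow> ennreal"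
  assumes p: "p \<ge> 1" and \<epsilon>: "\<epsilon> \<ge> 0" and \<eta>: "\<eta> \<ge> 0"
    and q: "\<And>s u. dist (q s (Q s u)) u \<le> \<eta>"
    and bounded: "AE z in \<mu>. \<forall>s\<in>{1..T}. norm (z s) \<le> B"
    and \<Gamma>_cost: "\<And>t x z. t < T \<Longrightarrow> x \<in> space (path_space t) \<Longrightarrow> z \<in> space (path_space t) \<Longrightarrow>
       AE u in \<kappa> t x. norm u \<le> B \<Longrightarrow> AE u in \<kappa> t z. norm u \<le> B \<Longrightarrow>
       Lnorm p (\<Gamma> t (x, z)) (\<lambda>(u, w). ennreal (dist u w)) \<le> wasserstein dist p (\<kappa> t x) (\<kappa> t z) + ennreal \<epsilon>"
    and \<sigma>: "real T * (\<epsilon> + 2 * \<eta>) < \<sigma>"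
    and h_0: "h 0 = ennreal \<sigma>" and h_finite: "\<And>t. t < T \<Longrightarrow> h t < \<top>"
    and continuity: "\<And>t \<pi>. t \<in> {1..<T} \<Longrightarrow> \<pi> \<in> couplings \<mu> \<mu> \<Longrightarrow>
       Lnorm p \<pi> (\<lambda>w. ennreal (path_dist t (fst w) (snd w))) < (\<Sum>s<t. h s) \<Longrightarrow>
       Lnorm p \<pi> (\<lambda>w. wasserstein dist p (\<kappa> t (restrict (fst w) {1..t})) (\<kappa> t (restrict (snd w) {1..t}))) \<le> h t"
begin

text \<open>Disintegration of the null event that the next position exceeds
  \<open>B\<close>.\<close>

lemma AE_kernel_bounded:
  assumes t: "t < T"
  shows "AE z in \<mu>. AE u in \<kappa> t (restrict z {1..t}). norm u \<le> B"
proof -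
  have tT: "t \<le> T" using t by simp
  have I [measurable]: "(\<lambda>w. indicator {w. B < norm (snd w)} w :: ennreal) \<in> borel_measurable (path_space t \<Otimes>\<^sub>M (borel :: (real ^ 'd) measure))"
  proof -
    have "(\<lambda>w. indicator {u. B < norm u} (snd w) :: ennreal) \<in> borel_measurable (path_space t \<Otimes>\<^sub>M (borel :: (real ^ 'd) measure))"
      by (rule measurable_compose[OF measurable_snd]) measurable
    then show ?thesis by (simp add: indicator_def)
  qed
  have "(\<integral>\<^sup>+z. \<integral>\<^sup>+u. indicator {w. B < norm (snd w)} (restrict z {1..t}, u) \<partial>\<kappa> t (restrict z {1..t}) \<partial>\<mu>) =
      (\<integral>\<^sup>+z. indicator {w. B < norm (snd w)} (restrict z {1..t}, z (Suc t)) \<partial>\<mu>)"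
    by (rule nn_integral_\<mu>_kernel[OF t I, symmetric])
  also have "\<dots> = (\<integral>\<^sup>+z. 0 \<partial>\<mu>)"
    using bounded
  proof (intro nn_integral_cong_AE, eventually_elim)
    case (elim z)
    have "Suc t \<in> {1..T}" using t by simp
    with elim have "norm (z (Suc t)) \<le> B" by blast
    then show ?case by (simp add: indicator_def)
  qed
  finally have "(\<integral>\<^sup>+z. \<integral>\<^sup>+u. indicator {w. B < norm (snd w)} (restrict z {1..t}, u) \<partial>\<kappa> t (restrict z {1..t}) \<partial>\<mu>) = 0" by simp
  moreover have "(\<lambda>z. \<integral>\<^sup>+u. indicator {w. B < norm (snd w)} (restrict z {1..t}, u) \<partial>\<kappa> t (restrict z {1..t})) \<in> borel_measurable \<mu>"
    by (rule measurable_compose[OF restrict_meas[OF tT], of "\<lambda>x. \<integral>\<^sup>+u. indicator {w. B < norm (snd w)} (x, u) \<partial>\<kappa> t x"],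
        rule nn_integral_kernel_measurable[OF \<kappa>[OF t]]) (use I in \<open>simp add: case_prod_beta'\<close>)
  ultimately have "AE z in \<mu>. (\<integral>\<^sup>+u. indicator {w. B < norm (snd w)} (restrict z {1..t}, u) \<partial>\<kappa> t (restrict z {1..t})) = 0"
    by (simp add: nn_integral_0_iff_AE)
  then show ?thesis
  proof eventually_elim
    case (elim z)
    have "(\<lambda>u. indicator {w. B < norm (snd w)} (restrict z {1..t}, u) :: ennreal) \<in> borel_measurable (\<kappa> t (restrict z {1..t}))"
      unfolding measurable_cong_sets[OF kernelD(2)[OF \<kappa>[OF t] restrict_in_path_space] refl]
      by (rule measurable_compose[OF measurable_Pair1'[OF restrict_in_path_space] I])
    with elim have "AE u in \<kappa> t (restrict z {1..t}). (indicator {w. B < norm (snd w)} (restrict z {1..t}, u) :: ennreal) = 0"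
      by (simp add: nn_integral_0_iff_AE)
    then show ?case by eventually_elim (auto simp: indicator_def split: if_splits)
  qed
qed

text \<open>The index is shifted: step \<open>t\<close> produces the position at time
  \<open>Suc t\<close> and entry \<open>t\<close> of the label list.\<close>

definition err :: "nat \<Rightarrow> ennreal" where
  "err t = Lnorm p (A T) (\<lambda>w. ennreal (dist (snd w (Suc t)) (q (Suc t) (fst w ! t))))"

text \<open>A measurable stand-in for the Wasserstein distance of the two kernels: it is obtained
  from an integral against a measurable kernel, and near-optimality of \<open>\<Gamma>\<close> puts
  it below that distance for almost all pairs.\<close>

definition gap :: "nat \<Rightarrow> (nat \<Rightarrow> real ^ 'd) \<times> (nat \<Rightarrow> real ^ 'd) \<Rightarrow> ennreal" where
  "gap t w = Lnorm p (\<Gamma> t (restrict (fst w) {1..t}, restrict (snd w) {1..t})) (\<lambda>v. ennreal (dist (fst v) (snd v))) - ennreal \<epsilon>"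

lemma restrict_pair_meas:
  assumes "t \<le> T"
  shows "(\<lambda>w. (restrict (fst w) {1..t}, restrict (snd w) {1..t})) \<in> path_space T \<Otimes>\<^sub>M path_space T \<rightarrow>\<^sub>M path_space t \<Otimes>\<^sub>M path_space t"
  by (intro measurable_Pair measurable_compose[OF _ measurable_path_restrict[OF assms]]) simp_all

lemma gap_meas: assumes t: "t < T" shows "gap t \<in> borel_measurable (path_space T \<Otimes>\<^sub>M path_space T)"
proof -
  have "(\<lambda>w. \<integral>\<^sup>+v. epowr (ennreal (dist (fst v) (snd v))) p \<partial>\<Gamma> t w) \<in> borel_measurable (path_space t \<Otimes>\<^sub>M path_space t)"
    by (rule nn_integral_kernel_measurable[OF \<Gamma>[OF t]]) measurable
  from measurable_compose[OF restrict_pair_meas[OF less_imp_le[OF t]] this]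
  show ?thesis unfolding gap_def[abs_def] Lnorm_def by measurable
qed

lemma \<Gamma>_sets: "t < T \<Longrightarrow> sets (\<Gamma> t (restrict x {1..t}, restrict z {1..t})) = sets (borel \<Otimes>\<^sub>M borel)"
  by (rule kernelD(2)[OF \<Gamma>]) (auto simp: space_pair_measure restrict_in_path_space)

lemma \<Gamma>_prob: "t < T \<Longrightarrow> prob_space (\<Gamma> t (restrict x {1..t}, restrict z {1..t}))"
  by (rule kernelD(1)[OF \<Gamma>]) (auto simp: space_pair_measure restrict_in_path_space)

text \<open>Given the past and \<open>z\<close>, position and label come from one draw of
  \<open>\<Gamma>\<close>, so their distance is at most that of the two components plus
  \<open>\<eta>\<close>. Averaging over past and \<open>z\<close> is integration over
  \<open>\<Theta> t\<close>, where Minkowski's inequality separates the tolerances.\<close>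

lemma err_le_gap:
  assumes t: "t < T"
  shows "err t \<le> Lnorm p (\<Theta> t) (gap t) + ennreal (\<epsilon> + \<eta>)"
proof -
  interpret \<Theta>: prob_space "\<Theta> t"
    by (rule prob_space_coupling[OF \<Theta>_couplings prob_space_axioms]) (use t in simp)
  have p0: "p > 0" using p by simp
  have tT: "t \<le> T" using t by simp
  let ?d = "\<lambda>v. ennreal (dist (fst v) (q (Suc t) (Q (Suc t) (snd v))))"
  have [measurable]: "(\<lambda>v. q (Suc t) (Q (Suc t) v)) \<in> borel_measurable borel"
    by (rule measurable_compose[OF Q]) simp
  have [measurable]: "?d \<in> borel_measurable (borel \<Otimes>\<^sub>M borel)" by measurable
  let ?f = "\<lambda>w. epowr (ennreal (dist (snd w (Suc t)) (q (Suc t) (fst w ! t)))) p"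
  have fm: "?f \<in> borel_measurable (count_space UNIV \<Otimes>\<^sub>M path_space (Suc t))"
  proof (rule measurable_pair_count_space1)
    fix c
    have [measurable]: "(\<lambda>x. x (Suc t)) \<in> path_space (Suc t) \<rightarrow>\<^sub>M (borel :: (real ^ 'd) measure)"
      by (rule measurable_path_component) simp
    show "(\<lambda>x. ?f (c, x)) \<in> borel_measurable (path_space (Suc t))" by simp
  qed
  have dV: "(\<lambda>v. epowr (ennreal (dist (fst v) (q (Suc t) (snd v)))) p) \<in> borel_measurable (borel \<Otimes>\<^sub>M count_space UNIV)"
    by (rule measurable_pair_count_space2) simp
  have gap_int_meas: "(\<lambda>z. epowr (gap t (x, z) + ennreal (\<epsilon> + \<eta>)) p) \<in> borel_measurable (path_space T)" if "x \<in> space (path_space T)" for x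
    using measurable_compose[OF measurable_Pair1'[OF that] gap_meas[OF t]] by simp
  have pw: "(\<integral>\<^sup>+v. epowr (?d v) p \<partial>\<Gamma> t (restrict x {1..t}, restrict z {1..t})) \<le> epowr (gap t (x, z) + ennreal (\<epsilon> + \<eta>)) p" for x z
  proof -
    interpret G: prob_space "\<Gamma> t (restrict x {1..t}, restrict z {1..t})" by (rule \<Gamma>_prob[OF t])
    note [measurable_cong] = \<Gamma>_sets[OF t, of x z]
    have "Lnorm p (\<Gamma> t (restrict x {1..t}, restrict z {1..t})) ?d \<le>
        Lnorm p (\<Gamma> t (restrict x {1..t}, restrict z {1..t})) (\<lambda>v. ennreal (dist (fst v) (snd v)) + ennreal \<eta>)"
    proof (rule Lnorm_mono)
      fix v :: "(real ^ 'd) \<times> (real ^ 'd)"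
      have "dist (fst v) (q (Suc t) (Q (Suc t) (snd v))) \<le> dist (fst v) (snd v) + \<eta>"
        using dist_triangle[of "fst v" "q (Suc t) (Q (Suc t) (snd v))" "snd v"] q[of "Suc t" "snd v"] by (simp add: dist_commute)
      then show "?d v \<le> ennreal (dist (fst v) (snd v)) + ennreal \<eta>"
        using \<eta> by (simp flip: ennreal_plus)
    qed (use p in simp)
    also have "\<dots> \<le> Lnorm p (\<Gamma> t (restrict x {1..t}, restrict z {1..t})) (\<lambda>v. ennreal (dist (fst v) (snd v))) + ennreal \<eta>"
      by (rule G.Lnorm_add_const[OF p]) measurable
    also have "\<dots> \<le> gap t (x, z) + ennreal \<epsilon> + ennreal \<eta>"
      unfolding gap_def fst_conv snd_conv
      by (intro add_right_mono le_diff_add_ennreal)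
    also have "\<dots> = gap t (x, z) + ennreal (\<epsilon> + \<eta>)" using \<epsilon> \<eta> by (simp add: add.assoc)
    finally show ?thesis by (simp only: Lnorm_le_iff[OF p0])
  qed
  have "(\<integral>\<^sup>+w. epowr (ennreal (dist (snd w (Suc t)) (q (Suc t) (fst w ! t)))) p \<partial>A T) = (\<integral>\<^sup>+w. ?f (take (Suc t) (fst w), restrict (snd w) {1..Suc t}) \<partial>A T)"
    by simp
  also have "\<dots> = (\<integral>\<^sup>+w. ?f w \<partial>A (Suc t))"
    by (rule A_consistent[OF _ order_refl fm]) (use t in simp)
  also have "\<dots> = (\<integral>\<^sup>+w. \<integral>\<^sup>+v. ?f (fst w @ [snd v], (snd w)(Suc t := fst v)) \<partial>V t (fst w) (snd w) \<partial>A t)"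
    by (rule A_Suc[OF t fm])
  also have "\<dots> = (\<integral>\<^sup>+w. \<integral>\<^sup>+v. epowr (ennreal (dist (fst v) (q (Suc t) (snd v)))) p \<partial>V t (fst w) (snd w) \<partial>A t)"
    using AE_length[OF tT]
    by (intro nn_integral_cong_AE) (auto elim!: eventually_mono simp: nth_append)
  \<comment> \<open>Back to horizon \<open>T\<close>, since \<open>\<Theta> t\<close> is built over
    \<open>A T\<close>.\<close>
  also have "\<dots> = (\<integral>\<^sup>+w. (\<lambda>w. \<integral>\<^sup>+v. epowr (ennreal (dist (fst v) (q (Suc t) (snd v)))) p \<partial>V t (fst w) (snd w)) (take t (fst w), restrict (snd w) {1..t}) \<partial>A T)"
  proof (rule A_consistent[OF tT order_refl, symmetric], rule measurable_pair_count_space1)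
    fix c
    show "(\<lambda>x. \<integral>\<^sup>+v. epowr (ennreal (dist (fst v) (q (Suc t) (snd v)))) p \<partial>V t (fst (c, x)) (snd (c, x))) \<in> borel_measurable (path_space t)"
      unfolding fst_conv snd_conv
      by (rule nn_integral_kernel_measurable[OF V_meas[OF t]])
        (use measurable_compose[OF measurable_snd dV] in \<open>simp add: case_prod_beta'\<close>)
  qed
  also have "\<dots> = (\<integral>\<^sup>+w. \<integral>\<^sup>+z. \<integral>\<^sup>+v. epowr (?d v) p \<partial>\<Gamma> t (restrict (snd w) {1..t}, restrict z {1..t}) \<partial>cm t (take t (fst w)) \<partial>A T)"
    using nn_integral_V[OF t restrict_in_path_space dV] by simp
  also have "\<dots> \<le> (\<integral>\<^sup>+w. \<integral>\<^sup>+z. epowr (gap t (snd w, z) + ennreal (\<epsilon> + \<eta>)) p \<partial>cm t (take t (fst w)) \<partial>A T)"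
    by (intro nn_integral_mono pw)
  also have "\<dots> = (\<integral>\<^sup>+w. epowr (gap t w + ennreal (\<epsilon> + \<eta>)) p \<partial>\<Theta> t)"
    using gap_meas[OF t] by (subst nn_integral_\<Theta>) auto
  finally have "err t \<le> Lnorm p (\<Theta> t) (\<lambda>w. gap t w + ennreal (\<epsilon> + \<eta>))"
    unfolding err_def Lnorm_def using p0 by (intro epowr_mono) auto
  also have "\<dots> \<le> Lnorm p (\<Theta> t) (gap t) + ennreal (\<epsilon> + \<eta>)"
    using gap_meas[OF t] by (intro \<Theta>.Lnorm_add_const[OF p]) (simp cong: measurable_cong_sets add: sets_\<Theta>)
  finally show ?thesis .
qed

lemma AE_gap_le:
  assumes t: "t < T"
  shows "AE w in \<Theta> t. gap t w \<le> wasserstein dist p (\<kappa> t (restrict (fst w) {1..t})) (\<kappa> t (restrict (snd w) {1..t}))"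
proof -
  have tT: "t \<le> T" using t by simp
  from AE_coupling_fst[OF \<Theta>_couplings[OF tT] AE_kernel_bounded[OF t]]
    AE_coupling_snd[OF \<Theta>_couplings[OF tT] AE_kernel_bounded[OF t]]
  show ?thesis
  proof eventually_elim
    case (elim w)
    from \<Gamma>_cost[OF t restrict_in_path_space restrict_in_path_space elim]
    show ?case by (simp add: gap_def ennreal_minus_le_iff case_prod_beta' add.commute)
  qed
qed

text \<open>The second path almost surely has the same first \<open>t\<close> labels, so at each of
  these times it lies within \<open>\<eta>\<close> of the representative whose distance from the
  simulated position is measured by \<open>err\<close>. This closes the recursion for the
  errors.\<close>

lemma Lnorm_path_dist_\<Theta>:
  assumes t: "t < T"
  shows "Lnorm p (\<Theta> t) (\<lambda>w. ennreal (path_dist t (fst w) (snd w))) \<le> (\<Sum>s<t. err s + ennreal \<eta>)"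
proof -
  interpret \<Theta>: prob_space "\<Theta> t"
    by (rule prob_space_coupling[OF \<Theta>_couplings prob_space_axioms]) (use t in simp)
  have p0: "p > 0" using p by simp
  have tT: "t \<le> T" using t by simp
  let ?h = "\<lambda>s w. ennreal (dist (fst w (Suc s)) (q (Suc s) (Q (Suc s) (snd w (Suc s)))))"
  have hm: "?h s \<in> borel_measurable (path_space T \<Otimes>\<^sub>M path_space T)" if "s < t" for s
  proof -
    have c: "(\<lambda>x. x (Suc s)) \<in> path_space T \<rightarrow>\<^sub>M (borel :: (real ^ 'd) measure)"
      by (rule measurable_path_component) (use that t in simp)
    have [measurable]: "(\<lambda>w. fst w (Suc s)) \<in> path_space T \<Otimes>\<^sub>M path_space T \<rightarrow>\<^sub>M (borel :: (real ^ 'd) measure)"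
      by (rule measurable_compose[OF measurable_fst c])
    have "(\<lambda>u. q (Suc s) (Q (Suc s) u)) \<in> borel \<rightarrow>\<^sub>M borel" by (rule measurable_compose[OF Q]) simp
    then have [measurable]: "(\<lambda>w. q (Suc s) (Q (Suc s) (snd w (Suc s)))) \<in> path_space T \<Otimes>\<^sub>M path_space T \<rightarrow>\<^sub>M (borel :: (real ^ 'd) measure)"
      by (rule measurable_compose[OF measurable_compose[OF measurable_snd c]])
    show ?thesis by measurable
  qed
  have hm': "?h s \<in> borel_measurable (\<Theta> t)" if "s < t" for s
    unfolding measurable_cong_sets[OF sets_\<Theta> refl] by (rule hm[OF that])
  have h_err: "Lnorm p (\<Theta> t) (?h s) = err s" if s: "s < t" for s
  proof -
    have "(\<integral>\<^sup>+w. epowr (?h s w) p \<partial>\<Theta> t) = (\<integral>\<^sup>+w. \<integral>\<^sup>+z. epowr (?h s (snd w, z)) p \<partial>cm t (take t (fst w)) \<partial>A T)"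
      by (rule nn_integral_\<Theta>) (use hm[OF s] in measurable)
    also have "\<dots> = (\<integral>\<^sup>+w. epowr (ennreal (dist (snd w (Suc s)) (q (Suc s) (fst w ! s)))) p \<partial>A T)"
    proof (rule nn_integral_cong_AE)
      show "AE w in A T. (\<integral>\<^sup>+z. epowr (?h s (snd w, z)) p \<partial>cm t (take t (fst w))) = epowr (ennreal (dist (snd w (Suc s)) (q (Suc s) (fst w ! s)))) p"
        using AE_\<Theta>_labels[OF tT]
      proof eventually_elim
        case (elim w)
        have "(\<integral>\<^sup>+z. epowr (?h s (snd w, z)) p \<partial>cm t (take t (fst w))) =
            (\<integral>\<^sup>+z. epowr (ennreal (dist (snd w (Suc s)) (q (Suc s) (fst w ! s)))) p \<partial>cm t (take t (fst w)))"
          using elim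
        proof (intro nn_integral_cong_AE, eventually_elim)
          case (elim z)
          have "Q (Suc s) (z (Suc s)) = hist Q t z ! s" by (rule nth_hist[OF s, symmetric])
          also have "\<dots> = fst w ! s" using elim s by simp
          finally show ?case by simp
        qed
        then show ?case using prob_space.emeasure_space_1[OF prob_cm] by simp
      qed
    qed
    finally show ?thesis by (simp add: Lnorm_def err_def)
  qed
  have "Lnorm p (\<Theta> t) (\<lambda>w. ennreal (path_dist t (fst w) (snd w))) \<le> Lnorm p (\<Theta> t) (\<lambda>w. \<Sum>s<t. ?h s w + ennreal \<eta>)"
  proof (rule Lnorm_mono)
    fix w :: "(nat \<Rightarrow> real ^ 'd) \<times> (nat \<Rightarrow> real ^ 'd)"
    have "path_dist t (fst w) (snd w) \<le> (\<Sum>s\<in>{1..t}. dist (fst w s) (snd w s))" by (rule path_dist_le_sum)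
    also have "\<dots> = (\<Sum>s<t. dist (fst w (Suc s)) (snd w (Suc s)))"
      by (rule sum.reindex_bij_witness[of _ Suc "\<lambda>s. s - 1"]) auto
    also have "\<dots> \<le> (\<Sum>s<t. dist (fst w (Suc s)) (q (Suc s) (Q (Suc s) (snd w (Suc s)))) + \<eta>)"
    proof (rule sum_mono)
      fix s
      show "dist (fst w (Suc s)) (snd w (Suc s)) \<le> dist (fst w (Suc s)) (q (Suc s) (Q (Suc s) (snd w (Suc s)))) + \<eta>"
        using dist_triangle[of "fst w (Suc s)" "snd w (Suc s)" "q (Suc s) (Q (Suc s) (snd w (Suc s)))"] q[of "Suc s" "snd w (Suc s)"] by simp
    qed
    finally have "ennreal (path_dist t (fst w) (snd w)) \<le> ennreal (\<Sum>s<t. dist (fst w (Suc s)) (q (Suc s) (Q (Suc s) (snd w (Suc s)))) + \<eta>)"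
      by (rule ennreal_leI)
    also have "\<dots> = (\<Sum>s<t. ?h s w + ennreal \<eta>)"
      using \<eta> by (subst sum_ennreal[symmetric]) auto
    finally show "ennreal (path_dist t (fst w) (snd w)) \<le> (\<Sum>s<t. ?h s w + ennreal \<eta>)" .
  qed (use p in simp)
  also have "\<dots> \<le> (\<Sum>s<t. Lnorm p (\<Theta> t) (\<lambda>w. ?h s w + ennreal \<eta>))"
    using hm' by (intro Lnorm_sum[OF p]) auto
  also have "\<dots> \<le> (\<Sum>s<t. err s + ennreal \<eta>)"
    using h_err hm' by (intro sum_mono order_trans[OF \<Theta>.Lnorm_add_const[OF p]]) auto
  finally show ?thesis .
qed

text \<open>The first step compares a kernel with itself, so \<open>h 0 = \<sigma>\<close> is not
  spent there and remains as slack for all later steps.\<close>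

definition err_bound :: "nat \<Rightarrow> ennreal" where
  "err_bound t = (if t = 0 then 0 else h t)"

text \<open>Strong induction: the earlier errors bound the distance of the pair under
  \<open>\<Theta> t\<close>, \<open>continuity\<close> turns this into a bound on the distance of
  the kernels, and \<open>err_le_gap\<close> into one on the next error.\<close>

theorem err_le:
  assumes "t < T"
  shows "err t \<le> err_bound t + ennreal (\<epsilon> + \<eta>)"
  using assms
proof (induction t rule: less_induct)
  case (less t)
  have p0: "p > 0" using p by simp
  show ?case
  proof (cases "t = 0")
    case True
    have "Lnorm p (\<Theta> t) (gap t) \<le> Lnorm p (\<Theta> t) (\<lambda>_. 0)"
    proof (rule Lnorm_mono_AE)
      show "AE w in \<Theta> t. gap t w \<le> 0"
        using AE_gap_le[OF less.prems]
      proof eventually_elim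
        case (elim w)
        have r0: "restrict x {1..t} = (\<lambda>_. undefined)" for x :: "nat \<Rightarrow> real ^ 'd" using True by (auto simp: restrict_def)
        have "(\<lambda>_. undefined) \<in> space (path_space t)" using True by (simp add: path_space_0)
        from wasserstein_self[OF p0 kernelD(1,2)[OF \<kappa>[OF less.prems] this]] elim
        show ?case by (simp add: r0)
      qed
    qed (use p in simp)
    also have "\<dots> = 0" by (simp add: Lnorm_def)
    finally have "Lnorm p (\<Theta> t) (gap t) = 0" by simp
    with err_le_gap[OF less.prems] show ?thesis by (simp add: err_bound_def True)
  next
    case False
    have \<sigma>0: "\<sigma> > 0" using \<sigma> \<epsilon> \<eta> by (smt (verit) mult_nonneg_nonneg of_nat_0_le_iff)
    have "(\<Sum>s<t. err s + ennreal \<eta>) \<le> (\<Sum>s<t. err_bound s + ennreal (\<epsilon> + 2 * \<eta>))"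
    proof (rule sum_mono)
      fix s assume "s \<in> {..<t}"
      then have "err s \<le> err_bound s + ennreal (\<epsilon> + \<eta>)" using less by auto
      then have "err s + ennreal \<eta> \<le> err_bound s + ennreal (\<epsilon> + \<eta>) + ennreal \<eta>" by (rule add_right_mono)
      also have "\<dots> = err_bound s + ennreal (\<epsilon> + 2 * \<eta>)" using \<epsilon> \<eta> by (simp add: add.assoc flip: ennreal_plus)
      finally show "err s + ennreal \<eta> \<le> err_bound s + ennreal (\<epsilon> + 2 * \<eta>)" .
    qed
    also have "\<dots> = (\<Sum>s<t. err_bound s) + ennreal (real t * (\<epsilon> + 2 * \<eta>))"
      using \<epsilon> \<eta> by (simp add: sum.distrib ennreal_mult ennreal_of_nat_eq_real_of_nat)
    \<comment> \<open>The unspent \<open>\<sigma>\<close> strictly exceeds the accumulated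
      tolerances; finiteness of the other summands preserves strictness.\<close>
    also have "\<dots> < (\<Sum>s<t. err_bound s) + ennreal \<sigma>"
    proof -
      have "real t * (\<epsilon> + 2 * \<eta>) \<le> real T * (\<epsilon> + 2 * \<eta>)" using less.prems \<epsilon> \<eta> by (intro mult_right_mono) auto
      then have lt: "real t * (\<epsilon> + 2 * \<eta>) < \<sigma>" using \<sigma> by simp
      have "err_bound s < \<top>" if "s < t" for s using h_finite[of s] that less.prems by (simp add: err_bound_def)
      then have "(\<Sum>s<t. err_bound s) < \<top>" by simp
      then obtain r where r: "(\<Sum>s<t. err_bound s) = ennreal r" "r \<ge> 0" by (cases "\<Sum>s<t. err_bound s") auto
      show ?thesis unfolding r(1) using r(2) lt \<epsilon> \<eta> \<sigma>0 by (simp flip: ennreal_plus add: ennreal_less_iff)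
    qed
    also have "\<dots> = (\<Sum>s<t. h s)"
    proof -
      obtain t' where t': "t = Suc t'" using False by (cases t) auto
      show ?thesis unfolding t' using h_0 by (simp add: sum.lessThan_Suc_shift err_bound_def add.commute del: sum.lessThan_Suc)
    qed
    finally have "Lnorm p (\<Theta> t) (\<lambda>w. ennreal (path_dist t (fst w) (snd w))) < (\<Sum>s<t. h s)"
      using Lnorm_path_dist_\<Theta>[OF less.prems] by (rule le_less_trans[rotated])
    from continuity[OF _ \<Theta>_couplings this]
    have "Lnorm p (\<Theta> t) (\<lambda>w. wasserstein dist p (\<kappa> t (restrict (fst w) {1..t})) (\<kappa> t (restrict (snd w) {1..t}))) \<le> err_bound t"
      using False less.prems by (simp add: err_bound_def)
    moreover have "Lnorm p (\<Theta> t) (gap t) \<le> Lnorm p (\<Theta> t) (\<lambda>w. wasserstein dist p (\<kappa> t (restrict (fst w) {1..t})) (\<kappa> t (restrict (snd w) {1..t})))"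
      using p by (intro Lnorm_mono_AE AE_gap_le[OF less.prems]) simp
    ultimately show ?thesis
      using err_le_gap[OF less.prems] by (meson add_right_mono order_trans)
  qed
qed

end

section \<open>Agreement of the labels\<close>

lemma nn_integral_discrete:
  fixes f :: "'g :: countable \<Rightarrow> ennreal"
  assumes "sets M = UNIV"
  shows "(\<integral>\<^sup>+a. f a \<partial>M) = (\<integral>\<^sup>+a. f a * emeasure M {a} \<partial>count_space UNIV)"
proof -
  have "sets M = sets (count_space UNIV)" using assms by simp
  note m = measurable_cong_sets[OF this refl]
  have "(\<integral>\<^sup>+a. f a \<partial>M) = (\<integral>\<^sup>+a. (\<integral>\<^sup>+\<omega>. f \<omega> * indicator {a} \<omega> \<partial>M) \<partial>count_space UNIV)"
    by (rule nn_integral_split_countable) (simp_all add: m)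
  also have "\<dots> = (\<integral>\<^sup>+a. (\<integral>\<^sup>+\<omega>. f a * indicator {a} \<omega> \<partial>M) \<partial>count_space UNIV)"
    by (intro nn_integral_cong) (auto split: split_indicator)
  also have "\<dots> = (\<integral>\<^sup>+a. f a * emeasure M {a} \<partial>count_space UNIV)"
    using assms by (intro nn_integral_cong nn_integral_cmult_indicator) auto
  finally show ?thesis .
qed

lemma pair_count_space:
  "count_space (UNIV :: 'a :: countable set) \<Otimes>\<^sub>M count_space (UNIV :: 'b :: countable set) = count_space UNIV"
  by (subst pair_measure_countable) auto

text \<open>The common mass stays on the diagonal. The two excesses both have total mass
  \<open>D\<close> and are coupled by their normalised product.\<close>

lemma maximal_coupling:
  fixes M N :: "'g :: countable measure"
  assumes M: "prob_space M" "sets M = UNIV" and N: "prob_space N" "sets N = UNIV"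
  shows "\<exists>r\<in>couplings M N. \<forall>a. min (emeasure M {a}) (emeasure N {a}) \<le> emeasure r {(a, a)}"
proof -
  interpret M: prob_space M by fact
  interpret N: prob_space N by fact
  define l where "l a = min (emeasure M {a}) (emeasure N {a})" for a
  define D where "D = 1 - (\<integral>\<^sup>+a. l a \<partial>count_space UNIV)"
  define f where "f ab = (if fst ab = snd ab then l (fst ab) else 0) +
    (emeasure M {fst ab} - l (fst ab)) * (emeasure N {snd ab} - l (snd ab)) / D" for ab
  define r where "r = density (count_space UNIV) f"
  have spM: "space M = UNIV" and spN: "space N = UNIV" using M(2) N(2) by (metis UNIV_I sets.sets_into_space top.extremum_uniqueI)+
  have sumM: "(\<integral>\<^sup>+a. emeasure M {a} \<partial>count_space UNIV) = 1"
    using nn_integral_discrete[OF M(2), of "\<lambda>_. 1"] M.emeasure_space_1 by simp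
  have sumN: "(\<integral>\<^sup>+a. emeasure N {a} \<partial>count_space UNIV) = 1"
    using nn_integral_discrete[OF N(2), of "\<lambda>_. 1"] N.emeasure_space_1 by simp
  have lM: "l a \<le> emeasure M {a}" and lN: "l a \<le> emeasure N {a}" for a by (auto simp: l_def)
  have lfin: "(\<integral>\<^sup>+a. l a \<partial>count_space UNIV) \<noteq> \<infinity>"
  proof -
    have "(\<integral>\<^sup>+a. l a \<partial>count_space UNIV) \<le> 1" unfolding sumM[symmetric] by (intro nn_integral_mono lM)
    then show ?thesis by (auto simp: top_unique)
  qed
  have DM: "(\<integral>\<^sup>+a. emeasure M {a} - l a \<partial>count_space UNIV) = D"
    unfolding D_def sumM[symmetric] using lM lfin by (intro nn_integral_diff) auto
  have DN: "(\<integral>\<^sup>+a. emeasure N {a} - l a \<partial>count_space UNIV) = D"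
    unfolding D_def sumN[symmetric] using lN lfin by (intro nn_integral_diff) auto
  have Dfin: "D \<noteq> \<top>" unfolding D_def by simp
  \<comment> \<open>For equal laws \<open>D = 0\<close>, but then both excesses vanish and the
    quotient multiplies zero.\<close>
  have cancel: "x * (D / D) = x" if "D = 0 \<Longrightarrow> x = 0" for x :: ennreal
  proof (cases "D = 0")
    case True
    then show ?thesis using that by simp
  next
    case False
    then have "D / D = 1" using Dfin by (simp add: ennreal_divide_self less_top)
    then show ?thesis by simp
  qed
  have zeroM: "emeasure M {a} - l a = 0" if "D = 0" for a
    using DM that by (simp add: nn_integral_0_iff_AE AE_count_space)
  have zeroN: "emeasure N {a} - l a = 0" if "D = 0" for a
    using DN that by (simp add: nn_integral_0_iff_AE AE_count_space)
  have split_eq: "(if a = b then l a else 0) = l a * indicator {a} b" for a b by auto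
  have row: "(\<integral>\<^sup>+b. f (a, b) \<partial>count_space UNIV) = emeasure M {a}" for a
  proof -
    have "(\<integral>\<^sup>+b. f (a, b) \<partial>count_space UNIV) = (\<integral>\<^sup>+b. l a * indicator {a} b + (emeasure M {a} - l a) / D * (emeasure N {b} - l b) \<partial>count_space UNIV)"
      by (intro nn_integral_cong) (simp add: f_def split_eq ennreal_times_divide mult.commute)
    also have "\<dots> = l a + (emeasure M {a} - l a) / D * D"
      by (simp add: nn_integral_add nn_integral_cmult DN)
    also have "(emeasure M {a} - l a) / D * D = (emeasure M {a} - l a) * (D / D)"
      by (metis ennreal_times_divide mult.commute)
    also have "\<dots> = emeasure M {a} - l a" by (rule cancel) (rule zeroM)
    also have "l a + (emeasure M {a} - l a) = emeasure M {a}"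
      using diff_add_cancel_ennreal[OF lM[of a]] by (simp add: add.commute)
    finally show ?thesis .
  qed
  have col: "(\<integral>\<^sup>+a. f (a, b) \<partial>count_space UNIV) = emeasure N {b}" for b
  proof -
    have "(\<integral>\<^sup>+a. f (a, b) \<partial>count_space UNIV) = (\<integral>\<^sup>+a. l b * indicator {b} a + (emeasure N {b} - l b) / D * (emeasure M {a} - l a) \<partial>count_space UNIV)"
      by (intro nn_integral_cong) (auto simp: f_def split_eq ennreal_times_divide mult.commute split: split_indicator)
    also have "\<dots> = l b + (emeasure N {b} - l b) / D * D"
      by (simp add: nn_integral_add nn_integral_cmult DM)
    also have "(emeasure N {b} - l b) / D * D = (emeasure N {b} - l b) * (D / D)"
      by (metis ennreal_times_divide mult.commute)
    also have "\<dots> = emeasure N {b} - l b" by (rule cancel) (rule zeroN)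
    also have "l b + (emeasure N {b} - l b) = emeasure N {b}"
      using diff_add_cancel_ennreal[OF lN[of b]] by (simp add: add.commute)
    finally show ?thesis .
  qed
  have "r \<in> couplings M N"
  proof (rule couplingsI)
    have "sets (M \<Otimes>\<^sub>M N) = sets (count_space (UNIV :: 'g set) \<Otimes>\<^sub>M count_space (UNIV :: 'g set))"
      by (rule sets_pair_measure_cong) (simp_all add: M N)
    then show "sets r = sets (M \<Otimes>\<^sub>M N)" unfolding pair_count_space by (simp add: r_def)
    fix A :: "'g set"
    have "(\<integral>\<^sup>+w. indicator A (fst w) \<partial>r) = (\<integral>\<^sup>+w. f w * indicator A (fst w) \<partial>count_space UNIV)"
      unfolding r_def by (rule nn_integral_density) auto
    also have "\<dots> = (\<integral>\<^sup>+a. \<integral>\<^sup>+b. f (a, b) * indicator A a \<partial>count_space UNIV \<partial>count_space UNIV)"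
      by (subst nn_integral_fst_count_space[symmetric]) simp
    also have "\<dots> = (\<integral>\<^sup>+a. emeasure M {a} * indicator A a \<partial>count_space UNIV)"
      by (simp add: nn_integral_multc row)
    also have "\<dots> = (\<integral>\<^sup>+a. indicator A a * emeasure M {a} \<partial>count_space UNIV)"
      by (simp add: mult.commute)
    also have "\<dots> = (\<integral>\<^sup>+a. indicator A a \<partial>M)" by (rule nn_integral_discrete[OF M(2), symmetric])
    finally show "(\<integral>\<^sup>+w. indicator A (fst w) \<partial>r) = emeasure M A" by (simp add: M)
    have "(\<integral>\<^sup>+w. indicator A (snd w) \<partial>r) = (\<integral>\<^sup>+w. f w * indicator A (snd w) \<partial>count_space UNIV)"
      unfolding r_def by (rule nn_integral_density) auto
    also have "\<dots> = (\<integral>\<^sup>+b. \<integral>\<^sup>+a. f (a, b) * indicator A b \<partial>count_space UNIV \<partial>count_space UNIV)"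
      by (subst nn_integral_snd_count_space[symmetric]) simp
    also have "\<dots> = (\<integral>\<^sup>+a. emeasure N {a} * indicator A a \<partial>count_space UNIV)"
      by (simp add: nn_integral_multc col)
    also have "\<dots> = (\<integral>\<^sup>+a. indicator A a * emeasure N {a} \<partial>count_space UNIV)"
      by (simp add: mult.commute)
    also have "\<dots> = (\<integral>\<^sup>+a. indicator A a \<partial>N)" by (rule nn_integral_discrete[OF N(2), symmetric])
    finally show "(\<integral>\<^sup>+w. indicator A (snd w) \<partial>r) = emeasure N A" by (simp add: N)
  qed
  moreover have "min (emeasure M {a}) (emeasure N {a}) \<le> emeasure r {(a, a)}" for a
    by (simp add: r_def emeasure_density f_def l_def)
  ultimately show ?thesis by blast
qed

lemma emeasure_split_countable:
  fixes k :: "'a \<Rightarrow> 'g :: countable"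
  assumes k: "k \<in> M \<rightarrow>\<^sub>M count_space UNIV" and S: "S \<in> sets M"
  shows "emeasure M S = (\<integral>\<^sup>+l. emeasure M (S \<inter> k -` {l}) \<partial>count_space UNIV)"
proof -
  have SS: "S \<inter> k -` {l} \<in> sets M" for l
  proof -
    have "S \<inter> k -` {l} = S \<inter> (k -` {l} \<inter> space M)" using sets.sets_into_space[OF S] by auto
    then show ?thesis using S measurable_sets[OF k, of "{l}"] by simp
  qed
  have "emeasure M S = (\<integral>\<^sup>+\<omega>. indicator S \<omega> \<partial>M)" using S by simp
  also have "\<dots> = (\<integral>\<^sup>+l. (\<integral>\<^sup>+\<omega>. indicator S \<omega> * indicator {l} (k \<omega>) \<partial>M) \<partial>count_space UNIV)"
    by (rule nn_integral_split_countable[OF k]) (use S in simp)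
  also have "\<dots> = (\<integral>\<^sup>+l. (\<integral>\<^sup>+\<omega>. indicator (S \<inter> k -` {l}) \<omega> \<partial>M) \<partial>count_space UNIV)"
    by (intro nn_integral_cong) (auto split: split_indicator)
  also have "\<dots> = (\<integral>\<^sup>+l. emeasure M (S \<inter> k -` {l}) \<partial>count_space UNIV)"
    using SS by simp
  finally show ?thesis .
qed

section \<open>One-sided projections of the chain and the chain of label pairs\<close>

context two_sided
begin

definition AX where "AX t = distr (P t) (count_space UNIV \<Otimes>\<^sub>M path_space t) (\<lambda>h. (fst (fst h), fst (snd h)))"
definition AY where "AY t = distr (P t) (count_space UNIV \<Otimes>\<^sub>M path_space t) (\<lambda>h. (snd (fst h), snd (snd h)))"

lemma AX_map: "t \<le> T \<Longrightarrow> (\<lambda>h. (fst (fst h), fst (snd h))) \<in> P t \<rightarrow>\<^sub>M count_space UNIV \<Otimes>\<^sub>M path_space t"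
  by (intro measurable_Pair P_measurable)

lemma AY_map: "t \<le> T \<Longrightarrow> (\<lambda>h. (snd (fst h), snd (snd h))) \<in> P t \<rightarrow>\<^sub>M count_space UNIV \<Otimes>\<^sub>M path_space t"
  by (intro measurable_Pair P_measurable)

lemma nn_integral_AX:
  "t \<le> T \<Longrightarrow> f \<in> borel_measurable (count_space UNIV \<Otimes>\<^sub>M path_space t) \<Longrightarrow> (\<integral>\<^sup>+w. f w \<partial>AX t) = (\<integral>\<^sup>+h. f (fst (fst h), fst (snd h)) \<partial>P t)"
  unfolding AX_def by (rule nn_integral_distr[OF AX_map]) simp_all

lemma nn_integral_AY:
  "t \<le> T \<Longrightarrow> f \<in> borel_measurable (count_space UNIV \<Otimes>\<^sub>M path_space t) \<Longrightarrow> (\<integral>\<^sup>+w. f w \<partial>AY t) = (\<integral>\<^sup>+h. f (snd (fst h), snd (snd h)) \<partial>P t)"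
  unfolding AY_def by (rule nn_integral_distr[OF AY_map]) simp_all

lemma V_average_measurable:
  fixes f :: "nat list \<times> (nat \<Rightarrow> real ^ 'd) \<Rightarrow> ennreal"
    and V' :: "nat \<Rightarrow> nat list \<Rightarrow> (nat \<Rightarrow> real ^ 'd) \<Rightarrow> ((real ^ 'd) \<times> nat) measure"
  assumes V: "\<And>c. V' t c \<in> path_space t \<rightarrow>\<^sub>M prob_algebra (borel \<Otimes>\<^sub>M count_space UNIV)"
    and f: "f \<in> borel_measurable (count_space UNIV \<Otimes>\<^sub>M path_space (Suc t))"
  shows "(\<lambda>w. \<integral>\<^sup>+v. f (fst w @ [snd v], (snd w)(Suc t := fst v)) \<partial>V' t (fst w) (snd w)) \<in> borel_measurable (count_space UNIV \<Otimes>\<^sub>M path_space t)"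
proof (rule measurable_pair_count_space1)
  fix c
  have "(\<lambda>p :: (nat \<Rightarrow> real ^ 'd) \<times> (real ^ 'd) \<times> nat. (c @ [snd (snd p)], (fst p)(Suc t := fst (snd p)))) \<in> path_space t \<Otimes>\<^sub>M (borel \<Otimes>\<^sub>M count_space UNIV) \<rightarrow>\<^sub>M count_space UNIV \<Otimes>\<^sub>M path_space (Suc t)"
  proof (rule measurable_Pair)
    show "(\<lambda>p :: (nat \<Rightarrow> real ^ 'd) \<times> (real ^ 'd) \<times> nat. c @ [snd (snd p)]) \<in> path_space t \<Otimes>\<^sub>M (borel \<Otimes>\<^sub>M count_space UNIV) \<rightarrow>\<^sub>M count_space UNIV"
      by (rule measurable_compose[OF measurable_compose[OF measurable_snd measurable_snd]]) simp
    show "(\<lambda>p :: (nat \<Rightarrow> real ^ 'd) \<times> (real ^ 'd) \<times> nat. (fst p)(Suc t := fst (snd p))) \<in> path_space t \<Otimes>\<^sub>M (borel \<Otimes>\<^sub>M count_space UNIV) \<rightarrow>\<^sub>M path_space (Suc t)"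
      using measurable_compose[OF _ measurable_path_upd, of "\<lambda>p. (fst p, fst (snd p))" "path_space t \<Otimes>\<^sub>M (borel \<Otimes>\<^sub>M count_space UNIV)" t]
      by simp
  qed
  from measurable_compose[OF this f]
  show "(\<lambda>x. \<integral>\<^sup>+v. f (fst (c, x) @ [snd v], (snd (c, x))(Suc t := fst v)) \<partial>V' t (fst (c, x)) (snd (c, x))) \<in> borel_measurable (path_space t)"
    unfolding fst_conv snd_conv by (intro nn_integral_kernel_measurable[OF V]) (unfold case_prod_beta')
qed

sublocale XL: labelled T \<mu> \<kappa> Q \<Gamma> AX
proof
  fix t assume t: "t \<le> T"
  show "AX t \<in> space (prob_algebra (count_space UNIV \<Otimes>\<^sub>M path_space t))"
    by (simp add: space_prob_algebra AX_def prob_space.prob_space_distr[OF P_props(1)[OF t] AX_map[OF t]])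
next
  fix f :: "nat list \<times> (nat \<Rightarrow> real ^ 'd) \<Rightarrow> ennreal" assume f: "f \<in> borel_measurable (count_space UNIV \<Otimes>\<^sub>M path_space 0)"
  have "(\<lambda>h. f (fst (fst h), fst (snd h))) \<in> borel_measurable (H 0)"
    by (rule measurable_compose[OF _ f]) (intro measurable_Pair H_measurable)
  then have "(\<integral>\<^sup>+h. f (fst (fst h), fst (snd h)) \<partial>P 0) = f ([], \<lambda>_. undefined)"
    unfolding P.simps by (subst nn_integral_return) (auto simp: space_H path_space_0)
  then show "(\<integral>\<^sup>+w. f w \<partial>AX 0) = f ([], \<lambda>_. undefined)" using nn_integral_AX[OF _ f] by simp
next
  fix t and f :: "nat list \<times> (nat \<Rightarrow> real ^ 'd) \<Rightarrow> ennreal"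
  assume t: "t < T" and f: "f \<in> borel_measurable (count_space UNIV \<Otimes>\<^sub>M path_space (Suc t))"
  have "(\<integral>\<^sup>+w. f w \<partial>AX (Suc t)) = (\<integral>\<^sup>+h. f (fst (fst h), fst (snd h)) \<partial>P (Suc t))"
    by (rule nn_integral_AX[OF _ f]) (use t in simp)
  also have "\<dots> = (\<integral>\<^sup>+h. \<integral>\<^sup>+w. f (fst (fst h) @ [snd w], (fst (snd h))(Suc t := fst w)) \<partial>X.V t (fst (fst h)) (fst (snd h)) \<partial>P t)"
    using nn_integral_P_Suc_X[OF t _ f, of "\<lambda>_. 1"] by (simp only: mult_1_left measurable_const UNIV_I space_borel simp_thms)
  also have "\<dots> = (\<integral>\<^sup>+w. \<integral>\<^sup>+v. f (fst w @ [snd v], (snd w)(Suc t := fst v)) \<partial>X.V t (fst w) (snd w) \<partial>AX t)"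
    using nn_integral_AX[OF less_imp_le[OF t] V_average_measurable[of X.V, OF X.V_meas[OF t] f]] by (simp only: fst_conv snd_conv)
  finally show "(\<integral>\<^sup>+w. f w \<partial>AX (Suc t)) = (\<integral>\<^sup>+w. \<integral>\<^sup>+v. f (fst w @ [snd v], (snd w)(Suc t := fst v)) \<partial>X.V t (fst w) (snd w) \<partial>AX t)" .
qed

sublocale YL: labelled T \<nu> \<kappa>' Q \<Gamma>' AY
proof
  fix t assume t: "t \<le> T"
  show "AY t \<in> space (prob_algebra (count_space UNIV \<Otimes>\<^sub>M path_space t))"
    by (simp add: space_prob_algebra AY_def prob_space.prob_space_distr[OF P_props(1)[OF t] AY_map[OF t]])
next
  fix f :: "nat list \<times> (nat \<Rightarrow> real ^ 'd) \<Rightarrow> ennreal" assume f: "f \<in> borel_measurable (count_space UNIV \<Otimes>\<^sub>M path_space 0)"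
  have "(\<lambda>h. f (snd (fst h), snd (snd h))) \<in> borel_measurable (H 0)"
    by (rule measurable_compose[OF _ f]) (intro measurable_Pair H_measurable)
  then have "(\<integral>\<^sup>+h. f (snd (fst h), snd (snd h)) \<partial>P 0) = f ([], \<lambda>_. undefined)"
    unfolding P.simps by (subst nn_integral_return) (auto simp: space_H path_space_0)
  then show "(\<integral>\<^sup>+w. f w \<partial>AY 0) = f ([], \<lambda>_. undefined)" using nn_integral_AY[OF _ f] by simp
next
  fix t and f :: "nat list \<times> (nat \<Rightarrow> real ^ 'd) \<Rightarrow> ennreal"
  assume t: "t < T" and f: "f \<in> borel_measurable (count_space UNIV \<Otimes>\<^sub>M path_space (Suc t))"
  have "(\<integral>\<^sup>+w. f w \<partial>AY (Suc t)) = (\<integral>\<^sup>+h. f (snd (fst h), snd (snd h)) \<partial>P (Suc t))"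
    by (rule nn_integral_AY[OF _ f]) (use t in simp)
  also have "\<dots> = (\<integral>\<^sup>+h. \<integral>\<^sup>+w. f (snd (fst h) @ [snd w], (snd (snd h))(Suc t := fst w)) \<partial>Y.V t (snd (fst h)) (snd (snd h)) \<partial>P t)"
    using nn_integral_P_Suc_Y[OF t _ f, of "\<lambda>_. 1"] by (simp only: mult_1_left measurable_const UNIV_I space_borel simp_thms)
  also have "\<dots> = (\<integral>\<^sup>+w. \<integral>\<^sup>+v. f (fst w @ [snd v], (snd w)(Suc t := fst v)) \<partial>Y.V t (fst w) (snd w) \<partial>AY t)"
    using nn_integral_AY[OF less_imp_le[OF t] V_average_measurable[of Y.V, OF Y.V_meas[OF t] f]] by (simp only: fst_conv snd_conv)
  finally show "(\<integral>\<^sup>+w. f w \<partial>AY (Suc t)) = (\<integral>\<^sup>+w. \<integral>\<^sup>+v. f (fst w @ [snd v], (snd w)(Suc t := fst v)) \<partial>Y.V t (fst w) (snd w) \<partial>AY t)" .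
qed

text \<open>The pairs of label histories form a Markov chain with transitions \<open>r\<close>,
  whatever the positions do. Disagreement is a matter of this discrete chain alone.\<close>

definition LD where "LD t = distr (P t) (count_space UNIV) fst"

lemma fst_P: "t \<le> T \<Longrightarrow> fst \<in> P t \<rightarrow>\<^sub>M count_space UNIV"
  unfolding measurable_cong_sets[OF P_props(2) refl] H_def by simp

lemma LD_props: "t \<le> T \<Longrightarrow> prob_space (LD t)" "sets (LD t) = UNIV" "space (LD t) = UNIV"
  unfolding LD_def by (auto intro: prob_space.prob_space_distr[OF P_props(1) fst_P])

lemma nn_integral_LD: "t \<le> T \<Longrightarrow> (\<integral>\<^sup>+cc. f cc \<partial>LD t) = (\<integral>\<^sup>+h. f (fst h) \<partial>P t)"
  unfolding LD_def by (rule nn_integral_distr[OF fst_P]) simp_all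

lemma nn_integral_LD_Suc:
  assumes t: "t < T"
  shows "(\<integral>\<^sup>+cc. f cc \<partial>LD (Suc t)) = (\<integral>\<^sup>+cc. \<integral>\<^sup>+ab. f (fst cc @ [fst ab], snd cc @ [snd ab]) \<partial>r t (fst cc) (snd cc) \<partial>LD t)"
proof -
  have "(\<integral>\<^sup>+cc. f cc \<partial>LD (Suc t)) = (\<integral>\<^sup>+h. f (fst h) \<partial>P (Suc t))" by (rule nn_integral_LD) (use t in simp)
  also have "\<dots> = (\<integral>\<^sup>+cc. \<integral>\<^sup>+ab. f (fst cc @ [fst ab], snd cc @ [snd ab]) \<partial>r t (fst cc) (snd cc) \<partial>LD t)"
    unfolding nn_integral_P_Suc_labels[OF t] by (rule nn_integral_LD[OF less_imp_le[OF t], symmetric])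
  finally show ?thesis .
qed

lemma nn_integral_LD_fst: "t \<le> T \<Longrightarrow> (\<integral>\<^sup>+cc. f (fst cc) \<partial>LD t) = (\<integral>\<^sup>+z. f (hist Q t z) \<partial>\<mu>)"
  using XL.label_law[of t f] nn_integral_AX[of t "\<lambda>w. f (fst w)"] measurable_compose[OF measurable_fst, of f]
  by (simp add: nn_integral_LD)

lemma nn_integral_LD_snd: "t \<le> T \<Longrightarrow> (\<integral>\<^sup>+cc. f (snd cc) \<partial>LD t) = (\<integral>\<^sup>+z. f (hist Q t z) \<partial>\<nu>)"
  using YL.label_law[of t f] nn_integral_AY[of t "\<lambda>w. f (fst w)"] measurable_compose[OF measurable_fst, of f]
  by (simp add: nn_integral_LD)

lemma emeasure_LD_Suc:
  assumes t: "t < T"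
  shows "emeasure (LD (Suc t)) E = (\<integral>\<^sup>+cc. emeasure (r t (fst cc) (snd cc)) {ab. (fst cc @ [fst ab], snd cc @ [snd ab]) \<in> E} \<partial>LD t)"
proof -
  have "emeasure (LD (Suc t)) E = (\<integral>\<^sup>+cc. indicator E cc \<partial>LD (Suc t))"
    using t by (simp add: LD_props)
  also have "\<dots> = (\<integral>\<^sup>+cc. \<integral>\<^sup>+ab. indicator E (fst cc @ [fst ab], snd cc @ [snd ab]) \<partial>r t (fst cc) (snd cc) \<partial>LD t)"
    by (rule nn_integral_LD_Suc[OF t])
  also have "\<dots> = (\<integral>\<^sup>+cc. emeasure (r t (fst cc) (snd cc)) {ab. (fst cc @ [fst ab], snd cc @ [snd ab]) \<in> E} \<partial>LD t)"
  proof (rule nn_integral_cong)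
    fix cc
    have "(\<integral>\<^sup>+ab. indicator E (fst cc @ [fst ab], snd cc @ [snd ab]) \<partial>r t (fst cc) (snd cc)) =
       (\<integral>\<^sup>+ab. indicator {ab. (fst cc @ [fst ab], snd cc @ [snd ab]) \<in> E} ab \<partial>r t (fst cc) (snd cc))"
      by (intro nn_integral_cong) (auto split: split_indicator)
    then show "(\<integral>\<^sup>+ab. indicator E (fst cc @ [fst ab], snd cc @ [snd ab]) \<partial>r t (fst cc) (snd cc)) =
       emeasure (r t (fst cc) (snd cc)) {ab. (fst cc @ [fst ab], snd cc @ [snd ab]) \<in> E}"
      by (simp add: r_props[OF t])
  qed
  finally show ?thesis .
qed

lemma r_fst:
  assumes t: "t < T" shows "emeasure (r t c c') {ab. fst ab = a} = emeasure (X.m t c) {a}"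
proof -
  have "emeasure (r t c c') {ab. fst ab = a} = (\<integral>\<^sup>+ab. indicator {ab. fst ab = a} ab \<partial>r t c c')"
    by (simp add: r_props[OF t])
  also have "\<dots> = (\<integral>\<^sup>+ab. indicator {a} (fst ab) \<partial>r t c c')" by (intro nn_integral_cong) (auto split: split_indicator)
  also have "\<dots> = (\<integral>\<^sup>+b. indicator {a} b \<partial>X.m t c)"
    by (rule nn_integral_coupling_fst[OF r[OF t]]) (simp add: measurable_def)
  finally show ?thesis by simp
qed

lemma r_snd:
  assumes t: "t < T" shows "emeasure (r t c c') {ab. snd ab = a} = emeasure (Y.m t c') {a}"
proof -
  have "emeasure (r t c c') {ab. snd ab = a} = (\<integral>\<^sup>+ab. indicator {ab. snd ab = a} ab \<partial>r t c c')"
    by (simp add: r_props[OF t])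
  also have "\<dots> = (\<integral>\<^sup>+ab. indicator {a} (snd ab) \<partial>r t c c')" by (intro nn_integral_cong) (auto split: split_indicator)
  also have "\<dots> = (\<integral>\<^sup>+b. indicator {a} b \<partial>Y.m t c')"
    by (rule nn_integral_coupling_snd[OF r[OF t]]) (simp add: measurable_def)
  finally show ?thesis by simp
qed

lemma LD_integral_const:
  assumes "\<And>cc. cc \<in> E \<Longrightarrow> f cc = k" "\<And>cc. cc \<notin> E \<Longrightarrow> f cc = 0"
  shows "(\<integral>\<^sup>+cc. f cc \<partial>LD t) = k * emeasure (LD t) E"
proof -
  have "(\<integral>\<^sup>+cc. f cc \<partial>LD t) = (\<integral>\<^sup>+cc. k * indicator E cc \<partial>LD t)"
    using assms by (intro nn_integral_cong) (auto split: split_indicator)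
  also have "\<dots> = k * emeasure (LD t) E" by (rule nn_integral_cmult_indicator) (simp add: LD_props)
  finally show ?thesis .
qed

text \<open>The state \<open>(c, c)\<close> is the only one from which
  \<open>(c @ [a], c @ [a])\<close> can be reached.\<close>

lemma LD_diag:
  assumes t: "t < T"
  shows "emeasure (LD (Suc t)) {(c @ [a], c @ [a])} = emeasure (r t c c) {(a, a)} * emeasure (LD t) {(c, c)}"
  unfolding emeasure_LD_Suc[OF t]
proof (rule LD_integral_const)
  fix cc :: "nat list \<times> nat list" assume "cc \<in> {(c, c)}"
  then have "{ab. (fst cc @ [fst ab], snd cc @ [snd ab]) \<in> {(c @ [a], c @ [a])}} = {(a, a)}" by auto
  with \<open>cc \<in> {(c, c)}\<close> show "emeasure (r t (fst cc) (snd cc)) {ab. (fst cc @ [fst ab], snd cc @ [snd ab]) \<in> {(c @ [a], c @ [a])}} = emeasure (r t c c) {(a, a)}"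
    by simp
next
  fix cc :: "nat list \<times> nat list" assume "cc \<notin> {(c, c)}"
  then have "{ab. (fst cc @ [fst ab], snd cc @ [snd ab]) \<in> {(c @ [a], c @ [a])}} = {}" by (cases cc) auto
  then show "emeasure (r t (fst cc) (snd cc)) {ab. (fst cc @ [fst ab], snd cc @ [snd ab]) \<in> {(c @ [a], c @ [a])}} = 0" by (simp only: emeasure_empty)
qed

text \<open>The first marginal of \<open>r t c c'\<close> is the same for every \<open>c'\<close>,
  so the probability of the new label factors out of any condition on the second history.\<close>

lemma LD_fst_part:
  assumes t: "t < T"
  shows "emeasure (LD (Suc t)) {cc. fst cc = c @ [a] \<and> butlast (snd cc) \<in> S} = emeasure (X.m t c) {a} * emeasure (LD t) {cc. fst cc = c \<and> snd cc \<in> S}"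
  unfolding emeasure_LD_Suc[OF t]
proof (rule LD_integral_const)
  fix cc :: "nat list \<times> nat list" assume cc: "cc \<in> {cc. fst cc = c \<and> snd cc \<in> S}"
  then have "{ab. (fst cc @ [fst ab], snd cc @ [snd ab]) \<in> {cc. fst cc = c @ [a] \<and> butlast (snd cc) \<in> S}} = {ab :: nat \<times> nat. fst ab = a}" by auto
  with cc show "emeasure (r t (fst cc) (snd cc)) {ab. (fst cc @ [fst ab], snd cc @ [snd ab]) \<in> {cc. fst cc = c @ [a] \<and> butlast (snd cc) \<in> S}} = emeasure (X.m t c) {a}"
    by (simp add: r_fst[OF t])
next
  fix cc :: "nat list \<times> nat list" assume "cc \<notin> {cc. fst cc = c \<and> snd cc \<in> S}"
  then have "{ab. (fst cc @ [fst ab], snd cc @ [snd ab]) \<in> {cc. fst cc = c @ [a] \<and> butlast (snd cc) \<in> S}} = {}" by auto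
  then show "emeasure (r t (fst cc) (snd cc)) {ab. (fst cc @ [fst ab], snd cc @ [snd ab]) \<in> {cc. fst cc = c @ [a] \<and> butlast (snd cc) \<in> S}} = 0" by (simp only: emeasure_empty)
qed

lemma LD_snd_part:
  assumes t: "t < T"
  shows "emeasure (LD (Suc t)) {cc. snd cc = c @ [a] \<and> butlast (fst cc) \<in> S} = emeasure (Y.m t c) {a} * emeasure (LD t) {cc. snd cc = c \<and> fst cc \<in> S}"
  unfolding emeasure_LD_Suc[OF t]
proof (rule LD_integral_const)
  fix cc :: "nat list \<times> nat list" assume cc: "cc \<in> {cc. snd cc = c \<and> fst cc \<in> S}"
  then have "{ab. (fst cc @ [fst ab], snd cc @ [snd ab]) \<in> {cc. snd cc = c @ [a] \<and> butlast (fst cc) \<in> S}} = {ab :: nat \<times> nat. snd ab = a}" by auto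
  with cc show "emeasure (r t (fst cc) (snd cc)) {ab. (fst cc @ [fst ab], snd cc @ [snd ab]) \<in> {cc. snd cc = c @ [a] \<and> butlast (fst cc) \<in> S}} = emeasure (Y.m t c) {a}"
    by (simp add: r_snd[OF t])
next
  fix cc :: "nat list \<times> nat list" assume "cc \<notin> {cc. snd cc = c \<and> fst cc \<in> S}"
  then have "{ab. (fst cc @ [fst ab], snd cc @ [snd ab]) \<in> {cc. snd cc = c @ [a] \<and> butlast (fst cc) \<in> S}} = {}" by auto
  then show "emeasure (r t (fst cc) (snd cc)) {ab. (fst cc @ [fst ab], snd cc @ [snd ab]) \<in> {cc. snd cc = c @ [a] \<and> butlast (fst cc) \<in> S}} = 0" by (simp only: emeasure_empty)
qed

lemma LD_fst_law:
  assumes t: "t \<le> T"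
  shows "emeasure (LD t) {cc. fst cc = l} = emeasure \<mu> (hist Q t -` {l} \<inter> space \<mu>)"
proof -
  have "emeasure (LD t) {cc. fst cc = l} = (\<integral>\<^sup>+cc. indicator {cc. fst cc = l} cc \<partial>LD t)" by (simp add: LD_props)
  also have "\<dots> = (\<integral>\<^sup>+cc. indicator {l} (fst cc) \<partial>LD t)" by (intro nn_integral_cong) (auto split: split_indicator)
  also have "\<dots> = (\<integral>\<^sup>+z. indicator {l} (hist Q t z) \<partial>\<mu>)" by (rule nn_integral_LD_fst[OF t])
  also have "\<dots> = (\<integral>\<^sup>+z. indicator (hist Q t -` {l} \<inter> space \<mu>) z \<partial>\<mu>)" by (intro nn_integral_cong) (auto split: split_indicator)
  also have "\<dots> = emeasure \<mu> (hist Q t -` {l} \<inter> space \<mu>)"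
    using measurable_sets[OF X.hist_meas[OF t], of "{l}"] by simp
  finally show ?thesis .
qed

lemma LD_snd_law:
  assumes t: "t \<le> T"
  shows "emeasure (LD t) {cc. snd cc = l} = emeasure \<nu> (hist Q t -` {l} \<inter> space \<nu>)"
proof -
  have "emeasure (LD t) {cc. snd cc = l} = (\<integral>\<^sup>+cc. indicator {cc. snd cc = l} cc \<partial>LD t)" by (simp add: LD_props)
  also have "\<dots> = (\<integral>\<^sup>+cc. indicator {l} (snd cc) \<partial>LD t)" by (intro nn_integral_cong) (auto split: split_indicator)
  also have "\<dots> = (\<integral>\<^sup>+z. indicator {l} (hist Q t z) \<partial>\<nu>)" by (rule nn_integral_LD_snd[OF t])
  also have "\<dots> = (\<integral>\<^sup>+z. indicator (hist Q t -` {l} \<inter> space \<nu>) z \<partial>\<nu>)" by (intro nn_integral_cong) (auto split: split_indicator)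
  also have "\<dots> = emeasure \<nu> (hist Q t -` {l} \<inter> space \<nu>)"
    using measurable_sets[OF Y.hist_meas[OF t], of "{l}"] by simp
  finally show ?thesis .
qed

end

text \<open>\<open>\<gamma>\<close> is the competitor, any coupling of the two laws; in the end one
  that is nearly optimal for the Wasserstein distance of order 1.\<close>

locale two_sided_maximal = two_sided T \<mu> \<nu> \<kappa> \<kappa>' Q \<Gamma> \<Gamma>' r
  for T :: nat and \<mu> \<nu> :: "(nat \<Rightarrow> real ^ 'd :: finite) measure" and \<kappa> \<kappa>' Q \<Gamma> \<Gamma>' r +
  fixes \<gamma> :: "((nat \<Rightarrow> real ^ 'd) \<times> (nat \<Rightarrow> real ^ 'd)) measure"
  assumes r_max: "\<And>t c a. t < T \<Longrightarrow> min (emeasure (X.m t c) {a}) (emeasure (Y.m t c) {a}) \<le> emeasure (r t c c) {(a, a)}"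
    and \<gamma>: "\<gamma> \<in> couplings \<mu> \<nu>"
begin

lemma prob_\<gamma>: "prob_space \<gamma>"
  by (rule prob_space_coupling[OF \<gamma> X.prob_space_axioms])

definition agree :: "nat \<Rightarrow> ((nat \<Rightarrow> real ^ 'd) \<times> (nat \<Rightarrow> real ^ 'd)) set" where
  "agree t = {w \<in> space \<gamma>. hist Q t (fst w) = hist Q t (snd w)}"

lemma hist_\<gamma>_fst: "t \<le> T \<Longrightarrow> (\<lambda>w. hist Q t (fst w)) \<in> \<gamma> \<rightarrow>\<^sub>M count_space UNIV"
  by (rule measurable_compose[OF couplingsD(5)[OF \<gamma>] X.hist_meas])

lemma hist_\<gamma>_snd: "t \<le> T \<Longrightarrow> (\<lambda>w. hist Q t (snd w)) \<in> \<gamma> \<rightarrow>\<^sub>M count_space UNIV"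
  by (rule measurable_compose[OF couplingsD(6)[OF \<gamma>] Y.hist_meas])

lemma agree_sets: assumes t: "t \<le> T" shows "agree t \<in> sets \<gamma>"
proof -
  have "(\<lambda>w. (hist Q t (fst w), hist Q t (snd w))) \<in> \<gamma> \<rightarrow>\<^sub>M count_space UNIV \<Otimes>\<^sub>M count_space UNIV"
    by (intro measurable_Pair hist_\<gamma>_fst hist_\<gamma>_snd t)
  from measurable_sets[OF this, of "{cc. fst cc = snd cc}"]
  have "(\<lambda>w. (hist Q t (fst w), hist Q t (snd w))) -` {cc. fst cc = snd cc} \<inter> space \<gamma> \<in> sets \<gamma>"
    unfolding pair_count_space by simp
  also have "(\<lambda>w. (hist Q t (fst w), hist Q t (snd w))) -` {cc. fst cc = snd cc} \<inter> space \<gamma> = agree t"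
    by (auto simp: agree_def)
  finally show ?thesis .
qed

text \<open>The left side is at most the probability of the history \<open>l\<close> under either
  law. Each of these probabilities splits into a part with agreeing earlier histories and a rest. On
  the side where the last label has the smaller conditional probability, maximality bounds the first
  part by the diagonal mass.\<close>

lemma agree_label_le:
  assumes t: "t < T"
  shows "emeasure \<gamma> (agree (Suc t) \<inter> (\<lambda>w. hist Q (Suc t) (fst w)) -` {l}) \<le>
    emeasure (LD (Suc t)) {(l, l)} + emeasure (LD (Suc t)) {cc. fst cc = l \<and> butlast (snd cc) \<in> - {butlast l}} +
    emeasure (LD (Suc t)) {cc. snd cc = l \<and> butlast (fst cc) \<in> - {butlast l}}" (is "?G \<le> ?D + ?EX + ?EY")
proof (cases l rule: rev_cases)
  case Nil
  have "hist Q (Suc t) x \<noteq> []" for x :: "nat \<Rightarrow> real ^ 'd" using length_hist[of Q "Suc t" x] by (metis list.size(3) nat.distinct(1))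
  then have "agree (Suc t) \<inter> (\<lambda>w. hist Q (Suc t) (fst w)) -` {l} = {}" using Nil by auto
  then show ?thesis by simp
next
  case (snoc c a)
  have tT: "Suc t \<le> T" using t by simp
  have GX: "?G \<le> emeasure \<mu> (hist Q (Suc t) -` {l} \<inter> space \<mu>)"
  proof -
    have "?G \<le> emeasure \<gamma> (fst -` (hist Q (Suc t) -` {l} \<inter> space \<mu>) \<inter> space \<gamma>)"
      using measurable_sets[OF couplingsD(5)[OF \<gamma>] measurable_sets[OF X.hist_meas[OF tT], of "{l}"]] couplingsD(2)[OF \<gamma>]
      by (intro emeasure_mono) (auto simp: agree_def)
    also have "\<dots> = emeasure (distr \<gamma> \<mu> fst) (hist Q (Suc t) -` {l} \<inter> space \<mu>)"
      using measurable_sets[OF X.hist_meas[OF tT], of "{l}"] by (intro emeasure_distr[symmetric] couplingsD(5)[OF \<gamma>]) simp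
    finally show ?thesis by (simp add: couplingsD(3)[OF \<gamma>])
  qed
  have GY: "?G \<le> emeasure \<nu> (hist Q (Suc t) -` {l} \<inter> space \<nu>)"
  proof -
    have "?G \<le> emeasure \<gamma> (snd -` (hist Q (Suc t) -` {l} \<inter> space \<nu>) \<inter> space \<gamma>)"
      using measurable_sets[OF couplingsD(6)[OF \<gamma>] measurable_sets[OF Y.hist_meas[OF tT], of "{l}"]] couplingsD(2)[OF \<gamma>]
      by (intro emeasure_mono) (auto simp: agree_def)
    also have "\<dots> = emeasure (distr \<gamma> \<nu> snd) (hist Q (Suc t) -` {l} \<inter> space \<nu>)"
      using measurable_sets[OF Y.hist_meas[OF tT], of "{l}"] by (intro emeasure_distr[symmetric] couplingsD(6)[OF \<gamma>]) simp
    finally show ?thesis by (simp add: couplingsD(4)[OF \<gamma>])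
  qed
  have D: "?D = emeasure (r t c c) {(a, a)} * emeasure (LD t) {(c, c)}"
    unfolding snoc by (rule LD_diag[OF t])
  have EX: "?EX = emeasure (X.m t c) {a} * emeasure (LD t) {cc. fst cc = c \<and> snd cc \<in> - {c}}"
    unfolding snoc using LD_fst_part[OF t, of c a "- {c}"] by simp
  have EY: "?EY = emeasure (Y.m t c) {a} * emeasure (LD t) {cc. snd cc = c \<and> fst cc \<in> - {c}}"
    unfolding snoc using LD_snd_part[OF t, of c a "- {c}"] by simp
  have LX: "emeasure \<mu> (hist Q (Suc t) -` {l} \<inter> space \<mu>) = emeasure (X.m t c) {a} * emeasure (LD t) {(c, c)} + ?EX"
  proof -
    have "emeasure (LD t) {cc. fst cc = c} = emeasure (LD t) {(c, c)} + emeasure (LD t) {cc. fst cc = c \<and> snd cc \<in> - {c}}"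
      by (subst plus_emeasure) (auto simp: LD_props intro!: arg_cong[where f = "emeasure (LD t)"])
    moreover have "emeasure \<mu> (hist Q (Suc t) -` {l} \<inter> space \<mu>) = emeasure (X.m t c) {a} * emeasure (LD t) {cc. fst cc = c}"
      using LD_fst_part[OF t, of c a UNIV] LD_fst_law[OF tT, of l] by (simp add: snoc)
    ultimately show ?thesis unfolding EX by (simp add: distrib_left)
  qed
  have LY: "emeasure \<nu> (hist Q (Suc t) -` {l} \<inter> space \<nu>) = emeasure (Y.m t c) {a} * emeasure (LD t) {(c, c)} + ?EY"
  proof -
    have "emeasure (LD t) {cc. snd cc = c} = emeasure (LD t) {(c, c)} + emeasure (LD t) {cc. snd cc = c \<and> fst cc \<in> - {c}}"
      by (subst plus_emeasure) (auto simp: LD_props intro!: arg_cong[where f = "emeasure (LD t)"])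
    moreover have "emeasure \<nu> (hist Q (Suc t) -` {l} \<inter> space \<nu>) = emeasure (Y.m t c) {a} * emeasure (LD t) {cc. snd cc = c}"
      using LD_snd_part[OF t, of c a UNIV] LD_snd_law[OF tT, of l] by (simp add: snoc)
    ultimately show ?thesis unfolding EY by (simp add: distrib_left)
  qed
  consider "emeasure (X.m t c) {a} \<le> emeasure (r t c c) {(a, a)}" | "emeasure (Y.m t c) {a} \<le> emeasure (r t c c) {(a, a)}"
    using r_max[OF t, of c a] by (auto simp: min_le_iff_disj)
  then show ?thesis
  proof cases
    case 1
    have "?G \<le> emeasure (X.m t c) {a} * emeasure (LD t) {(c, c)} + ?EX" using GX LX by simp
    also have "\<dots> \<le> ?D + ?EX" unfolding D by (intro add_right_mono mult_right_mono 1) simp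
    also have "\<dots> \<le> ?D + ?EX + ?EY" by simp
    finally show ?thesis .
  next
    case 2
    have "?G \<le> emeasure (Y.m t c) {a} * emeasure (LD t) {(c, c)} + ?EY" using GY LY by simp
    also have "\<dots> \<le> ?D + ?EY" unfolding D by (intro add_right_mono mult_right_mono 2) simp
    also have "\<dots> \<le> ?D + ?EX + ?EY" by (simp add: add.assoc add_left_mono)
    finally show ?thesis .
  qed
qed

text \<open>Summation over all histories. Pairs that already differ at time \<open>t\<close> are
  counted once for each side, hence the factor 2.\<close>

lemma agree_step:
  assumes t: "t < T"
  shows "emeasure \<gamma> (agree (Suc t)) \<le> emeasure (LD (Suc t)) {cc. fst cc = snd cc} + 2 * emeasure (LD t) {cc. fst cc \<noteq> snd cc}"
proof -
  have tT: "Suc t \<le> T" using t by simp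
  have disc: "f \<in> LD (Suc t) \<rightarrow>\<^sub>M count_space UNIV" for f :: "nat list \<times> nat list \<Rightarrow> nat list"
    unfolding LD_def by simp
  have "emeasure (LD (Suc t)) {cc. butlast (fst cc) \<noteq> butlast (snd cc)} = emeasure (LD t) {cc. fst cc \<noteq> snd cc}"
    unfolding emeasure_LD_Suc[OF t]
  proof (subst LD_integral_const[where k = 1 and E = "{cc. fst cc \<noteq> snd cc}"])
    fix cc :: "nat list \<times> nat list" assume "cc \<in> {cc. fst cc \<noteq> snd cc}"
    then have "{ab :: nat \<times> nat. (fst cc @ [fst ab], snd cc @ [snd ab]) \<in> {cc. butlast (fst cc) \<noteq> butlast (snd cc)}} = space (r t (fst cc) (snd cc))"
      by (auto simp: r_props[OF t])
    then show "emeasure (r t (fst cc) (snd cc)) {ab. (fst cc @ [fst ab], snd cc @ [snd ab]) \<in> {cc. butlast (fst cc) \<noteq> butlast (snd cc)}} = 1"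
      by (simp only: prob_space.emeasure_space_1[OF r_props(3)[OF t]])
  next
    fix cc :: "nat list \<times> nat list" assume "cc \<notin> {cc. fst cc \<noteq> snd cc}"
    then have "{ab :: nat \<times> nat. (fst cc @ [fst ab], snd cc @ [snd ab]) \<in> {cc. butlast (fst cc) \<noteq> butlast (snd cc)}} = {}" by auto
    then show "emeasure (r t (fst cc) (snd cc)) {ab. (fst cc @ [fst ab], snd cc @ [snd ab]) \<in> {cc. butlast (fst cc) \<noteq> butlast (snd cc)}} = 0"
      by (simp only: emeasure_empty)
  qed simp
  note off = this
  have "emeasure \<gamma> (agree (Suc t)) = (\<integral>\<^sup>+l. emeasure \<gamma> (agree (Suc t) \<inter> (\<lambda>w. hist Q (Suc t) (fst w)) -` {l}) \<partial>count_space UNIV)"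
    by (rule emeasure_split_countable[OF hist_\<gamma>_fst[OF tT] agree_sets[OF tT]])
  also have "\<dots> \<le> (\<integral>\<^sup>+l. emeasure (LD (Suc t)) {(l, l)} + emeasure (LD (Suc t)) {cc. fst cc = l \<and> butlast (snd cc) \<in> - {butlast l}} +
    emeasure (LD (Suc t)) {cc. snd cc = l \<and> butlast (fst cc) \<in> - {butlast l}} \<partial>count_space UNIV)"
    by (intro nn_integral_mono agree_label_le[OF t])
  also have "\<dots> = (\<integral>\<^sup>+l. emeasure (LD (Suc t)) {(l, l)} \<partial>count_space UNIV) +
     (\<integral>\<^sup>+l. emeasure (LD (Suc t)) {cc. fst cc = l \<and> butlast (snd cc) \<in> - {butlast l}} \<partial>count_space UNIV) +
     (\<integral>\<^sup>+l. emeasure (LD (Suc t)) {cc. snd cc = l \<and> butlast (fst cc) \<in> - {butlast l}} \<partial>count_space UNIV)"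
    by (simp add: nn_integral_add)
  also have "(\<integral>\<^sup>+l. emeasure (LD (Suc t)) {(l, l)} \<partial>count_space UNIV) = emeasure (LD (Suc t)) {cc. fst cc = snd cc}"
    by (subst emeasure_split_countable[OF disc[of fst], of "{cc. fst cc = snd cc}"])
      (auto simp: LD_props intro!: nn_integral_cong arg_cong[where f = "emeasure (LD (Suc t))"])
  also have "(\<integral>\<^sup>+l. emeasure (LD (Suc t)) {cc. fst cc = l \<and> butlast (snd cc) \<in> - {butlast l}} \<partial>count_space UNIV) = emeasure (LD (Suc t)) {cc. butlast (fst cc) \<noteq> butlast (snd cc)}"
    by (subst emeasure_split_countable[OF disc[of fst], of "{cc. butlast (fst cc) \<noteq> butlast (snd cc)}"])
      (auto simp: LD_props intro!: nn_integral_cong arg_cong[where f = "emeasure (LD (Suc t))"])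
  also have "(\<integral>\<^sup>+l. emeasure (LD (Suc t)) {cc. snd cc = l \<and> butlast (fst cc) \<in> - {butlast l}} \<partial>count_space UNIV) = emeasure (LD (Suc t)) {cc. butlast (fst cc) \<noteq> butlast (snd cc)}"
    by (subst emeasure_split_countable[OF disc[of snd], of "{cc. butlast (fst cc) \<noteq> butlast (snd cc)}"])
      (auto simp: LD_props intro!: nn_integral_cong arg_cong[where f = "emeasure (LD (Suc t))"])
  finally show ?thesis by (simp add: off mult_2 add.assoc)
qed

text \<open>With \<open>d\<close> the probability of disagreement under \<open>\<gamma>\<close>,
  \<open>agree_step\<close> reads e' \<le> d + 2 e with initial value 0, and (2 ^ t - 1) d solves
  this recursion.\<close>

theorem disagreement_le:
  "t \<le> T \<Longrightarrow> measure (LD t) {cc. fst cc \<noteq> snd cc} \<le> (2 ^ t - 1) * measure \<gamma> (space \<gamma> - agree T)"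
proof (induction t)
  case 0
  have "emeasure (LD 0) {cc. fst cc \<noteq> snd cc} = (\<integral>\<^sup>+cc. indicator {cc. fst cc \<noteq> snd cc} cc \<partial>LD 0)" by (simp add: LD_props)
  also have "\<dots> = (\<integral>\<^sup>+h. indicator {cc. fst cc \<noteq> snd cc} (fst h) \<partial>P 0)" by (rule nn_integral_LD) simp
  also have "\<dots> = 0"
  proof -
    have "(\<lambda>h. indicator {cc. fst cc \<noteq> snd cc} (fst h) :: ennreal) \<in> borel_measurable (H 0)"
      unfolding H_def by (rule measurable_compose[OF measurable_fst]) simp
    then show ?thesis unfolding P.simps by (subst nn_integral_return) (auto simp: space_H path_space_0)
  qed
  finally show ?case by (simp add: measure_def)
next
  case (Suc t)
  then have t: "t < T" by simp
  interpret \<gamma>: prob_space \<gamma> by (rule prob_\<gamma>)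
  interpret L: prob_space "LD t" by (rule LD_props(1)) (use t in simp)
  interpret L': prob_space "LD (Suc t)" by (rule LD_props(1)) (use t in simp)
  define d where "d = measure \<gamma> (space \<gamma> - agree T)"
  have "1 - d = measure \<gamma> (agree T)"
    unfolding d_def using \<gamma>.prob_compl[OF agree_sets[OF order_refl]] by simp
  \<comment> \<open>Agreement up to \<open>T\<close> implies agreement up to any earlier time, so
    the same \<open>d\<close> serves all steps.\<close>
  also have "\<dots> \<le> measure \<gamma> (agree (Suc t))"
  proof (rule \<gamma>.finite_measure_mono)
    show "agree T \<subseteq> agree (Suc t)"
      using Suc.prems unfolding agree_def by (auto simp: take_hist[of "Suc t" T, symmetric])
  qed (use agree_sets Suc.prems in simp)
  also have "\<dots> \<le> measure (LD (Suc t)) {cc. fst cc = snd cc} + 2 * measure (LD t) {cc. fst cc \<noteq> snd cc}"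
  proof -
    have "ennreal (measure \<gamma> (agree (Suc t))) \<le> ennreal (measure (LD (Suc t)) {cc. fst cc = snd cc} + 2 * measure (LD t) {cc. fst cc \<noteq> snd cc})"
      using agree_step[OF t] by (simp add: \<gamma>.emeasure_eq_measure L.emeasure_eq_measure L'.emeasure_eq_measure ennreal_mult)
    then show ?thesis by (subst (asm) ennreal_le_iff) auto
  qed
  also have "measure (LD (Suc t)) {cc. fst cc = snd cc} = 1 - measure (LD (Suc t)) {cc. fst cc \<noteq> snd cc}"
    using L'.prob_compl[of "{cc. fst cc \<noteq> snd cc}"] by (simp add: LD_props Compl_eq_Diff_UNIV[symmetric] Collect_neg_eq[symmetric])
  finally have "measure (LD (Suc t)) {cc. fst cc \<noteq> snd cc} \<le> d + 2 * measure (LD t) {cc. fst cc \<noteq> snd cc}" by simp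
  also have "\<dots> \<le> d + 2 * ((2 ^ t - 1) * d)" using Suc.IH t by (simp add: d_def)
  also have "\<dots> = (2 ^ Suc t - 1) * d" by (simp add: algebra_simps)
  finally show ?case by (simp add: d_def)
qed

end

section \<open>Randomly shifted grids\<close>

text \<open>The floors differ only if an integer separates \<open>a + u\<close> from
  \<open>b + u\<close>. For \<open>u\<close> in the unit interval two integers are possible, and
  each confines \<open>u\<close> to an interval of length \<open>\<bar>a - b\<bar>\<close>.\<close>

lemma emeasure_floor_shift_le:
  fixes a b :: real
  shows "emeasure lborel {u\<in>{0..1}. \<lfloor>a + u\<rfloor> \<noteq> \<lfloor>b + u\<rfloor>} \<le> ennreal (2 * \<bar>a - b\<bar>)"
proof -
  have *: "emeasure lborel {u\<in>{0..1}. \<lfloor>a + u\<rfloor> \<noteq> \<lfloor>b + u\<rfloor>} \<le> ennreal (2 * (b - a))" if ab: "a \<le> b" for a b :: real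
  proof -
    define n where "n = real_of_int \<lfloor>b\<rfloor>"
    have "{u\<in>{0..1}. \<lfloor>a + u\<rfloor> \<noteq> \<lfloor>b + u\<rfloor>} \<subseteq> {n - b..n - a} \<union> {n + 1 - b..n + 1 - a}"
    proof
      fix u assume "u \<in> {u\<in>{0..1}. \<lfloor>a + u\<rfloor> \<noteq> \<lfloor>b + u\<rfloor>}"
      then have u: "0 \<le> u" "u \<le> 1" "\<lfloor>a + u\<rfloor> \<noteq> \<lfloor>b + u\<rfloor>" by auto
      moreover have "\<lfloor>a + u\<rfloor> \<le> \<lfloor>b + u\<rfloor>" using ab by (intro floor_mono) simp
      ultimately have lt: "a + u < \<lfloor>b + u\<rfloor>" "\<lfloor>b + u\<rfloor> \<le> b + u" by linarith+
      have "\<lfloor>b + u\<rfloor> = \<lfloor>b\<rfloor> \<or> \<lfloor>b + u\<rfloor> = \<lfloor>b\<rfloor> + 1" using u by linarith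
      then show "u \<in> {n - b..n - a} \<union> {n + 1 - b..n + 1 - a}"
      proof
        assume "\<lfloor>b + u\<rfloor> = \<lfloor>b\<rfloor>"
        with lt have "u \<in> {n - b..n - a}" unfolding n_def atLeastAtMost_iff by linarith
        then show ?thesis ..
      next
        assume "\<lfloor>b + u\<rfloor> = \<lfloor>b\<rfloor> + 1"
        with lt have "u \<in> {n + 1 - b..n + 1 - a}" unfolding n_def atLeastAtMost_iff by linarith
        then show ?thesis ..
      qed
    qed
    then have "emeasure lborel {u\<in>{0..1}. \<lfloor>a + u\<rfloor> \<noteq> \<lfloor>b + u\<rfloor>} \<le> emeasure lborel ({n - b..n - a} \<union> {n + 1 - b..n + 1 - a})"
      by (rule emeasure_mono) simp
    also have "\<dots> \<le> emeasure lborel {n - b..n - a} + emeasure lborel {n + 1 - b..n + 1 - a}"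
      by (rule emeasure_subadditive) simp_all
    also have "\<dots> = ennreal (2 * (b - a))" using ab by (simp flip: ennreal_plus)
    finally show ?thesis .
  qed
  show ?thesis
  proof (cases "a \<le> b")
    case True
    then show ?thesis using *[of a b] by simp
  next
    case False
    have "{u\<in>{0..1}. \<lfloor>a + u\<rfloor> \<noteq> \<lfloor>b + u\<rfloor>} = {u\<in>{0..1}. \<lfloor>b + u\<rfloor> \<noteq> \<lfloor>a + u\<rfloor>}" by auto
    then show ?thesis using False *[of b a] by simp
  qed
qed

text \<open>The bound holds on average over a uniformly random shift \<open>v\<close>, by Fubini's theorem.\<close>

lemma exists_floor_shift:
  assumes \<gamma>: "prob_space \<gamma>" and [measurable]: "X \<in> borel_measurable \<gamma>" "Y \<in> borel_measurable \<gamma>"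
  shows "\<exists>v::real. emeasure \<gamma> {w\<in>space \<gamma>. \<lfloor>X w + v\<rfloor> \<noteq> \<lfloor>Y w + v\<rfloor>} \<le> (\<integral>\<^sup>+w. ennreal (2 * \<bar>X w - Y w\<bar>) \<partial>\<gamma>)"
proof (rule ccontr)
  interpret prob_space \<gamma> by fact
  define U where "U = uniform_measure lborel {0..1::real}"
  interpret U: prob_space U unfolding U_def by (rule prob_space_uniform_measure) auto
  interpret U\<gamma>: pair_sigma_finite U \<gamma> ..
  have [measurable_cong]: "sets U = sets borel" by (simp add: U_def)
  have spU: "space U = UNIV" by (simp add: U_def)
  let ?c = "\<integral>\<^sup>+w. ennreal (2 * \<bar>X w - Y w\<bar>) \<partial>\<gamma>"
  let ?I = "\<lambda>v w. indicator {v. \<lfloor>X w + v\<rfloor> \<noteq> \<lfloor>Y w + v\<rfloor>} v :: ennreal"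
  have set1: "{v. \<lfloor>X w + v\<rfloor> \<noteq> \<lfloor>Y w + v\<rfloor>} \<in> sets borel" for w
  proof -
    have "Measurable.pred borel (\<lambda>v. \<lfloor>X w + v\<rfloor> \<noteq> \<lfloor>Y w + v\<rfloor>)" by measurable
    then show ?thesis by (simp add: pred_def)
  qed
  have g: "emeasure \<gamma> {w\<in>space \<gamma>. \<lfloor>X w + v\<rfloor> \<noteq> \<lfloor>Y w + v\<rfloor>} = (\<integral>\<^sup>+w. ?I v w \<partial>\<gamma>)" for v
  proof -
    have "{w\<in>space \<gamma>. \<lfloor>X w + v\<rfloor> \<noteq> \<lfloor>Y w + v\<rfloor>} \<in> sets \<gamma>" by measurable
    then have "emeasure \<gamma> {w\<in>space \<gamma>. \<lfloor>X w + v\<rfloor> \<noteq> \<lfloor>Y w + v\<rfloor>} = (\<integral>\<^sup>+w. indicator {w\<in>space \<gamma>. \<lfloor>X w + v\<rfloor> \<noteq> \<lfloor>Y w + v\<rfloor>} w \<partial>\<gamma>)" by simp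
    also have "\<dots> = (\<integral>\<^sup>+w. ?I v w \<partial>\<gamma>)" by (intro nn_integral_cong) (auto split: split_indicator)
    finally show ?thesis .
  qed
  have I [measurable]: "case_prod ?I \<in> borel_measurable (U \<Otimes>\<^sub>M \<gamma>)"
  proof -
    have "Measurable.pred (U \<Otimes>\<^sub>M \<gamma>) (\<lambda>p. \<lfloor>X (snd p) + fst p\<rfloor> \<noteq> \<lfloor>Y (snd p) + fst p\<rfloor>)" by measurable
    then have "(\<lambda>p. if \<lfloor>X (snd p) + fst p\<rfloor> \<noteq> \<lfloor>Y (snd p) + fst p\<rfloor> then 1 else 0 :: ennreal) \<in> borel_measurable (U \<Otimes>\<^sub>M \<gamma>)" by measurable
    then show ?thesis by (simp add: case_prod_beta' indicator_def)
  qed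
  assume "\<nexists>v. emeasure \<gamma> {w\<in>space \<gamma>. \<lfloor>X w + v\<rfloor> \<noteq> \<lfloor>Y w + v\<rfloor>} \<le> ?c"
  then have gt: "?c < (\<integral>\<^sup>+w. ?I v w \<partial>\<gamma>)" for v unfolding g by (simp add: not_le)
  then have cfin: "?c \<noteq> \<infinity>" using top.not_eq_extremum by fastforce
  have "?c = (\<integral>\<^sup>+v. ?c \<partial>U)" by (simp add: U.emeasure_space_1)
  also have "\<dots> < (\<integral>\<^sup>+v. \<integral>\<^sup>+w. ?I v w \<partial>\<gamma> \<partial>U)"
  proof (rule nn_integral_less)
    show "(\<lambda>v. \<integral>\<^sup>+w. ?I v w \<partial>\<gamma>) \<in> borel_measurable U"
      by (rule borel_measurable_nn_integral[OF I])
    show "(\<integral>\<^sup>+v. ?c \<partial>U) \<noteq> \<infinity>" using cfin by (simp add: U.emeasure_space_1)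
    show "AE v in U. ?c \<le> (\<integral>\<^sup>+w. ?I v w \<partial>\<gamma>)" using gt by (auto intro: less_imp_le)
    have "\<not> (\<integral>\<^sup>+w. ?I v w \<partial>\<gamma>) \<le> ?c" for v using gt[of v] by (simp add: not_le)
    then show "\<not> (AE v in U. (\<integral>\<^sup>+w. ?I v w \<partial>\<gamma>) \<le> ?c)" by (simp add: U.AE_False)
  qed simp
  also have "\<dots> = (\<integral>\<^sup>+w. \<integral>\<^sup>+v. ?I v w \<partial>U \<partial>\<gamma>)" by (rule U\<gamma>.Fubini'[OF I, symmetric])
  also have "\<dots> \<le> ?c"
  proof (rule nn_integral_mono)
    fix w
    have "(\<integral>\<^sup>+v. ?I v w \<partial>U) = emeasure U {v. \<lfloor>X w + v\<rfloor> \<noteq> \<lfloor>Y w + v\<rfloor>}"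
      using set1[of w] by (simp add: U_def)
    also have "\<dots> = emeasure lborel {u\<in>{0..1}. \<lfloor>X w + u\<rfloor> \<noteq> \<lfloor>Y w + u\<rfloor>}"
    proof -
      have "{0..1} \<inter> {v. \<lfloor>X w + v\<rfloor> \<noteq> \<lfloor>Y w + v\<rfloor>} = {u\<in>{0..1}. \<lfloor>X w + u\<rfloor> \<noteq> \<lfloor>Y w + u\<rfloor>}" by auto
      then show ?thesis unfolding U_def using set1[of w] by (simp add: divide_ennreal_def)
    qed
    also have "\<dots> \<le> ennreal (2 * \<bar>X w - Y w\<bar>)" by (rule emeasure_floor_shift_le)
    finally show "(\<integral>\<^sup>+v. ?I v w \<partial>U) \<le> ennreal (2 * \<bar>X w - Y w\<bar>)" .
  qed
  finally show False by simp
qed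

lemma norm_vec_le_const:
  fixes x :: "real ^ 'd :: finite"
  assumes "\<And>i. \<bar>x $ i\<bar> \<le> l" shows "norm x \<le> real CARD('d) * l"
proof -
  have "norm x \<le> (\<Sum>i\<in>UNIV. \<bar>x $ i\<bar>)" by (rule norm_le_l1_cart)
  also have "\<dots> \<le> (\<Sum>i\<in>(UNIV :: 'd set). l)" by (intro sum_mono assms)
  finally show ?thesis by simp
qed

text \<open>Cells are cubes of side \<open>l\<close>. Every time and every coordinate gets a good
  shift of its own, and a union bound over the \<open>T * CARD('d)\<close> pairs gives the constant:
  the 2 is that of \<open>emeasure_floor_shift_le\<close>, the division by \<open>l\<close> comes
  from rescaling to unit cells.\<close>

lemma exists_quantizer:
  fixes \<mu> \<nu> :: "(nat \<Rightarrow> real ^ 'd :: finite) measure"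
  assumes \<mu>: "\<mu> \<in> space (prob_algebra (path_space T))" and \<nu>: "\<nu> \<in> space (prob_algebra (path_space T))"
    and \<gamma>: "\<gamma> \<in> couplings \<mu> \<nu>" and l: "l > 0"
  obtains Q :: "nat \<Rightarrow> real ^ 'd \<Rightarrow> nat" and q where "\<And>s. Q s \<in> borel \<rightarrow>\<^sub>M count_space UNIV"
    "\<And>s u. dist (q s (Q s u)) u \<le> real CARD('d) * l"
    "emeasure \<gamma> {w\<in>space \<gamma>. hist Q T (fst w) \<noteq> hist Q T (snd w)} \<le>
       ennreal (2 * real T * real CARD('d) / l) * (\<integral>\<^sup>+w. ennreal (path_dist T (fst w) (snd w)) \<partial>\<gamma>)"
proof -
  have P\<mu>: "prob_space \<mu>" "sets \<mu> = sets (path_space T)" "sets \<nu> = sets (path_space T)"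
    using \<mu> \<nu> by (auto simp: space_prob_algebra)
  have P\<gamma>: "prob_space \<gamma>" by (rule prob_space_coupling[OF \<gamma> P\<mu>(1)])
  let ?c = "\<integral>\<^sup>+w. ennreal (path_dist T (fst w) (snd w)) \<partial>\<gamma>"
  let ?S = "\<lambda>v s i. {w\<in>space \<gamma>. \<lfloor>fst w s $ i / l + v\<rfloor> \<noteq> \<lfloor>snd w s $ i / l + v\<rfloor>}"
  have cf [measurable]: "(\<lambda>w. fst w s) \<in> borel_measurable \<gamma>" and cs [measurable]: "(\<lambda>w. snd w s) \<in> borel_measurable \<gamma>" if "s \<in> {1..T}" for s
  proof -
    have c: "(\<lambda>x. x s) \<in> path_space T \<rightarrow>\<^sub>M (borel :: (real ^ 'd) measure)" by (rule measurable_path_component[OF that])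
    show "(\<lambda>w. fst w s) \<in> borel_measurable \<gamma>"
      by (rule measurable_compose[OF couplingsD(5)[OF \<gamma>]]) (unfold measurable_cong_sets[OF P\<mu>(2) refl], rule c)
    show "(\<lambda>w. snd w s) \<in> borel_measurable \<gamma>"
      by (rule measurable_compose[OF couplingsD(6)[OF \<gamma>]]) (unfold measurable_cong_sets[OF P\<mu>(3) refl], rule c)
  qed
  have cfi: "(\<lambda>w. fst w s $ i / l) \<in> borel_measurable \<gamma>" and csi: "(\<lambda>w. snd w s $ i / l) \<in> borel_measurable \<gamma>" if "s \<in> {1..T}" for s i
  proof -
    have "(\<lambda>u :: real ^ 'd. u $ i / l) \<in> borel_measurable borel" by (intro borel_measurable_continuous_onI continuous_intros) (use l in auto)
    from measurable_compose[OF cf[OF that] this] measurable_compose[OF cs[OF that] this]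
    show "(\<lambda>w. fst w s $ i / l) \<in> borel_measurable \<gamma>" "(\<lambda>w. snd w s $ i / l) \<in> borel_measurable \<gamma>" by auto
  qed
  have ex: "\<exists>v. emeasure \<gamma> (?S v s i) \<le> ennreal (2 / l) * ?c" if s: "s \<in> {1..T}" for s i
  proof -
    from exists_floor_shift[OF P\<gamma> cfi[OF s, of i] csi[OF s, of i]]
    obtain v where v: "emeasure \<gamma> (?S v s i) \<le> (\<integral>\<^sup>+w. ennreal (2 * \<bar>fst w s $ i / l - snd w s $ i / l\<bar>) \<partial>\<gamma>)" by blast
    also have "\<dots> \<le> (\<integral>\<^sup>+w. ennreal (2 / l) * ennreal (path_dist T (fst w) (snd w)) \<partial>\<gamma>)"
    proof (rule nn_integral_mono)
      fix w :: "(nat \<Rightarrow> real ^ 'd) \<times> (nat \<Rightarrow> real ^ 'd)"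
      have "2 * \<bar>fst w s $ i / l - snd w s $ i / l\<bar> = 2 / l * \<bar>(fst w s - snd w s) $ i\<bar>"
        using l by (simp add: diff_divide_distrib[symmetric] abs_divide)
      also have "\<dots> \<le> 2 / l * path_dist T (fst w) (snd w)"
        using component_le_norm_cart[of "fst w s - snd w s" i] dist_le_path_dist[OF s, of "fst w" "snd w"] l
        by (intro mult_left_mono) (auto simp: dist_norm)
      finally show "ennreal (2 * \<bar>fst w s $ i / l - snd w s $ i / l\<bar>) \<le> ennreal (2 / l) * ennreal (path_dist T (fst w) (snd w))"
        using l by (simp add: ennreal_mult[symmetric])
    qed
    also have "\<dots> = ennreal (2 / l) * ?c"
    proof (rule nn_integral_cmult)
      have "(\<lambda>w. path_dist T (fst w) (snd w)) \<in> borel_measurable \<gamma>"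
        unfolding path_dist_def L2_set_def by measurable
      then show "(\<lambda>w. ennreal (path_dist T (fst w) (snd w))) \<in> borel_measurable \<gamma>" by measurable
    qed
    finally show ?thesis by blast
  qed
  define v where "v s i = (SOME v. emeasure \<gamma> (?S v s i) \<le> ennreal (2 / l) * ?c)" for s i
  have v: "emeasure \<gamma> (?S (v s i) s i) \<le> ennreal (2 / l) * ?c" if "s \<in> {1..T}" for s i
    unfolding v_def by (rule someI_ex[OF ex[OF that]])
  define Q :: "nat \<Rightarrow> real ^ 'd \<Rightarrow> nat" where "Q s u = to_nat (\<lambda>i. \<lfloor>u $ i / l + v s i\<rfloor>)" for s u
  \<comment> \<open>The corner of the cell with the smallest coordinates. Each coordinate of a point
    of the cell exceeds it by at most \<open>l\<close>.\<close>
  define q :: "nat \<Rightarrow> nat \<Rightarrow> real ^ 'd" where "q s n = (\<chi> i. l * (of_int ((from_nat n :: 'd \<Rightarrow> int) i) - v s i))" for s n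
  have Qm: "Q s \<in> borel \<rightarrow>\<^sub>M count_space UNIV" for s
  proof -
    have "(\<lambda>u :: real ^ 'd. (\<lambda>i. \<lfloor>u $ i / l + v s i\<rfloor>)) \<in> borel \<rightarrow>\<^sub>M count_space UNIV"
    proof (subst measurable_count_space_eq2_countable, safe)
      fix k :: "'d \<Rightarrow> int"
      have "{u :: real ^ 'd. \<forall>i. \<lfloor>u $ i / l + v s i\<rfloor> = k i} = (\<Inter>i. {u. \<lfloor>u $ i / l + v s i\<rfloor> = k i})" by auto
      also have "\<dots> \<in> sets borel"
      proof (intro sets.finite_INT)
        fix i
        have [measurable]: "(\<lambda>u :: real ^ 'd. u $ i / l + v s i) \<in> borel_measurable borel" by (intro borel_measurable_continuous_onI continuous_intros) (use l in auto)
        have "Measurable.pred borel (\<lambda>u :: real ^ 'd. \<lfloor>u $ i / l + v s i\<rfloor> = k i)" by measurable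
        then show "{u :: real ^ 'd. \<lfloor>u $ i / l + v s i\<rfloor> = k i} \<in> sets borel" by (simp add: pred_def)
      qed auto
      also have "{u :: real ^ 'd. \<forall>i. \<lfloor>u $ i / l + v s i\<rfloor> = k i} = (\<lambda>u i. \<lfloor>u $ i / l + v s i\<rfloor>) -` {k} \<inter> space borel" by auto
      finally show "(\<lambda>u i. \<lfloor>u $ i / l + v s i\<rfloor>) -` {k} \<inter> space borel \<in> sets borel" .
    qed auto
    from measurable_compose[OF this, of to_nat "count_space UNIV"] show ?thesis unfolding Q_def by simp
  qed
  have qd: "dist (q s (Q s u)) u \<le> real CARD('d) * l" for s u
    unfolding dist_norm
  proof (rule norm_vec_le_const)
    fix i
    have "(q s (Q s u) - u) $ i = l * (of_int \<lfloor>u $ i / l + v s i\<rfloor> - (u $ i / l + v s i))"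
      using l by (simp add: q_def Q_def algebra_simps)
    also have "\<bar>\<dots>\<bar> = l * \<bar>of_int \<lfloor>u $ i / l + v s i\<rfloor> - (u $ i / l + v s i)\<bar>" using l by (simp add: abs_mult)
    also have "\<dots> \<le> l * 1" using l by (intro mult_left_mono) linarith+
    finally show "\<bar>(q s (Q s u) - u) $ i\<bar> \<le> l" by simp
  qed
  have Sm: "?S (v s i) s i \<in> sets \<gamma>" if "s \<in> {1..T}" for s i
  proof -
    note [measurable] = cfi[OF that, of i] csi[OF that, of i]
    show ?thesis by measurable
  qed
  have "emeasure \<gamma> {w\<in>space \<gamma>. hist Q T (fst w) \<noteq> hist Q T (snd w)} \<le> emeasure \<gamma> (\<Union>(s, i)\<in>{1..T} \<times> UNIV. ?S (v s i) s i)"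
  proof (rule emeasure_mono)
    show "(\<Union>(s, i)\<in>{1..T} \<times> UNIV. ?S (v s i) s i) \<in> sets \<gamma>" using Sm by (intro sets.finite_UN) auto
    show "{w\<in>space \<gamma>. hist Q T (fst w) \<noteq> hist Q T (snd w)} \<subseteq> (\<Union>(s, i)\<in>{1..T} \<times> UNIV. ?S (v s i) s i)"
    proof safe
      fix x y :: "nat \<Rightarrow> real ^ 'd" assume w: "(x, y) \<in> space \<gamma>" and ne: "hist Q T (fst (x, y)) \<noteq> hist Q T (snd (x, y))"
      then obtain s where s: "s \<in> {1..T}" "Q s (x s) \<noteq> Q s (y s)" by (fastforce simp: hist_def)
      then obtain i where "\<lfloor>x s $ i / l + v s i\<rfloor> \<noteq> \<lfloor>y s $ i / l + v s i\<rfloor>" unfolding Q_def by (metis (no_types, lifting))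
      with w s show "(x, y) \<in> (\<Union>(s, i)\<in>{1..T} \<times> UNIV. ?S (v s i) s i)" by (auto intro!: bexI[of _ s])
    qed
  qed
  also have "\<dots> \<le> (\<Sum>(s, i)\<in>{1..T} \<times> UNIV. emeasure \<gamma> (?S (v s i) s i))"
    proof -
    have "(\<lambda>(s, i). ?S (v s i) s i) ` ({1..T} \<times> (UNIV :: 'd set)) \<subseteq> sets \<gamma>" using Sm by auto
    from emeasure_subadditive_finite[of "{1..T} \<times> (UNIV :: 'd set)" "\<lambda>(s, i). ?S (v s i) s i", OF _ this]
    show ?thesis by (simp add: case_prod_beta')
  qed
  also have "\<dots> \<le> (\<Sum>(s, i)\<in>{1..T} \<times> (UNIV :: 'd set). ennreal (2 / l) * ?c)"
    using v by (intro sum_mono) auto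
  also have "\<dots> = ennreal (2 * real T * real CARD('d) / l) * ?c"
  proof -
    have "(\<Sum>(s, i)\<in>{1..T} \<times> (UNIV :: 'd set). ennreal (2 / l) * ?c) = ennreal (real (T * CARD('d))) * (ennreal (2 / l) * ?c)"
      by (simp add: case_prod_beta' ennreal_of_nat_eq_real_of_nat)
    also have "\<dots> = (ennreal (real (T * CARD('d))) * ennreal (2 / l)) * ?c" by (rule mult.assoc[symmetric])
    also have "ennreal (real (T * CARD('d))) * ennreal (2 / l) = ennreal (2 * real T * real CARD('d) / l)"
      using l by (simp add: ennreal_mult[symmetric] mult_ac)
    finally show ?thesis .
  qed
  finally show ?thesis by (intro that[of Q q] Qm qd)
qed

section \<open>Diameter bounds and the cost of a single time step\<close>

lemma path_dist_le_norms: "path_dist t x y \<le> path_norm t x + path_norm t y"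
proof -
  have "path_dist t x y \<le> L2_set (\<lambda>s. norm (x s) + norm (y s)) {1..t}"
    unfolding path_dist_def by (intro L2_set_mono norm_triangle_ineq4) auto
  also have "\<dots> \<le> path_norm t x + path_norm t y"
    unfolding path_norm_def by (rule L2_set_triangle_ineq)
  finally show ?thesis .
qed

lemma norm_le_path_norm: "s \<in> {1..t} \<Longrightarrow> norm (x s) \<le> path_norm t x"
  unfolding path_norm_def by (rule member_le_L2_set) auto

lemma path_dist_le_diam:
  assumes F: "path_bounded T F" and x: "x \<in> F" and y: "y \<in> F"
  shows "path_dist T x y \<le> path_diam T F"
proof -
  obtain B where B: "\<And>x. x \<in> F \<Longrightarrow> path_norm T x \<le> B" using F by (auto simp: path_bounded_def)
  have "bdd_above ((\<lambda>w. path_dist T (fst w) (snd w)) ` (F \<times> F))"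
  proof (rule bdd_aboveI2)
    fix w assume "w \<in> F \<times> F"
    then show "path_dist T (fst w) (snd w) \<le> B + B"
      using path_dist_le_norms[of T "fst w" "snd w"] B[of "fst w"] B[of "snd w"] by auto
  qed
  then have "path_dist T (fst (x, y)) (snd (x, y)) \<le> (SUP w\<in>F \<times> F. path_dist T (fst w) (snd w))"
    by (rule cSUP_upper[rotated]) (use x y in auto)
  then show ?thesis by (simp add: path_diam_def case_prod_beta')
qed

lemma measurable_path_dist:
  assumes "t \<le> T"
  shows "(\<lambda>w. path_dist t (fst w) (snd w)) \<in> borel_measurable (path_space T \<Otimes>\<^sub>M path_space T)"
proof -
  have [measurable]: "(\<lambda>w. fst w s) \<in> borel_measurable (path_space T \<Otimes>\<^sub>M path_space T)"
    "(\<lambda>w. snd w s) \<in> borel_measurable (path_space T \<Otimes>\<^sub>M path_space T)" if "s \<in> {1..t}" for s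
  proof -
    have s: "s \<in> {1..T}" using that assms by simp
    show "(\<lambda>w. fst w s) \<in> borel_measurable (path_space T \<Otimes>\<^sub>M path_space T)"
      "(\<lambda>w. snd w s) \<in> borel_measurable (path_space T \<Otimes>\<^sub>M path_space T)"
      using measurable_compose[OF measurable_fst measurable_path_component[OF s]]
        measurable_compose[OF measurable_snd measurable_path_component[OF s]] by auto
  qed
  show ?thesis unfolding path_dist_def L2_set_def by measurable
qed

context two_sided_maximal
begin

lemma label_separation_le:
  "emeasure (LD T) {cc. fst cc \<noteq> snd cc} \<le> ennreal (2 ^ T) * emeasure \<gamma> {w\<in>space \<gamma>. hist Q T (fst w) \<noteq> hist Q T (snd w)}"
proof -
  interpret G: prob_space \<gamma> by (rule prob_\<gamma>)
  interpret L: prob_space "LD T" by (rule LD_props) simp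
  have eq: "{w\<in>space \<gamma>. hist Q T (fst w) \<noteq> hist Q T (snd w)} = space \<gamma> - agree T" by (auto simp: agree_def)
  have "measure (LD T) {cc. fst cc \<noteq> snd cc} \<le> (2 ^ T - 1) * measure \<gamma> (space \<gamma> - agree T)" by (rule disagreement_le) simp
  also have "\<dots> \<le> 2 ^ T * measure \<gamma> (space \<gamma> - agree T)" by (intro mult_right_mono) auto
  finally show ?thesis
    unfolding eq G.emeasure_eq_measure L.emeasure_eq_measure by (simp add: ennreal_mult[symmetric])
qed

text \<open>On equal label histories both positions are compared with the same representative.
  Otherwise the distance is at most \<open>D\<close>, and the \<open>p\<close>-norm of this part is
  the root of the disagreement probability times \<open>D\<close>.\<close>

lemma coordinate_cost_le:
  assumes lX: "labelled_cost T \<mu> \<kappa> Q \<Gamma> AX p \<epsilon> \<eta> B \<sigma> q hX" and lY: "labelled_cost T \<nu> \<kappa>' Q \<Gamma>' AY p \<epsilon> \<eta> B \<sigma> q hY"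
    and D: "AE w in \<pi>. path_dist T (fst w) (snd w) \<le> D" and t: "t < T"
  shows "Lnorm p (P T) (\<lambda>h. ennreal (dist (fst (snd h) (Suc t)) (snd (snd h) (Suc t)))) \<le>
    (if t = 0 then 0 else hX t + hY t) + ennreal (2 * (\<epsilon> + \<eta>)) + epowr (emeasure (LD T) {cc. fst cc \<noteq> snd cc}) (1 / p) * ennreal D"
proof -
  interpret CX: labelled_cost T \<mu> \<kappa> Q \<Gamma> AX p \<epsilon> \<eta> B \<sigma> q hX by (rule lX)
  interpret CY: labelled_cost T \<nu> \<kappa>' Q \<Gamma>' AY p \<epsilon> \<eta> B \<sigma> q hY by (rule lY)
  have p: "p \<ge> 1" by (rule CX.p)
  have TT: "T \<le> T" by simp
  have st: "Suc t \<in> {1..T}" using t by simp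
  let ?eX = "\<lambda>w :: nat list \<times> (nat \<Rightarrow> real ^ 'd). ennreal (dist (snd w (Suc t)) (q (Suc t) (fst w ! t)))"
  let ?X = "\<lambda>h :: (nat list \<times> nat list) \<times> (nat \<Rightarrow> real ^ 'd) \<times> (nat \<Rightarrow> real ^ 'd). ?eX (fst (fst h), fst (snd h))"
  let ?Y = "\<lambda>h :: (nat list \<times> nat list) \<times> (nat \<Rightarrow> real ^ 'd) \<times> (nat \<Rightarrow> real ^ 'd). ?eX (snd (fst h), snd (snd h))"
  let ?N = "\<lambda>h :: (nat list \<times> nat list) \<times> (nat \<Rightarrow> real ^ 'd) \<times> (nat \<Rightarrow> real ^ 'd). indicator {cc. fst cc \<noteq> snd cc} (fst h) * ennreal D"
  have eXm: "?eX \<in> borel_measurable (count_space UNIV \<Otimes>\<^sub>M path_space T)"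
  proof (rule measurable_pair_count_space1)
    fix c
    have [measurable]: "(\<lambda>x. x (Suc t)) \<in> path_space T \<rightarrow>\<^sub>M (borel :: (real ^ 'd) measure)"
      by (rule measurable_path_component[OF st])
    show "(\<lambda>x. ?eX (c, x)) \<in> borel_measurable (path_space T)" by simp
  qed
  have Xm: "?X \<in> borel_measurable (P T)" by (rule measurable_compose[OF AX_map eXm]) simp
  have Ym: "?Y \<in> borel_measurable (P T)" by (rule measurable_compose[OF AY_map eXm]) simp
  have Nm: "?N \<in> borel_measurable (P T)" by (rule measurable_compose[OF fst_P]) simp_all
  have eX: "Lnorm p (P T) ?X = CX.err t"
    unfolding CX.err_def Lnorm_def by (subst nn_integral_AX) (use eXm in \<open>auto\<close>)
  have eY: "Lnorm p (P T) ?Y = CY.err t"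
    unfolding CY.err_def Lnorm_def by (subst nn_integral_AY) (use eXm in \<open>auto\<close>)
  have eN: "Lnorm p (P T) ?N = epowr (emeasure (LD T) {cc. fst cc \<noteq> snd cc}) (1 / p) * ennreal D"
  proof -
    have "(\<integral>\<^sup>+h. epowr (?N h) p \<partial>P T) = (\<integral>\<^sup>+h. (\<lambda>cc. epowr (ennreal D) p * indicator {cc. fst cc \<noteq> snd cc} cc) (fst h) \<partial>P T)"
      by (intro nn_integral_cong) (auto split: split_indicator)
    also have "\<dots> = (\<integral>\<^sup>+cc. epowr (ennreal D) p * indicator {cc. fst cc \<noteq> snd cc} cc \<partial>LD T)"
      by (rule nn_integral_LD[OF TT, symmetric])
    also have "\<dots> = epowr (ennreal D) p * emeasure (LD T) {cc. fst cc \<noteq> snd cc}"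
      by (rule nn_integral_cmult_indicator) (simp add: LD_props)
    finally show ?thesis using p by (simp add: Lnorm_def epowr_mult mult.commute)
  qed
  have "Lnorm p (P T) (\<lambda>h. ennreal (dist (fst (snd h) (Suc t)) (snd (snd h) (Suc t)))) \<le> Lnorm p (P T) (\<lambda>h. (?X h + ?Y h) + ?N h)"
  proof (rule Lnorm_mono_AE)
    have "AE h in P T. path_dist T (fst (snd h)) (snd (snd h)) \<le> D"
      by (rule AE_distrD[OF snd_P D[unfolded \<pi>_def]])
    then show "AE h in P T. ennreal (dist (fst (snd h) (Suc t)) (snd (snd h) (Suc t))) \<le> (?X h + ?Y h) + ?N h"
    proof eventually_elim
      case (elim h)
      show ?case
      proof (cases "fst (fst h) = snd (fst h)")
        case True
        have "dist (fst (snd h) (Suc t)) (snd (snd h) (Suc t)) \<le>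
            dist (fst (snd h) (Suc t)) (q (Suc t) (fst (fst h) ! t)) + dist (snd (snd h) (Suc t)) (q (Suc t) (snd (fst h) ! t))"
          unfolding True by (rule dist_triangle2)
        then have "ennreal (dist (fst (snd h) (Suc t)) (snd (snd h) (Suc t))) \<le> ?X h + ?Y h"
          by (simp flip: ennreal_plus)
        then show ?thesis by (rule order_trans) simp
      next
        case False
        have "ennreal (dist (fst (snd h) (Suc t)) (snd (snd h) (Suc t))) \<le> ennreal D"
          using dist_le_path_dist[OF st, of "fst (snd h)" "snd (snd h)"] elim by (intro ennreal_leI) simp
        also have "\<dots> \<le> (?X h + ?Y h) + ?N h" using False by (intro add_increasing) auto
        finally show ?thesis .
      qed
    qed
  qed (use p in simp)
  also have "\<dots> \<le> Lnorm p (P T) (\<lambda>h. ?X h + ?Y h) + Lnorm p (P T) ?N"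
    using Xm Ym Nm by (intro Lnorm_add[OF p] borel_measurable_add)
  also have "\<dots> \<le> (CX.err t + CY.err t) + Lnorm p (P T) ?N"
    using Lnorm_add[OF p Xm Ym] unfolding eX eY by (rule add_right_mono)
  also have "CX.err t + CY.err t \<le> (CX.err_bound t + ennreal (\<epsilon> + \<eta>)) + (CY.err_bound t + ennreal (\<epsilon> + \<eta>))"
    by (intro add_mono CX.err_le CY.err_le t)
  also have "\<dots> = (if t = 0 then 0 else hX t + hY t) + ennreal (2 * (\<epsilon> + \<eta>))"
  proof -
    have "ennreal (2 * (\<epsilon> + \<eta>)) = ennreal (\<epsilon> + \<eta>) + ennreal (\<epsilon> + \<eta>)"
      using CX.\<epsilon> CX.\<eta> by (simp flip: ennreal_plus)
    then show ?thesis by (simp add: CX.err_bound_def CY.err_bound_def add_ac)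
  qed
  finally show ?thesis unfolding eN by (simp add: add_right_mono)
qed

end

section \<open>The transport estimate\<close>

text \<open>Origin of the factors: \<open>T\<close> time steps; \<open>2 powr p\<close> from the
  power of a sum of two terms; inside, \<open>2 powr p\<close> from the bound \<open>2 * S\<close>
  on the errors. For the disagreement, \<open>D powr p\<close>, the \<open>2 ^ T\<close> of
  \<open>label_separation_le\<close>, and \<open>2 * T * d / l\<close> with
  \<open>l = \<sigma> / (8 * T * d)\<close>, which equals 16 (T d)^2 / \<sigma>.\<close>

definition transport_const :: "nat \<Rightarrow> real \<Rightarrow> nat \<Rightarrow> real \<Rightarrow> real" where
  "transport_const T p d D = real T * 2 powr p * (2 powr p + D powr p * (2 ^ T * 16 * (real T * real d)\<^sup>2))"

lemma near_optimal_kernel_family: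
  fixes \<kappa> :: "nat \<Rightarrow> (nat \<Rightarrow> real ^ 'd :: finite) \<Rightarrow> (real ^ 'd) measure" and p B \<epsilon> :: real
  assumes \<kappa>: "\<And>t. t < T \<Longrightarrow> \<kappa> t \<in> path_space t \<rightarrow>\<^sub>M prob_algebra borel" and p: "p \<ge> 1" and \<epsilon>: "\<epsilon> > 0" and B: "B \<ge> 0"
  obtains \<Gamma> where "\<And>t. t < T \<Longrightarrow> \<Gamma> t \<in> path_space t \<Otimes>\<^sub>M path_space t \<rightarrow>\<^sub>M prob_algebra (borel \<Otimes>\<^sub>M borel)"
    "\<And>t x z. t < T \<Longrightarrow> x \<in> space (path_space t) \<Longrightarrow> z \<in> space (path_space t) \<Longrightarrow> \<Gamma> t (x, z) \<in> couplings (\<kappa> t x) (\<kappa> t z)"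
    "\<And>t x z. t < T \<Longrightarrow> x \<in> space (path_space t) \<Longrightarrow> z \<in> space (path_space t) \<Longrightarrow> AE u in \<kappa> t x. norm u \<le> B \<Longrightarrow> AE u in \<kappa> t z. norm u \<le> B \<Longrightarrow>
       Lnorm p (\<Gamma> t (x, z)) (\<lambda>(u, w). ennreal (dist u w)) \<le> wasserstein dist p (\<kappa> t x) (\<kappa> t z) + ennreal \<epsilon>"
proof -
  define good where "good t G \<longleftrightarrow> G \<in> path_space t \<Otimes>\<^sub>M path_space t \<rightarrow>\<^sub>M prob_algebra (borel \<Otimes>\<^sub>M borel) \<and>
    (\<forall>x\<in>space (path_space t). \<forall>z\<in>space (path_space t). G (x, z) \<in> couplings (\<kappa> t x) (\<kappa> t z) \<and>
      ((AE u in \<kappa> t x. norm u \<le> B) \<longrightarrow> (AE u in \<kappa> t z. norm u \<le> B) \<longrightarrow>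
       Lnorm p (G (x, z)) (\<lambda>(u, w). ennreal (dist u w)) \<le> wasserstein dist p (\<kappa> t x) (\<kappa> t z) + ennreal \<epsilon>))" for t G
  have "\<exists>G. good t G" if "t < T" for t
    unfolding good_def by (rule near_optimal_couplings[OF \<kappa>[OF that] p \<epsilon> B]) blast
  then have good: "good t (SOME G. good t G)" if "t < T" for t using that by (metis someI_ex)
  show ?thesis
    by (rule that[of "\<lambda>t. SOME G. good t G"]) (use good in \<open>auto simp: good_def\<close>)
qed

text \<open>Arbitrary versions of the kernels and arbitrary finite \<open>hX\<close>,
  \<open>hY\<close> compatible with them are allowed, so that iterated moduli and Hoelder bounds
  become two instances. The coupling \<open>\<gamma>\<close> is fixed; the infimum over it is taken
  afterwards.\<close>

theorem adapted_wasserstein_le: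
  fixes \<mu> \<nu> :: "(nat \<Rightarrow> real ^ 'd :: finite) measure" and p \<sigma> :: real
  assumes T: "T \<ge> 1" and p: "p \<ge> 1" and F: "path_bounded T F" and \<mu>F: "\<mu> \<in> probs_on T F" and \<nu>F: "\<nu> \<in> probs_on T F"
    and \<gamma>: "\<gamma> \<in> couplings \<mu> \<nu>" and \<sigma>: "\<sigma> > 0"
    and \<kappa>: "\<And>t. t < T \<Longrightarrow> cond_kernel \<mu> (path_space t) (\<lambda>x. restrict x {1..t}) borel (\<lambda>x. x (Suc t)) (\<kappa> t)"
    and \<kappa>': "\<And>t. t < T \<Longrightarrow> cond_kernel \<nu> (path_space t) (\<lambda>x. restrict x {1..t}) borel (\<lambda>x. x (Suc t)) (\<kappa>' t)"
    and hX: "hX 0 = ennreal \<sigma>" "\<And>t. t < T \<Longrightarrow> hX t < \<top>"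
      "\<And>t \<pi>. t \<in> {1..<T} \<Longrightarrow> \<pi> \<in> couplings \<mu> \<mu> \<Longrightarrow>
       Lnorm p \<pi> (\<lambda>w. ennreal (path_dist t (fst w) (snd w))) < (\<Sum>s<t. hX s) \<Longrightarrow>
       Lnorm p \<pi> (\<lambda>w. wasserstein dist p (\<kappa> t (restrict (fst w) {1..t})) (\<kappa> t (restrict (snd w) {1..t}))) \<le> hX t"
    and hY: "hY 0 = ennreal \<sigma>" "\<And>t. t < T \<Longrightarrow> hY t < \<top>"
      "\<And>t \<pi>. t \<in> {1..<T} \<Longrightarrow> \<pi> \<in> couplings \<nu> \<nu> \<Longrightarrow>
       Lnorm p \<pi> (\<lambda>w. ennreal (path_dist t (fst w) (snd w))) < (\<Sum>s<t. hY s) \<Longrightarrow>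
       Lnorm p \<pi> (\<lambda>w. wasserstein dist p (\<kappa>' t (restrict (fst w) {1..t})) (\<kappa>' t (restrict (snd w) {1..t}))) \<le> hY t"
  shows "epowr (adapted_wasserstein T p \<mu> \<nu>) p \<le> ennreal (transport_const T p CARD('d) (path_diam T F)) *
    (ennreal (1 / \<sigma>) * (\<integral>\<^sup>+w. ennreal (path_dist T (fst w) (snd w)) \<partial>\<gamma>) + epowr (\<Sum>t<T. max (hX t) (hY t)) p)"
proof -
  define d where "d = real CARD('d)"
  have d: "d > 0" by (simp add: d_def)
  have T0: "real T > 0" using T by simp
  \<comment> \<open>Mesh and tolerance are matched: the cell radius \<open>d * l\<close> equals
    \<open>\<epsilon>\<close>, and the total \<open>3 * T * \<epsilon>\<close> is 3/8 of
    \<open>\<sigma>\<close>.\<close>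
  define l where "l = \<sigma> / (8 * real T * d)"
  define \<epsilon> where "\<epsilon> = \<sigma> / (8 * real T)"
  have l: "l > 0" using \<sigma> T0 d by (simp add: l_def)
  have \<epsilon>: "\<epsilon> > 0" using \<sigma> T0 by (simp add: \<epsilon>_def)
  have dl: "d * l = \<epsilon>" using d by (simp add: l_def \<epsilon>_def)
  have T\<epsilon>: "real T * (\<epsilon> + 2 * \<epsilon>) < \<sigma>" using \<sigma> T0 by (simp add: \<epsilon>_def field_simps)
  define D where "D = path_diam T F"
  have \<mu>: "\<mu> \<in> space (prob_algebra (path_space T))" "AE z in \<mu>. z \<in> F" and \<nu>: "\<nu> \<in> space (prob_algebra (path_space T))" "AE z in \<nu>. z \<in> F"
    using \<mu>F \<nu>F by (auto simp: probs_on_def)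
  obtain B0 where B0: "\<And>x. x \<in> F \<Longrightarrow> path_norm T x \<le> B0" using F by (auto simp: path_bounded_def)
  define B where "B = max B0 0"
  have bound: "\<forall>s\<in>{1..T}. norm (z s) \<le> B" if "z \<in> F" for z
    using norm_le_path_norm[of _ T z] B0[OF that] by (fastforce simp: B_def)
  have bound\<mu>: "AE z in \<mu>. \<forall>s\<in>{1..T}. norm (z s) \<le> B" using \<mu>(2) by (rule eventually_mono) (rule bound)
  have bound\<nu>: "AE z in \<nu>. \<forall>s\<in>{1..T}. norm (z s) \<le> B" using \<nu>(2) by (rule eventually_mono) (rule bound)
  have B: "B \<ge> 0" by (simp add: B_def)
  have \<kappa>m: "\<kappa> t \<in> path_space t \<rightarrow>\<^sub>M prob_algebra borel" and \<kappa>'m: "\<kappa>' t \<in> path_space t \<rightarrow>\<^sub>M prob_algebra borel" if "t < T" for t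
    using \<kappa>[OF that] \<kappa>'[OF that] by (auto simp: cond_kernel_def)
  obtain \<Gamma> where \<Gamma>: "\<And>t. t < T \<Longrightarrow> \<Gamma> t \<in> path_space t \<Otimes>\<^sub>M path_space t \<rightarrow>\<^sub>M prob_algebra (borel \<Otimes>\<^sub>M borel)"
    "\<And>t x z. t < T \<Longrightarrow> x \<in> space (path_space t) \<Longrightarrow> z \<in> space (path_space t) \<Longrightarrow> \<Gamma> t (x, z) \<in> couplings (\<kappa> t x) (\<kappa> t z)"
    "\<And>t x z. t < T \<Longrightarrow> x \<in> space (path_space t) \<Longrightarrow> z \<in> space (path_space t) \<Longrightarrow> AE u in \<kappa> t x. norm u \<le> B \<Longrightarrow> AE u in \<kappa> t z. norm u \<le> B \<Longrightarrow>
       Lnorm p (\<Gamma> t (x, z)) (\<lambda>(u, w). ennreal (dist u w)) \<le> wasserstein dist p (\<kappa> t x) (\<kappa> t z) + ennreal \<epsilon>"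
    using near_optimal_kernel_family[OF \<kappa>m p \<epsilon> B] by blast
  obtain \<Gamma>' where \<Gamma>': "\<And>t. t < T \<Longrightarrow> \<Gamma>' t \<in> path_space t \<Otimes>\<^sub>M path_space t \<rightarrow>\<^sub>M prob_algebra (borel \<Otimes>\<^sub>M borel)"
    "\<And>t x z. t < T \<Longrightarrow> x \<in> space (path_space t) \<Longrightarrow> z \<in> space (path_space t) \<Longrightarrow> \<Gamma>' t (x, z) \<in> couplings (\<kappa>' t x) (\<kappa>' t z)"
    "\<And>t x z. t < T \<Longrightarrow> x \<in> space (path_space t) \<Longrightarrow> z \<in> space (path_space t) \<Longrightarrow> AE u in \<kappa>' t x. norm u \<le> B \<Longrightarrow> AE u in \<kappa>' t z. norm u \<le> B \<Longrightarrow>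
       Lnorm p (\<Gamma>' t (x, z)) (\<lambda>(u, w). ennreal (dist u w)) \<le> wasserstein dist p (\<kappa>' t x) (\<kappa>' t z) + ennreal \<epsilon>"
    using near_optimal_kernel_family[OF \<kappa>'m p \<epsilon> B] by blast
  obtain Q :: "nat \<Rightarrow> real ^ 'd \<Rightarrow> nat" and q where Q: "\<And>s. Q s \<in> borel \<rightarrow>\<^sub>M count_space UNIV"
    and q: "\<And>s u. dist (q s (Q s u)) u \<le> \<epsilon>"
    and sep: "emeasure \<gamma> {w\<in>space \<gamma>. hist Q T (fst w) \<noteq> hist Q T (snd w)} \<le>
       ennreal (2 * real T * d / l) * (\<integral>\<^sup>+w. ennreal (path_dist T (fst w) (snd w)) \<partial>\<gamma>)"
    using exists_quantizer[OF \<mu>(1) \<nu>(1) \<gamma> l] unfolding dl[unfolded d_def] d_def by blast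
  interpret X: quantized T \<mu> \<kappa> Q \<Gamma> by (unfold_locales; fact \<mu>(1) \<kappa> Q \<Gamma>)
  interpret Y: quantized T \<nu> \<kappa>' Q \<Gamma>' by (unfold_locales; fact \<nu>(1) \<kappa>' Q \<Gamma>')
  define maximal where "maximal t c c' r \<longleftrightarrow> r \<in> couplings (X.m t c) (Y.m t c') \<and>
     (\<forall>a. min (emeasure (X.m t c) {a}) (emeasure (Y.m t c') {a}) \<le> emeasure r {(a, a)})" for t c c' r
  define r where "r t c c' = (SOME r. maximal t c c' r)" for t c c'
  have r: "maximal t c c' (r t c c')" if "t < T" for t c c'
  proof -
    have "\<exists>r. maximal t c c' r"
      using maximal_coupling[OF X.prob_m[OF that] X.sets_m Y.prob_m[OF that] Y.sets_m, of c c'] unfolding maximal_def by blast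
    then show ?thesis unfolding r_def by (rule someI_ex)
  qed
  interpret M: two_sided_maximal T \<mu> \<nu> \<kappa> \<kappa>' Q \<Gamma> \<Gamma>' r \<gamma>
    by unfold_locales (use r \<gamma> in \<open>auto simp: maximal_def\<close>)
  have lX: "labelled_cost T \<mu> \<kappa> Q \<Gamma> M.AX p \<epsilon> \<epsilon> B \<sigma> q hX"
    by unfold_locales (fact p less_imp_le[OF \<epsilon>] q bound\<mu> \<Gamma>(3) T\<epsilon> hX)+
  have lY: "labelled_cost T \<nu> \<kappa>' Q \<Gamma>' M.AY p \<epsilon> \<epsilon> B \<sigma> q hY"
    by unfold_locales (fact p less_imp_le[OF \<epsilon>] q bound\<nu> \<Gamma>'(3) T\<epsilon> hY)+
  have AED: "AE w in M.\<pi>. path_dist T (fst w) (snd w) \<le> D"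
    using AE_coupling_fst[OF M.\<pi>_couplings \<mu>(2)] AE_coupling_snd[OF M.\<pi>_couplings \<nu>(2)]
    unfolding D_def by eventually_elim (rule path_dist_le_diam[OF F])
  have D0: "D \<ge> 0"
  proof -
    interpret \<pi>: prob_space M.\<pi> by (rule M.prob_\<pi>)
    from AED have "AE w in M.\<pi>. D \<ge> 0" by eventually_elim (rule order_trans[OF path_dist_nonneg])
    then show ?thesis by simp
  qed
  define S where "S = (\<Sum>t<T. max (hX t) (hY t))"
  define \<delta> where "\<delta> = emeasure (M.LD T) {cc. fst cc \<noteq> snd cc}"
  define c where "c = (\<integral>\<^sup>+w. ennreal (path_dist T (fst w) (snd w)) \<partial>\<gamma>)"
  define K where "K = D powr p * (2 ^ T * 16 * (real T * d)\<^sup>2)"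
  have \<delta>: "epowr (epowr \<delta> (1 / p) * ennreal D) p \<le> ennreal K * (ennreal (1 / \<sigma>) * c)"
  proof -
    have "epowr (epowr \<delta> (1 / p) * ennreal D) p = \<delta> * ennreal (D powr p)"
      using p D0 by (simp add: epowr_mult epowr_ennreal)
    also have "\<delta> \<le> ennreal (2 ^ T) * (ennreal (2 * real T * d / l) * c)"
      unfolding \<delta>_def c_def by (rule order_trans[OF M.label_separation_le mult_left_mono[OF sep]]) simp
    also have "ennreal (2 ^ T) * (ennreal (2 * real T * d / l) * c) * ennreal (D powr p) = ennreal (D powr p) * ennreal (2 ^ T) * ennreal (2 * real T * d / l) * c"
      by (simp add: ac_simps)
    also have "ennreal (D powr p) * ennreal (2 ^ T) * ennreal (2 * real T * d / l) = ennreal (D powr p * 2 ^ T * (2 * real T * d / l))"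
      using d l by (simp flip: ennreal_mult)
    also have "D powr p * 2 ^ T * (2 * real T * d / l) = K * (1 / \<sigma>)"
      using T0 d \<sigma> by (simp add: K_def l_def power2_eq_square)
    also have "ennreal (K * (1 / \<sigma>)) = ennreal K * ennreal (1 / \<sigma>)"
      using \<sigma> by (intro ennreal_mult) (auto simp: K_def)
    finally show ?thesis by (simp add: mult.assoc mult_right_mono)
  qed
  have coord: "(\<integral>\<^sup>+w. ennreal (norm (fst w (Suc t) - snd w (Suc t)) powr p) \<partial>M.\<pi>) \<le>
      ennreal (2 powr p) * (ennreal (2 powr p) * epowr S p + ennreal K * (ennreal (1 / \<sigma>) * c))" if t: "t < T" for t
  proof -
    have st: "Suc t \<in> {1..T}" using t by simp
    have m0: "max (hX 0) (hY 0) = ennreal \<sigma>" using hX(1) hY(1) by simp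
    \<comment> \<open>The tolerance \<open>4 * \<epsilon>\<close> is at most
      \<open>\<sigma>\<close>, which is the summand of \<open>S\<close> at time 0. The errors of the
      two sides are each bounded by their maximum, which costs the factor 2.\<close>
    have "(if t = 0 then 0 else hX t + hY t) + ennreal (2 * (\<epsilon> + \<epsilon>)) \<le> 2 * S"
    proof -
      have "2 * (\<epsilon> + \<epsilon>) \<le> \<sigma>" using T \<sigma> by (simp add: \<epsilon>_def field_simps)
      then have e: "ennreal (2 * (\<epsilon> + \<epsilon>)) \<le> max (hX 0) (hY 0)" unfolding m0 by (rule ennreal_leI)
      show ?thesis
      proof (cases "t = 0")
        case True
        have "max (hX 0) (hY 0) \<le> S" unfolding S_def using t True by (intro member_le_sum) auto
        also have "S \<le> 2 * S" by (simp add: mult_2)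
        finally have "ennreal (2 * (\<epsilon> + \<epsilon>)) \<le> 2 * S" by (rule order_trans[OF e])
        then show ?thesis using True by simp
      next
        case False
        have "max (hX 0) (hY 0) + max (hX t) (hY t) = (\<Sum>s\<in>{0, t}. max (hX s) (hY s))" using False by simp
        also have "\<dots> \<le> S" unfolding S_def using t by (intro sum_mono2) auto
        finally have *: "max (hX 0) (hY 0) + max (hX t) (hY t) \<le> S" .
        have "hX t + hY t + ennreal (2 * (\<epsilon> + \<epsilon>)) \<le> max (hX t) (hY t) + max (hX t) (hY t) + max (hX 0) (hY 0)"
          using e by (intro add_mono) auto
        also have "\<dots> \<le> (max (hX 0) (hY 0) + max (hX t) (hY t)) + (max (hX 0) (hY 0) + max (hX t) (hY t))"
          by (simp add: ac_simps add_increasing)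
        also have "\<dots> \<le> 2 * S" using * unfolding mult_2 by (intro add_mono)
        finally show ?thesis using False by simp
      qed
    qed
    then have le: "Lnorm p (M.P T) (\<lambda>h. ennreal (dist (fst (snd h) (Suc t)) (snd (snd h) (Suc t)))) \<le> 2 * S + epowr \<delta> (1 / p) * ennreal D"
      unfolding \<delta>_def by (rule order_trans[OF M.coordinate_cost_le[OF lX lY AED t] add_right_mono])
    have cf: "(\<lambda>w. fst w (Suc t)) \<in> path_space T \<Otimes>\<^sub>M path_space T \<rightarrow>\<^sub>M (borel :: (real ^ 'd) measure)"
      and cs: "(\<lambda>w. snd w (Suc t)) \<in> path_space T \<Otimes>\<^sub>M path_space T \<rightarrow>\<^sub>M (borel :: (real ^ 'd) measure)"
      using measurable_compose[OF measurable_fst measurable_path_component[OF st]]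
        measurable_compose[OF measurable_snd measurable_path_component[OF st]] by auto
    have "(\<integral>\<^sup>+w. ennreal (norm (fst w (Suc t) - snd w (Suc t)) powr p) \<partial>M.\<pi>) =
        (\<integral>\<^sup>+h. epowr (ennreal (dist (fst (snd h) (Suc t)) (snd (snd h) (Suc t)))) p \<partial>M.P T)"
    proof -
      note [measurable] = cf cs
      show ?thesis by (subst M.nn_integral_\<pi>) (measurable, simp add: epowr_ennreal dist_norm)
    qed
    also have "\<dots> = epowr (Lnorm p (M.P T) (\<lambda>h. ennreal (dist (fst (snd h) (Suc t)) (snd (snd h) (Suc t))))) p"
      using p by (simp add: epowr_Lnorm)
    also have "\<dots> \<le> epowr (2 * S + epowr \<delta> (1 / p) * ennreal D) p"
      using p le by (intro epowr_mono) auto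
    also have "\<dots> \<le> ennreal (2 powr (p - 1)) * (epowr (2 * S) p + epowr (epowr \<delta> (1 / p) * ennreal D) p)"
      using epowr_convex_combination[of 1 1 p "2 * S" "epowr \<delta> (1 / p) * ennreal D"] p by simp
    also have "\<dots> \<le> ennreal (2 powr p) * (epowr (2 * S) p + epowr (epowr \<delta> (1 / p) * ennreal D) p)"
      by (intro mult_right_mono ennreal_leI powr_mono) auto
    also have "epowr (2 * S) p = ennreal (2 powr p) * epowr S p"
      using p epowr_ennreal[of 2 p] by (simp add: epowr_mult)
    also have "ennreal (2 powr p) * (ennreal (2 powr p) * epowr S p + epowr (epowr \<delta> (1 / p) * ennreal D) p) \<le>
        ennreal (2 powr p) * (ennreal (2 powr p) * epowr S p + ennreal K * (ennreal (1 / \<sigma>) * c))"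
      by (intro mult_left_mono add_left_mono \<delta>) simp
    finally show ?thesis .
  qed
  have "epowr (adapted_wasserstein T p \<mu> \<nu>) p = (INF \<pi>\<in>bc_couplings T \<mu> \<nu>. \<integral>\<^sup>+ (x, y). ennreal (\<Sum>t=1..T. norm (x t - y t) powr p) \<partial>\<pi>)"
    using p by (simp add: adapted_wasserstein_def)
  also have "\<dots> \<le> (\<integral>\<^sup>+ (x, y). ennreal (\<Sum>t=1..T. norm (x t - y t) powr p) \<partial>M.\<pi>)"
    by (rule INF_lower[OF M.\<pi>_bicausal])
  also have "\<dots> = (\<integral>\<^sup>+w. (\<Sum>t<T. ennreal (norm (fst w (Suc t) - snd w (Suc t)) powr p)) \<partial>M.\<pi>)"
  proof (rule nn_integral_cong)
    fix w :: "(nat \<Rightarrow> real ^ 'd) \<times> (nat \<Rightarrow> real ^ 'd)"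
    have "(\<Sum>t=1..T. norm (fst w t - snd w t) powr p) = (\<Sum>t<T. norm (fst w (Suc t) - snd w (Suc t)) powr p)"
      by (rule sum.reindex_bij_witness[of _ Suc "\<lambda>s. s - 1"]) auto
    then show "(case w of (x, y) \<Rightarrow> ennreal (\<Sum>t=1..T. norm (x t - y t) powr p)) = (\<Sum>t<T. ennreal (norm (fst w (Suc t) - snd w (Suc t)) powr p))"
      by (simp add: case_prod_beta' sum_ennreal)
  qed
  also have "\<dots> = (\<Sum>t<T. \<integral>\<^sup>+w. ennreal (norm (fst w (Suc t) - snd w (Suc t)) powr p) \<partial>M.\<pi>)"
  proof (rule nn_integral_sum)
    fix t assume "t \<in> {..<T}"
    then have st: "Suc t \<in> {1..T}" by simp
    have [measurable]: "(\<lambda>w. fst w (Suc t)) \<in> path_space T \<Otimes>\<^sub>M path_space T \<rightarrow>\<^sub>M (borel :: (real ^ 'd) measure)"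
      "(\<lambda>w. snd w (Suc t)) \<in> path_space T \<Otimes>\<^sub>M path_space T \<rightarrow>\<^sub>M (borel :: (real ^ 'd) measure)"
      using measurable_compose[OF measurable_fst measurable_path_component[OF st]]
        measurable_compose[OF measurable_snd measurable_path_component[OF st]] by auto
    show "(\<lambda>w. ennreal (norm (fst w (Suc t) - snd w (Suc t)) powr p)) \<in> borel_measurable M.\<pi>"
      unfolding measurable_cong_sets[OF M.sets_\<pi> refl] by measurable
  qed
  also have "\<dots> \<le> (\<Sum>t<T. ennreal (2 powr p) * (ennreal (2 powr p) * epowr S p + ennreal K * (ennreal (1 / \<sigma>) * c)))"
    by (intro sum_mono coord) simp
  also have "\<dots> = ennreal (real T * 2 powr p) * (ennreal (2 powr p) * epowr S p + ennreal K * (ennreal (1 / \<sigma>) * c))"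
    by (simp add: ennreal_mult ennreal_of_nat_eq_real_of_nat mult.assoc)
  also have "\<dots> \<le> ennreal (real T * 2 powr p) * (ennreal (2 powr p + K) * (ennreal (1 / \<sigma>) * c + epowr S p))"
  proof (intro mult_left_mono)
    have K: "K \<ge> 0" by (simp add: K_def)
    have "ennreal (2 powr p) * epowr S p + ennreal K * (ennreal (1 / \<sigma>) * c) \<le>
        ennreal (2 powr p + K) * epowr S p + ennreal (2 powr p + K) * (ennreal (1 / \<sigma>) * c)"
      using K by (intro add_mono mult_right_mono ennreal_leI) auto
    then show "ennreal (2 powr p) * epowr S p + ennreal K * (ennreal (1 / \<sigma>) * c) \<le> ennreal (2 powr p + K) * (ennreal (1 / \<sigma>) * c + epowr S p)"
      by (simp add: distrib_left add.commute)
  qed simp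
  also have "\<dots> = ennreal (transport_const T p CARD('d) D) * (ennreal (1 / \<sigma>) * c + epowr S p)"
    by (simp add: transport_const_def K_def d_def ennreal_mult mult.assoc[symmetric])
  finally show ?thesis unfolding D_def c_def S_def .
qed

section \<open>From a fixed coupling to the Wasserstein distance and the iterated moduli\<close>

lemma measurable_law:
  assumes \<mu>: "\<mu> \<in> space (prob_algebra (path_space T))" and t: "t < T"
  shows "(\<lambda>x. restrict x {1..t}) \<in> \<mu> \<rightarrow>\<^sub>M path_space t" "(\<lambda>x. x (Suc t)) \<in> \<mu> \<rightarrow>\<^sub>M (borel :: (real ^ 'd :: finite) measure)"
proof -
  have s: "sets \<mu> = sets (path_space T)" using \<mu> by (simp add: space_prob_algebra)
  show "(\<lambda>x. restrict x {1..t}) \<in> \<mu> \<rightarrow>\<^sub>M path_space t"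
    unfolding measurable_cong_sets[OF s refl] by (rule measurable_path_restrict) (use t in simp)
  show "(\<lambda>x. x (Suc t)) \<in> \<mu> \<rightarrow>\<^sub>M borel"
    unfolding measurable_cong_sets[OF s refl] by (rule measurable_path_component) (use t in simp)
qed

lemma cond_kernel_if_is_cond_law:
  fixes \<mu> :: "(nat \<Rightarrow> real ^ 'd :: finite) measure"
  assumes \<mu>: "\<mu> \<in> space (prob_algebra (path_space T))" and t: "t < T" and \<kappa>: "is_cond_law \<mu> t \<kappa>"
  shows "cond_kernel \<mu> (path_space t) (\<lambda>x. restrict x {1..t}) borel (\<lambda>x. x (Suc t)) \<kappa>"
proof (rule cond_kernelI)
  show "prob_space \<mu>" using \<mu> by (simp add: space_prob_algebra)
  show "sets (borel :: (real ^ 'd) measure) = sigma_sets (space borel) (sets borel)"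
    by (rule sets.sigma_sets_eq[symmetric])
  show "Int_stable (sets (borel :: (real ^ 'd) measure))" by (rule sets.Int_stable)
qed (use \<kappa> measurable_law[OF \<mu> t] in \<open>auto simp: is_cond_law_def\<close>)

text \<open>Existence of a regular conditional law makes the choice operator in
  \<open>cond_law\<close> meaningful.\<close>

lemma is_cond_law_cond_law:
  fixes \<mu> :: "(nat \<Rightarrow> real ^ 'd :: finite) measure"
  assumes \<mu>: "\<mu> \<in> space (prob_algebra (path_space T))" and t: "t < T"
  shows "is_cond_law \<mu> t (cond_law \<mu> t)"
proof -
  have P: "prob_space \<mu>" using \<mu> by (simp add: space_prob_algebra)
  note [measurable] = measurable_law[OF \<mu> t]
  obtain \<kappa> where \<kappa>: "cond_kernel \<mu> (path_space t) (\<lambda>x. restrict x {1..t}) borel (\<lambda>x. x (Suc t)) \<kappa>"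
    using cond_kernel_vec_exists[OF P measurable_law[OF \<mu> t]] by blast
  then have \<kappa>m: "\<kappa> \<in> path_space t \<rightarrow>\<^sub>M prob_algebra borel" by (simp add: cond_kernel_def)
  have "is_cond_law \<mu> t \<kappa>"
    unfolding is_cond_law_def
  proof (intro conjI ballI \<kappa>m)
    fix A :: "(nat \<Rightarrow> real ^ 'd) set" and B :: "(real ^ 'd) set" assume A [measurable]: "A \<in> sets (path_space t)" and B [measurable]: "B \<in> sets borel"
    let ?f = "\<lambda>w :: (nat \<Rightarrow> real ^ 'd) \<times> (real ^ 'd). indicator A (fst w) * indicator B (snd w) :: ennreal"
    have f: "?f \<in> borel_measurable (path_space t \<Otimes>\<^sub>M borel)" by measurable
    have m: "{x \<in> space \<mu>. restrict x {1..t} \<in> A \<and> x (Suc t) \<in> B} \<in> sets \<mu>" by measurable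
    have "emeasure \<mu> {x \<in> space \<mu>. restrict x {1..t} \<in> A \<and> x (Suc t) \<in> B} = (\<integral>\<^sup>+x. indicator {x \<in> space \<mu>. restrict x {1..t} \<in> A \<and> x (Suc t) \<in> B} x \<partial>\<mu>)"
      using m by simp
    also have "\<dots> = (\<integral>\<^sup>+x. ?f (restrict x {1..t}, x (Suc t)) \<partial>\<mu>)"
      by (intro nn_integral_cong) (auto split: split_indicator)
    also have "\<dots> = (\<integral>\<^sup>+x. \<integral>\<^sup>+u. ?f (restrict x {1..t}, u) \<partial>\<kappa> (restrict x {1..t}) \<partial>\<mu>)"
      using \<kappa> f by (auto simp: cond_kernel_def dest!: bspec[of _ _ ?f])
    also have "\<dots> = (\<integral>\<^sup>+x. indicator A (restrict x {1..t}) * emeasure (\<kappa> (restrict x {1..t})) B \<partial>\<mu>)"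
    proof (rule nn_integral_cong)
      fix x assume "x \<in> space \<mu>"
      then have "restrict x {1..t} \<in> space (path_space t)" by (rule measurable_space[OF measurable_law(1)[OF \<mu> t]])
      from kernelD[OF \<kappa>m this]
      show "(\<integral>\<^sup>+u. ?f (restrict x {1..t}, u) \<partial>\<kappa> (restrict x {1..t})) = indicator A (restrict x {1..t}) * emeasure (\<kappa> (restrict x {1..t})) B"
        by (simp add: nn_integral_cmult_indicator)
    qed
    finally show "emeasure \<mu> {x \<in> space \<mu>. restrict x {1..t} \<in> A \<and> x (Suc t) \<in> B} = (\<integral>\<^sup>+x. indicator A (restrict x {1..t}) * emeasure (\<kappa> (restrict x {1..t})) B \<partial>\<mu>)" .
  qed
  then show ?thesis unfolding cond_law_def by (rule someI[of "is_cond_law \<mu> t"])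
qed

lemma wasserstein_1: "wasserstein (path_dist T) 1 \<mu> \<nu> = (INF \<gamma>\<in>couplings \<mu> \<nu>. \<integral>\<^sup>+w. ennreal (path_dist T (fst w) (snd w)) \<partial>\<gamma>)"
  by (simp add: wasserstein_def case_prod_beta')

lemma transport_const_pos: "T \<ge> 1 \<Longrightarrow> transport_const T p d D > 0"
  unfolding transport_const_def by (intro mult_pos_pos add_pos_nonneg) auto

text \<open>The bound is affine in the cost of \<open>\<gamma>\<close>, so a near-minimiser
  suffices: an excess of \<open>e * \<sigma> / C\<close> in its cost adds exactly \<open>e\<close>.
  An infinite Wasserstein distance makes the right side infinite.\<close>

theorem adapted_wasserstein_le_wasserstein:
  fixes \<mu> \<nu> :: "(nat \<Rightarrow> real ^ 'd :: finite) measure" and p \<sigma> :: real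
  assumes T: "T \<ge> 1" and p: "p \<ge> 1" and F: "path_bounded T F" and \<mu>F: "\<mu> \<in> probs_on T F" and \<nu>F: "\<nu> \<in> probs_on T F"
    and \<sigma>: "\<sigma> > 0"
    and \<kappa>: "\<And>t. t < T \<Longrightarrow> is_cond_law \<mu> t (\<kappa> t)"
    and \<kappa>': "\<And>t. t < T \<Longrightarrow> is_cond_law \<nu> t (\<kappa>' t)"
    and hX: "hX 0 = ennreal \<sigma>" "\<And>t. t < T \<Longrightarrow> hX t < \<top>"
      "\<And>t \<pi>. t \<in> {1..<T} \<Longrightarrow> \<pi> \<in> couplings \<mu> \<mu> \<Longrightarrow>
       Lnorm p \<pi> (\<lambda>w. ennreal (path_dist t (fst w) (snd w))) < (\<Sum>s<t. hX s) \<Longrightarrow>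
       Lnorm p \<pi> (\<lambda>w. wasserstein dist p (\<kappa> t (restrict (fst w) {1..t})) (\<kappa> t (restrict (snd w) {1..t}))) \<le> hX t"
    and hY: "hY 0 = ennreal \<sigma>" "\<And>t. t < T \<Longrightarrow> hY t < \<top>"
      "\<And>t \<pi>. t \<in> {1..<T} \<Longrightarrow> \<pi> \<in> couplings \<nu> \<nu> \<Longrightarrow>
       Lnorm p \<pi> (\<lambda>w. ennreal (path_dist t (fst w) (snd w))) < (\<Sum>s<t. hY s) \<Longrightarrow>
       Lnorm p \<pi> (\<lambda>w. wasserstein dist p (\<kappa>' t (restrict (fst w) {1..t})) (\<kappa>' t (restrict (snd w) {1..t}))) \<le> hY t"
  shows "epowr (adapted_wasserstein T p \<mu> \<nu>) p \<le> ennreal (transport_const T p CARD('d) (path_diam T F)) *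
    (ennreal (1 / \<sigma>) * wasserstein (path_dist T) 1 \<mu> \<nu> + epowr (\<Sum>t<T. max (hX t) (hY t)) p)"
proof (rule ennreal_le_epsilon)
  let ?C = "transport_const T p CARD('d) (path_diam T F)"
  let ?W = "wasserstein (path_dist T) 1 \<mu> \<nu>"
  let ?S = "epowr (\<Sum>t<T. max (hX t) (hY t)) p"
  fix e :: real assume fin: "ennreal ?C * (ennreal (1 / \<sigma>) * ?W + ?S) < \<top>" and e: "e > 0"
  have C: "?C > 0" using T by (rule transport_const_pos)
  define e' where "e' = e * \<sigma> / ?C"
  have e': "e' > 0" using e C \<sigma> by (simp add: e'_def)
  have \<mu>: "\<mu> \<in> space (prob_algebra (path_space T))" and \<nu>: "\<nu> \<in> space (prob_algebra (path_space T))"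
    using \<mu>F \<nu>F by (auto simp: probs_on_def)
  have "?W \<noteq> \<infinity>"
  proof
    assume "?W = \<infinity>"
    then have "ennreal ?C * (ennreal (1 / \<sigma>) * ?W + ?S) = \<top>" using C \<sigma> by (simp add: ennreal_mult_top)
    with fin show False by simp
  qed
  then obtain \<gamma> where \<gamma>: "\<gamma> \<in> couplings \<mu> \<nu>" "(\<integral>\<^sup>+w. ennreal (path_dist T (fst w) (snd w)) \<partial>\<gamma>) < ?W + ennreal e'"
    using INF_approx_ennreal[OF e' wasserstein_1[of T \<mu> \<nu>]] by blast
  have "epowr (adapted_wasserstein T p \<mu> \<nu>) p \<le> ennreal ?C * (ennreal (1 / \<sigma>) * (\<integral>\<^sup>+w. ennreal (path_dist T (fst w) (snd w)) \<partial>\<gamma>) + ?S)"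
    by (rule adapted_wasserstein_le[OF T p F \<mu>F \<nu>F \<gamma>(1) \<sigma> cond_kernel_if_is_cond_law[OF \<mu>] cond_kernel_if_is_cond_law[OF \<nu>]])
      (fact \<kappa> \<kappa>' hX hY | assumption)+
  also have "\<dots> \<le> ennreal ?C * (ennreal (1 / \<sigma>) * (?W + ennreal e') + ?S)"
    using \<gamma>(2) by (intro mult_left_mono add_right_mono) auto
  also have "\<dots> = ennreal ?C * (ennreal (1 / \<sigma>) * ?W + ?S) + ennreal ?C * (ennreal (1 / \<sigma>) * ennreal e')"
    by (simp add: distrib_left ac_simps)
  also have "ennreal ?C * (ennreal (1 / \<sigma>) * ennreal e') = ennreal (?C * (1 / \<sigma> * e'))"
    using C \<sigma> e' by (simp flip: ennreal_mult)
  also have "?C * (1 / \<sigma> * e') = e" using C \<sigma> by (simp add: e'_def)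
  finally show "epowr (adapted_wasserstein T p \<mu> \<nu>) p \<le> ennreal ?C * (ennreal (1 / \<sigma>) * ?W + ?S) + ennreal e" .
qed

text \<open>Iterated moduli satisfy the continuity hypothesis because \<open>modulus\<close> is a
  supremum over the couplings in question. If one of them is infinite, so is the right side. At the
  end \<open>1 / \<sigma>\<close> is enlarged, using that \<open>(1 + \<sigma>) powr p\<close> is at
  least 1.\<close>

theorem adapted_wasserstein_le_iter_modulus:
  fixes \<mu> \<nu> :: "(nat \<Rightarrow> real ^ 'd :: finite) measure" and p \<sigma> :: real
  assumes T: "T \<ge> 1" and p: "p \<ge> 1" and F: "path_bounded T F" and \<mu>F: "\<mu> \<in> probs_on T F" and \<nu>F: "\<nu> \<in> probs_on T F"
    and \<sigma>: "\<sigma> > 0"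
  shows "epowr (adapted_wasserstein T p \<mu> \<nu>) p \<le> ennreal (transport_const T p CARD('d) (path_diam T F)) *
    (ennreal ((1 + \<sigma>) powr p / \<sigma>) * wasserstein (path_dist T) 1 \<mu> \<nu> +
     epowr (\<Sum>t<T. max (iter_modulus p \<mu> t (ennreal \<sigma>)) (iter_modulus p \<nu> t (ennreal \<sigma>))) p)"
proof (cases "\<forall>t<T. iter_modulus p \<mu> t (ennreal \<sigma>) < \<top> \<and> iter_modulus p \<nu> t (ennreal \<sigma>) < \<top>")
  case False
  then obtain t where "t < T" "max (iter_modulus p \<mu> t (ennreal \<sigma>)) (iter_modulus p \<nu> t (ennreal \<sigma>)) = \<top>"
    by (auto simp: max_def less_top[symmetric] top_unique)
  then have *: "(\<Sum>t<T. max (iter_modulus p \<mu> t (ennreal \<sigma>)) (iter_modulus p \<nu> t (ennreal \<sigma>))) = \<top>"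
    using member_le_sum[of t "{..<T}" "\<lambda>t. max (iter_modulus p \<mu> t (ennreal \<sigma>)) (iter_modulus p \<nu> t (ennreal \<sigma>))"]
    by (simp add: top_unique)
  show ?thesis using transport_const_pos[OF T, of p "CARD('d)" "path_diam T F"] unfolding * by (simp add: ennreal_mult_top)
next
  case True
  have \<mu>: "\<mu> \<in> space (prob_algebra (path_space T))" and \<nu>: "\<nu> \<in> space (prob_algebra (path_space T))"
    using \<mu>F \<nu>F by (auto simp: probs_on_def)
  have h0: "iter_modulus p \<rho> 0 (ennreal \<sigma>) = ennreal \<sigma>" for \<rho> :: "(nat \<Rightarrow> real ^ 'd) measure"
    by (subst iter_modulus.simps) simp
  have ht: "iter_modulus p \<rho> t (ennreal \<sigma>) = modulus p \<rho> t (\<Sum>s<t. iter_modulus p \<rho> s (ennreal \<sigma>))" if "t \<in> {1..<T}" for t and \<rho> :: "(nat \<Rightarrow> real ^ 'd) measure"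
    using that by (subst iter_modulus.simps) simp
  have "epowr (adapted_wasserstein T p \<mu> \<nu>) p \<le> ennreal (transport_const T p CARD('d) (path_diam T F)) *
    (ennreal (1 / \<sigma>) * wasserstein (path_dist T) 1 \<mu> \<nu> +
     epowr (\<Sum>t<T. max (iter_modulus p \<mu> t (ennreal \<sigma>)) (iter_modulus p \<nu> t (ennreal \<sigma>))) p)"
  proof (rule adapted_wasserstein_le_wasserstein[OF T p F \<mu>F \<nu>F \<sigma> is_cond_law_cond_law[OF \<mu>] is_cond_law_cond_law[OF \<nu>]])
    fix t \<pi> assume t: "t \<in> {1..<T}" and "\<pi> \<in> couplings \<mu> \<mu>" "Lnorm p \<pi> (\<lambda>w. ennreal (path_dist t (fst w) (snd w))) < (\<Sum>s<t. iter_modulus p \<mu> s (ennreal \<sigma>))"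
    then show "Lnorm p \<pi> (\<lambda>w. wasserstein dist p (cond_law \<mu> t (restrict (fst w) {1..t})) (cond_law \<mu> t (restrict (snd w) {1..t}))) \<le> iter_modulus p \<mu> t (ennreal \<sigma>)"
      unfolding ht[OF t] by (intro modulus_ge)
  next
    fix t \<pi> assume t: "t \<in> {1..<T}" and "\<pi> \<in> couplings \<nu> \<nu>" "Lnorm p \<pi> (\<lambda>w. ennreal (path_dist t (fst w) (snd w))) < (\<Sum>s<t. iter_modulus p \<nu> s (ennreal \<sigma>))"
    then show "Lnorm p \<pi> (\<lambda>w. wasserstein dist p (cond_law \<nu> t (restrict (fst w) {1..t})) (cond_law \<nu> t (restrict (snd w) {1..t}))) \<le> iter_modulus p \<nu> t (ennreal \<sigma>)"
      unfolding ht[OF t] by (intro modulus_ge)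
  qed (use True h0 in auto)
  also have "\<dots> \<le> ennreal (transport_const T p CARD('d) (path_diam T F)) *
    (ennreal ((1 + \<sigma>) powr p / \<sigma>) * wasserstein (path_dist T) 1 \<mu> \<nu> +
     epowr (\<Sum>t<T. max (iter_modulus p \<mu> t (ennreal \<sigma>)) (iter_modulus p \<nu> t (ennreal \<sigma>))) p)"
  proof (intro mult_left_mono add_right_mono mult_right_mono ennreal_leI)
    show "1 / \<sigma> \<le> (1 + \<sigma>) powr p / \<sigma>" using \<sigma> p by (intro divide_right_mono ge_one_powr_ge_zero) auto
  qed auto
  finally show ?thesis .
qed

section \<open>Hoelder continuous kernels\<close>

lemma Lnorm_cmult:
  assumes "p > 0" "f \<in> borel_measurable M"
  shows "Lnorm p M (\<lambda>x. c * f x) = c * Lnorm p M f"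
proof -
  have "(\<integral>\<^sup>+x. epowr (c * f x) p \<partial>M) = epowr c p * (\<integral>\<^sup>+x. epowr (f x) p \<partial>M)"
    using assms by (simp add: epowr_mult nn_integral_cmult)
  then show ?thesis using assms by (simp add: Lnorm_def epowr_mult)
qed

text \<open>Partial sums of the iterated moduli when each modulus is \<open>\<delta> \<mapsto> L \<delta>\<^sup>\<alpha>\<close>.\<close>

primrec holder_sum :: "real \<Rightarrow> real \<Rightarrow> real \<Rightarrow> nat \<Rightarrow> real" where
  "holder_sum L \<alpha> \<sigma> 0 = \<sigma>"
| "holder_sum L \<alpha> \<sigma> (Suc t) = holder_sum L \<alpha> \<sigma> t + L * holder_sum L \<alpha> \<sigma> t powr \<alpha>"

lemma holder_sum_ge: "L \<ge> 0 \<Longrightarrow> \<sigma> \<le> holder_sum L \<alpha> \<sigma> t"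
  by (induction t) (auto intro: order_trans)

text \<open>Each step multiplies the exponent of \<open>\<sigma>\<close> by \<open>\<alpha>\<close>,
  and for \<open>\<sigma> \<le> 1\<close> the power with the smaller exponent dominates the one from
  the step before. The constants then obey the same recursion started at 1.\<close>

lemma holder_sum_le:
  assumes L: "L \<ge> 0" and \<alpha>: "0 < \<alpha>" "\<alpha> \<le> 1" and \<sigma>: "0 < \<sigma>" "\<sigma> \<le> 1"
  shows "holder_sum L \<alpha> \<sigma> t \<le> holder_sum L \<alpha> 1 t * \<sigma> powr (\<alpha> ^ t)"
proof (induction t)
  case 0
  then show ?case using \<sigma> by simp
next
  case (Suc t)
  let ?K = "holder_sum L \<alpha> 1 t"
  have K: "?K \<ge> 0" using holder_sum_ge[OF L, of 1 \<alpha> t] by simp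
  have "holder_sum L \<alpha> \<sigma> t powr \<alpha> \<le> (?K * \<sigma> powr (\<alpha> ^ t)) powr \<alpha>"
    using Suc.IH holder_sum_ge[OF L, of \<sigma> \<alpha> t] \<alpha> \<sigma> by (intro powr_mono2) auto
  also have "\<dots> = ?K powr \<alpha> * \<sigma> powr (\<alpha> ^ Suc t)"
    using K \<sigma> by (simp add: powr_mult powr_powr mult.commute)
  finally have 1: "L * holder_sum L \<alpha> \<sigma> t powr \<alpha> \<le> L * (?K powr \<alpha> * \<sigma> powr (\<alpha> ^ Suc t))"
    using L by (rule mult_left_mono)
  have "\<sigma> powr (\<alpha> ^ t) \<le> \<sigma> powr (\<alpha> ^ Suc t)"
    using \<sigma> \<alpha> by (intro powr_mono') (auto intro: mult_left_le_one_le)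
  then have "?K * \<sigma> powr (\<alpha> ^ t) \<le> ?K * \<sigma> powr (\<alpha> ^ Suc t)" using K by (rule mult_left_mono)
  with Suc.IH 1 show ?case by (simp add: algebra_simps)
qed

text \<open>The summand at \<open>s > 0\<close> is the Hoelder modulus at the sum of all earlier
  summands, exactly as in the definition of the iterated moduli.\<close>

lemma holder_sum_eq_sum:
  assumes "L \<ge> 0" "\<sigma> > 0"
  shows "(\<Sum>s<Suc t. ennreal (if s = 0 then \<sigma> else L * holder_sum L \<alpha> \<sigma> (s - 1) powr \<alpha>)) = ennreal (holder_sum L \<alpha> \<sigma> t)"
proof (induction t)
  case (Suc t)
  have "(\<Sum>s<Suc (Suc t). ennreal (if s = 0 then \<sigma> else L * holder_sum L \<alpha> \<sigma> (s - 1) powr \<alpha>)) =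
      ennreal (holder_sum L \<alpha> \<sigma> t) + ennreal (L * holder_sum L \<alpha> \<sigma> t powr \<alpha>)"
    using Suc.IH by simp
  also have "\<dots> = ennreal (holder_sum L \<alpha> \<sigma> (Suc t))"
    using holder_sum_ge[OF assms(1), of \<sigma> \<alpha> t] assms by (simp flip: ennreal_plus)
  finally show ?case .
qed simp

lemma path_dist_restrict: "path_dist t (restrict x {1..t}) (restrict y {1..t}) = path_dist t x y"
  by (auto simp: path_dist_def intro: L2_set_cong)

text \<open>The pointwise Hoelder bound is integrated, and Jensen's inequality moves the power
  \<open>\<alpha>\<close> out of the norm.\<close>

lemma holder_kernels_continuity:
  fixes \<mu> :: "(nat \<Rightarrow> real ^ 'd :: finite) measure"
  assumes \<mu>: "\<mu> \<in> space (prob_algebra (path_space T))" and p: "p \<ge> 1" and L: "L > 0" and \<alpha>: "0 < \<alpha>" "\<alpha> \<le> 1"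
    and s: "s > 0" and t: "t < T" and \<pi>: "\<pi> \<in> couplings \<mu> \<mu>"
    and \<kappa>: "\<And>x y. x \<in> space (path_space t) \<Longrightarrow> y \<in> space (path_space t) \<Longrightarrow>
      wasserstein dist p (\<kappa> x) (\<kappa> y) \<le> ennreal (L * path_dist t x y powr \<alpha>)"
    and d: "Lnorm p \<pi> (\<lambda>w. ennreal (path_dist t (fst w) (snd w))) < ennreal s"
  shows "Lnorm p \<pi> (\<lambda>w. wasserstein dist p (\<kappa> (restrict (fst w) {1..t})) (\<kappa> (restrict (snd w) {1..t}))) \<le> ennreal (L * s powr \<alpha>)"
proof -
  have P: "prob_space \<mu>" "sets \<mu> = sets (path_space T)" "space \<mu> = space (path_space T)" using \<mu> by (auto simp: space_prob_algebra dest: sets_eq_imp_space_eq)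
  interpret \<pi>: prob_space \<pi> by (rule prob_space_coupling[OF \<pi> P(1)])
  have sets: "sets \<pi> = sets (path_space T \<Otimes>\<^sub>M path_space T)"
    unfolding couplingsD(1)[OF \<pi>] by (rule sets_pair_measure_cong[OF P(2) P(2)])
  have m [measurable]: "(\<lambda>w. path_dist t (fst w) (snd w)) \<in> borel_measurable \<pi>"
    unfolding measurable_cong_sets[OF sets refl] by (rule measurable_path_dist) (use t in simp)
  have "Lnorm p \<pi> (\<lambda>w. wasserstein dist p (\<kappa> (restrict (fst w) {1..t})) (\<kappa> (restrict (snd w) {1..t}))) \<le>
      Lnorm p \<pi> (\<lambda>w. ennreal L * epowr (ennreal (path_dist t (fst w) (snd w))) \<alpha>)"
  proof (rule Lnorm_mono)
    fix w assume "w \<in> space \<pi>"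
    then have "restrict (fst w) {1..t} \<in> space (path_space t)" "restrict (snd w) {1..t} \<in> space (path_space t)"
      using t by (auto simp: restrict_in_path_space)
    from \<kappa>[OF this]
    show "wasserstein dist p (\<kappa> (restrict (fst w) {1..t})) (\<kappa> (restrict (snd w) {1..t})) \<le> ennreal L * epowr (ennreal (path_dist t (fst w) (snd w))) \<alpha>"
      using L by (simp add: path_dist_restrict epowr_ennreal ennreal_mult del: restrict_apply)
  qed (use p in simp)
  also have "\<dots> = ennreal L * Lnorm p \<pi> (\<lambda>w. epowr (ennreal (path_dist t (fst w) (snd w))) \<alpha>)"
    using p by (intro Lnorm_cmult) auto
  also have "\<dots> \<le> ennreal L * ennreal (s powr \<alpha>)"
    using p d by (intro mult_left_mono \<pi>.Lnorm_epowr_le \<alpha> s) auto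
  finally show ?thesis using L by (simp add: ennreal_mult)
qed

text \<open>The class \<open>holder_kernels\<close> speaks of times from 1 on; at time 0 the fixed
  version \<open>cond_law\<close> completes the family.\<close>

lemma holder_kernelsE:
  fixes \<mu> :: "(nat \<Rightarrow> real ^ 'd :: finite) measure"
  assumes "\<mu> \<in> holder_kernels T p \<alpha> L"
  obtains \<kappa> where "\<And>t. t < T \<Longrightarrow> is_cond_law \<mu> t (\<kappa> t)"
    "\<And>t x y. t \<in> {1..<T} \<Longrightarrow> x \<in> space (path_space t) \<Longrightarrow> y \<in> space (path_space t) \<Longrightarrow>
      wasserstein dist p (\<kappa> t x) (\<kappa> t y) \<le> ennreal (L * path_dist t x y powr \<alpha>)"
proof -
  have \<mu>: "\<mu> \<in> space (prob_algebra (path_space T))" using assms by (simp add: holder_kernels_def)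
  define good where "good t \<kappa> \<longleftrightarrow> is_cond_law \<mu> t \<kappa> \<and> (\<forall>x\<in>space (path_space t). \<forall>y\<in>space (path_space t).
     wasserstein dist p (\<kappa> x) (\<kappa> y) \<le> ennreal (L * path_dist t x y powr \<alpha>))" for t \<kappa>
  define \<kappa> where "\<kappa> t = (if t = 0 then cond_law \<mu> 0 else (SOME \<kappa>. good t \<kappa>))" for t
  have good: "good t (\<kappa> t)" if "t \<in> {1..<T}" for t
  proof -
    have "\<exists>\<kappa>. good t \<kappa>" using assms that unfolding holder_kernels_def good_def by blast
    then have "good t (SOME \<kappa>. good t \<kappa>)" by (rule someI_ex)
    then show ?thesis using that by (simp add: \<kappa>_def)
  qed
  have "is_cond_law \<mu> t (\<kappa> t)" if "t < T" for t
  proof (cases "t = 0")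
    case True
    then show ?thesis using is_cond_law_cond_law[OF \<mu> that] by (simp add: \<kappa>_def)
  next
    case False
    then show ?thesis using good[of t] that by (simp add: good_def)
  qed
  then show ?thesis by (rule that) (use good in \<open>auto simp: good_def\<close>)
qed

text \<open>The Hoelder continuous versions themselves serve as kernels, so their relation to
  \<open>cond_law\<close> does not enter. The same finite \<open>h\<close> is admissible for both
  measures, and its sum is \<open>holder_sum\<close>.\<close>

lemma adapted_wasserstein_le_holder:
  fixes \<mu> \<nu> :: "(nat \<Rightarrow> real ^ 'd :: finite) measure" and p \<sigma> :: real
  assumes T: "T \<ge> 1" and p: "p \<ge> 1" and F: "path_bounded T F" and \<mu>F: "\<mu> \<in> probs_on T F" and \<nu>F: "\<nu> \<in> probs_on T F"
    and L: "L > 0" and \<alpha>: "0 < \<alpha>" "\<alpha> \<le> 1" and \<mu>: "\<mu> \<in> holder_kernels T p \<alpha> L" and \<nu>: "\<nu> \<in> holder_kernels T p \<alpha> L"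
    and \<sigma>: "0 < \<sigma>" "\<sigma> \<le> 1"
  shows "epowr (adapted_wasserstein T p \<mu> \<nu>) p \<le> ennreal (transport_const T p CARD('d) (path_diam T F)) *
    (ennreal (1 / \<sigma>) * wasserstein (path_dist T) 1 \<mu> \<nu> +
     ennreal (holder_sum L \<alpha> 1 (T - 1) powr p * \<sigma> powr (p * \<alpha> ^ (T - 1))))"
proof -
  define h where "h t = ennreal (if t = 0 then \<sigma> else L * holder_sum L \<alpha> \<sigma> (t - 1) powr \<alpha>)" for t
  have sum_h: "(\<Sum>s<t. h s) = ennreal (holder_sum L \<alpha> \<sigma> (t - 1))" if "t \<ge> 1" for t
    using holder_sum_eq_sum[of L \<sigma> \<alpha> "t - 1"] L \<sigma> that by (simp add: h_def)
  have cont: "Lnorm p \<pi> (\<lambda>w. wasserstein dist p (\<kappa> t (restrict (fst w) {1..t})) (\<kappa> t (restrict (snd w) {1..t}))) \<le> h t"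
    if "\<rho> \<in> holder_kernels T p \<alpha> L" "t \<in> {1..<T}" "\<pi> \<in> couplings \<rho> \<rho>"
      "Lnorm p \<pi> (\<lambda>w. ennreal (path_dist t (fst w) (snd w))) < (\<Sum>s<t. h s)"
      "\<And>t x y. t \<in> {1..<T} \<Longrightarrow> x \<in> space (path_space t) \<Longrightarrow> y \<in> space (path_space t) \<Longrightarrow>
         wasserstein dist p (\<kappa> t x) (\<kappa> t y) \<le> ennreal (L * path_dist t x y powr \<alpha>)"
    for \<rho> :: "(nat \<Rightarrow> real ^ 'd) measure" and t \<pi> \<kappa>
  proof -
    have \<rho>: "\<rho> \<in> space (prob_algebra (path_space T))" using that(1) by (simp add: holder_kernels_def)
    have t: "t \<ge> 1" "t < T" using that(2) by auto
    have "holder_sum L \<alpha> \<sigma> (t - 1) > 0" using holder_sum_ge[of L \<sigma> \<alpha> "t - 1"] L \<sigma> by simp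
    from holder_kernels_continuity[OF \<rho> p L \<alpha> this t(2) that(3) that(5)[OF that(2)] that(4)[unfolded sum_h[OF t(1)]]]
    show ?thesis using t by (simp add: h_def)
  qed
  obtain \<kappa> where \<kappa>: "\<And>t. t < T \<Longrightarrow> is_cond_law \<mu> t (\<kappa> t)"
    "\<And>t x y. t \<in> {1..<T} \<Longrightarrow> x \<in> space (path_space t) \<Longrightarrow> y \<in> space (path_space t) \<Longrightarrow>
      wasserstein dist p (\<kappa> t x) (\<kappa> t y) \<le> ennreal (L * path_dist t x y powr \<alpha>)"
    using holder_kernelsE[OF \<mu>] by blast
  obtain \<kappa>' where \<kappa>': "\<And>t. t < T \<Longrightarrow> is_cond_law \<nu> t (\<kappa>' t)"
    "\<And>t x y. t \<in> {1..<T} \<Longrightarrow> x \<in> space (path_space t) \<Longrightarrow> y \<in> space (path_space t) \<Longrightarrow>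
      wasserstein dist p (\<kappa>' t x) (\<kappa>' t y) \<le> ennreal (L * path_dist t x y powr \<alpha>)"
    using holder_kernelsE[OF \<nu>] by blast
  have h0: "h 0 = ennreal \<sigma>" and hf: "h t < \<top>" for t by (simp_all add: h_def)
  have "epowr (adapted_wasserstein T p \<mu> \<nu>) p \<le> ennreal (transport_const T p CARD('d) (path_diam T F)) *
    (ennreal (1 / \<sigma>) * wasserstein (path_dist T) 1 \<mu> \<nu> + epowr (\<Sum>t<T. max (h t) (h t)) p)"
    by (rule adapted_wasserstein_le_wasserstein[OF T p F \<mu>F \<nu>F \<sigma>(1) \<kappa>(1) \<kappa>'(1) h0 hf cont[OF \<mu> _ _ _ \<kappa>(2)] h0 hf cont[OF \<nu> _ _ _ \<kappa>'(2)]])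
  also have "epowr (\<Sum>t<T. max (h t) (h t)) p = ennreal (holder_sum L \<alpha> \<sigma> (T - 1) powr p)"
    using sum_h[OF T] holder_sum_ge[of L \<sigma> \<alpha> "T - 1"] L \<sigma> by (simp add: epowr_ennreal)
  also have "holder_sum L \<alpha> \<sigma> (T - 1) powr p \<le> (holder_sum L \<alpha> 1 (T - 1) * \<sigma> powr (\<alpha> ^ (T - 1))) powr p"
    using holder_sum_le[of L \<alpha> \<sigma> "T - 1"] holder_sum_ge[of L \<sigma> \<alpha> "T - 1"] L \<sigma> \<alpha> p by (intro powr_mono2) auto
  also have "\<dots> = holder_sum L \<alpha> 1 (T - 1) powr p * \<sigma> powr (p * \<alpha> ^ (T - 1))"
    using holder_sum_ge[of L 1 \<alpha> "T - 1"] L by (simp add: powr_mult powr_powr mult.commute)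
  finally show ?thesis by (simp add: mult_left_mono add_left_mono ennreal_leI)
qed

text \<open>Under the independent coupling both paths almost surely lie in \<open>F\<close>.\<close>

lemma wasserstein_1_le_diam:
  assumes F: "path_bounded T F" and \<mu>F: "\<mu> \<in> probs_on T F" and \<nu>F: "\<nu> \<in> probs_on T F"
  shows "wasserstein (path_dist T) 1 \<mu> \<nu> \<le> ennreal (path_diam T F)"
proof -
  have \<mu>: "prob_space \<mu>" "AE x in \<mu>. x \<in> F" and \<nu>: "prob_space \<nu>" "AE x in \<nu>. x \<in> F"
    using \<mu>F \<nu>F by (auto simp: probs_on_def space_prob_algebra)
  note c = pair_measure_in_couplings[OF \<mu>(1) \<nu>(1)]
  interpret prob_space "\<mu> \<Otimes>\<^sub>M \<nu>" by (rule prob_space_coupling[OF c \<mu>(1)])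
  have "wasserstein (path_dist T) 1 \<mu> \<nu> \<le> (\<integral>\<^sup>+w. ennreal (path_dist T (fst w) (snd w)) \<partial>(\<mu> \<Otimes>\<^sub>M \<nu>))"
    unfolding wasserstein_1 by (rule INF_lower[OF c])
  also have "\<dots> \<le> (\<integral>\<^sup>+w. ennreal (path_diam T F) \<partial>(\<mu> \<Otimes>\<^sub>M \<nu>))"
    using AE_coupling_fst[OF c \<mu>(2)] AE_coupling_snd[OF c \<nu>(2)]
  proof (intro nn_integral_mono_AE, eventually_elim)
    case (elim w)
    then show ?case by (intro ennreal_leI path_dist_le_diam[OF F])
  qed
  also have "\<dots> = ennreal (path_diam T F)" by (simp add: emeasure_space_1)
  finally show ?thesis .
qed

text \<open>Write w for the transport cost and \<beta> for \<open>\<alpha> ^ (T - 1)\<close>. The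
  terms w / \<sigma> and \<sigma>^(p \<beta>) balance when \<sigma>^(p \<beta> + 1) is proportional
  to w, and the p-th root \<sigma>^\<beta> is then of order w^(\<beta> / (p \<beta> + 1)).\<close>

theorem adapted_wasserstein_le_powr:
  fixes \<mu> \<nu> :: "(nat \<Rightarrow> real ^ 'd :: finite) measure" and p L \<alpha> :: real
  assumes T: "T \<ge> 1" and p: "p \<ge> 1" and F: "path_bounded T F" and \<mu>F: "\<mu> \<in> probs_on T F" and \<nu>F: "\<nu> \<in> probs_on T F"
    and L: "L > 0" and \<alpha>: "0 < \<alpha>" "\<alpha> \<le> 1" and \<mu>: "\<mu> \<in> holder_kernels T p \<alpha> L" and \<nu>: "\<nu> \<in> holder_kernels T p \<alpha> L"
  shows "adapted_wasserstein T p \<mu> \<nu> \<le>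
    ennreal ((transport_const T p CARD('d) (path_diam T F) * (max (path_diam T F) 1 + holder_sum L \<alpha> 1 (T - 1) powr p)) powr (1 / p)) *
    epowr (wasserstein (path_dist T) 1 \<mu> \<nu>) (\<alpha> ^ (T - 1) / (p * \<alpha> ^ (T - 1) + 1))"
proof -
  \<comment> \<open>The diameter bounds the transport cost, so \<open>w / D \<le> 1\<close> and
    hence \<open>\<sigma> \<le> 1\<close>. Taking at least 1 ensures \<open>w / D \<le> w\<close>,
    which removes \<open>D\<close> from the final power.\<close>
  define D where "D = max (path_diam T F) 1"
  define C where "C = transport_const T p CARD('d) (path_diam T F)"
  define K where "K = holder_sum L \<alpha> 1 (T - 1) powr p"
  define \<beta> where "\<beta> = \<alpha> ^ (T - 1)"
  define e where "e = \<beta> / (p * \<beta> + 1)"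
  define A where "A = (C * (D + K)) powr (1 / p)"
  let ?W = "wasserstein (path_dist T) 1 \<mu> \<nu>"
  have D: "D \<ge> 1" by (simp add: D_def)
  have C: "C > 0" unfolding C_def using T by (rule transport_const_pos)
  have K: "K \<ge> 0" by (simp add: K_def)
  have \<beta>: "\<beta> > 0" using \<alpha> by (simp add: \<beta>_def)
  have p\<beta>: "p * \<beta> > 0" using p \<beta> by simp
  have e: "e > 0" using \<beta> p\<beta> by (simp add: e_def add_pos_pos)
  have A: "A > 0" using C D K by (simp add: A_def)
  \<comment> \<open>The choice of \<open>\<sigma>\<close> makes both terms of the estimate proportional to \<open>\<sigma> powr (p * \<beta>)\<close>.\<close>
  have bound: "adapted_wasserstein T p \<mu> \<nu> \<le> ennreal (A * w powr e)" if w: "0 < w" "w \<le> D" and W: "?W \<le> ennreal w" for w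
  proof -
    define \<sigma> where "\<sigma> = (w / D) powr (1 / (p * \<beta> + 1))"
    have wD: "0 < w / D" "w / D \<le> 1" using w D by auto
    have \<sigma>: "0 < \<sigma>" "\<sigma> \<le> 1" using wD p\<beta> by (auto simp: \<sigma>_def intro!: powr_le1)
    have "w / D = \<sigma> powr (p * \<beta> + 1)" using wD w D p\<beta> by (simp add: \<sigma>_def powr_powr)
    also have "\<dots> = \<sigma> powr (p * \<beta>) * \<sigma>" using \<sigma> by (simp add: powr_add)
    finally have w_eq: "1 / \<sigma> * w = D * \<sigma> powr (p * \<beta>)" using D \<sigma> by (simp add: field_simps)
    have "\<sigma> powr (p * \<beta>) = (w / D) powr (p * e)"
      by (simp add: \<sigma>_def powr_powr e_def)
    also have "\<dots> \<le> w powr (p * e)"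
      using w D e p by (intro powr_mono2) (auto simp: divide_le_eq mult_left_le)
    finally have \<sigma>w: "\<sigma> powr (p * \<beta>) \<le> (w powr e) powr p" by (simp add: powr_powr mult.commute)
    have "epowr (adapted_wasserstein T p \<mu> \<nu>) p \<le> ennreal C * (ennreal (1 / \<sigma>) * ?W + ennreal (K * \<sigma> powr (p * \<beta>)))"
      unfolding C_def K_def \<beta>_def by (rule adapted_wasserstein_le_holder[OF T p F \<mu>F \<nu>F L \<alpha> \<mu> \<nu> \<sigma>])
    also have "\<dots> \<le> ennreal C * (ennreal (1 / \<sigma>) * ennreal w + ennreal (K * \<sigma> powr (p * \<beta>)))"
      using W by (intro mult_left_mono add_right_mono) auto
    also have "ennreal (1 / \<sigma>) * ennreal w = ennreal (D * \<sigma> powr (p * \<beta>))"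
      unfolding w_eq[symmetric] using \<sigma> w by (intro ennreal_mult[symmetric]) auto
    also have "ennreal C * (ennreal (D * \<sigma> powr (p * \<beta>)) + ennreal (K * \<sigma> powr (p * \<beta>))) = ennreal (C * (D + K) * \<sigma> powr (p * \<beta>))"
      using C D K by (simp add: ennreal_mult[symmetric] ennreal_plus[symmetric] distrib_right distrib_left mult.assoc del: ennreal_plus)
    also have "\<dots> \<le> ennreal (C * (D + K) * (w powr e) powr p)"
      using C D K \<sigma>w by (intro ennreal_leI mult_left_mono) auto
    finally have le: "epowr (adapted_wasserstein T p \<mu> \<nu>) p \<le> ennreal (C * (D + K) * (w powr e) powr p)" .
    have "adapted_wasserstein T p \<mu> \<nu> = epowr (epowr (adapted_wasserstein T p \<mu> \<nu>) p) (1 / p)" using p by simp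
    also have "\<dots> \<le> epowr (ennreal (C * (D + K) * (w powr e) powr p)) (1 / p)" using p by (intro epowr_mono le) simp
    also have "\<dots> = ennreal (A * w powr e)"
      using C D K p by (simp add: epowr_ennreal A_def powr_mult powr_powr)
    finally show ?thesis .
  qed
  have WD: "?W \<le> ennreal D"
    using wasserstein_1_le_diam[OF F \<mu>F \<nu>F] by (rule order_trans) (simp add: D_def ennreal_leI)
  have "adapted_wasserstein T p \<mu> \<nu> \<le> ennreal A * epowr ?W e"
  proof (cases "?W = 0")
    case False
    obtain w where w: "?W = ennreal w" "w \<ge> 0" using WD by (cases ?W) (auto simp: top_unique)
    have "w > 0" using False w by (cases "w = 0") auto
    moreover have "w \<le> D" using WD w D by simp
    ultimately have "adapted_wasserstein T p \<mu> \<nu> \<le> ennreal (A * w powr e)" using w by (intro bound) auto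
    also have "\<dots> = ennreal A * epowr ?W e" using w A by (simp add: epowr_ennreal ennreal_mult)
    finally show ?thesis .
  next
    case True
    \<comment> \<open>At transport cost zero there is no positive \<open>w\<close> to balance
      against; but \<open>bound\<close> then holds for every small positive \<open>w\<close>, and
      its right side tends to 0.\<close>
    have "adapted_wasserstein T p \<mu> \<nu> \<le> 0"
    proof (rule ennreal_le_epsilon)
      fix \<epsilon> :: real assume \<epsilon>: "\<epsilon> > 0"
      define w where "w = min 1 ((\<epsilon> / A) powr (1 / e))"
      have w: "0 < w" "w \<le> D" using D \<epsilon> A by (auto simp: w_def)
      have "w powr e \<le> ((\<epsilon> / A) powr (1 / e)) powr e" using w e by (intro powr_mono2) (auto simp: w_def)
      also have "\<dots> = \<epsilon> / A" using e \<epsilon> A by (simp add: powr_powr)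
      finally have "A * w powr e \<le> \<epsilon>" using A by (simp add: field_simps)
      then have "ennreal (A * w powr e) \<le> ennreal \<epsilon>" by (rule ennreal_leI)
      with bound[OF w] True show "adapted_wasserstein T p \<mu> \<nu> \<le> 0 + ennreal \<epsilon>" by simp
    qed
    then show ?thesis by simp
  qed
  then show ?thesis by (simp add: A_def C_def D_def K_def e_def \<beta>_def)
qed

theorem corollary32:
  fixes T :: nat and p :: real
  assumes "T \<ge> 1" and "p \<ge> 1"
  shows
    "(\<forall>D::real. \<exists>C::real. C > 0 \<and>
       (\<forall>(F :: (nat \<Rightarrow> real ^ 'd::finite) set) \<mu> \<nu>.
          path_bounded T F \<longrightarrow> path_diam T F = D \<longrightarrow> \<mu> \<in> probs_on T F \<longrightarrow> \<nu> \<in> probs_on T F \<longrightarrow>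
          (\<forall>\<sigma>::real. \<sigma> > 0 \<longrightarrow>
             epowr (adapted_wasserstein T p \<mu> \<nu>) p \<le>
               ennreal C *
               (ennreal ((1 + \<sigma>) powr p / \<sigma>) * wasserstein (path_dist T) 1 \<mu> \<nu> +
                epowr (\<Sum>t<T. max (iter_modulus p \<mu> t (ennreal \<sigma>))
                                   (iter_modulus p \<nu> t (ennreal \<sigma>))) p)))) \<and>
     (\<forall>(D::real) (L::real) (\<alpha>::real). L > 0 \<longrightarrow> 0 < \<alpha> \<longrightarrow> \<alpha> \<le> 1 \<longrightarrow>
       (\<exists>C::real. C > 0 \<and>
         (\<forall>(F :: (nat \<Rightarrow> real ^ 'd) set) \<mu> \<nu>.
            path_bounded T F \<longrightarrow> path_diam T F = D \<longrightarrow> \<mu> \<in> probs_on T F \<longrightarrow> \<nu> \<in> probs_on T F \<longrightarrow>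
            \<mu> \<in> holder_kernels T p \<alpha> L \<longrightarrow> \<nu> \<in> holder_kernels T p \<alpha> L \<longrightarrow>
            adapted_wasserstein T p \<mu> \<nu> \<le>
              ennreal C *
              epowr (wasserstein (path_dist T) 1 \<mu> \<nu>)
                (\<alpha> ^ (T - 1) / (p * \<alpha> ^ (T - 1) + 1)))))"
proof (intro conjI allI impI)
  fix D :: real
  show "\<exists>C::real. C > 0 \<and>
       (\<forall>(F :: (nat \<Rightarrow> real ^ 'd::finite) set) \<mu> \<nu>.
          path_bounded T F \<longrightarrow> path_diam T F = D \<longrightarrow> \<mu> \<in> probs_on T F \<longrightarrow> \<nu> \<in> probs_on T F \<longrightarrow>
          (\<forall>\<sigma>::real. \<sigma> > 0 \<longrightarrow>
             epowr (adapted_wasserstein T p \<mu> \<nu>) p \<le>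
               ennreal C *
               (ennreal ((1 + \<sigma>) powr p / \<sigma>) * wasserstein (path_dist T) 1 \<mu> \<nu> +
                epowr (\<Sum>t<T. max (iter_modulus p \<mu> t (ennreal \<sigma>))
                                   (iter_modulus p \<nu> t (ennreal \<sigma>))) p)))"
    using assms by (intro exI[of _ "transport_const T p CARD('d) D"])
      (auto intro: transport_const_pos adapted_wasserstein_le_iter_modulus)
next
  fix D L \<alpha> :: real assume L: "L > 0" and \<alpha>: "0 < \<alpha>" "\<alpha> \<le> 1"
  let ?C = "(transport_const T p CARD('d) D * (max D 1 + holder_sum L \<alpha> 1 (T - 1) powr p)) powr (1 / p)"
  have "max D 1 + holder_sum L \<alpha> 1 (T - 1) powr p > 0" by (intro add_pos_nonneg) auto
  then have "?C > 0"
    using transport_const_pos[OF assms(1), of p "CARD('d)" D] by simp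
  then show "\<exists>C::real. C > 0 \<and>
         (\<forall>(F :: (nat \<Rightarrow> real ^ 'd) set) \<mu> \<nu>.
            path_bounded T F \<longrightarrow> path_diam T F = D \<longrightarrow> \<mu> \<in> probs_on T F \<longrightarrow> \<nu> \<in> probs_on T F \<longrightarrow>
            \<mu> \<in> holder_kernels T p \<alpha> L \<longrightarrow> \<nu> \<in> holder_kernels T p \<alpha> L \<longrightarrow>
            adapted_wasserstein T p \<mu> \<nu> \<le>
              ennreal C *
              epowr (wasserstein (path_dist T) 1 \<mu> \<nu>)
                (\<alpha> ^ (T - 1) / (p * \<alpha> ^ (T - 1) + 1)))"
    using assms L \<alpha> by (intro exI[of _ ?C]) (auto intro: adapted_wasserstein_le_powr)
qed

end
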